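(* Let $\alpha>-1$. Let $\Psi:[0,\infty)\to\mathbb{R}$ be a function of bounded variation, let $m_k=\int_0^\infty e^{-kt}\,d\Psi(t)$ for $k\in\mathbb{N}_0$, and let $M_{\alpha,m}$ be the associated multiplier operator for Laguerre expansions, $M_{\alpha,m}f\sim\sum_{k=0}^\infty a_{\alpha,k}(f)\,m_k\,l_k^\alpha$. Assume that: (H1) $\int_0^\infty |d\Psi|(t)<+\infty$; (H2) there exist $\delta>0$, $0<\sigma<\alpha+1$ and $C>0$ such that $|\Psi(t)|\le C t^\sigma$ for $0\le t\le\delta$. Let $p,q,a,b$ be real numbers such that $$1<p\le q<\infty,\qquad a<\frac{\alpha+1}{p'},\qquad b<\frac{\alpha+1}{q},$$ and $$\left(\frac1q-\frac1p\right)\left(\alpha+\frac12\right)\le a+b\le\left(\frac1q-\frac1p\right)(\alpha+1)+\sigma .$$ Then $M_{\alpha,m}$ (initially defined on the finite linear combinations of the functions $l_k^\alpha$) can be extended to a bounded operator from $L^p(\mathbb{R}_+,x^{\alpha+ap}\,dx)$ to $L^q(\mathbb{R}_+,x^{\alpha-bq}\,dx)$; that is, there is a constant $C$ independent of $f$ such that $$\|M_{\alpha,m}f\|_{L^q(\mathbb{R}_+,x^{\alpha-bq}dx)}\le C\,\|f\|_{L^p(\mathbb{R}_+,x^{\alpha+ap}dx)} .$$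
   Context: Here $\mathbb{R}_+=(0,\infty)$, $p'=p/(p-1)$, and $\|f\|_{L^p(\mathbb{R}_+,w\,dx)}=\left(\int_0^\infty |f(x)|^p w(x)\,dx\right)^{1/p}$. For $\alpha>-1$, $L_k^\alpha$ ($k\in\mathbb{N}_0$) denotes the Laguerre polynomial of degree $k$ and order $\alpha$, with generating function $\sum_{k\ge0}L_k^\alpha(x)w^k=(1-w)^{-\alpha-1}e^{-xw/(1-w)}$ for $|w|<1$. The Laguerre functions are $$l_k^\alpha(x)=\left(\frac{k!}{\Gamma(k+\alpha+1)}\right)^{1/2}e^{-x/2}L_k^\alpha(x),\qquad k\in\mathbb{N}_0,$$ and form an orthonormal basis of $L^2(\mathbb{R}_+,x^\alpha dx)$. The Laguerre coefficients of $f$ are $a_{\alpha,k}(f)=\int_0^\infty f(x)\,l_k^\alpha(x)\,x^\alpha\,dx$. Given a bounded sequence $\{m_k\}$, the multiplier operator $M_{\alpha,m}$ is given by $M_{\alpha,m}f\sim\sum_{k=0}^\infty a_{\alpha,k}(f)\,m_k\,l_k^\alpha$; for $f$ a finite linear combination of the $l_k^\alpha$ (equivalently, $f(x)=P(x)e^{-x/2}$ with $P$ a polynomial) the sum is finite. Integrals against $d\Psi$ are Stieltjes integrals over $[0,\infty)$, and $|d\Psi|$ is the total variation measure of $\Psi$. *)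

theory Defs
  imports "HOL-Analysis.Analysis"
begin

definition laguerre :: "real \<Rightarrow> nat \<Rightarrow> real \<Rightarrow> real" where
  "laguerre \<alpha> k x =
     (\<Sum>i\<le>k. (-1) ^ i * ((real k + \<alpha>) gchoose (k - i)) * x ^ i / fact i)"

lemma one_minus_powr_sums:
  fixes s w :: real
  assumes "\<bar>w\<bar> < 1"
  shows "(\<lambda>n. ((s + real n - 1) gchoose n) * w ^ n) sums (1 - w) powr (- s)"
proof -
  have "(\<lambda>n. ((- s) gchoose n) * (- w) ^ n) sums (1 + (- w)) powr (- s)"
    using assms by (intro gen_binomial_real) simp
  moreover have "((- s) gchoose n) * (- w) ^ n = ((s + real n - 1) gchoose n) * w ^ n" for n
  proof -
    have "(- 1) ^ n * (- w) ^ n = w ^ n"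
      by (simp flip: power_mult_distrib)
    thus ?thesis by (simp add: gbinomial_minus mult_ac)
  qed
  ultimately show ?thesis by simp
qed

lemma gbinomial_shift_nonneg:
  fixes s :: real
  assumes "s > 0"
  shows "((s + real n - 1) gchoose n) \<ge> 0"
proof -
  have "((s + real n - 1) gchoose n) = pochhammer s n / fact n"
    by (simp add: gbinomial_pochhammer')
  thus ?thesis using assms by (simp add: pochhammer_nonneg)
qed

lemma one_minus_powr_has_sum:
  fixes s w :: real
  assumes "\<bar>w\<bar> < 1" "s > 0"
  shows "((\<lambda>n. ((s + real n - 1) gchoose n) * w ^ n) has_sum (1 - w) powr (- s)) UNIV"
proof (rule norm_summable_imp_has_sum[OF _ one_minus_powr_sums[OF assms(1)]])
  have "norm (((s + real n - 1) gchoose n) * w ^ n) = ((s + real n - 1) gchoose n) * \<bar>w\<bar> ^ n" for n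
    using gbinomial_shift_nonneg[OF assms(2), of n] by (simp add: abs_mult power_abs)
  thus "summable (\<lambda>n. norm (((s + real n - 1) gchoose n) * w ^ n))"
    using one_minus_powr_sums[of "\<bar>w\<bar>" s] assms(1) by (simp add: sums_iff)
qed

lemma exp_has_sum: "((\<lambda>i. z ^ i / fact i) has_sum exp z) (UNIV :: nat set)" for z :: real
proof (rule norm_summable_imp_has_sum)
  show "(\<lambda>i. z ^ i / fact i) sums exp z"
    using exp_converges[of z] by (simp add: field_simps)
  show "summable (\<lambda>i. norm (z ^ i / fact i))"
    using summable_norm_exp[of z] by (simp add: field_simps)
qed

theorem laguerre_generating_function:
  fixes \<alpha> x w :: real
  assumes \<alpha>: "\<alpha> > -1" and w: "\<bar>w\<bar> < 1"
  shows "(\<lambda>k. laguerre \<alpha> k x * w ^ k) sums ((1 - w) powr (- \<alpha> - 1) * exp (- x * w / (1 - w)))"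
proof -
  define B where "B = (\<lambda>i n. ((\<alpha> + 1 + real i + real n - 1) gchoose n))"
  define F where "F = (\<lambda>y v. \<lambda>(i, n). ((y * v) ^ i / fact i) * (B i n * v ^ n) :: real)"
  have inner: "((\<lambda>n. F y v (i, n)) has_sum
      ((1 - v) powr (- \<alpha> - 1) * ((y * v / (1 - v)) ^ i / fact i))) UNIV"
    if v: "\<bar>v\<bar> < 1" for y v i
  proof -
    have "((\<lambda>n. F y v (i, n)) has_sum
       ((y * v) ^ i / fact i * (1 - v) powr (- (\<alpha> + 1 + real i)))) UNIV"
      unfolding F_def B_def prod.case
      by (intro has_sum_cmult_right one_minus_powr_has_sum v) (use \<alpha> in linarith)
    moreover have "(1 - v) powr (- (\<alpha> + 1 + real i)) = (1 - v) powr (- \<alpha> - 1) / (1 - v) ^ i"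
    proof -
      have "- (\<alpha> + 1 + real i) = (- \<alpha> - 1) - real i" by simp
      thus ?thesis using v by (simp only: powr_diff) (simp add: powr_realpow)
    qed
    ultimately show ?thesis by (simp add: power_divide mult_ac)
  qed
  have outer: "((\<lambda>i. (1 - v) powr (- \<alpha> - 1) * ((y * v / (1 - v)) ^ i / fact i)) has_sum
      ((1 - v) powr (- \<alpha> - 1) * exp (y * v / (1 - v)))) UNIV" for y v
    by (intro has_sum_cmult_right exp_has_sum)
  have B_nonneg: "B i n \<ge> 0" for i n
    unfolding B_def by (rule gbinomial_shift_nonneg) (use \<alpha> in linarith)
  have "F \<bar>x\<bar> \<bar>w\<bar> summable_on (UNIV \<times> UNIV)"
  proof (rule summable_on_SigmaI)
    show "((\<lambda>n. F \<bar>x\<bar> \<bar>w\<bar> (i, n)) has_sum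
      ((1 - \<bar>w\<bar>) powr (- \<alpha> - 1) * ((\<bar>x\<bar> * \<bar>w\<bar> / (1 - \<bar>w\<bar>)) ^ i / fact i))) UNIV" for i
      by (rule inner) (use w in simp)
    show "(\<lambda>i. (1 - \<bar>w\<bar>) powr (- \<alpha> - 1) * ((\<bar>x\<bar> * \<bar>w\<bar> / (1 - \<bar>w\<bar>)) ^ i / fact i)) summable_on UNIV"
      using outer[of "\<bar>w\<bar>" "\<bar>x\<bar>"] by (rule has_sum_imp_summable)
    show "F \<bar>x\<bar> \<bar>w\<bar> (i, n) \<ge> 0" for i n
      using B_nonneg by (simp add: F_def)
  qed
  moreover have "norm (F (- x) w z) = F \<bar>x\<bar> \<bar>w\<bar> z" for z
    using B_nonneg by (cases z) (simp add: F_def abs_mult power_abs power_mult_distrib)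
  ultimately have "(\<lambda>z. norm (F (- x) w z)) summable_on (UNIV \<times> UNIV)"
    by simp
  hence summ: "F (- x) w summable_on (UNIV \<times> UNIV)"
    by (rule abs_summable_summable)
  have "(F (- x) w has_sum ((1 - w) powr (- \<alpha> - 1) * exp (- x * w / (1 - w)))) (UNIV \<times> UNIV)"
    by (rule has_sum_SigmaI[OF _ outer summ]) (rule inner[OF w])
  also have "?this \<longleftrightarrow> ((\<lambda>(k, i). F (- x) w (i, k - i)) has_sum
      ((1 - w) powr (- \<alpha> - 1) * exp (- x * w / (1 - w)))) (SIGMA k:UNIV. {..k})"
    by (rule has_sum_reindex_bij_witness[of _ "\<lambda>(k, i). (i, k - i)" "\<lambda>(i, n). (i + n, i)"]) auto
  finally have "((\<lambda>k. \<Sum>i\<le>k. F (- x) w (i, k - i)) has_sum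
      ((1 - w) powr (- \<alpha> - 1) * exp (- x * w / (1 - w)))) UNIV"
    by (rule has_sum_SigmaD) (auto intro!: has_sum_finiteI)
  moreover have "(\<Sum>i\<le>k. F (- x) w (i, k - i)) = laguerre \<alpha> k x * w ^ k" for k
  proof -
    have "F (- x) w (i, k - i) =
        (-1) ^ i * ((real k + \<alpha>) gchoose (k - i)) * x ^ i / fact i * w ^ k" if "i \<le> k" for i
    proof -
      have w_pow: "w ^ k = w ^ i * w ^ (k - i)" using that by (simp flip: power_add)
      have B_eq: "B i (k - i) = (real k + \<alpha>) gchoose (k - i)"
        unfolding B_def using that by (intro arg_cong2[where f = "(gchoose)"]) auto
      have neg_pow: "(- x * w) ^ i = (-1) ^ i * x ^ i * w ^ i"
        by (metis power_minus power_mult_distrib)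
      show ?thesis unfolding F_def prod.case w_pow B_eq neg_pow by (simp only: mult_ac times_divide_eq_left times_divide_eq_right)
    qed
    thus ?thesis by (simp add: laguerre_def sum_distrib_right)
  qed
  ultimately show ?thesis by (simp add: has_sum_imp_sums)
qed

definition laguerre_fun :: "real \<Rightarrow> nat \<Rightarrow> real \<Rightarrow> real" where
  "laguerre_fun \<alpha> k x =
     sqrt (fact k / Gamma (real k + \<alpha> + 1)) * exp (- x / 2) * laguerre \<alpha> k x"

text \<open>
  The measure \<open>x\<^sup>\<gamma> dx\<close> on the open half-line \<open>(0, \<infinity>)\<close>.
\<close>

definition halfline_measure :: "real \<Rightarrow> real measure" where
  "halfline_measure \<gamma> = density (restrict_space lborel {0<..}) (\<lambda>x. ennreal (x powr \<gamma>))"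

text \<open>
  Real-valued functions in \<open>L\<^sup>p\<close>, not quotiented by equality almost everywhere.
\<close>

definition Lp_space :: "real \<Rightarrow> 'a measure \<Rightarrow> ('a \<Rightarrow> real) set" where
  "Lp_space p M = {f \<in> borel_measurable M. integrable M (\<lambda>x. \<bar>f x\<bar> powr p)}"

definition Lp_norm :: "real \<Rightarrow> 'a measure \<Rightarrow> ('a \<Rightarrow> real) \<Rightarrow> real" where
  "Lp_norm p M f = (\<integral>x. \<bar>f x\<bar> powr p \<partial>M) powr (1 / p)"

text \<open>
  Linearity is only required almost everywhere. With boundedness it also makes \<open>T\<close>
  respect equality almost everywhere, so \<open>T\<close> descends to a linear map between the
  quotient spaces.
\<close>

definition bounded_Lp_operator ::
  "real \<Rightarrow> 'a measure \<Rightarrow> real \<Rightarrow> 'b measure \<Rightarrow> real \<Rightarrow> (('a \<Rightarrow> real) \<Rightarrow> 'b \<Rightarrow> real) \<Rightarrow> bool" where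
  "bounded_Lp_operator p M q N C T \<longleftrightarrow>
     (\<forall>f\<in>Lp_space p M. T f \<in> Lp_space q N \<and> Lp_norm q N (T f) \<le> C * Lp_norm p M f) \<and>
     (\<forall>f\<in>Lp_space p M. \<forall>g\<in>Lp_space p M. \<forall>c d.
        AE x in N. T (\<lambda>y. c * f y + d * g y) x = c * T f x + d * T g x)"

definition laguerre_coeff :: "real \<Rightarrow> nat \<Rightarrow> (real \<Rightarrow> real) \<Rightarrow> real" where
  "laguerre_coeff \<alpha> k f =
     (\<integral>x. f x * laguerre_fun \<alpha> k x \<partial>halfline_measure \<alpha>)"

definition laguerre_span :: "real \<Rightarrow> (real \<Rightarrow> real) set" where
  "laguerre_span \<alpha> = {f. \<exists>N c. f = (\<lambda>x. \<Sum>k<N. c k * laguerre_fun \<alpha> k x)}"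

text \<open>
  For \<open>f\<close> in \<^const>\<open>laguerre_span\<close> only finitely many terms are non-zero, by orthogonality;
  the operator is only used there.
\<close>

definition laguerre_multiplier :: "real \<Rightarrow> (nat \<Rightarrow> real) \<Rightarrow> (real \<Rightarrow> real) \<Rightarrow> real \<Rightarrow> real" where
  "laguerre_multiplier \<alpha> m f x = (\<Sum>k. laguerre_coeff \<alpha> k f * m k * laguerre_fun \<alpha> k x)"

definition variation :: "real set \<Rightarrow> (real \<Rightarrow> real) \<Rightarrow> ennreal" where
  "variation S g =
     (SUP (n, s) \<in> {(n :: nat, s :: nat \<Rightarrow> real). mono_on {..n} s \<and> s ` {..n} \<subseteq> S}.
        \<Sum>i<n. ennreal \<bar>g (s (Suc i)) - g (s i)\<bar>)"

definition bounded_variation_on :: "real set \<Rightarrow> (real \<Rightarrow> real) \<Rightarrow> bool" where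
  "bounded_variation_on S g \<longleftrightarrow> variation S g < \<infinity>"

definition variation_fun :: "(real \<Rightarrow> real) \<Rightarrow> real \<Rightarrow> real" where
  "variation_fun g t = enn2real (variation {0..t} g)"

text \<open>
  The Riemann--Stieltjes integral of \<open>f\<close> with respect to \<open>g\<close> over \<open>[a, b]\<close>, as a limit over
  tagged partitions of mesh tending to \<open>0\<close>, and its improper version over \<open>[0, \<infinity>)\<close>.
  The integrator need not be one-sided continuous, and a jump of \<open>g\<close> at \<open>0\<close> is counted.
\<close>

definition has_stieltjes_integral_on ::
  "(real \<Rightarrow> real) \<Rightarrow> (real \<Rightarrow> real) \<Rightarrow> real \<Rightarrow> real \<Rightarrow> real \<Rightarrow> bool" where
  "has_stieltjes_integral_on f g a b I \<longleftrightarrow>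
     (\<forall>\<epsilon>>0. \<exists>\<delta>>0. \<forall>(n :: nat) s \<xi>.
        s 0 = a \<and> s n = b \<and>
        (\<forall>i<n. s i \<le> \<xi> i \<and> \<xi> i \<le> s (Suc i) \<and> s (Suc i) - s i < \<delta>) \<longrightarrow>
        \<bar>(\<Sum>i<n. f (\<xi> i) * (g (s (Suc i)) - g (s i))) - I\<bar> < \<epsilon>)"

definition has_stieltjes_integral ::
  "(real \<Rightarrow> real) \<Rightarrow> (real \<Rightarrow> real) \<Rightarrow> real \<Rightarrow> bool" where
  "has_stieltjes_integral f g I \<longleftrightarrow>
     (\<exists>J. (\<forall>T\<ge>0. has_stieltjes_integral_on f g 0 T (J T)) \<and> (J \<longlongrightarrow> I) at_top)"

text \<open>
  Integration against \<open>|dg|\<close> is Stieltjes integration against the total variation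
  \<open>t \<mapsto> V(g; [0, t])\<close> of \<open>g\<close>.
\<close>

definition has_abs_stieltjes_integral ::
  "(real \<Rightarrow> real) \<Rightarrow> (real \<Rightarrow> real) \<Rightarrow> real \<Rightarrow> bool" where
  "has_abs_stieltjes_integral f g I \<longleftrightarrow> has_stieltjes_integral f (variation_fun g) I"

end

(* Integration by parts gives m_k = k * integral of e^(-kt) Psi(t) dt for k >= 1, so M f is the
   integral operator with kernel  m_0 l_0(x) l_0(y) - integral of Psi(t) (d/dt) P_t(x,y) dt,
   where P_t is the kernel of the Laguerre semigroup l_k |-> e^(-kt) l_k.  By (H2) and the bounds
   on dP_t/dt this kernel is dominated by max(x,y)^(-D), D = (alpha+1)/p' - a + (alpha+1)/q - b,
   plus a singular part supported on x/4 <= y <= 4x.  After passing to the measure dx/x, the first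
   part is homogeneous of degree 0 and the second is a fractional integration kernel; the L^p -> L^q
   bound follows by splitting the kernel, at a height depending on the level, in an estimate of the
   level sets {T f > l}. *)
theory Submission
  imports Defs
begin

text \<open>By (H2) the t-integral behaves like t^(\<sigma> - 1) dt, as d/dt P_t costs one factor
  1/t. Put A = (\<alpha> + 1)/p' - a and B = (\<alpha> + 1)/q - b, so that D = A + B. With the power
  weights moved into it, max(x,y)^(-D) becomes (y/x)^A for y < x and (x/y)^B for y > x; this is
  integrable for dy/y exactly if A, B > 0, the hypotheses on a and b. With \<tau> = \<alpha> + 1 - D
  = a + b - (1/q - 1/p)(\<alpha> + 1), the hypothesis on a + b reads (1/p - 1/q)/2 \<le> \<tau>
  \<le> \<sigma>. The upper bound makes \<Psi> small enough at t = 0; the lower one is what the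
  passage from L^p to L^q costs on the near part. The level set argument covers this case and gives
  the strong bound without interpolation.\<close>

section \<open>Power weights on the half-line\<close>

lemma space_halfline_measure [simp]: "space (halfline_measure \<gamma>) = {0<..}"
  by (simp add: halfline_measure_def space_restrict_space)

lemma sets_halfline_measure: "sets (halfline_measure \<gamma>) = sets (restrict_space borel {0<..})"
  by (simp add: halfline_measure_def sets_restrict_space)

lemma measurable_halfline_measure:
  "f \<in> borel_measurable borel \<Longrightarrow> f \<in> borel_measurable (halfline_measure \<gamma>)"
  by (subst measurable_cong_sets[OF sets_halfline_measure refl]) (rule measurable_restrict_space1)

lemma sigma_finite_halfline_measure: "sigma_finite_measure (halfline_measure \<gamma>)"
proof -
  interpret sigma_finite_measure "restrict_space lborel {0<..} :: real measure"
    by (intro sigma_finite_measure_restrict_space lborel.sigma_finite_measure_axioms) auto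
  show ?thesis unfolding halfline_measure_def
    by (subst sigma_finite_iff_density_finite) (auto intro!: measurable_restrict_space1)
qed

lemma nn_integral_halfline_measure:
  assumes "f \<in> borel_measurable (halfline_measure \<gamma>)"
  shows "(\<integral>\<^sup>+x. f x \<partial>halfline_measure \<gamma>) = (\<integral>\<^sup>+x. ennreal (x powr \<gamma>) * f x * indicator {0<..} x \<partial>lborel)"
proof -
  have f: "f \<in> borel_measurable (restrict_space lborel {0<..})"
    using assms by (simp add: measurable_def halfline_measure_def)
  show ?thesis unfolding halfline_measure_def
    by (subst nn_integral_density) (auto intro!: f measurable_restrict_space1 nn_integral_restrict_space)
qed

lemma nn_integral_halfline_measure_shift:
  assumes "f \<in> borel_measurable (halfline_measure \<gamma>)"
  shows "(\<integral>\<^sup>+x. f x \<partial>halfline_measure \<gamma>) = (\<integral>\<^sup>+x. ennreal (x powr (\<gamma> - \<beta>)) * f x \<partial>halfline_measure \<beta>)"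
proof -
  have f: "f \<in> borel_measurable (halfline_measure \<beta>)"
    using assms by (simp add: measurable_def sets_halfline_measure)
  have "(\<integral>\<^sup>+x. ennreal (x powr (\<gamma> - \<beta>)) * f x \<partial>halfline_measure \<beta>) =
    (\<integral>\<^sup>+x. ennreal (x powr \<beta>) * (ennreal (x powr (\<gamma> - \<beta>)) * f x) * indicator {0<..} x \<partial>lborel)"
    by (rule nn_integral_halfline_measure) (intro borel_measurable_times_ennreal f measurable_halfline_measure, measurable)
  also have "\<dots> = (\<integral>\<^sup>+x. ennreal (x powr \<gamma>) * f x * indicator {0<..} x \<partial>lborel)"
    by (intro nn_integral_cong) (simp add: mult.assoc[symmetric] ennreal_mult[symmetric] powr_add[symmetric])
  also have "\<dots> = (\<integral>\<^sup>+x. f x \<partial>halfline_measure \<gamma>)"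
    by (rule nn_integral_halfline_measure[OF assms, symmetric])
  finally show ?thesis ..
qed

lemma nn_integral_exp_halfline_measure:
  assumes c: "c > 0" and s: "s > -1"
  shows "(\<integral>\<^sup>+x. ennreal (exp (- c * x)) \<partial>halfline_measure s) = ennreal (Gamma (s + 1) * c powr (- (s + 1)))"
proof -
  have "(\<integral>\<^sup>+x. ennreal (exp (- c * x)) \<partial>halfline_measure s) =
     (\<integral>\<^sup>+x. ennreal (x powr s) * ennreal (exp (- c * x)) * indicator {0<..} x \<partial>lborel)"
    by (intro nn_integral_halfline_measure measurable_halfline_measure) measurable
  \<comment> \<open>The integrand is written in the variable c x to match the Gamma integral. The
    closed indicator is harmless: at x = 0 the power is 0.\<close>
  also have "\<dots> = (\<integral>\<^sup>+x. ennreal (c powr (-s)) * ennreal (indicator {0..} (c * x) * (c * x) powr s / exp (c * x)) \<partial>lborel)"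
    by (intro nn_integral_cong)
       (use c in \<open>auto simp: indicator_def zero_le_mult_iff powr_mult powr_minus exp_minus divide_inverse
          simp flip: ennreal_mult\<close>)
  also have "\<dots> = ennreal (c powr (-s)) * (\<integral>\<^sup>+x. ennreal (indicator {0..} (c * x) * (c * x) powr s / exp (c * x)) \<partial>lborel)"
    by (rule nn_integral_cmult) measurable
  also have "(\<integral>\<^sup>+x. ennreal (indicator {0..} (c * x) * (c * x) powr s / exp (c * x)) \<partial>lborel) = ennreal (Gamma (s + 1) / c)"
  proof -
    have "ennreal (Gamma (s + 1)) = c * (\<integral>\<^sup>+x. ennreal (indicator {0..} (c * x) * (c * x) powr s / exp (c * x)) \<partial>lborel)"
      using Gamma_conv_nn_integral_real[of "s + 1"] s c nn_integral_real_affine[of "\<lambda>t. ennreal (indicator {0..} t * t powr s / exp t)" c 0]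
      by simp
    hence "ennreal (1 / c) * ennreal (Gamma (s + 1)) =
      (ennreal (1 / c) * ennreal c) * (\<integral>\<^sup>+x. ennreal (indicator {0..} (c * x) * (c * x) powr s / exp (c * x)) \<partial>lborel)"
      by (simp add: mult.assoc)
    thus ?thesis using c s by (simp flip: ennreal_mult)
  qed
  also have "ennreal (c powr (-s)) * ennreal (Gamma (s + 1) / c) = ennreal (Gamma (s + 1) * c powr (- (s + 1)))"
    using c s by (simp add: powr_diff powr_minus Gamma_real_pos divide_inverse mult_ac flip: ennreal_mult)
  finally show ?thesis .
qed

subsection \<open>Stieltjes integrals\<close>

lemma variation_mono: "S \<subseteq> T \<Longrightarrow> variation S g \<le> variation T g"
  unfolding variation_def by (rule SUP_subset_mono) auto

text \<open>Prolong a partition of [0, s] by the points s and t and discard the increment from its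
  last point to s. A single increment over [s, t] suffices: it already makes the variation function
  and its difference with \<open>g\<close> monotone.\<close>

lemma variation_superadditive:
  assumes "0 \<le> s" "s \<le> t"
  shows "variation {0..s} g + ennreal \<bar>g t - g s\<bar> \<le> variation {0..t} g"
proof -
  let ?A = "{(n :: nat, \<sigma> :: nat \<Rightarrow> real). mono_on {..n} \<sigma> \<and> \<sigma> ` {..n} \<subseteq> {0..s}}"
  \<comment> \<open>A constant can be pulled into a supremum of \<open>ennreal\<close> values only
    over a nonempty set; the one-point partition provides this.\<close>
  have "(0, \<lambda>_. s) \<in> ?A" using assms by (auto simp: mono_on_def)
  hence ne: "?A \<noteq> {}" by blast
  have "variation {0..s} g + ennreal \<bar>g t - g s\<bar> =
    (SUP (n, \<sigma>) \<in> ?A. (\<Sum>i<n. ennreal \<bar>g (\<sigma> (Suc i)) - g (\<sigma> i)\<bar>) + ennreal \<bar>g t - g s\<bar>)"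
    unfolding variation_def by (subst ennreal_SUP_add_left[OF ne, symmetric]) (simp add: case_prod_unfold)
  also have "\<dots> \<le> variation {0..t} g"
  proof (rule SUP_least, clarify)
    fix n :: nat and \<sigma> :: "nat \<Rightarrow> real"
    assume mono: "mono_on {..n} \<sigma>" and img: "\<sigma> ` {..n} \<subseteq> {0..s}"
    define \<tau> where "\<tau> = (\<lambda>i. if i \<le> n then \<sigma> i else if i = Suc n then s else t)"
    have \<sigma>: "0 \<le> \<sigma> i \<and> \<sigma> i \<le> s" if "i \<le> n" for i using img that by force
    have "mono_on {..Suc (Suc n)} \<tau>"
      using mono \<sigma> assms unfolding mono_on_def \<tau>_def by (auto intro: order_trans)
    moreover have "\<tau> ` {..Suc (Suc n)} \<subseteq> {0..t}"
    proof -
      have "\<sigma> i \<le> t" if "i \<le> n" for i using \<sigma>[OF that] assms by linarith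
      thus ?thesis using \<sigma> assms by (auto simp: \<tau>_def)
    qed
    ultimately have "(\<Sum>i<Suc (Suc n). ennreal \<bar>g (\<tau> (Suc i)) - g (\<tau> i)\<bar>) \<le> variation {0..t} g"
      unfolding variation_def by (intro SUP_upper2[of "(Suc (Suc n), \<tau>)"]) auto
    moreover have "(\<Sum>i<n. ennreal \<bar>g (\<tau> (Suc i)) - g (\<tau> i)\<bar>) = (\<Sum>i<n. ennreal \<bar>g (\<sigma> (Suc i)) - g (\<sigma> i)\<bar>)"
      by (intro sum.cong) (auto simp: \<tau>_def)
    ultimately have "(\<Sum>i<n. ennreal \<bar>g (\<sigma> (Suc i)) - g (\<sigma> i)\<bar>) + ennreal \<bar>g s - g (\<sigma> n)\<bar> + ennreal \<bar>g t - g s\<bar> \<le> variation {0..t} g"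
      by (simp add: \<tau>_def)
    thus "(\<Sum>i<n. ennreal \<bar>g (\<sigma> (Suc i)) - g (\<sigma> i)\<bar>) + ennreal \<bar>g t - g s\<bar> \<le> variation {0..t} g"
      by (rule order_trans[rotated]) (simp add: add_increasing2 add_right_mono)
  qed
  finally show ?thesis .
qed

context
  fixes g :: "real \<Rightarrow> real"
  assumes bv: "bounded_variation_on {0..} g"
begin

lemma variation_initial_finite: "variation {0..t} g < \<infinity>"
  using variation_mono[of "{0..t}" "{0..}" g] bv unfolding bounded_variation_on_def by (auto intro: le_less_trans)

lemma variation_fun_diff:
  assumes "0 \<le> s" "s \<le> t"
  shows "\<bar>g t - g s\<bar> \<le> variation_fun g t - variation_fun g s"
proof -
  have "ennreal (variation_fun g s) + ennreal \<bar>g t - g s\<bar> \<le> ennreal (variation_fun g t)"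
    using variation_superadditive[OF assms, of g] variation_initial_finite[of s] variation_initial_finite[of t]
    by (simp add: variation_fun_def)
  moreover have "variation_fun g s \<ge> 0" "variation_fun g t \<ge> 0" by (simp_all add: variation_fun_def)
  ultimately show ?thesis by (simp flip: ennreal_plus)
qed

lemma variation_fun_bounded: "\<exists>V. \<forall>t. variation_fun g t \<le> V"
proof (intro exI allI)
  fix t
  show "variation_fun g t \<le> enn2real (variation {0..} g)"
    unfolding variation_fun_def
    using bv by (intro enn2real_mono variation_mono) (auto simp: bounded_variation_on_def)
qed

lemma bounded_variation_bounded: "\<exists>B. \<forall>t\<ge>0. \<bar>g t\<bar> \<le> B"
proof -
  obtain V where V: "\<And>t. variation_fun g t \<le> V" using variation_fun_bounded by blast
  have "\<bar>g t\<bar> \<le> \<bar>g 0\<bar> + V" if "t \<ge> 0" for t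
  proof -
    have "variation_fun g 0 \<ge> 0" by (simp add: variation_fun_def)
    thus ?thesis using variation_fun_diff[of 0 t] V[of t] that by linarith
  qed
  thus ?thesis by blast
qed

text \<open>Jordan decomposition: the variation function and its difference with \<open>g\<close>
  are both nondecreasing, hence Borel. Composing with \<open>max 0\<close> extends \<open>g\<close>
  to the whole line, since nothing is known about it at negative arguments.\<close>

lemma bounded_variation_measurable: "(\<lambda>t. g (max 0 t)) \<in> borel_measurable borel"
proof -
  have "mono (\<lambda>t. variation_fun g (max 0 t))" "mono (\<lambda>t. variation_fun g (max 0 t) - g (max 0 t))"
    using variation_fun_diff by (auto intro!: monoI) (smt (verit))+
  hence "(\<lambda>t. variation_fun g (max 0 t) - (variation_fun g (max 0 t) - g (max 0 t))) \<in> borel_measurable borel"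
    by (intro borel_measurable_diff borel_measurable_mono)
  thus ?thesis by simp
qed

text \<open>Existence of the Stieltjes integral is assumed, so it may be evaluated along one
  convenient family of partitions: uniform, with tags at the right endpoints. Summation by parts
  leaves boundary terms and a sum that is compared cell by cell with the Lebesgue integral. Jumps of
  \<open>g\<close> do no harm because the error is controlled by the variation.\<close>

lemma stieltjes_integral_exp_by_parts:
  fixes c T I :: real
  assumes c: "c \<ge> 0" and T: "T > 0"
    and I: "has_stieltjes_integral_on (\<lambda>t. exp (- (c * t))) g 0 T I"
  shows "(\<lambda>t. exp (- (c * t)) * g t) integrable_on {0..T}"
    and "I = exp (- (c * T)) * g T - g 0 + c * integral {0..T} (\<lambda>t. exp (- (c * t)) * g t)"
proof -
  let ?e = "\<lambda>t::real. exp (- (c * t))"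
  let ?v = "variation_fun g"
  obtain B where B: "\<And>t. t \<ge> 0 \<Longrightarrow> \<bar>g t\<bar> \<le> B" using bounded_variation_bounded by blast
  obtain V where V: "\<And>t. ?v t \<le> V" using variation_fun_bounded by blast
  have v0: "?v t \<ge> 0" for t by (simp add: variation_fun_def)
  have h_int: "(\<lambda>t. ?e t * g t) integrable_on {a..b}" if "0 \<le> a" for a b
  proof -
    have "integrable lborel (\<lambda>t. indicator {a..b} t *\<^sub>R (?e t * g (max 0 t)))"
    proof (rule integrableI_bounded_set_indicator[where B = B])
      have [measurable]: "(\<lambda>t. g (max 0 t)) \<in> borel_measurable borel" by (rule bounded_variation_measurable)
      show "(\<lambda>t. ?e t * g (max 0 t)) \<in> borel_measurable lborel" by measurable
      show "AE t in lborel. t \<in> {a..b} \<longrightarrow> norm (?e t * g (max 0 t)) \<le> B"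
      proof (rule AE_I2, rule impI)
        fix t :: real assume t: "t \<in> {a..b}"
        have "exp (- (c * t)) * \<bar>g (max 0 t)\<bar> \<le> 1 * \<bar>g (max 0 t)\<bar>"
          using t that c by (intro mult_right_mono) auto
        thus "norm (?e t * g (max 0 t)) \<le> B" using B[of "max 0 t"] by (simp add: abs_mult)
      qed
      show "emeasure lborel {a..b} < \<infinity>" by (rule emeasure_bounded_finite) simp
    qed simp
    hence "set_integrable lborel {a..b} (\<lambda>t. ?e t * g (max 0 t))" by (simp add: set_integrable_def)
    hence "(\<lambda>t. ?e t * g (max 0 t)) integrable_on {a..b}" by (rule set_borel_integral_eq_integral(1))
    thus ?thesis by (rule integrable_eq) (use that in auto)
  qed
  show "(\<lambda>t. ?e t * g t) integrable_on {0..T}" by (rule h_int) simp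
  define K where "K = ?e T * g T - g 0 + c * integral {0..T} (\<lambda>t. ?e t * g t)"
  define s where "s = (\<lambda>n i. real i * T / real n)"
  define S where "S = (\<lambda>n. \<Sum>i<n. ?e (s n (Suc i)) * (g (s n (Suc i)) - g (s n i)))"
  have est: "\<bar>S n - K\<bar> \<le> c * V * T / n" if n: "n > 0" for n
  proof -
    have s0: "s n i \<ge> 0" for i using T by (simp add: s_def)
    have sS: "s n (Suc i) = s n i + T / n" for i by (simp add: s_def add_divide_distrib distrib_right)
    have sle: "s n i \<le> s n (Suc i)" for i using T by (simp add: sS)
    have sn: "s n n = T" "s n 0 = 0" using n by (simp_all add: s_def)
    have parts: "(\<Sum>i<m. ?e (s n (Suc i)) * (g (s n (Suc i)) - g (s n i))) =
       ?e (s n m) * g (s n m) - ?e (s n 0) * g (s n 0) - (\<Sum>i<m. g (s n i) * (?e (s n (Suc i)) - ?e (s n i)))" for m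
      by (induction m) (simp_all add: algebra_simps)
    have e_int: "((\<lambda>t. c * ?e t) has_integral (?e a - ?e b)) {a..b}" if "a \<le> b" for a b
    proof -
      have "((\<lambda>t. c * ?e t) has_integral ((- ?e b) - (- ?e a))) {a..b}"
        by (rule fundamental_theorem_of_calculus[OF that])
           (auto intro!: derivative_eq_intros simp flip: has_real_derivative_iff_has_vector_derivative)
      thus ?thesis by simp
    qed
    have comb: "integral {0..s n m} (\<lambda>t. ?e t * g t) = (\<Sum>i<m. integral {s n i..s n (Suc i)} (\<lambda>t. ?e t * g t))" for m
    proof (induction m)
      case (Suc m)
      have "integral {0..s n m} (\<lambda>t. ?e t * g t) + integral {s n m..s n (Suc m)} (\<lambda>t. ?e t * g t) = integral {0..s n (Suc m)} (\<lambda>t. ?e t * g t)"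
        by (rule Henstock_Kurzweil_Integration.integral_combine) (use s0 sle h_int in auto)
      thus ?case using Suc by simp
    qed (simp add: sn)
    \<comment> \<open>On one cell, freezing \<open>g\<close> at the left endpoint costs at most the
      increment of the variation function. These increments telescope, so the total error is of the
      order of the mesh.\<close>
    have piece: "\<bar>g (s n i) * (?e (s n (Suc i)) - ?e (s n i)) + c * integral {s n i..s n (Suc i)} (\<lambda>t. ?e t * g t)\<bar>
      \<le> c * (?v (s n (Suc i)) - ?v (s n i)) * (T / n)" for i
    proof -
      let ?a = "s n i" and ?b = "s n (Suc i)"
      have 1: "((\<lambda>t. g ?a * (c * ?e t)) has_integral g ?a * (?e ?a - ?e ?b)) {?a..?b}"
        by (intro has_integral_mult_right e_int sle)
      have 2: "((\<lambda>t. c * (?e t * g t)) has_integral c * integral {?a..?b} (\<lambda>t. ?e t * g t)) {?a..?b}"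
        by (intro has_integral_mult_right integrable_integral h_int s0)
      have d: "((\<lambda>t. c * (?e t * g t) - g ?a * (c * ?e t)) has_integral
         (c * integral {?a..?b} (\<lambda>t. ?e t * g t) - g ?a * (?e ?a - ?e ?b))) {?a..?b}"
        by (intro has_integral_diff 1 2)
      have "norm (c * integral {?a..?b} (\<lambda>t. ?e t * g t) - g ?a * (?e ?a - ?e ?b)) \<le>
         c * (?v ?b - ?v ?a) * measure lborel {?a..?b}"
      proof (rule has_integral_bound_real[where S = "{}", OF _ _ d])
        show "0 \<le> c * (?v ?b - ?v ?a)" using c variation_fun_diff[OF s0[of i] sle[of i]] by (intro mult_nonneg_nonneg) linarith+
        fix t assume "t \<in> {?a..?b} - {}"
        hence t: "t \<in> {?a..?b}" by simp
        have "\<bar>g t - g ?a\<bar> \<le> ?v ?b - ?v ?a"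
          using variation_fun_diff[of ?a t] variation_fun_diff[of t ?b] t s0[of i] by auto
        moreover have "?e t \<le> 1" using t s0[of i] c by simp
        ultimately have "?e t * \<bar>g t - g ?a\<bar> \<le> 1 * (?v ?b - ?v ?a)" by (intro mult_mono) auto
        hence "c * (?e t * \<bar>g t - g ?a\<bar>) \<le> c * (?v ?b - ?v ?a)" using c by (intro mult_left_mono) auto
        moreover have "c * (?e t * g t) - g ?a * (c * ?e t) = c * (?e t * (g t - g ?a))" by (simp add: algebra_simps)
        ultimately show "norm (c * (?e t * g t) - g ?a * (c * ?e t)) \<le> c * (?v ?b - ?v ?a)"
          using c by (simp add: abs_mult)
      qed simp
      thus ?thesis using sle[of i] by (simp add: sS algebra_simps)
    qed
    have "S n - K = - (\<Sum>i<n. g (s n i) * (?e (s n (Suc i)) - ?e (s n i)) + c * integral {s n i..s n (Suc i)} (\<lambda>t. ?e t * g t))"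
      unfolding S_def K_def parts[of n] sum.distrib using comb[of n] by (simp add: sn sum_distrib_left)
    hence "\<bar>S n - K\<bar> \<le> (\<Sum>i<n. \<bar>g (s n i) * (?e (s n (Suc i)) - ?e (s n i)) + c * integral {s n i..s n (Suc i)} (\<lambda>t. ?e t * g t)\<bar>)"
      by (simp only: abs_minus_cancel) (rule sum_abs)
    also have "\<dots> \<le> (\<Sum>i<n. c * (?v (s n (Suc i)) - ?v (s n i)) * (T / n))"
      by (intro sum_mono piece)
    also have "\<dots> = c * (\<Sum>i<n. ?v (s n (Suc i)) - ?v (s n i)) * (T / n)"
      by (simp only: sum_distrib_left sum_distrib_right)
    also have "(\<Sum>i<n. ?v (s n (Suc i)) - ?v (s n i)) = ?v T - ?v 0"
      using sum_lessThan_telescope[of "\<lambda>i. ?v (s n i)" n] by (simp add: sn)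
    also have "c * (?v T - ?v 0) * (T / n) \<le> c * V * (T / n)"
      using c T V[of T] v0[of 0] by (intro mult_right_mono mult_left_mono) auto
    finally show ?thesis by simp
  qed
  have "\<bar>I - K\<bar> \<le> 0 + \<epsilon>" if \<epsilon>: "\<epsilon> > 0" for \<epsilon>
  proof -
    have "\<exists>\<delta>>0. \<forall>(n :: nat) s \<xi>.
        s 0 = 0 \<and> s n = T \<and> (\<forall>i<n. s i \<le> \<xi> i \<and> \<xi> i \<le> s (Suc i) \<and> s (Suc i) - s i < \<delta>) \<longrightarrow>
        \<bar>(\<Sum>i<n. ?e (\<xi> i) * (g (s (Suc i)) - g (s i))) - I\<bar> < \<epsilon> / 2"
      using I half_gt_zero[OF \<epsilon>] unfolding has_stieltjes_integral_on_def by blast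
    then obtain \<delta> where \<delta>: "\<delta> > 0" and D: "\<And>(n :: nat) s \<xi>. s 0 = 0 \<Longrightarrow> s n = T \<Longrightarrow>
        \<forall>i<n. s i \<le> \<xi> i \<and> \<xi> i \<le> s (Suc i) \<and> s (Suc i) - s i < \<delta> \<Longrightarrow>
        \<bar>(\<Sum>i<n. ?e (\<xi> i) * (g (s (Suc i)) - g (s i))) - I\<bar> < \<epsilon> / 2"
      by blast
    \<comment> \<open>The first summand makes the mesh smaller than \<open>\<delta>\<close>, the
      second makes the error in \<open>est\<close> smaller than
      \<open>\<epsilon> / 2\<close>.\<close>
    define n where "n = Suc (nat \<lceil>T / \<delta>\<rceil> + nat \<lceil>c * V * T / (\<epsilon> / 2)\<rceil>)"
    have n0: "n > 0" by (simp add: n_def)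
    have "T / \<delta> < n" unfolding n_def by linarith
    hence n1: "T / n < \<delta>" using \<delta> n0 by (simp add: field_simps)
    have "c * V * T / (\<epsilon> / 2) < n" unfolding n_def by linarith
    hence n2: "c * V * T / n < \<epsilon> / 2" using \<epsilon> n0 by (simp add: field_simps)
    have "\<bar>S n - I\<bar> < \<epsilon> / 2" unfolding S_def
    proof (rule D)
      show "s n 0 = 0" "s n n = T" using n0 by (simp_all add: s_def)
      show "\<forall>i<n. s n i \<le> s n (Suc i) \<and> s n (Suc i) \<le> s n (Suc i) \<and> s n (Suc i) - s n i < \<delta>"
        using n1 T n0 by (auto simp: s_def field_simps)
    qed
    thus ?thesis using est[OF n0] n2 by linarith
  qed
  hence "\<bar>I - K\<bar> \<le> 0" by (rule field_le_epsilon)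
  thus "I = exp (- (c * T)) * g T - g 0 + c * integral {0..T} (\<lambda>t. ?e t * g t)" by (simp add: K_def)
qed

text \<open>Let T tend to infinity in the integration by parts over [0, T]: \<open>g 0 = 0\<close>
  removes the boundary term at 0, while boundedness of \<open>g\<close> and c > 0 remove the one at
  T.\<close>

lemma stieltjes_integral_exp:
  fixes c I :: real
  assumes c: "c > 0" and g0: "g 0 = 0"
    and I: "has_stieltjes_integral (\<lambda>t. exp (- (c * t))) g I"
  shows "has_bochner_integral lborel (\<lambda>t. indicator {0<..} t * (c * exp (- (c * t)) * g t)) I"
proof -
  let ?e = "\<lambda>t::real. exp (- (c * t))"
  obtain B where B: "\<And>t. t \<ge> 0 \<Longrightarrow> \<bar>g t\<bar> \<le> B" using bounded_variation_bounded by blast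
  obtain J where J: "\<And>T. T \<ge> 0 \<Longrightarrow> has_stieltjes_integral_on ?e g 0 T (J T)" and lim: "(J \<longlongrightarrow> I) at_top"
    using I unfolding has_stieltjes_integral_def by blast
  define F where "F = (\<lambda>t. indicator {0..} t * (?e t * g t))"
  have [measurable]: "(\<lambda>t. g (max 0 t)) \<in> borel_measurable borel" by (rule bounded_variation_measurable)
  have Feq: "F = (\<lambda>t. indicator {0..} t * (?e t * g (max 0 t)))"
    by (auto simp: F_def indicator_def fun_eq_iff)
  have Fm[measurable]: "F \<in> borel_measurable borel" unfolding Feq by measurable
  have "(\<integral>\<^sup>+t. ennreal (?e t) * indicator {0..} t \<partial>lborel) < \<infinity>"
  proof -
    have "((\<lambda>t. exp (- c * t)) has_integral exp (- c * 0) / c) {0..}"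
      by (rule has_integral_exp_minus_to_infinity[OF c])
    hence "(\<integral>\<^sup>+t. ennreal (exp (- c * t)) * indicator {0..} t \<partial>lborel) = ennreal (exp (- c * 0) / c)"
      by (intro nn_integral_has_integral_lebesgue') auto
    thus ?thesis by simp
  qed
  hence "integrable lborel (\<lambda>t. ?e t * indicator {0..} t)"
    by (intro integrableI_nonneg) (auto simp: ennreal_mult' ennreal_indicator)
  hence Fi: "integrable lborel F"
  proof (rule Bochner_Integration.integrable_bound[OF integrable_mult_right[of B]])
    show "AE t in lborel. norm (F t) \<le> norm (B * (?e t * indicator {0..} t))"
    proof (rule AE_I2)
      fix t :: real
      have "?e t * \<bar>g t\<bar> \<le> \<bar>B\<bar> * ?e t" if "t \<ge> 0"
        using B[OF that] by (simp add: mult.commute mult_left_mono)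
      thus "norm (F t) \<le> norm (B * (?e t * indicator {0..} t))"
        by (simp add: F_def indicator_def abs_mult)
    qed
  qed (auto simp: Fm)
  have JT: "J T = ?e T * g T + c * (\<integral>t. indicator {..T} t *\<^sub>R F t \<partial>lborel)" if T: "T > 0" for T
  proof -
    have "(\<integral>t. indicator {..T} t *\<^sub>R F t \<partial>lborel) = (LINT t:{0..T}|lborel. ?e t * g (max 0 t))"
      unfolding set_lebesgue_integral_def by (intro Bochner_Integration.integral_cong) (auto simp: F_def indicator_def)
    also have "\<dots> = integral {0..T} (\<lambda>t. ?e t * g (max 0 t))"
    proof (rule set_borel_integral_eq_integral(2))
      have "integrable lborel (\<lambda>t. indicator {..T} t *\<^sub>R F t)"
        by (rule integrable_mult_indicator[OF _ Fi]) simp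
      also have "(\<lambda>t. indicator {..T} t *\<^sub>R F t) = (\<lambda>t. indicator {0..T} t *\<^sub>R (?e t * g (max 0 t)))"
        by (auto simp: F_def indicator_def fun_eq_iff)
      finally show "set_integrable lborel {0..T} (\<lambda>t. ?e t * g (max 0 t))" by (simp add: set_integrable_def)
    qed
    also have "\<dots> = integral {0..T} (\<lambda>t. ?e t * g t)"
      by (rule Henstock_Kurzweil_Integration.integral_cong) auto
    finally show ?thesis
      using stieltjes_integral_exp_by_parts(2)[OF _ T J] c T g0 by simp
  qed
  have "filterlim (\<lambda>T. c * T) at_top at_top"
    by (rule filterlim_tendsto_pos_mult_at_top[OF tendsto_const c filterlim_ident])
  hence "filterlim (\<lambda>T. - (c * T)) at_bot at_top" by (simp add: filterlim_uminus_at_top)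
  hence "(?e \<longlongrightarrow> 0) at_top" by (rule filterlim_compose[OF exp_at_bot])
  from tendsto_mult_right[OF this, of B] have "((\<lambda>T. ?e T * B) \<longlongrightarrow> 0) at_top" by simp
  moreover have "\<forall>\<^sub>F T in at_top. norm (?e T * g T) \<le> ?e T * B"
    using B by (intro eventually_at_top_linorderI[of 0]) (simp add: abs_mult)
  ultimately have lim1: "((\<lambda>T. ?e T * g T) \<longlongrightarrow> 0) at_top"
    by (rule Lim_null_comparison[rotated])
  have lim2: "((\<lambda>T. \<integral>t. indicator {..T} t *\<^sub>R F t \<partial>lborel) \<longlongrightarrow> (\<integral>t. F t \<partial>lborel)) at_top"
    by (rule tendsto_integral_at_top[OF _ Fi]) simp
  have "((\<lambda>T. ?e T * g T + c * (\<integral>t. indicator {..T} t *\<^sub>R F t \<partial>lborel)) \<longlongrightarrow> 0 + c * (\<integral>t. F t \<partial>lborel)) at_top"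
    by (rule tendsto_add[OF lim1 tendsto_mult_left[OF lim2]])
  moreover have "\<forall>\<^sub>F T in at_top. ?e T * g T + c * (\<integral>t. indicator {..T} t *\<^sub>R F t \<partial>lborel) = J T"
    using JT by (intro eventually_at_top_linorderI[of 1]) auto
  ultimately have "(J \<longlongrightarrow> 0 + c * (\<integral>t. F t \<partial>lborel)) at_top"
    by (rule Lim_transform_eventually)
  hence Ieq: "I = (\<integral>t. c * F t \<partial>lborel)"
    using tendsto_unique[OF _ lim] by (simp add: trivial_limit_at_top_linorder)
  have "has_bochner_integral lborel (\<lambda>t. c * F t) I"
    using Fi by (simp add: has_bochner_integral_iff Ieq)
  thus ?thesis
  proof (rule has_bochner_integral_cong_AE[THEN iffD1, rotated 3])
    show "AE t in lborel. c * F t = indicator {0<..} t * (c * exp (- (c * t)) * g t)"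
      using AE_lborel_singleton[of 0] by eventually_elim (auto simp: F_def indicator_def)
    have "(\<lambda>t. indicator {0<..} t * (c * exp (- (c * t)) * g (max 0 t))) \<in> borel_measurable lborel" by measurable
    also have "(\<lambda>t. indicator {0<..} t * (c * exp (- (c * t)) * g (max 0 t))) = (\<lambda>t. indicator {0<..} t * (c * exp (- (c * t)) * g t))"
      by (auto simp: indicator_def fun_eq_iff max_def)
    finally show "(\<lambda>t. indicator {0<..} t * (c * exp (- (c * t)) * g t)) \<in> borel_measurable lborel" .
  qed (auto simp: Fm)
qed

end

subsection \<open>Laguerre functions and the Laguerre semigroup\<close>

text \<open>Used to identify integrals against the k-th Laguerre polynomial for all k at once, by
  comparing generating functions. After removing the terms known to agree, divide by
  \<open>w ^ n\<close> and let w tend to 0.\<close>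

lemma powser_coeff_unique:
  fixes a b :: "nat \<Rightarrow> real"
  assumes r: "r > 0"
    and a: "\<And>w. \<bar>w\<bar> < r \<Longrightarrow> (\<lambda>k. a k * w ^ k) sums f w"
    and b: "\<And>w. \<bar>w\<bar> < r \<Longrightarrow> (\<lambda>k. b k * w ^ k) sums f w"
  shows "a n = b n"
proof (induction n rule: less_induct)
  case (less n)
  have "((\<lambda>w :: real. 0 :: real) \<longlongrightarrow> (\<lambda>k. a (k + n) - b (k + n)) 0) (at 0)"
  proof (rule powser_limit_0_strong[OF r])
    fix w :: real assume w: "w \<noteq> 0" "norm w < r"
    have "(\<lambda>k. (a k - b k) * w ^ k) sums (f w - f w)"
      using sums_diff[OF a[of w] b[of w]] w by (simp add: left_diff_distrib)
    hence "(\<lambda>k. (a (k + n) - b (k + n)) * w ^ (k + n)) sums (0 - (\<Sum>i<n. (a i - b i) * w ^ i))"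
      using sums_split_initial_segment[of "\<lambda>k. (a k - b k) * w ^ k" 0 n] by simp
    moreover have "(\<Sum>i<n. (a i - b i) * w ^ i) = 0" using less by simp
    ultimately have "(\<lambda>k. (a (k + n) - b (k + n)) * w ^ (k + n) * (1 / w ^ n)) sums (0 * (1 / w ^ n))"
      by (intro sums_mult2) simp
    thus "(\<lambda>k. (a (k + n) - b (k + n)) * w ^ k) sums 0" using w by (simp add: power_add mult.assoc)
  qed
  from LIM_unique[OF this tendsto_const] show ?case by simp
qed

lemma laguerre_coeff_nonneg:
  assumes "\<alpha> > -1" "i \<le> k"
  shows "((real k + \<alpha>) gchoose (k - i)) \<ge> 0"
proof -
  have "((real k + \<alpha>) gchoose (k - i)) = (((\<alpha> + 1 + real i) + real (k - i) - 1) gchoose (k - i))"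
    using assms by (intro arg_cong2[where f = "(gchoose)"]) (auto simp: of_nat_diff)
  thus ?thesis using gbinomial_shift_nonneg[of "\<alpha> + 1 + real i" "k - i"] assms by simp
qed

text \<open>The coefficients alternate in sign, so passing to -y makes all terms nonnegative. The
  majorant is again a Laguerre polynomial and so has a generating function in closed form, which is
  what makes it usable for domination.\<close>

lemma abs_laguerre_le:
  assumes "\<alpha> > -1" "y \<ge> 0"
  shows "\<bar>laguerre \<alpha> k y\<bar> \<le> laguerre \<alpha> k (- y)"
proof -
  have "\<bar>laguerre \<alpha> k y\<bar> \<le> (\<Sum>i\<le>k. \<bar>(-1) ^ i * ((real k + \<alpha>) gchoose (k - i)) * y ^ i / fact i\<bar>)"
    unfolding laguerre_def by (rule sum_abs)
  also have "\<dots> = laguerre \<alpha> k (- y)"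
    unfolding laguerre_def
  proof (intro sum.cong refl)
    fix i assume "i \<in> {..k}"
    hence "\<bar>(real k + \<alpha>) gchoose (k - i)\<bar> = (real k + \<alpha>) gchoose (k - i)"
      using laguerre_coeff_nonneg[OF assms(1), of i k] by simp
    moreover have "(-1) ^ i * c * (- y) ^ i / fact i = c * y ^ i / fact i" for c :: real
    proof -
      have "(-1) ^ i * c * (- y) ^ i / fact i = ((-1) ^ i * (- y) ^ i) * c / fact i" by (simp only: mult_ac)
      also have "(-1) ^ i * (- y) ^ i = y ^ i" by (simp flip: power_mult_distrib)
      finally show ?thesis by (simp only: mult_ac)
    qed
    ultimately show "\<bar>(-1) ^ i * ((real k + \<alpha>) gchoose (k - i)) * y ^ i / fact i\<bar> =
       (-1) ^ i * ((real k + \<alpha>) gchoose (k - i)) * (- y) ^ i / fact i"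
      using assms(2) by (simp only: abs_mult power_abs abs_divide) simp
  qed
  finally show ?thesis .
qed

lemma laguerre_measurable [measurable]: "laguerre \<alpha> k \<in> borel_measurable borel"
  unfolding laguerre_def by measurable

section \<open>Generating functions under an integral sign, and orthogonality\<close>

text \<open>The Laplace transform \<open>H\<close> of \<open>F\<close> in the variable
  \<open>Y\<close> determines all integrals of \<open>F * exp (- Y)\<close> against Laguerre
  polynomials in \<open>Y\<close>: at \<open>1 / (1 - w)\<close> it is, up to a power, their
  generating function. To exchange sum and integral, the polynomials are dominated by their values
  at \<open>- Y\<close>; this produces the exponent \<open>- ((1 - 2 * v) / (1 - v)) * Y\<close>,
  which decays for v < 1/2, whence the restriction on w.\<close>

lemma laguerre_generating_integral:
  fixes F Y :: "'a \<Rightarrow> real" and H :: "real \<Rightarrow> real"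
  assumes \<alpha>: "\<alpha> > -1" and [measurable]: "F \<in> borel_measurable M" "Y \<in> borel_measurable M"
    and F0: "\<And>x. x \<in> space M \<Longrightarrow> F x \<ge> 0" and Y0: "\<And>x. x \<in> space M \<Longrightarrow> Y x \<ge> 0"
    and H: "\<And>a. a > 0 \<Longrightarrow> (\<integral>\<^sup>+x. ennreal (F x * exp (- a * Y x)) \<partial>M) = ennreal (H a)"
    and H0: "\<And>a. a > 0 \<Longrightarrow> H a \<ge> 0"
    and w: "\<bar>w\<bar> < 1 / 2"
  shows "integrable M (\<lambda>x. F x * exp (- Y x) * laguerre \<alpha> k (Y x))" (is ?int)
    and "(\<lambda>k. (\<integral>x. F x * exp (- Y x) * laguerre \<alpha> k (Y x) \<partial>M) * w ^ k) sums
      ((1 - w) powr (- \<alpha> - 1) * H (1 / (1 - w)))" (is ?sum)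
proof -
  have hbi: "has_bochner_integral M (\<lambda>x. F x * exp (- a * Y x)) (H a)" if "a > 0" for a
  proof (rule has_bochner_integral_nn_integral)
    show "AE x in M. 0 \<le> F x * exp (- a * Y x)" using F0 by (intro AE_I2) simp
    show "(\<integral>\<^sup>+x. ennreal (F x * exp (- a * Y x)) \<partial>M) = ennreal (H a)" by (rule H[OF that])
    show "0 \<le> H a" by (rule H0[OF that])
  qed measurable
  define D where "D = (\<lambda>v k x. F x * exp (- Y x) * laguerre \<alpha> k (- Y x) * v ^ k)"
  have Dsum: "(\<lambda>k. D v k x) sums ((1 - v) powr (- \<alpha> - 1) * (F x * exp (- ((1 - 2 * v) / (1 - v)) * Y x)))"
    if "0 \<le> v" "v < 1 / 2" for v x
  proof -
    have s: "(\<lambda>k. F x * exp (- Y x) * (laguerre \<alpha> k (- Y x) * v ^ k)) sums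
      (F x * exp (- Y x) * ((1 - v) powr (- \<alpha> - 1) * exp (- (- Y x) * v / (1 - v))))"
      using laguerre_generating_function[OF \<alpha>, of v "- Y x"] that by (intro sums_mult) auto
    have e: "exp (- Y x) * exp (- (- Y x) * v / (1 - v)) = exp (- ((1 - 2 * v) / (1 - v)) * Y x)"
    proof -
      have "- Y x + - (- Y x) * v / (1 - v) = - ((1 - 2 * v) / (1 - v)) * Y x"
        using that by (simp add: divide_simps) (simp add: algebra_simps)
      thus ?thesis by (simp only: exp_add[symmetric])
    qed
    have "F x * exp (- Y x) * ((1 - v) powr (- \<alpha> - 1) * exp (- (- Y x) * v / (1 - v))) =
      (1 - v) powr (- \<alpha> - 1) * (F x * exp (- ((1 - 2 * v) / (1 - v)) * Y x))"
      unfolding e[symmetric] by (simp only: mult_ac)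
    thus ?thesis using s by (simp only: D_def mult.assoc)
  qed
  have L0: "laguerre \<alpha> k (- Y x) \<ge> 0" if "x \<in> space M" for k x
    using abs_laguerre_le[OF \<alpha> Y0[OF that], of k] by linarith
  have D0: "D v k x \<ge> 0" if "x \<in> space M" "0 \<le> v" for v k x
    using that L0 F0 by (simp add: D_def)
  have Dint: "integrable M (D v k)" "(\<lambda>k. \<integral>x. D v k x \<partial>M) sums ((1 - v) powr (- \<alpha> - 1) * H ((1 - 2 * v) / (1 - v)))"
    if v: "0 < v" "v < 1 / 2" for v k
  proof -
    have tot: "has_bochner_integral M (\<lambda>x. (1 - v) powr (- \<alpha> - 1) * (F x * exp (- ((1 - 2 * v) / (1 - v)) * Y x)))
       ((1 - v) powr (- \<alpha> - 1) * H ((1 - 2 * v) / (1 - v)))"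
      using v by (intro has_bochner_integral_mult_right hbi) auto
    have part: "(\<Sum>k<n. D v k x) \<le> (1 - v) powr (- \<alpha> - 1) * (F x * exp (- ((1 - 2 * v) / (1 - v)) * Y x))"
      if "x \<in> space M" for n x
    proof -
      have "(\<Sum>k<n. D v k x) \<le> (\<Sum>k. D v k x)"
        using Dsum[of v x] D0[OF that, of v] v by (intro sum_le_suminf) (auto simp: sums_iff)
      thus ?thesis using Dsum[of v x] v by (simp add: sums_iff)
    qed
    show int: "integrable M (D v k)" for k
    proof (rule Bochner_Integration.integrable_bound[OF has_bochner_integral_iff[THEN iffD1, OF tot, THEN conjunct1]])
      show "D v k \<in> borel_measurable M" unfolding D_def by measurable
      show "AE x in M. norm (D v k x) \<le> norm ((1 - v) powr (- \<alpha> - 1) * (F x * exp (- ((1 - 2 * v) / (1 - v)) * Y x)))"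
      proof (rule AE_I2)
        fix x assume x: "x \<in> space M"
        have "D v k x \<le> (\<Sum>k<Suc k. D v k x)" using D0[OF x, of v] v by (simp add: sum_nonneg)
        thus "norm (D v k x) \<le> norm ((1 - v) powr (- \<alpha> - 1) * (F x * exp (- ((1 - 2 * v) / (1 - v)) * Y x)))"
          using part[OF x, of "Suc k"] D0[OF x, of v k] v by simp
      qed
    qed
    have "(\<lambda>k. \<integral>x. D v k x \<partial>M) sums (\<integral>x. (\<Sum>k. D v k x) \<partial>M)"
    proof (rule sums_integral[OF int])
      show "AE x in M. summable (\<lambda>k. norm (D v k x))"
        using Dsum[of v] D0[of _ v] v by (intro AE_I2) (auto simp: sums_iff)
      show "summable (\<lambda>k. \<integral>x. norm (D v k x) \<partial>M)"
      proof (rule bounded_imp_summable)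
        fix n
        have "(\<Sum>k\<le>n. \<integral>x. norm (D v k x) \<partial>M) = (\<integral>x. (\<Sum>k\<le>n. norm (D v k x)) \<partial>M)"
          using int by (intro Bochner_Integration.integral_sum[symmetric]) auto
        also have "\<dots> \<le> (\<integral>x. (1 - v) powr (- \<alpha> - 1) * (F x * exp (- ((1 - 2 * v) / (1 - v)) * Y x)) \<partial>M)"
        proof (rule integral_mono)
          show "(\<Sum>k\<le>n. norm (D v k x)) \<le> (1 - v) powr (- \<alpha> - 1) * (F x * exp (- ((1 - 2 * v) / (1 - v)) * Y x))"
            if "x \<in> space M" for x
            using part[OF that, of "Suc n"] D0[OF that, of v] v by (simp add: lessThan_Suc_atMost)
        qed (use int tot in \<open>auto simp: has_bochner_integral_iff\<close>)
        also have "\<dots> = (1 - v) powr (- \<alpha> - 1) * H ((1 - 2 * v) / (1 - v))"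
          using tot by (simp add: has_bochner_integral_iff)
        finally show "(\<Sum>k\<le>n. \<integral>x. norm (D v k x) \<partial>M) \<le> (1 - v) powr (- \<alpha> - 1) * H ((1 - 2 * v) / (1 - v))" .
      qed simp
    qed
    also have "(\<integral>x. (\<Sum>k. D v k x) \<partial>M) = (1 - v) powr (- \<alpha> - 1) * H ((1 - 2 * v) / (1 - v))"
      using Dsum[of v] v tot by (simp add: sums_iff has_bochner_integral_iff)
    finally show "(\<lambda>k. \<integral>x. D v k x \<partial>M) sums ((1 - v) powr (- \<alpha> - 1) * H ((1 - 2 * v) / (1 - v)))" .
  qed
  define G where "G = (\<lambda>k x. F x * exp (- Y x) * laguerre \<alpha> k (Y x))"
  have Gle: "\<bar>G k x\<bar> * v ^ k \<le> D v k x" if "x \<in> space M" "0 \<le> v" for k x v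
    using abs_laguerre_le[OF \<alpha> Y0[OF that(1)], of k] F0[OF that(1)] that
    by (simp add: G_def D_def abs_mult mult_left_mono mult_right_mono)
  have Gint: "integrable M (G k)" for k
  proof (rule Bochner_Integration.integrable_bound)
    \<comment> \<open>Any v strictly between 0 and 1/2 would do; dividing out \<open>v ^ k\<close>
      gives the factor \<open>4 ^ k\<close>.\<close>
    show "integrable M (\<lambda>x. D (1 / 4) k x * 4 ^ k)" using Dint(1)[of "1 / 4" k] by simp
    show "G k \<in> borel_measurable M" unfolding G_def by measurable
    show "AE x in M. norm (G k x) \<le> norm (D (1 / 4) k x * 4 ^ k)"
      using Gle[of _ "1 / 4" k] D0[of _ "1 / 4" k]
      by (intro AE_I2) (simp add: field_simps)
  qed
  thus ?int by (simp add: G_def)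
  have "(\<lambda>k. \<integral>x. G k x * w ^ k \<partial>M) sums (\<integral>x. (\<Sum>k. G k x * w ^ k) \<partial>M)"
  proof (rule sums_integral)
    \<comment> \<open>Halfway between |w| and 1/2: positive even for w = 0, at least |w|, and below
      1/2.\<close>
    define v where "v = (\<bar>w\<bar> + 1 / 2) / 2"
    have v: "0 < v" "v < 1 / 2" "\<bar>w\<bar> \<le> v" using w by (auto simp: v_def)
    have Gle': "\<bar>G k x * w ^ k\<bar> \<le> D v k x" if "x \<in> space M" for k x
    proof -
      have "\<bar>G k x * w ^ k\<bar> \<le> \<bar>G k x\<bar> * v ^ k"
        using v by (simp add: abs_mult power_abs mult_left_mono power_mono)
      thus ?thesis using Gle[OF that, of v k] v by simp
    qed
    show "integrable M (\<lambda>x. G k x * w ^ k)" for k using Gint by simp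
    show "AE x in M. summable (\<lambda>k. norm (G k x * w ^ k))"
    proof (rule AE_I2)
      fix x assume "x \<in> space M"
      show "summable (\<lambda>k. norm (G k x * w ^ k))"
      proof (rule summable_comparison_test'[where N = 0])
        show "summable (\<lambda>k. D v k x)" using Dsum[of v x] v by (simp add: sums_iff)
        show "norm (norm (G k x * w ^ k)) \<le> D v k x" for k using Gle'[OF \<open>x \<in> space M\<close>] by simp
      qed
    qed
    show "summable (\<lambda>k. \<integral>x. norm (G k x * w ^ k) \<partial>M)"
    proof (rule summable_comparison_test'[where N = 0])
      show "summable (\<lambda>k. \<integral>x. D v k x \<partial>M)" using Dint(2)[of v] v by (simp add: sums_iff)
      show "norm (\<integral>x. norm (G k x * w ^ k) \<partial>M) \<le> (\<integral>x. D v k x \<partial>M)" for k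
        using Gle'[of _ k] Gint[of k] Dint(1)[of v k] v by (auto intro!: integral_mono)
    qed
  qed
  also have "(\<integral>x. (\<Sum>k. G k x * w ^ k) \<partial>M) = (\<integral>x. (1 - w) powr (- \<alpha> - 1) * (F x * exp (- (1 / (1 - w)) * Y x)) \<partial>M)"
  proof (intro Bochner_Integration.integral_cong refl)
    fix x
    have s: "(\<lambda>k. F x * exp (- Y x) * (laguerre \<alpha> k (Y x) * w ^ k)) sums
      (F x * exp (- Y x) * ((1 - w) powr (- \<alpha> - 1) * exp (- Y x * w / (1 - w))))"
      using laguerre_generating_function[OF \<alpha>, of w "Y x"] w by (intro sums_mult) auto
    have e: "exp (- Y x) * exp (- Y x * w / (1 - w)) = exp (- (1 / (1 - w)) * Y x)"
    proof -
      have "- Y x + - Y x * w / (1 - w) = - (1 / (1 - w)) * Y x"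
        using w by (simp add: divide_simps) (simp add: algebra_simps)
      thus ?thesis by (simp only: exp_add[symmetric])
    qed
    have "F x * exp (- Y x) * ((1 - w) powr (- \<alpha> - 1) * exp (- Y x * w / (1 - w))) =
      (1 - w) powr (- \<alpha> - 1) * (F x * exp (- (1 / (1 - w)) * Y x))"
      unfolding e[symmetric] by (simp only: mult_ac)
    thus "(\<Sum>k. G k x * w ^ k) = (1 - w) powr (- \<alpha> - 1) * (F x * exp (- (1 / (1 - w)) * Y x))"
      using s by (simp only: G_def mult.assoc sums_iff)
  qed
  also have "\<dots> = (1 - w) powr (- \<alpha> - 1) * H (1 / (1 - w))"
    using hbi[of "1 / (1 - w)"] w by (simp add: has_bochner_integral_iff)
  finally show ?sum by (simp add: G_def)
qed

lemma nn_integral_power_exp_halfline_measure: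
  assumes \<alpha>: "\<alpha> > -1" and a: "a > 0"
  shows "(\<integral>\<^sup>+x. ennreal (x ^ i * exp (- a * x)) \<partial>halfline_measure \<alpha>) = ennreal (Gamma (\<alpha> + 1 + real i) * a powr (- (\<alpha> + 1 + real i)))"
proof -
  have "(\<integral>\<^sup>+x. ennreal (x ^ i * exp (- a * x)) \<partial>halfline_measure \<alpha>) =
     (\<integral>\<^sup>+x. ennreal (x powr (\<alpha> - (\<alpha> + i))) * ennreal (x ^ i * exp (- a * x)) \<partial>halfline_measure (\<alpha> + i))"
    by (intro nn_integral_halfline_measure_shift measurable_halfline_measure) measurable
  also have "\<dots> = (\<integral>\<^sup>+x. ennreal (exp (- a * x)) \<partial>halfline_measure (\<alpha> + i))"
  proof (rule nn_integral_cong)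
    fix x :: real assume "x \<in> space (halfline_measure (\<alpha> + i))"
    hence "x powr (\<alpha> - (\<alpha> + i)) * x ^ i = 1" by (simp add: powr_minus powr_realpow)
    hence "x powr (\<alpha> - (\<alpha> + i)) * (x ^ i * exp (- a * x)) = exp (- a * x)"
      by (metis mult.assoc mult_1)
    thus "ennreal (x powr (\<alpha> - (\<alpha> + i))) * ennreal (x ^ i * exp (- a * x)) = ennreal (exp (- a * x))"
      by (metis ennreal_mult' powr_ge_zero)
  qed
  also have "\<dots> = ennreal (Gamma (\<alpha> + 1 + real i) * a powr (- (\<alpha> + 1 + real i)))"
    using nn_integral_exp_halfline_measure[OF a, of "\<alpha> + i"] \<alpha> by (simp add: add_ac)
  finally show ?thesis .
qed

text \<open>The Laplace transform of \<open>y ^ i\<close> makes the generating function collapse to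
  a multiple of \<open>(1 - w) ^ i\<close>. The coefficients of this polynomial vanish beyond i,
  which is orthogonality to lower powers.\<close>

lemma laguerre_moment:
  fixes \<alpha> :: real
  assumes \<alpha>: "\<alpha> > -1"
  shows "integrable (halfline_measure \<alpha>) (\<lambda>y. y ^ i * exp (- y) * laguerre \<alpha> l y)"
    and "(\<integral>y. y ^ i * exp (- y) * laguerre \<alpha> l y \<partial>halfline_measure \<alpha>) =
       Gamma (\<alpha> + 1 + i) * (real (i choose l) * (-1) ^ l)"
proof -
  define H where "H = (\<lambda>a. Gamma (\<alpha> + 1 + i) * a powr (- (\<alpha> + 1 + i)))"
  have H: "(\<integral>\<^sup>+x. ennreal (x ^ i * exp (- a * x)) \<partial>halfline_measure \<alpha>) = ennreal (H a)" if "a > 0" for a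
    unfolding H_def by (rule nn_integral_power_exp_halfline_measure[OF \<alpha> that])
  have H0: "H a \<ge> 0" if "a > 0" for a using \<alpha> that by (simp add: H_def Gamma_real_nonneg)
  have meas: "(\<lambda>x. x ^ i) \<in> borel_measurable (halfline_measure \<alpha>)" "(\<lambda>x. x) \<in> borel_measurable (halfline_measure \<alpha>)"
    by (rule measurable_halfline_measure, measurable)+
  note gen = laguerre_generating_integral[OF \<alpha> meas _ _ H H0]
  show "integrable (halfline_measure \<alpha>) (\<lambda>y. y ^ i * exp (- y) * laguerre \<alpha> l y)"
    by (rule gen(1)[of 0]) auto
  show "(\<integral>y. y ^ i * exp (- y) * laguerre \<alpha> l y \<partial>halfline_measure \<alpha>) =
       Gamma (\<alpha> + 1 + i) * (real (i choose l) * (-1) ^ l)"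
  proof (rule powser_coeff_unique[of "1 / 2" "\<lambda>l. (\<integral>y. y ^ i * exp (- y) * laguerre \<alpha> l y \<partial>halfline_measure \<alpha>)"
       "\<lambda>w. (1 - w) powr (- \<alpha> - 1) * H (1 / (1 - w))"])
    fix w :: real assume w: "\<bar>w\<bar> < 1 / 2"
    show "(\<lambda>k. (\<integral>y. y ^ i * exp (- y) * laguerre \<alpha> k y \<partial>halfline_measure \<alpha>) * w ^ k) sums
         ((1 - w) powr (- \<alpha> - 1) * H (1 / (1 - w)))"
      by (rule gen(2)) (use w in auto)
    have "(\<lambda>k. Gamma (\<alpha> + 1 + i) * (real (i choose k) * (-1) ^ k) * w ^ k) sums
        (\<Sum>k\<le>i. Gamma (\<alpha> + 1 + i) * (real (i choose k) * (-1) ^ k) * w ^ k)"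
      by (rule sums_finite) (auto simp: binomial_eq_0)
    also have "(\<Sum>k\<le>i. Gamma (\<alpha> + 1 + i) * (real (i choose k) * (-1) ^ k) * w ^ k) = Gamma (\<alpha> + 1 + i) * (1 - w) ^ i"
    proof -
      have "(- w + 1) ^ i = (\<Sum>k\<le>i. real (i choose k) * (- w) ^ k * 1 ^ (i - k))"
        by (rule binomial_ring)
      also have "\<dots> = (\<Sum>k\<le>i. real (i choose k) * (-1) ^ k * w ^ k)"
        by (intro sum.cong refl) (simp only: power_minus[of w] mult.assoc power_one mult_1_right)
      finally have "(1 - w) ^ i = (\<Sum>k\<le>i. real (i choose k) * (-1) ^ k * w ^ k)" by simp
      thus ?thesis by (simp only: sum_distrib_left mult.assoc)
    qed
    also have "Gamma (\<alpha> + 1 + i) * (1 - w) ^ i = (1 - w) powr (- \<alpha> - 1) * H (1 / (1 - w))"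
    proof -
      have "(1 - w) powr (- \<alpha> - 1) * (1 / (1 - w)) powr (- (\<alpha> + 1 + i)) = (1 - w) powr (- \<alpha> - 1) * (1 - w) powr (\<alpha> + 1 + i)"
      proof -
        have "(1 / (1 - w)) powr (- (\<alpha> + 1 + i)) = (1 - w) powr (\<alpha> + 1 + i)"
          using w by (subst powr_minus) (simp add: powr_divide)
        thus ?thesis by (simp only:)
      qed
      also have "\<dots> = (1 - w) powr real i" by (simp flip: powr_add)
      also have "\<dots> = (1 - w) ^ i" using w by (simp add: powr_realpow)
      finally show ?thesis by (simp add: H_def)
    qed
    finally show "(\<lambda>k. Gamma (\<alpha> + 1 + i) * (real (i choose k) * (-1) ^ k) * w ^ k) sums
       ((1 - w) powr (- \<alpha> - 1) * H (1 / (1 - w)))" .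
  qed simp
qed

text \<open>For k \<le> l expand the polynomial of lower degree in powers: the i-th power
  contributes only if l \<le> i \<le> k, that is, only for i = k = l.\<close>

lemma laguerre_orthogonal:
  fixes \<alpha> :: real
  assumes \<alpha>: "\<alpha> > -1"
  shows "has_bochner_integral (halfline_measure \<alpha>) (\<lambda>y. exp (- y) * laguerre \<alpha> k y * laguerre \<alpha> l y)
     (if k = l then Gamma (k + \<alpha> + 1) / fact k else 0)"
proof -
  define c where "c = (\<lambda>k i. (-1) ^ i * ((real k + \<alpha>) gchoose (k - i)) / fact i)"
  have L: "laguerre \<alpha> k y = (\<Sum>i\<le>k. c k i * y ^ i)" for k y
    by (simp add: laguerre_def c_def)
  have le: "has_bochner_integral (halfline_measure \<alpha>) (\<lambda>y. exp (- y) * laguerre \<alpha> k y * laguerre \<alpha> l y)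
     (if k = l then Gamma (k + \<alpha> + 1) / fact k else 0)" if "k \<le> l" for k l
  proof -
    have "has_bochner_integral (halfline_measure \<alpha>) (\<lambda>y. \<Sum>i\<le>k. c k i * (y ^ i * exp (- y) * laguerre \<alpha> l y))
       (\<Sum>i\<le>k. c k i * (Gamma (\<alpha> + 1 + i) * (real (i choose l) * (-1) ^ l)))"
      by (intro has_bochner_integral_sum has_bochner_integral_mult_right)
         (auto simp: has_bochner_integral_iff laguerre_moment[OF \<alpha>])
    also have "(\<lambda>y. \<Sum>i\<le>k. c k i * (y ^ i * exp (- y) * laguerre \<alpha> l y)) = (\<lambda>y. exp (- y) * laguerre \<alpha> k y * laguerre \<alpha> l y)"
      by (simp add: L[of k] sum_distrib_left sum_distrib_right mult_ac)
    also have "(\<Sum>i\<le>k. c k i * (Gamma (\<alpha> + 1 + i) * (real (i choose l) * (-1) ^ l))) =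
      (\<Sum>i\<le>k. if i = k then (if k = l then Gamma (k + \<alpha> + 1) / fact k else 0) else 0)"
    proof (intro sum.cong refl)
      fix i assume "i \<in> {..k}"
      have "(-1) ^ k * (-1) ^ k = (1::real)" by (simp flip: power_mult_distrib)
      hence "(-1) ^ k * ((-1) ^ k * x) = x" for x :: real by (metis mult.assoc mult_1)
      thus "c k i * (Gamma (\<alpha> + 1 + i) * (real (i choose l) * (-1) ^ l)) =
         (if i = k then (if k = l then Gamma (k + \<alpha> + 1) / fact k else 0) else 0)"
        using \<open>i \<in> {..k}\<close> that by (auto simp: binomial_eq_0 c_def add_ac)
    qed
    finally show ?thesis by simp
  qed
  show ?thesis
  proof (cases "k \<le> l")
    case False
    thus ?thesis using le[of l k] by (auto simp: mult_ac)
  qed (use le in auto)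
qed

lemma laguerre_fun_measurable [measurable]: "laguerre_fun \<alpha> k \<in> borel_measurable borel"
  unfolding laguerre_fun_def by measurable

lemma laguerre_fun_orthonormal:
  fixes \<alpha> :: real
  assumes \<alpha>: "\<alpha> > -1"
  shows "has_bochner_integral (halfline_measure \<alpha>) (\<lambda>y. laguerre_fun \<alpha> k y * laguerre_fun \<alpha> l y) (if k = l then 1 else 0)"
proof -
  have G: "Gamma (real k + \<alpha> + 1) > 0" for k :: nat using \<alpha> by (intro Gamma_real_pos) simp
  define s where "s = (\<lambda>k. sqrt (fact k / Gamma (real k + \<alpha> + 1)))"
  have "has_bochner_integral (halfline_measure \<alpha>) (\<lambda>y. (s k * s l) * (exp (- y) * laguerre \<alpha> k y * laguerre \<alpha> l y))
     ((s k * s l) * (if k = l then Gamma (k + \<alpha> + 1) / fact k else 0))"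
    by (intro has_bochner_integral_mult_right laguerre_orthogonal \<alpha>)
  also have "(\<lambda>y. (s k * s l) * (exp (- y) * laguerre \<alpha> k y * laguerre \<alpha> l y)) = (\<lambda>y. laguerre_fun \<alpha> k y * laguerre_fun \<alpha> l y)"
  proof
    fix y :: real
    have "exp (- y) = exp (- y / 2) * exp (- y / 2)" by (simp flip: exp_add)
    thus "(s k * s l) * (exp (- y) * laguerre \<alpha> k y * laguerre \<alpha> l y) = laguerre_fun \<alpha> k y * laguerre_fun \<alpha> l y"
      by (simp add: laguerre_fun_def s_def mult_ac)
  qed
  also have "(s k * s l) * (if k = l then Gamma (k + \<alpha> + 1) / fact k else 0) = (if k = l then 1 else 0)"
  proof -
    have "s k * s k = fact k / Gamma (real k + \<alpha> + 1)" using G[of k] by (simp add: s_def)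
    hence "s k * s k * (Gamma (real k + \<alpha> + 1) / fact k) = 1" using G[of k] by simp
    thus ?thesis by auto
  qed
  finally show ?thesis .
qed

section \<open>The eigenfunction relation of the semigroup kernel\<close>

text \<open>
  Up to the factor \<open>sqrt pi * Gamma (\<alpha> + 3 / 2)\<close>, the even part of
  \<open>\<lambda>v. theta \<alpha> (2 * v * sqrt s)\<close> at \<open>v = sqrt u\<close>, integrated against \<open>bessel_measure \<alpha>\<close>, is the Bessel series
  \<open>\<Sum>j. s ^ j / (j! * Gamma (j + \<alpha> + 1))\<close>. Poisson's integral for it, with weight \<open>(1 - u) powr (\<alpha> - 1 / 2)\<close>,
  diverges for \<open>\<alpha> \<le> - 1 / 2\<close>; raising the order by one costs the linear factor in \<open>theta\<close> and works for all \<open>\<alpha> > - 1\<close>.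
\<close>

definition bessel_measure :: "real \<Rightarrow> real measure" where
  "bessel_measure \<alpha> = density lborel (\<lambda>u. ennreal (indicator {0<..<1} u * (u powr (- 1 / 2) * (1 - u) powr (\<alpha> + 1 / 2))))"

definition theta :: "real \<Rightarrow> real \<Rightarrow> real" where
  "theta \<alpha> z = (\<alpha> + 1 + z / 2) * exp z"

lemma space_bessel_measure [simp]: "space (bessel_measure \<alpha>) = UNIV"
  by (simp add: bessel_measure_def)

lemma sets_bessel_measure [simp, measurable_cong]: "sets (bessel_measure \<alpha>) = sets borel"
  by (simp add: bessel_measure_def)

lemma AE_bessel_measure: "AE u in bessel_measure \<alpha>. 0 < u \<and> u < 1"
  unfolding bessel_measure_def by (subst AE_density) (auto simp: indicator_def)

lemma sigma_finite_bessel_measure: "sigma_finite_measure (bessel_measure \<alpha>)"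
  unfolding bessel_measure_def by (subst sigma_finite_measure.sigma_finite_iff_density_finite[OF sigma_finite_lborel]) auto

lemma theta_measurable [measurable]: "theta \<alpha> \<in> borel_measurable borel"
  unfolding theta_def by measurable

text \<open>The linear factor of \<open>theta\<close> adds n/2 to the n-th coefficient of the
  exponential series. In the even part n = 2 j, which leaves the factor \<alpha> + 1 + j that later
  cancels against Gamma(j + \<alpha> + 2).\<close>

lemma theta_sums:
  "(\<lambda>j. (\<alpha> + 1 + real j) * z ^ (2 * j) / fact (2 * j)) sums ((theta \<alpha> z + theta \<alpha> (- z)) / 2)"
proof -
  have th: "(\<lambda>n. (\<alpha> + 1 + real n / 2) * z ^ n / fact n) sums theta \<alpha> z" for z
  proof -
    have e: "(\<lambda>n. z ^ n / fact n) sums exp z"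
      using exp_converges[of z] by (simp add: divide_inverse mult.commute)
    have "(\<lambda>n. real (Suc n) * z ^ Suc n / fact (Suc n)) sums (z * exp z)"
      using sums_mult[OF e, of z] by (simp add: fact_Suc field_simps del: of_nat_Suc)
    hence "(\<lambda>n. real n * z ^ n / fact n) sums (z * exp z)"
      by (subst (asm) sums_Suc_iff) simp
    from sums_add[OF sums_mult[OF e, of "\<alpha> + 1"] sums_mult[OF this, of "1 / 2"]]
    show ?thesis by (simp add: theta_def ring_distribs add_divide_distrib mult_ac)
  qed
  define f where "f = (\<lambda>n. ((\<alpha> + 1 + real n / 2) * z ^ n / fact n + (\<alpha> + 1 + real n / 2) * (- z) ^ n / fact n) / 2)"
  have "f sums ((theta \<alpha> z + theta \<alpha> (- z)) / 2)"
    unfolding f_def by (intro sums_divide sums_add th)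
  moreover have "(\<lambda>j. f (2 * j)) sums c \<longleftrightarrow> f sums c" for c
  proof (rule sums_mono_reindex)
    show "strict_mono (\<lambda>j::nat. 2 * j)" by (simp add: strict_mono_def)
    fix n :: nat assume "n \<notin> range (\<lambda>j. 2 * j)"
    hence "odd n" by (auto elim!: evenE)
    thus "f n = 0" by (simp add: f_def)
  qed
  moreover have "f (2 * j) = (\<alpha> + 1 + real j) * z ^ (2 * j) / fact (2 * j)" for j
    by (simp add: f_def)
  ultimately show ?thesis by simp
qed

text \<open>\<open>theta\<close> itself changes sign at z = -2(\<alpha> + 1), but its even part has
  a power series with nonnegative coefficients. This sign is what lets the averaged kernel serve as
  the weight \<open>F\<close> in \<open>laguerre_generating_integral\<close>.\<close>

lemma theta_even_nonneg:
  assumes "\<alpha> > -1"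
  shows "theta \<alpha> z + theta \<alpha> (- z) \<ge> 0"
proof -
  have "0 \<le> (\<Sum>j. (\<alpha> + 1 + real j) * z ^ (2 * j) / fact (2 * j))"
    using assms sums_summable[OF theta_sums[of \<alpha> z]] by (intro suminf_nonneg) (auto simp: power_mult)
  thus ?thesis using sums_unique[OF theta_sums[of \<alpha> z]] by simp
qed

lemma nn_integral_power_bessel_measure:
  assumes "\<alpha> > -1"
  shows "(\<integral>\<^sup>+u. ennreal (u ^ j) \<partial>bessel_measure \<alpha>) = ennreal (Beta (real j + 1 / 2) (\<alpha> + 3 / 2))"
proof -
  have "((\<lambda>t. t powr (real j + 1 / 2 - 1) * (1 - t) powr (\<alpha> + 3 / 2 - 1)) has_integral Beta (real j + 1 / 2) (\<alpha> + 3 / 2)) {0<..<1}"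
    using has_integral_Beta_real[of "real j + 1 / 2" "\<alpha> + 3 / 2"] assms by (simp add: has_integral_Icc_iff_Ioo)
  hence *: "(\<integral>\<^sup>+t. ennreal (t powr (real j + 1 / 2 - 1) * (1 - t) powr (\<alpha> + 3 / 2 - 1)) * indicator {0<..<1} t \<partial>lborel) =
      ennreal (Beta (real j + 1 / 2) (\<alpha> + 3 / 2))"
    by (intro nn_integral_has_integral_lebesgue') auto
  have "(\<integral>\<^sup>+u. ennreal (u ^ j) \<partial>bessel_measure \<alpha>) = (\<integral>\<^sup>+u. ennreal (indicator {0<..<1} u * (u powr (- 1 / 2) * (1 - u) powr (\<alpha> + 1 / 2))) * ennreal (u ^ j) \<partial>lborel)"
    unfolding bessel_measure_def by (rule nn_integral_density) measurable
  also have "\<dots> = (\<integral>\<^sup>+t. ennreal (t powr (real j + 1 / 2 - 1) * (1 - t) powr (\<alpha> + 3 / 2 - 1)) * indicator {0<..<1} t \<partial>lborel)"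
  proof (rule nn_integral_cong)
    fix u :: real
    show "ennreal (indicator {0<..<1} u * (u powr (- 1 / 2) * (1 - u) powr (\<alpha> + 1 / 2))) * ennreal (u ^ j) =
       ennreal (u powr (real j + 1 / 2 - 1) * (1 - u) powr (\<alpha> + 3 / 2 - 1)) * indicator {0<..<1} u"
    proof (cases "u \<in> {0<..<1}")
      case True
      hence "u powr (real j + 1 / 2 - 1) = u ^ j * u powr (- 1 / 2)"
        by (simp add: powr_realpow[symmetric] powr_add[symmetric])
      moreover have "\<alpha> + 3 / 2 - 1 = \<alpha> + 1 / 2" by simp
      ultimately show ?thesis using True by (simp add: ennreal_mult[symmetric] mult_ac add.commute)
    qed auto
  qed
  finally show ?thesis using * by simp
qed

lemma Gamma_half_plus_nat: "Gamma (real j + 1 / 2) = fact (2 * j) * sqrt pi / (4 ^ j * fact j)"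
proof -
  have "pochhammer (1 / 2 :: real) j = Gamma (1 / 2 + real j) / Gamma (1 / 2)"
    by (rule pochhammer_Gamma) (auto elim!: nonpos_Ints_cases simp: field_simps)
  hence "Gamma (real j + 1 / 2) = pochhammer (1 / 2) j * sqrt pi"
    by (simp add: Gamma_one_half_real add.commute)
  moreover have "fact (2 * j) = (4 ^ j * pochhammer (1 / 2) j * fact j :: real)"
    using fact_double[of j, where ?'a = real] by (simp add: power_mult)
  ultimately show ?thesis by simp
qed

lemma nn_integral_theta_bessel_measure:
  assumes \<alpha>: "\<alpha> > -1" and s: "s \<ge> 0"
  shows "(\<integral>\<^sup>+u. ennreal ((theta \<alpha> (2 * sqrt (s * u)) + theta \<alpha> (- (2 * sqrt (s * u)))) / 2) \<partial>bessel_measure \<alpha>) =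
    (\<Sum>j. ennreal (sqrt pi * Gamma (\<alpha> + 3 / 2) / (fact j * Gamma (real j + \<alpha> + 1)) * s ^ j))"
proof -
  define c where "c = (\<lambda>j. (\<alpha> + 1 + real j) * (4 * s) ^ j / fact (2 * j))"
  have c0: "c j \<ge> 0" for j using \<alpha> s by (simp add: c_def)
  have "(\<integral>\<^sup>+u. ennreal ((theta \<alpha> (2 * sqrt (s * u)) + theta \<alpha> (- (2 * sqrt (s * u)))) / 2) \<partial>bessel_measure \<alpha>) =
    (\<integral>\<^sup>+u. (\<Sum>j. ennreal (c j) * ennreal (u ^ j)) \<partial>bessel_measure \<alpha>)"
  proof (rule nn_integral_cong_AE, rule AE_mp[OF AE_bessel_measure], rule AE_I2, rule impI)
    fix u :: real assume u: "0 < u \<and> u < 1"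
    have z: "(2 * sqrt (s * u)) ^ (2 * j) = (4 * s) ^ j * u ^ j" for j
    proof -
      have "(2 * sqrt (s * u)) ^ 2 = 4 * s * u" using u s by (simp add: power_mult_distrib)
      thus ?thesis by (simp add: power_mult power_mult_distrib)
    qed
    have "(\<lambda>j. c j * u ^ j) sums ((theta \<alpha> (2 * sqrt (s * u)) + theta \<alpha> (- (2 * sqrt (s * u)))) / 2)"
      using theta_sums[of \<alpha> "2 * sqrt (s * u)"] by (simp only: z c_def times_divide_eq_left mult.assoc)
    hence "summable (\<lambda>j. c j * u ^ j)" "(theta \<alpha> (2 * sqrt (s * u)) + theta \<alpha> (- (2 * sqrt (s * u)))) / 2 = (\<Sum>j. c j * u ^ j)"
      by (rule sums_summable, rule sums_unique)
    moreover have "(\<Sum>j. ennreal (c j) * ennreal (u ^ j)) = (\<Sum>j. ennreal (c j * u ^ j))"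
      using c0 u by (simp add: ennreal_mult)
    ultimately show "ennreal ((theta \<alpha> (2 * sqrt (s * u)) + theta \<alpha> (- (2 * sqrt (s * u)))) / 2) = (\<Sum>j. ennreal (c j) * ennreal (u ^ j))"
      using c0 u by (simp only: suminf_ennreal2 mult_nonneg_nonneg zero_le_power less_imp_le)
  qed
  also have "\<dots> = (\<Sum>j. \<integral>\<^sup>+u. ennreal (c j) * ennreal (u ^ j) \<partial>bessel_measure \<alpha>)"
    by (rule nn_integral_suminf) measurable
  also have "\<dots> = (\<Sum>j. ennreal (sqrt pi * Gamma (\<alpha> + 3 / 2) / (fact j * Gamma (real j + \<alpha> + 1)) * s ^ j))"
  proof (rule suminf_cong)
    fix j
    have "(\<integral>\<^sup>+u. ennreal (c j) * ennreal (u ^ j) \<partial>bessel_measure \<alpha>) = ennreal (c j) * ennreal (Beta (real j + 1 / 2) (\<alpha> + 3 / 2))"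
      by (subst nn_integral_cmult) (simp_all add: nn_integral_power_bessel_measure[OF \<alpha>])
    also have "\<dots> = ennreal (c j * Beta (real j + 1 / 2) (\<alpha> + 3 / 2))"
      using c0 by (simp add: ennreal_mult')
    also have "c j * Beta (real j + 1 / 2) (\<alpha> + 3 / 2) = sqrt pi * Gamma (\<alpha> + 3 / 2) / (fact j * Gamma (real j + \<alpha> + 1)) * s ^ j"
    proof -
      \<comment> \<open>The functional equation lowers the argument of the Gamma function by one;
        the factor released cancels the one in \<open>c j\<close>.\<close>
      have "real j + \<alpha> + 1 \<notin> \<int>\<^sub>\<le>\<^sub>0" using \<alpha> by (auto elim!: nonpos_Ints_cases)
      hence "Gamma (real j + \<alpha> + 1 + 1) = (real j + \<alpha> + 1) * Gamma (real j + \<alpha> + 1)"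
        by (rule Gamma_plus1)
      moreover have "real j + 1 / 2 + (\<alpha> + 3 / 2) = real j + \<alpha> + 1 + 1" by simp
      ultimately have "Beta (real j + 1 / 2) (\<alpha> + 3 / 2) = fact (2 * j) * sqrt pi / (4 ^ j * fact j) * Gamma (\<alpha> + 3 / 2) / ((real j + \<alpha> + 1) * Gamma (real j + \<alpha> + 1))"
        unfolding Beta_def Gamma_half_plus_nat by metis
      moreover have "real j + \<alpha> + 1 \<noteq> 0" using \<alpha> by linarith
      moreover have "c j = (real j + \<alpha> + 1) * 4 ^ j * s ^ j / fact (2 * j)"
        by (simp only: c_def power_mult_distrib mult_ac add_ac)
      moreover have "D * F * S / f2 * (f2 * P / (F * f1) * K / (D * G)) = P * K / (f1 * G) * S"
        if "D \<noteq> 0" "F \<noteq> 0" "f2 \<noteq> 0" for D F S f2 P f1 K G :: real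
        using that by simp
      ultimately show ?thesis by simp
    qed
    finally show "(\<integral>\<^sup>+u. ennreal (c j) * ennreal (u ^ j) \<partial>bessel_measure \<alpha>) =
       ennreal (sqrt pi * Gamma (\<alpha> + 3 / 2) / (fact j * Gamma (real j + \<alpha> + 1)) * s ^ j)" .
  qed
  finally show ?thesis .
qed

text \<open>Laplace transform of a modified Bessel function against the weight
  \<open>y powr \<alpha>\<close>: in the term by term integration the Gamma factors cancel and an
  exponential series remains.\<close>

lemma nn_integral_theta_exp:
  assumes \<alpha>: "\<alpha> > -1" and b: "b \<ge> 0" and A: "A > 0"
  shows "(\<integral>\<^sup>+y. ennreal (exp (- A * y)) * (\<integral>\<^sup>+u. ennreal ((theta \<alpha> (2 * sqrt (b * y * u)) + theta \<alpha> (- (2 * sqrt (b * y * u)))) / 2) \<partial>bessel_measure \<alpha>) \<partial>halfline_measure \<alpha>) =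
    ennreal (sqrt pi * Gamma (\<alpha> + 3 / 2) * (A powr (- \<alpha> - 1) * exp (b / A)))"
proof -
  define c where "c = sqrt pi * Gamma (\<alpha> + 3 / 2)"
  have c0: "c \<ge> 0" using \<alpha> unfolding c_def by (intro mult_nonneg_nonneg Gamma_real_nonneg) auto
  have G: "Gamma (real j + \<alpha> + 1) > 0" for j using \<alpha> by (intro Gamma_real_pos) simp
  have "(\<integral>\<^sup>+y. ennreal (exp (- A * y)) * (\<integral>\<^sup>+u. ennreal ((theta \<alpha> (2 * sqrt (b * y * u)) + theta \<alpha> (- (2 * sqrt (b * y * u)))) / 2) \<partial>bessel_measure \<alpha>) \<partial>halfline_measure \<alpha>) =
    (\<integral>\<^sup>+y. (\<Sum>j. ennreal (c / (fact j * Gamma (real j + \<alpha> + 1)) * b ^ j) * ennreal (y ^ j * exp (- A * y))) \<partial>halfline_measure \<alpha>)"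
  proof (rule nn_integral_cong)
    fix y assume "y \<in> space (halfline_measure \<alpha>)"
    hence y: "y > 0" by simp
    have "ennreal (exp (- A * y)) * ennreal (c / (fact j * Gamma (real j + \<alpha> + 1)) * (b * y) ^ j) =
      ennreal (c / (fact j * Gamma (real j + \<alpha> + 1)) * b ^ j) * ennreal (y ^ j * exp (- A * y))" for j
    proof -
      have "0 \<le> c / (fact j * Gamma (real j + \<alpha> + 1)) * b ^ j" using c0 G[of j] b by simp
      thus ?thesis using c0 G[of j] b y
        by (simp only: ennreal_mult'[symmetric] exp_ge_zero power_mult_distrib) (simp only: mult_ac)
    qed
    thus "ennreal (exp (- A * y)) * (\<integral>\<^sup>+u. ennreal ((theta \<alpha> (2 * sqrt (b * y * u)) + theta \<alpha> (- (2 * sqrt (b * y * u)))) / 2) \<partial>bessel_measure \<alpha>) =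
      (\<Sum>j. ennreal (c / (fact j * Gamma (real j + \<alpha> + 1)) * b ^ j) * ennreal (y ^ j * exp (- A * y)))"
      using nn_integral_theta_bessel_measure[OF \<alpha>, of "b * y"] b y
      by (simp add: c_def flip: ennreal_suminf_cmult)
  qed
  also have "\<dots> = (\<Sum>j. \<integral>\<^sup>+y. ennreal (c / (fact j * Gamma (real j + \<alpha> + 1)) * b ^ j) * ennreal (y ^ j * exp (- A * y)) \<partial>halfline_measure \<alpha>)"
    by (intro nn_integral_suminf measurable_halfline_measure) measurable
  also have "\<dots> = (\<Sum>j. ennreal (c * A powr (- \<alpha> - 1) * ((b / A) ^ j / fact j)))"
  proof (rule suminf_cong)
    fix j
    have "(\<integral>\<^sup>+y. ennreal (c / (fact j * Gamma (real j + \<alpha> + 1)) * b ^ j) * ennreal (y ^ j * exp (- A * y)) \<partial>halfline_measure \<alpha>)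
      = ennreal (c / (fact j * Gamma (real j + \<alpha> + 1)) * b ^ j) * (\<integral>\<^sup>+y. ennreal (y ^ j * exp (- A * y)) \<partial>halfline_measure \<alpha>)"
      by (intro nn_integral_cmult measurable_halfline_measure) measurable
    also have "(\<integral>\<^sup>+y. ennreal (y ^ j * exp (- A * y)) \<partial>halfline_measure \<alpha>) = ennreal (Gamma (\<alpha> + 1 + j) * A powr (- (\<alpha> + 1 + j)))"
      by (rule nn_integral_power_exp_halfline_measure[OF \<alpha> A])
    also have "ennreal (c / (fact j * Gamma (real j + \<alpha> + 1)) * b ^ j) * ennreal (Gamma (\<alpha> + 1 + j) * A powr (- (\<alpha> + 1 + j))) =
      ennreal (c / (fact j * Gamma (real j + \<alpha> + 1)) * b ^ j * (Gamma (\<alpha> + 1 + j) * A powr (- (\<alpha> + 1 + j))))"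
      using c0 G[of j] b by (intro ennreal_mult'[symmetric]) simp
    also have "A powr (- (\<alpha> + 1 + j)) = A powr (- \<alpha> - 1) / A ^ j"
    proof -
      have "- (\<alpha> + 1 + j) = (- \<alpha> - 1) - real j" by simp
      thus ?thesis using A by (simp only: powr_diff powr_realpow)
    qed
    also have "c / (fact j * Gamma (real j + \<alpha> + 1)) * b ^ j * (Gamma (\<alpha> + 1 + j) * (A powr (- \<alpha> - 1) / A ^ j)) =
      c * A powr (- \<alpha> - 1) * ((b / A) ^ j / fact j)"
    proof -
      have "Gamma (\<alpha> + 1 + j) = Gamma (real j + \<alpha> + 1)" by (simp add: add_ac)
      thus ?thesis using G[of j] by (simp add: power_divide mult_ac)
    qed
    finally show "(\<integral>\<^sup>+y. ennreal (c / (fact j * Gamma (real j + \<alpha> + 1)) * b ^ j) * ennreal (y ^ j * exp (- A * y)) \<partial>halfline_measure \<alpha>)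
      = ennreal (c * A powr (- \<alpha> - 1) * ((b / A) ^ j / fact j))" .
  qed
  also have "\<dots> = ennreal (c * A powr (- \<alpha> - 1) * exp (b / A))"
  proof -
    have "(\<lambda>j. (b / A) ^ j / fact j) sums exp (b / A)"
      using exp_converges[of "b / A"] by (simp add: divide_inverse mult.commute)
    from sums_mult[OF this, of "c * A powr (- \<alpha> - 1)"] show ?thesis
      using c0 b A by (subst suminf_ennreal2) (auto simp: sums_iff)
  qed
  finally show ?thesis by (simp add: c_def mult.assoc)
qed

lemma measurable_halfline_bessel:
  assumes "f \<in> borel_measurable (borel \<Otimes>\<^sub>M borel)"
  shows "f \<in> borel_measurable (halfline_measure \<gamma> \<Otimes>\<^sub>M bessel_measure \<alpha>)"
proof -
  have id: "(\<lambda>x. x) \<in> halfline_measure \<gamma> \<rightarrow>\<^sub>M borel"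
    by (rule measurable_halfline_measure) measurable
  have "(\<lambda>z. (fst z, snd z)) \<in> halfline_measure \<gamma> \<Otimes>\<^sub>M bessel_measure \<alpha> \<rightarrow>\<^sub>M borel \<Otimes>\<^sub>M borel"
    by (rule measurable_Pair[OF measurable_compose[OF measurable_fst id]]) measurable
  from measurable_compose[OF this assms] show ?thesis by simp
qed

text \<open>The kernel is not expanded in Laguerre functions. For fixed x its Laplace transform in y
  is known in closed form, and inserting \<open>1 / (1 - w)\<close> yields the generating function
  of the Laguerre polynomials of x at \<open>r * w\<close>. Comparing coefficients gives the
  eigenvalue \<open>r ^ k\<close>.\<close>

lemma laguerre_theta_integral:
  assumes \<alpha>: "\<alpha> > -1" and r: "0 < r" "r < 1" and x: "x > 0"
  defines "c \<equiv> sqrt pi * Gamma (\<alpha> + 3 / 2)"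
  defines "Z \<equiv> (\<lambda>y u. 2 * sqrt (x * r / (1 - r)\<^sup>2 * y * u))"
  shows "has_bochner_integral (halfline_measure \<alpha> \<Otimes>\<^sub>M bessel_measure \<alpha>)
     (\<lambda>(y, u). exp (- (y / (1 - r))) * ((theta \<alpha> (Z y u) + theta \<alpha> (- Z y u)) / 2) * laguerre \<alpha> k y)
     (c * (1 - r) powr (\<alpha> + 1) * exp (x * r / (1 - r)) * (r ^ k * laguerre \<alpha> k x))"
proof -
  let ?M = "halfline_measure \<alpha> \<Otimes>\<^sub>M bessel_measure \<alpha>"
  interpret B: sigma_finite_measure "bessel_measure \<alpha>" by (rule sigma_finite_bessel_measure)
  define b where "b = x * r / (1 - r)\<^sup>2"
  have b0: "b \<ge> 0" using r x by (simp add: b_def)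
  \<comment> \<open>Of exp(- y/(1 - r)) the part exp(- y) is kept out of \<open>F\<close>, because
    \<open>laguerre_generating_integral\<close> supplies it.\<close>
  define F where "F = (\<lambda>(y, u). exp (- (y * r / (1 - r))) * ((theta \<alpha> (Z y u) + theta \<alpha> (- Z y u)) / 2))"
  define H where "H = (\<lambda>a. c * ((a + r / (1 - r)) powr (- \<alpha> - 1) * exp (b / (a + r / (1 - r)))))"
  have c0: "c \<ge> 0" using \<alpha> unfolding c_def by (intro mult_nonneg_nonneg Gamma_real_nonneg) auto
  have Fm: "F \<in> borel_measurable ?M" unfolding F_def Z_def by (rule measurable_halfline_bessel) measurable
  have Ym: "fst \<in> borel_measurable ?M" by (rule measurable_halfline_bessel) measurable
  have F0: "F z \<ge> 0" for z
    using theta_even_nonneg[OF \<alpha>] by (auto simp: F_def split: prod.splits)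
  have H: "(\<integral>\<^sup>+z. ennreal (F z * exp (- a * fst z)) \<partial>?M) = ennreal (H a)" if a: "a > 0" for a
  proof -
    have m: "(\<lambda>z. ennreal (F z * exp (- a * fst z))) \<in> borel_measurable ?M"
      using Fm Ym by measurable
    have "(\<integral>\<^sup>+z. ennreal (F z * exp (- a * fst z)) \<partial>?M) =
      (\<integral>\<^sup>+y. (\<integral>\<^sup>+u. ennreal (F (y, u) * exp (- a * y)) \<partial>bessel_measure \<alpha>) \<partial>halfline_measure \<alpha>)"
      using B.nn_integral_fst[OF m] by simp
    also have "\<dots> = (\<integral>\<^sup>+y. ennreal (exp (- (a + r / (1 - r)) * y)) * (\<integral>\<^sup>+u. ennreal ((theta \<alpha> (2 * sqrt (b * y * u)) + theta \<alpha> (- (2 * sqrt (b * y * u)))) / 2) \<partial>bessel_measure \<alpha>) \<partial>halfline_measure \<alpha>)"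
    proof (rule nn_integral_cong)
      fix y
      have e: "exp (- (y * r / (1 - r))) * exp (- a * y) = exp (- (a + r / (1 - r)) * y)"
        unfolding exp_add[symmetric] by (rule arg_cong[where f = exp]) (simp add: algebra_simps)
      have "(\<integral>\<^sup>+u. ennreal (F (y, u) * exp (- a * y)) \<partial>bessel_measure \<alpha>) =
        (\<integral>\<^sup>+u. ennreal (exp (- (a + r / (1 - r)) * y)) * ennreal ((theta \<alpha> (2 * sqrt (b * y * u)) + theta \<alpha> (- (2 * sqrt (b * y * u)))) / 2) \<partial>bessel_measure \<alpha>)"
        unfolding e[symmetric] by (intro nn_integral_cong) (simp add: F_def Z_def b_def mult_ac flip: ennreal_mult')
      also have "\<dots> = ennreal (exp (- (a + r / (1 - r)) * y)) * (\<integral>\<^sup>+u. ennreal ((theta \<alpha> (2 * sqrt (b * y * u)) + theta \<alpha> (- (2 * sqrt (b * y * u)))) / 2) \<partial>bessel_measure \<alpha>)"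
        by (rule nn_integral_cmult) measurable
      finally show "(\<integral>\<^sup>+u. ennreal (F (y, u) * exp (- a * y)) \<partial>bessel_measure \<alpha>) = \<dots>" .
    qed
    also have "\<dots> = ennreal (H a)"
      unfolding H_def c_def by (rule nn_integral_theta_exp[OF \<alpha> b0]) (use a r in \<open>auto intro!: add_pos_nonneg\<close>)
    finally show ?thesis .
  qed
  have H0: "H a \<ge> 0" if "a > 0" for a using c0 by (simp add: H_def)
  have Y0: "fst z \<ge> 0" if "z \<in> space ?M" for z using that by (auto simp: space_pair_measure)
  note gen = laguerre_generating_integral[OF \<alpha> Fm Ym F0 Y0 H H0]
  have "(\<integral>z. F z * exp (- fst z) * laguerre \<alpha> k (fst z) \<partial>?M) =
     c * (1 - r) powr (\<alpha> + 1) * exp (x * r / (1 - r)) * (r ^ k * laguerre \<alpha> k x)"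
  proof (rule powser_coeff_unique[of "1 / 2" "\<lambda>k. \<integral>z. F z * exp (- fst z) * laguerre \<alpha> k (fst z) \<partial>?M"
       "\<lambda>w. (1 - w) powr (- \<alpha> - 1) * H (1 / (1 - w))"])
    fix w :: real assume w: "\<bar>w\<bar> < 1 / 2"
    show "(\<lambda>k. (\<integral>z. F z * exp (- fst z) * laguerre \<alpha> k (fst z) \<partial>?M) * w ^ k) sums ((1 - w) powr (- \<alpha> - 1) * H (1 / (1 - w)))"
      by (rule gen(2)) (use w in auto)
    have rw: "\<bar>r * w\<bar> < 1" using w r mult_mono[of r 1 "\<bar>w\<bar>" "1 / 2"] by (simp add: abs_mult)
    hence rw1: "r * w < 1" by linarith
    have "(\<lambda>k. c * (1 - r) powr (\<alpha> + 1) * exp (x * r / (1 - r)) * (laguerre \<alpha> k x * (r * w) ^ k)) sums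
      (c * (1 - r) powr (\<alpha> + 1) * exp (x * r / (1 - r)) * ((1 - r * w) powr (- \<alpha> - 1) * exp (- x * (r * w) / (1 - r * w))))"
      by (intro sums_mult laguerre_generating_function \<alpha> rw)
    moreover have "c * (1 - r) powr (\<alpha> + 1) * exp (x * r / (1 - r)) * ((1 - r * w) powr (- \<alpha> - 1) * exp (- x * (r * w) / (1 - r * w))) =
      (1 - w) powr (- \<alpha> - 1) * H (1 / (1 - w))"
    proof -
      have a': "1 / (1 - w) + r / (1 - r) = (1 - r * w) / ((1 - r) * (1 - w))"
        using w r by (simp add: field_simps)
      have p: "(1 - w) powr (- \<alpha> - 1) * ((1 - r * w) / ((1 - r) * (1 - w))) powr (- \<alpha> - 1) = (1 - r) powr (\<alpha> + 1) * (1 - r * w) powr (- \<alpha> - 1)"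
      proof -
        have "(1 - r) powr (\<alpha> + 1) * (1 - r) powr (- \<alpha> - 1) = 1" using r by (simp flip: powr_add)
        hence "(1 - r) powr (\<alpha> + 1) = 1 / (1 - r) powr (- \<alpha> - 1)" using r by (simp add: field_simps)
        thus ?thesis using w r rw1 by (simp add: powr_divide powr_mult)
      qed
      have e: "x * r / (1 - r) + - x * (r * w) / (1 - r * w) = b / ((1 - r * w) / ((1 - r) * (1 - w)))"
      proof -
        have "1 - r \<noteq> 0" "1 - r * w \<noteq> 0" "1 - w \<noteq> 0" using w r rw1 by auto
        thus ?thesis unfolding b_def by (simp add: divide_simps power2_eq_square) (simp add: algebra_simps)
      qed
      have "exp (x * r / (1 - r)) * exp (- x * (r * w) / (1 - r * w)) = exp (b / ((1 - r * w) / ((1 - r) * (1 - w))))"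
        unfolding e[symmetric] by (rule exp_add[symmetric])
      hence "c * (1 - r) powr (\<alpha> + 1) * exp (x * r / (1 - r)) * ((1 - r * w) powr (- \<alpha> - 1) * exp (- x * (r * w) / (1 - r * w)))
        = c * ((1 - r) powr (\<alpha> + 1) * (1 - r * w) powr (- \<alpha> - 1)) * exp (b / ((1 - r * w) / ((1 - r) * (1 - w))))"
        by (simp only: mult_ac)
      thus ?thesis unfolding H_def a' p[symmetric] by (simp only: mult_ac)
    qed
    ultimately show "(\<lambda>k. c * (1 - r) powr (\<alpha> + 1) * exp (x * r / (1 - r)) * (r ^ k * laguerre \<alpha> k x) * w ^ k) sums
       ((1 - w) powr (- \<alpha> - 1) * H (1 / (1 - w)))"
      by (simp add: power_mult_distrib mult_ac)
  qed simp
  moreover have "integrable ?M (\<lambda>z. F z * exp (- fst z) * laguerre \<alpha> k (fst z))"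
    by (rule gen(1)[of 0]) auto
  moreover have "F z * exp (- fst z) * laguerre \<alpha> k (fst z) =
     (\<lambda>(y, u). exp (- (y / (1 - r))) * ((theta \<alpha> (Z y u) + theta \<alpha> (- Z y u)) / 2) * laguerre \<alpha> k y) z" for z
  proof -
    have "exp (- (y * r / (1 - r))) * exp (- y) = exp (- (y / (1 - r)))" for y
    proof -
      have "- (y * r / (1 - r)) + - y = - (y / (1 - r))" using r by (simp add: field_simps)
      thus ?thesis unfolding exp_add[symmetric] by (simp only:)
    qed
    from this[of "fst z", symmetric] show ?thesis by (simp add: F_def split_beta mult_ac)
  qed
  ultimately show ?thesis by (simp add: has_bochner_integral_iff)
qed

subsection \<open>Mapping properties of integral operators\<close>

lemma nn_integral_powr_from_0:
  fixes a c :: real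
  assumes "a > -1" "c \<ge> 0"
  shows "(\<integral>\<^sup>+x. ennreal (x powr a) * indicator {0<..<c} x \<partial>lborel) = ennreal (c powr (a + 1) / (a + 1))"
proof -
  have "((\<lambda>x. x powr a) has_integral (c powr (a + 1) / (a + 1))) {0<..<c}"
    using has_integral_powr_from_0[OF assms] has_integral_Icc_iff_Ioo by blast
  thus ?thesis by (intro nn_integral_has_integral_lebesgue') auto
qed

lemma powr_less_iff:
  fixes a b e :: real
  assumes "e > 0" "a \<ge> 0" "b \<ge> 0"
  shows "a powr e < b powr e \<longleftrightarrow> a < b"
  using powr_less_mono2[of e a b] powr_mono2[of e b a] assms by linarith

lemma nn_integral_layer_cake:
  fixes H :: "'a \<Rightarrow> real"
  assumes "sigma_finite_measure M" and [measurable]: "H \<in> borel_measurable M"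
    and H: "\<And>x. H x \<ge> 0" and q: "q > 0"
  shows "(\<integral>\<^sup>+x. ennreal (H x powr q) \<partial>M) =
    (\<integral>\<^sup>+l. ennreal (q * l powr (q - 1)) * indicator {0<..} l * emeasure M {x \<in> space M. l < H x} \<partial>lborel)"
proof -
  interpret M: sigma_finite_measure M by fact
  interpret pair_sigma_finite lborel M ..
  \<comment> \<open>In the double integral the last two factors together express l < H x.\<close>
  have "(\<integral>\<^sup>+x. ennreal (H x powr q) \<partial>M) =
    (\<integral>\<^sup>+x. (\<integral>\<^sup>+l. ennreal (q * l powr (q - 1)) * indicator {0<..} l * indicator {l..} (H x) * (if l = H x then 0 else 1) \<partial>lborel) \<partial>M)"
  proof (intro nn_integral_cong)
    fix x
    have "(\<integral>\<^sup>+l. ennreal (q * l powr (q - 1)) * indicator {0<..} l * indicator {l..} (H x) * (if l = H x then 0 else 1) \<partial>lborel)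
       = (\<integral>\<^sup>+l. ennreal q * (ennreal (l powr (q - 1)) * indicator {0<..<H x} l) \<partial>lborel)"
      using q by (intro nn_integral_cong) (auto simp: ennreal_mult indicator_def)
    also have "\<dots> = ennreal q * ennreal (H x powr q / q)"
      using nn_integral_powr_from_0[of "q - 1" "H x"] q H[of x] by (subst nn_integral_cmult) auto
    also have "\<dots> = ennreal (H x powr q)"
      using q by (simp flip: ennreal_mult)
    finally show "ennreal (H x powr q) = (\<integral>\<^sup>+l. ennreal (q * l powr (q - 1)) * indicator {0<..} l * indicator {l..} (H x) * (if l = H x then 0 else 1) \<partial>lborel)" ..
  qed
  also have "\<dots> = (\<integral>\<^sup>+x. (\<integral>\<^sup>+l. ennreal (q * l powr (q - 1)) * indicator {0<..} l * indicator {x \<in> space M. l < H x} x \<partial>lborel) \<partial>M)"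
    by (intro nn_integral_cong) (auto simp: indicator_def)
  also have "\<dots> = (\<integral>\<^sup>+l. (\<integral>\<^sup>+x. ennreal (q * l powr (q - 1)) * indicator {0<..} l * indicator {x \<in> space M. l < H x} x \<partial>M) \<partial>lborel)"
    by (rule Fubini') (simp, measurable)
  also have "\<dots> = (\<integral>\<^sup>+l. ennreal (q * l powr (q - 1)) * indicator {0<..} l * emeasure M {x \<in> space M. l < H x} \<partial>lborel)"
    by (intro nn_integral_cong, subst nn_integral_cmult) auto
  finally show ?thesis .
qed

text \<open>
  To estimate the level set \<open>{T f > 3 * l}\<close>, take \<open>R = (C / l) powr q\<close> and \<open>h = (l / C) powr (q / p)\<close>:
  then \<open>k2\<close> contributes at most \<open>l\<close>, and so does \<open>k1\<close> applied to the part of \<open>f\<close> below \<open>h\<close>, so that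
  Markov's inequality is only needed for \<open>k1\<close> applied to the part above \<open>h\<close>.
\<close>

lemma nn_integral_kernel_bounded_Lp_Lq:
  fixes k :: "'a \<Rightarrow> 'b \<Rightarrow> ennreal" and f :: "'b \<Rightarrow> real" and p q C :: real
  assumes "sigma_finite_measure M" "sigma_finite_measure N"
    and [measurable]: "case_prod k \<in> borel_measurable (M \<Otimes>\<^sub>M N)" "f \<in> borel_measurable N"
    and f0: "\<And>y. f y \<ge> 0" and fp: "(\<integral>\<^sup>+y. ennreal (f y powr p) \<partial>N) \<le> 1"
    and pq: "1 < p" "p \<le> q" and C: "C > 0"
    and split: "\<And>R. R > 0 \<Longrightarrow> \<exists>k1 k2.
      case_prod k1 \<in> borel_measurable (M \<Otimes>\<^sub>M N) \<and> case_prod k2 \<in> borel_measurable (M \<Otimes>\<^sub>M N) \<and>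
      (\<forall>x\<in>space M. \<forall>y\<in>space N. k x y \<le> k1 x y + k2 x y) \<and>
      (\<forall>x\<in>space M. (\<integral>\<^sup>+y. k1 x y \<partial>N) \<le> ennreal (C * R powr (1 / p - 1 / q))) \<and>
      (\<forall>y\<in>space N. (\<integral>\<^sup>+x. k1 x y \<partial>M) \<le> ennreal (C * R powr (1 / p - 1 / q))) \<and>
      (\<forall>x\<in>space M. (\<integral>\<^sup>+y. k2 x y * ennreal (f y) \<partial>N) \<le> ennreal (C * R powr (- 1 / q)))"
  shows "(AE x in M. (\<integral>\<^sup>+y. k x y * ennreal (f y) \<partial>N) < \<infinity>) \<and>
    (\<integral>\<^sup>+x. ennreal (enn2real (\<integral>\<^sup>+y. k x y * ennreal (f y) \<partial>N) powr q) \<partial>M)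
      \<le> ennreal ((3 * C) powr q * (p / (p - 1)))"
proof -
  interpret M: sigma_finite_measure M by fact
  interpret N: sigma_finite_measure N by fact
  interpret MN: pair_sigma_finite M N ..
  have q: "q > 1" using pq by simp
  define T where "T = (\<lambda>x. \<integral>\<^sup>+y. k x y * ennreal (f y) \<partial>N)"
  have T_meas[measurable]: "T \<in> borel_measurable M" unfolding T_def by measurable
  define h where "h = (\<lambda>l. (l / C) powr (q / p))"
  have weak: "emeasure M {x \<in> space M. ennreal (3 * l) < T x} \<le>
     (\<integral>\<^sup>+y. ennreal (1 / h l) * (ennreal (f y) * indicator {h l<..} (f y)) \<partial>N)" if l: "l > 0" for l
  proof -
    define R where "R = (C / l) powr q"
    have R: "R > 0" using l C by (simp add: R_def)
    have hpos: "h l > 0" using l C by (simp add: h_def)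
    have CR: "C * R powr (1 / p - 1 / q) = l / h l"
    proof -
      have "R powr (1 / p - 1 / q) = (C / l) powr (q / p - 1)"
        using q pq by (simp add: R_def powr_powr right_diff_distrib)
      also have "\<dots> = (C / l) powr (q / p) / (C / l)"
        using l C by (simp add: powr_diff)
      also have "(C / l) powr (q / p) = 1 / h l"
        using l C unfolding h_def by (simp add: powr_divide)
      finally show ?thesis using C l by simp
    qed
    have CR2: "C * R powr (- 1 / q) = l"
      using q l C by (simp add: R_def powr_powr powr_minus_divide)
    obtain k1 k2 where [measurable]: "case_prod k1 \<in> borel_measurable (M \<Otimes>\<^sub>M N)"
        "case_prod k2 \<in> borel_measurable (M \<Otimes>\<^sub>M N)"
      and k: "\<And>x y. x \<in> space M \<Longrightarrow> y \<in> space N \<Longrightarrow> k x y \<le> k1 x y + k2 x y"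
      and row: "\<And>x. x \<in> space M \<Longrightarrow> (\<integral>\<^sup>+y. k1 x y \<partial>N) \<le> ennreal (l / h l)"
      and col: "\<And>y. y \<in> space N \<Longrightarrow> (\<integral>\<^sup>+x. k1 x y \<partial>M) \<le> ennreal (l / h l)"
      and k2: "\<And>x. x \<in> space M \<Longrightarrow> (\<integral>\<^sup>+y. k2 x y * ennreal (f y) \<partial>N) \<le> ennreal l"
      using split[OF R] unfolding CR CR2 by blast
    define G where "G = (\<lambda>x. \<integral>\<^sup>+y. k1 x y * (ennreal (f y) * indicator {h l<..} (f y)) \<partial>N)"
    have [measurable]: "G \<in> borel_measurable M" unfolding G_def by measurable
    have TG: "T x \<le> ennreal (2 * l) + G x" if x: "x \<in> space M" for x
    proof -
      have [measurable]: "k1 x \<in> borel_measurable N" "k2 x \<in> borel_measurable N"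
        using measurable_Pair2[OF \<open>case_prod k1 \<in> _\<close> x] measurable_Pair2[OF \<open>case_prod k2 \<in> _\<close> x] by simp_all
      have "T x \<le> (\<integral>\<^sup>+y. ennreal (h l) * k1 x y + k1 x y * (ennreal (f y) * indicator {h l<..} (f y)) + k2 x y * ennreal (f y) \<partial>N)"
        unfolding T_def
      proof (intro nn_integral_mono)
        fix y assume y: "y \<in> space N"
        have "k x y * ennreal (f y) \<le> k1 x y * ennreal (f y) + k2 x y * ennreal (f y)"
          using mult_right_mono[OF k[OF x y], of "ennreal (f y)"] by (simp add: distrib_right)
        also have "\<dots> \<le> (ennreal (h l) * k1 x y + k1 x y * (ennreal (f y) * indicator {h l<..} (f y))) + k2 x y * ennreal (f y)"
        proof (rule add_right_mono)
          show "k1 x y * ennreal (f y) \<le> ennreal (h l) * k1 x y + k1 x y * (ennreal (f y) * indicator {h l<..} (f y))"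
        proof (cases "f y > h l")
          case True thus ?thesis by (simp add: add_increasing)
        next
          case False
          hence "k1 x y * ennreal (f y) \<le> k1 x y * ennreal (h l)"
            by (intro mult_left_mono) (auto simp: ennreal_leI)
          thus ?thesis by (simp add: mult.commute add_increasing2)
        qed
        qed
        finally show "k x y * ennreal (f y) \<le> ennreal (h l) * k1 x y + k1 x y * (ennreal (f y) * indicator {h l<..} (f y)) + k2 x y * ennreal (f y)" .
      qed
      also have "\<dots> = ennreal (h l) * (\<integral>\<^sup>+y. k1 x y \<partial>N) + G x + (\<integral>\<^sup>+y. k2 x y * ennreal (f y) \<partial>N)"
        by (simp add: nn_integral_add nn_integral_cmult G_def)
      also have "\<dots> \<le> ennreal (h l) * ennreal (l / h l) + G x + ennreal l"
        by (intro add_mono mult_left_mono row k2 x order.refl) auto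
      also have "ennreal (h l) * ennreal (l / h l) = ennreal l"
        using hpos l by (simp flip: ennreal_mult)
      also have "ennreal l + G x + ennreal l = (ennreal l + ennreal l) + G x"
        by (simp only: ac_simps)
      also have "ennreal l + ennreal l = ennreal (2 * l)"
        using l by (simp flip: ennreal_plus)
      finally show ?thesis .
    qed
    have "emeasure M {x \<in> space M. ennreal (3 * l) < T x} \<le> emeasure M {x \<in> space M. 1 \<le> ennreal (1 / l) * G x}"
    proof (rule emeasure_mono, rule subsetI)
      fix x assume "x \<in> {x \<in> space M. ennreal (3 * l) < T x}"
      hence x: "x \<in> space M" and "ennreal (3 * l) < T x" by auto
      hence "ennreal (2 * l) + ennreal l < ennreal (2 * l) + G x"
        using TG[OF x] l by (simp flip: ennreal_plus)
      hence "ennreal l \<le> G x"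
        by (meson add_left_mono not_le order_less_imp_le)
      hence "ennreal (1 / l) * ennreal l \<le> ennreal (1 / l) * G x"
        by (intro mult_left_mono) auto
      thus "x \<in> {x \<in> space M. 1 \<le> ennreal (1 / l) * G x}" using l x by (simp flip: ennreal_mult)
    qed measurable
    also have "\<dots> \<le> ennreal (1 / l) * (\<integral>\<^sup>+x. G x * indicator (space M) x \<partial>M)"
      using nn_integral_Markov_inequality[of G "space M" M "ennreal (1 / l)"] by simp
    also have "(\<integral>\<^sup>+x. G x * indicator (space M) x \<partial>M) = (\<integral>\<^sup>+x. G x \<partial>M)"
      by (intro nn_integral_cong) auto
    also have "(\<integral>\<^sup>+x. G x \<partial>M) = (\<integral>\<^sup>+y. (\<integral>\<^sup>+x. k1 x y * (ennreal (f y) * indicator {h l<..} (f y)) \<partial>M) \<partial>N)"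
      unfolding G_def by (rule MN.Fubini'[symmetric]) simp
    also have "\<dots> = (\<integral>\<^sup>+y. (\<integral>\<^sup>+x. k1 x y \<partial>M) * (ennreal (f y) * indicator {h l<..} (f y)) \<partial>N)"
    proof (intro nn_integral_cong nn_integral_multc)
      fix y assume "y \<in> space N"
      thus "(\<lambda>x. k1 x y) \<in> borel_measurable M"
        using measurable_Pair1[OF \<open>case_prod k1 \<in> _\<close>] by simp
    qed
    also have "\<dots> \<le> (\<integral>\<^sup>+y. ennreal (l / h l) * (ennreal (f y) * indicator {h l<..} (f y)) \<partial>N)"
      by (intro nn_integral_mono mult_right_mono col) auto
    finally have "emeasure M {x \<in> space M. ennreal (3 * l) < T x} \<le>
       ennreal (1 / l) * (\<integral>\<^sup>+y. ennreal (l / h l) * (ennreal (f y) * indicator {h l<..} (f y)) \<partial>N)"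
      by (simp add: mult_left_mono)
    also have "\<dots> = (\<integral>\<^sup>+y. ennreal (1 / h l) * (ennreal (f y) * indicator {h l<..} (f y)) \<partial>N)"
      using l hpos by (subst nn_integral_cmult[symmetric]) (auto simp: mult.assoc[symmetric] ennreal_mult[symmetric])
    finally show ?thesis .
  qed
  \<comment> \<open>\<open>enn2real\<close> sends infinity to 0, so finiteness almost everywhere has
    to be shown separately. The infinity set lies in every level set, and these have measure at most
    \<open>h l powr (- p)\<close>, which tends to 0 as l grows.\<close>
  have fin: "AE x in M. T x < \<infinity>"
  proof -
    have bound: "emeasure M {x \<in> space M. T x = \<infinity>} \<le> ennreal (h l powr (- p))" if l: "l > 0" for l
    proof -
      have hpos: "h l > 0" using l C by (simp add: h_def)
      have "emeasure M {x \<in> space M. T x = \<infinity>} \<le> emeasure M {x \<in> space M. ennreal (3 * l) < T x}"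
        by (intro emeasure_mono) auto
      also have "\<dots> \<le> (\<integral>\<^sup>+y. ennreal (1 / h l) * (ennreal (f y) * indicator {h l<..} (f y)) \<partial>N)"
        by (rule weak[OF l])
      also have "\<dots> \<le> (\<integral>\<^sup>+y. ennreal (h l powr (- p)) * ennreal (f y powr p) \<partial>N)"
      proof (intro nn_integral_mono)
        fix y
        show "ennreal (1 / h l) * (ennreal (f y) * indicator {h l<..} (f y)) \<le> ennreal (h l powr (- p)) * ennreal (f y powr p)"
        proof (cases "f y > h l")
          case True
          have "h l powr (p - 1) \<le> f y powr (p - 1)" using True hpos pq by (intro powr_mono2) auto
          hence "1 / h l * f y \<le> h l powr (- p) * f y powr p"
            using True hpos by (simp add: powr_diff powr_minus field_simps)
          thus ?thesis using True hpos f0 by (simp add: ennreal_leI flip: ennreal_mult)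
        qed auto
      qed
      also have "\<dots> = ennreal (h l powr (- p)) * (\<integral>\<^sup>+y. ennreal (f y powr p) \<partial>N)"
        by (rule nn_integral_cmult) measurable
      also have "\<dots> \<le> ennreal (h l powr (- p)) * 1" by (intro mult_left_mono fp) auto
      finally show ?thesis by simp
    qed
    have "emeasure M {x \<in> space M. T x = \<infinity>} \<le> 0"
    proof (rule ennreal_le_epsilon)
      fix e :: real assume e: "e > 0"
      \<comment> \<open>Solves \<open>h l powr (- p) = e\<close>, the left side being
        (l/C)^(-q).\<close>
      define l where "l = C * e powr (- (1 / q))"
      have "l > 0" using C e by (simp add: l_def)
      moreover have "h l powr (- p) = e"
        using C e pq q by (simp add: h_def l_def powr_powr)
      ultimately show "emeasure M {x \<in> space M. T x = \<infinity>} \<le> 0 + ennreal e"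
        using bound[of l] by simp
    qed
    hence "{x \<in> space M. T x = \<infinity>} \<in> null_sets M" by (intro null_setsI) auto
    thus ?thesis by (rule AE_I') (auto simp flip: less_top)
  qed
  have "(\<integral>\<^sup>+x. ennreal ((enn2real (T x) / 3) powr q) \<partial>M) =
     (\<integral>\<^sup>+l. ennreal (q * l powr (q - 1)) * indicator {0<..} l * emeasure M {x \<in> space M. l < enn2real (T x) / 3} \<partial>lborel)"
    by (rule nn_integral_layer_cake) (use q in \<open>auto intro: M.sigma_finite_measure_axioms\<close>)
  also have "\<dots> \<le> (\<integral>\<^sup>+l. ennreal (q * l powr (q - 1)) * indicator {0<..} l * (\<integral>\<^sup>+y. ennreal (1 / h l) * (ennreal (f y) * indicator {h l<..} (f y)) \<partial>N) \<partial>lborel)"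
  proof (intro nn_integral_mono)
    fix l :: real
    show "ennreal (q * l powr (q - 1)) * indicator {0<..} l * emeasure M {x \<in> space M. l < enn2real (T x) / 3}
       \<le> ennreal (q * l powr (q - 1)) * indicator {0<..} l * (\<integral>\<^sup>+y. ennreal (1 / h l) * (ennreal (f y) * indicator {h l<..} (f y)) \<partial>N)"
    proof (cases "l > 0")
      case True
      have "emeasure M {x \<in> space M. l < enn2real (T x) / 3} \<le> emeasure M {x \<in> space M. ennreal (3 * l) < T x}"
      proof (rule emeasure_mono)
        have "ennreal (3 * l) < T x" if "l < enn2real (T x) / 3" for x
          using that True by (cases "T x") (auto simp: ennreal_less_iff)
        thus "{x \<in> space M. l < enn2real (T x) / 3} \<subseteq> {x \<in> space M. ennreal (3 * l) < T x}"
          by blast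
      qed measurable
      also note weak[OF True]
      finally show ?thesis by (intro mult_left_mono) auto
    qed auto
  qed
  also have "\<dots> = (\<integral>\<^sup>+l. (\<integral>\<^sup>+y. ennreal (q * l powr (q - 1)) * indicator {0<..} l * (ennreal (1 / h l) * (ennreal (f y) * indicator {h l<..} (f y))) \<partial>N) \<partial>lborel)"
    by (intro nn_integral_cong nn_integral_cmult[symmetric]) measurable
  also have "\<dots> = (\<integral>\<^sup>+y. (\<integral>\<^sup>+l. ennreal (q * l powr (q - 1)) * indicator {0<..} l * (ennreal (1 / h l) * (ennreal (f y) * indicator {h l<..} (f y))) \<partial>lborel) \<partial>N)"
  proof -
    interpret LN: pair_sigma_finite lborel N ..
    have [measurable]: "h \<in> borel_measurable borel" unfolding h_def by measurable
    have *: "indicator {h l<..} (f y) = (if h l < f y then 1 else 0 :: ennreal)" for l y by (auto simp: indicator_def)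
    show ?thesis unfolding * by (rule LN.Fubini'[symmetric]) measurable
  qed
  also have "\<dots> = (\<integral>\<^sup>+y. ennreal (C powr q * (p / (p - 1))) * ennreal (f y powr p) \<partial>N)"
  proof (intro nn_integral_cong)
    fix y
    \<comment> \<open>The level at which the threshold \<open>h\<close> reaches
      \<open>f y\<close>.\<close>
    define c where "c = C * f y powr (p / q)"
    have c0: "c \<ge> 0" using C by (simp add: c_def)
    \<comment> \<open>Here p > 1 enters: the integral over the levels converges at 0, and its value
      produces the factor p/(p - 1).\<close>
    have qp: "q - 1 - q / p > -1" using pq q by (simp add: field_simps)
    have "(\<integral>\<^sup>+l. ennreal (q * l powr (q - 1)) * indicator {0<..} l * (ennreal (1 / h l) * (ennreal (f y) * indicator {h l<..} (f y))) \<partial>lborel)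
      = (\<integral>\<^sup>+l. ennreal (q * C powr (q / p) * f y) * (ennreal (l powr (q - 1 - q / p)) * indicator {0<..<c} l) \<partial>lborel)"
    proof (intro nn_integral_cong)
      fix l :: real
      show "ennreal (q * l powr (q - 1)) * indicator {0<..} l * (ennreal (1 / h l) * (ennreal (f y) * indicator {h l<..} (f y)))
        = ennreal (q * C powr (q / p) * f y) * (ennreal (l powr (q - 1 - q / p)) * indicator {0<..<c} l)"
      proof (cases "l > 0")
        case l: True
        have iff: "h l < f y \<longleftrightarrow> l < c"
        proof -
          have "f y = (f y powr (p / q)) powr (q / p)"
            using pq q f0[of y] by (simp add: powr_powr)
          hence "h l < f y \<longleftrightarrow> l / C < f y powr (p / q)"
            unfolding h_def using powr_less_iff[of "q / p" "l / C" "f y powr (p / q)"] pq q C l by simp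
          also have "l / C < f y powr (p / q) \<longleftrightarrow> l < c" using C by (simp add: c_def field_simps)
          finally show ?thesis .
        qed
        have eq: "q * l powr (q - 1) * (1 / h l * f y) = q * C powr (q / p) * f y * l powr (q - 1 - q / p)"
          using l C by (simp add: h_def powr_diff powr_divide)
        show ?thesis
          using l iff eq q f0[of y] by (cases "l < c") (auto simp: h_def simp flip: ennreal_mult)
      qed auto
    qed
    also have "\<dots> = ennreal (q * C powr (q / p) * f y) * ennreal (c powr (q - q / p) / (q - q / p))"
      using nn_integral_powr_from_0[OF qp c0] by (subst nn_integral_cmult) (auto simp: algebra_simps)
    also have "\<dots> = ennreal (C powr q * (p / (p - 1))) * ennreal (f y powr p)"
    proof (cases "f y = 0")
      case False
      hence f: "f y > 0" using f0[of y] by simp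
      have "c powr (q - q / p) = C powr (q - q / p) * f y powr (p - 1)"
        using f C q pq by (simp add: c_def powr_mult powr_powr right_diff_distrib)
      moreover have "f y * f y powr (p - 1) = f y powr p" using f by (simp add: powr_diff)
      moreover have "C powr (q / p) * C powr (q - q / p) = C powr q" by (simp flip: powr_add)
      moreover have "q / (q - q / p) = p / (p - 1)" using pq q by (simp add: field_simps)
      moreover have "q * Cp * F * (Cq * Fp / Q) = (Cp * Cq) * (q / Q) * (F * Fp)" for Cp F Cq Fp Q :: real by simp
      ultimately have "q * C powr (q / p) * f y * (c powr (q - q / p) / (q - q / p)) = C powr q * (p / (p - 1)) * f y powr p"
        by presburger
      thus ?thesis using f q pq C qp by (simp flip: ennreal_mult)
    qed (use C in auto)
    finally show "(\<integral>\<^sup>+l. ennreal (q * l powr (q - 1)) * indicator {0<..} l * (ennreal (1 / h l) * (ennreal (f y) * indicator {h l<..} (f y))) \<partial>lborel)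
      = ennreal (C powr q * (p / (p - 1))) * ennreal (f y powr p)" .
  qed
  also have "\<dots> = ennreal (C powr q * (p / (p - 1))) * (\<integral>\<^sup>+y. ennreal (f y powr p) \<partial>N)"
    by (rule nn_integral_cmult) measurable
  also have "\<dots> \<le> ennreal (C powr q * (p / (p - 1))) * 1"
    by (intro mult_left_mono fp) auto
  finally have main: "(\<integral>\<^sup>+x. ennreal ((enn2real (T x) / 3) powr q) \<partial>M) \<le> ennreal (C powr q * (p / (p - 1)))" by simp
  have "(\<integral>\<^sup>+x. ennreal (enn2real (T x) powr q) \<partial>M) = (\<integral>\<^sup>+x. ennreal (3 powr q) * ennreal ((enn2real (T x) / 3) powr q) \<partial>M)"
    by (intro nn_integral_cong) (simp add: powr_divide flip: ennreal_mult)
  also have "\<dots> = ennreal (3 powr q) * (\<integral>\<^sup>+x. ennreal ((enn2real (T x) / 3) powr q) \<partial>M)"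
    by (rule nn_integral_cmult) measurable
  also have "\<dots> \<le> ennreal (3 powr q) * ennreal (C powr q * (p / (p - 1)))"
    by (intro mult_left_mono main) auto
  also have "\<dots> = ennreal ((3 * C) powr q * (p / (p - 1)))"
    using C pq by (simp add: powr_mult mult_ac flip: ennreal_mult)
  finally show ?thesis using fin unfolding T_def by blast
qed

section \<open>The semigroup kernel in hyperbolic form and its time derivative\<close>

text \<open>
  Averaging over \<open>s = sqrt u\<close> and \<open>s = - sqrt u\<close> and integrating against \<open>bessel_measure \<alpha>\<close> turns
  \<open>mehler \<alpha> t s x y\<close> into the semigroup kernel (the Hille--Hardy formula). All estimates of its time derivative
  can be made pointwise in \<open>s\<close>, without using cancellation.
\<close>

definition mehler :: "real \<Rightarrow> real \<Rightarrow> real \<Rightarrow> real \<Rightarrow> real \<Rightarrow> real" where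
  "mehler \<alpha> t s x y = (1 - exp (- t)) powr (- (\<alpha> + 1)) * (\<alpha> + 1 + s * sqrt (x * y) / (2 * sinh (t / 2)))
     * exp (- (((x + y) / 2 * cosh (t / 2) - s * sqrt (x * y)) / sinh (t / 2)))"

definition mehler_deriv :: "real \<Rightarrow> real \<Rightarrow> real \<Rightarrow> real \<Rightarrow> real \<Rightarrow> real" where
  "mehler_deriv \<alpha> t s x y = (1 - exp (- t)) powr (- (\<alpha> + 1))
     * exp (- (((x + y) / 2 * cosh (t / 2) - s * sqrt (x * y)) / sinh (t / 2)))
     * ((\<alpha> + 1 + s * sqrt (x * y) / (2 * sinh (t / 2)))
         * (- ((\<alpha> + 1) * exp (- t) / (1 - exp (- t)))
            + ((x + y) / 2 - s * sqrt (x * y) * cosh (t / 2)) / (2 * (sinh (t / 2))\<^sup>2))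
        - s * sqrt (x * y) * cosh (t / 2) / (4 * (sinh (t / 2))\<^sup>2))"

lemma mehler_has_real_derivative:
  assumes t: "t > 0"
  shows "((\<lambda>t. mehler \<alpha> t s x y) has_real_derivative mehler_deriv \<alpha> t s x y) (at t)"
proof -
  define v where "v = s * sqrt (x * y)"
  define w where "w = (x + y) / 2"
  define S where "S = sinh (t / 2)"
  define Ch where "Ch = cosh (t / 2)"
  define r where "r = exp (- t)"
  have S0: "S > 0" using t by (simp add: S_def)
  have r1: "r < 1" using t by (simp add: r_def)
  have pyth: "Ch\<^sup>2 = S\<^sup>2 + 1" unfolding Ch_def S_def by (simp add: cosh_square_eq)
  have dS: "((\<lambda>t. sinh (t / 2)) has_real_derivative Ch / 2) (at t)"
    unfolding Ch_def by (auto intro!: derivative_eq_intros)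
  have dC: "((\<lambda>t. cosh (t / 2)) has_real_derivative S / 2) (at t)"
    unfolding S_def by (auto intro!: derivative_eq_intros)
  have dr: "((\<lambda>t. 1 - exp (- t)) has_real_derivative r) (at t)"
    unfolding r_def by (auto intro!: derivative_eq_intros)
  define A where "A = (1 - r) powr (- (\<alpha> + 1))"
  define E where "E = exp (- ((w * Ch - v) / S))"
  have dA: "((\<lambda>t. (1 - exp (- t)) powr (- (\<alpha> + 1))) has_real_derivative A * (- ((\<alpha> + 1) * r / (1 - r)))) (at t)"
  proof -
    have "((\<lambda>z. z powr (- (\<alpha> + 1))) has_real_derivative (- (\<alpha> + 1)) * (1 - exp (- t)) powr (- (\<alpha> + 1) - 1)) (at (1 - exp (- t)))"
      using t by (intro has_real_derivative_powr) simp
    from DERIV_chain2[OF this dr]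
    have "((\<lambda>t. (1 - exp (- t)) powr (- (\<alpha> + 1))) has_real_derivative (- (\<alpha> + 1)) * (1 - r) powr (- (\<alpha> + 1) - 1) * r) (at t)"
      by (simp only: r_def)
    moreover have "(1 - r) powr (- (\<alpha> + 1) - 1) = A / (1 - r)"
      using r1 unfolding A_def by (subst powr_diff) simp
    moreover have "(- (\<alpha> + 1)) * (A / (1 - r)) * r = A * (- ((\<alpha> + 1) * r / (1 - r)))"
      by (simp only: mult_minus_left mult_minus_right times_divide_eq_right times_divide_eq_left mult_ac)
    ultimately show ?thesis by metis
  qed
  have dB: "((\<lambda>t. \<alpha> + 1 + v / (2 * sinh (t / 2))) has_real_derivative - (v * Ch / (4 * S\<^sup>2))) (at t)"
  proof -
    have "((\<lambda>t. v / (2 * sinh (t / 2))) has_real_derivative (0 * (2 * sinh (t / 2)) - v * (2 * (Ch / 2))) / (2 * sinh (t / 2) * (2 * sinh (t / 2)))) (at t)"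
      using S0 by (intro DERIV_divide DERIV_const DERIV_cmult dS) (simp add: S_def)
    also have "(0 * (2 * sinh (t / 2)) - v * (2 * (Ch / 2))) / (2 * sinh (t / 2) * (2 * sinh (t / 2))) = - (v * Ch / (4 * S\<^sup>2))"
      by (simp add: S_def power2_eq_square)
    finally show ?thesis using DERIV_add[OF DERIV_const[of "\<alpha> + 1"]] by force
  qed
  have dE: "((\<lambda>t. exp (- ((w * cosh (t / 2) - v) / sinh (t / 2)))) has_real_derivative E * ((w - v * Ch) / (2 * S\<^sup>2))) (at t)"
  proof -
    have "((\<lambda>t. w * cosh (t / 2) - v) has_real_derivative (w * (S / 2) - 0)) (at t)"
      by (intro DERIV_diff DERIV_cmult DERIV_const dC)
    from DERIV_divide[OF this dS] S0
    have "((\<lambda>t. (w * cosh (t / 2) - v) / sinh (t / 2)) has_real_derivative ((w * (S / 2) - 0) * S - (w * Ch - v) * (Ch / 2)) / (S * S)) (at t)"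
      by (simp add: S_def Ch_def)
    \<comment> \<open>Because Ch^2 - S^2 = 1, the terms quadratic in Ch and S collapse and only w -
      v Ch survives in the numerator.\<close>
    moreover have "((w * (S / 2) - 0) * S - (w * Ch - v) * (Ch / 2)) / (S * S) = - ((w - v * Ch) / (2 * S\<^sup>2))"
    proof -
      have "(w * (S / 2) - 0) * S - (w * Ch - v) * (Ch / 2) = (w * (S\<^sup>2 - Ch\<^sup>2) + v * Ch) / 2"
        by (simp add: power2_eq_square left_diff_distrib right_diff_distrib add_divide_distrib diff_divide_distrib)
      also have "\<dots> = - (w - v * Ch) / 2" unfolding pyth by simp
      finally show ?thesis by (simp only: power2_eq_square)
    qed
    ultimately have "((\<lambda>t. - ((w * cosh (t / 2) - v) / sinh (t / 2))) has_real_derivative (w - v * Ch) / (2 * S\<^sup>2)) (at t)"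
      using DERIV_minus by fastforce
    from DERIV_chain2[OF DERIV_exp this] show ?thesis by (simp add: E_def Ch_def S_def)
  qed
  from DERIV_mult[OF DERIV_mult[OF dA dB] dE]
  have "((\<lambda>t. mehler \<alpha> t s x y) has_real_derivative
      (A * (- ((\<alpha> + 1) * r / (1 - r))) * (\<alpha> + 1 + v / (2 * S)) + - (v * Ch / (4 * S\<^sup>2)) * A) * E
      + E * ((w - v * Ch) / (2 * S\<^sup>2)) * (A * (\<alpha> + 1 + v / (2 * S)))) (at t)"
    by (simp only: mehler_def v_def[symmetric] w_def[symmetric] A_def E_def S_def Ch_def r_def)
  moreover have "(A * (- ((\<alpha> + 1) * r / (1 - r))) * (\<alpha> + 1 + v / (2 * S)) + - (v * Ch / (4 * S\<^sup>2)) * A) * E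
      + E * ((w - v * Ch) / (2 * S\<^sup>2)) * (A * (\<alpha> + 1 + v / (2 * S))) = mehler_deriv \<alpha> t s x y"
    unfolding mehler_deriv_def v_def[symmetric] w_def[symmetric] S_def[symmetric] Ch_def[symmetric] r_def[symmetric] A_def[symmetric] E_def[symmetric]
    by (simp only: ring_distribs mult_ac)
  ultimately show ?thesis by simp
qed

lemma mehler_deriv_measurable [measurable]:
  assumes [measurable]: "t \<in> borel_measurable M" "s \<in> borel_measurable M" "x \<in> borel_measurable M" "y \<in> borel_measurable M"
  shows "(\<lambda>z. mehler_deriv \<alpha> (t z) (s z) (x z) (y z)) \<in> borel_measurable M"
  unfolding mehler_deriv_def sinh_def cosh_def by measurable

lemma mehler_measurable [measurable]:
  assumes [measurable]: "t \<in> borel_measurable M" "s \<in> borel_measurable M" "x \<in> borel_measurable M" "y \<in> borel_measurable M"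
  shows "(\<lambda>z. mehler \<alpha> (t z) (s z) (x z) (y z)) \<in> borel_measurable M"
  unfolding mehler_def sinh_def cosh_def by measurable

text \<open>The hyperbolic form suits estimates in t, the form in r = exp(-t) suits generating
  functions. The translation rests on h = sqrt r, for which sinh(t/2) = (1 - r)/(2h) and cosh(t/2) =
  (1 + r)/(2h).\<close>

lemma mehler_eq_theta:
  assumes t: "t > 0"
  defines "r \<equiv> exp (- t)"
  shows "mehler \<alpha> t (sqrt u) x y = (1 - r) powr (- (\<alpha> + 1)) * exp (- ((x + y) / 2 * ((1 + r) / (1 - r)))) * theta \<alpha> (2 * sqrt (x * r / (1 - r)\<^sup>2 * y * u))"
    and "mehler \<alpha> t (- sqrt u) x y = (1 - r) powr (- (\<alpha> + 1)) * exp (- ((x + y) / 2 * ((1 + r) / (1 - r)))) * theta \<alpha> (- (2 * sqrt (x * r / (1 - r)\<^sup>2 * y * u)))"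
proof -
  define h where "h = exp (- (t / 2))"
  have h: "0 < h" "h < 1" using t by (simp_all add: h_def)
  have rh: "r = h\<^sup>2" unfolding r_def h_def by (simp add: power2_eq_square flip: exp_add)
  have r1: "r < 1" using t by (simp add: r_def)
  have et: "exp (t / 2) = 1 / h" by (simp add: h_def exp_minus inverse_eq_divide)
  have S: "sinh (t / 2) = (1 - r) / (2 * h)" "cosh (t / 2) = (1 + r) / (2 * h)"
    unfolding sinh_field_def cosh_field_def et h_def[symmetric] using h by (simp_all add: rh power2_eq_square field_simps)
  have sq: "sqrt (x * r / (1 - r)\<^sup>2 * y * u) = sqrt u * sqrt (x * y) * h / (1 - r)"
    using h r1 by (simp add: rh real_sqrt_mult real_sqrt_divide mult_ac)
  have gen: "mehler \<alpha> t s x y = (1 - r) powr (- (\<alpha> + 1)) * exp (- ((x + y) / 2 * ((1 + r) / (1 - r)))) * theta \<alpha> (2 * (s * sqrt (x * y) * h / (1 - r)))" for s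
  proof -
    have "- (((x + y) / 2 * cosh (t / 2) - s * sqrt (x * y)) / sinh (t / 2)) = - ((x + y) / 2 * ((1 + r) / (1 - r))) + 2 * (s * sqrt (x * y) * h / (1 - r))"
    proof -
      have *: "- ((P * (a / (2 * h)) - q) / (d / (2 * h))) = - (P * (a / d)) + 2 * (q * h / d)" if "d \<noteq> 0" for P a q d :: real
        using that h by (simp add: field_simps)
      show ?thesis unfolding S by (rule *) (use r1 in simp)
    qed
    moreover have "s * sqrt (x * y) / (2 * sinh (t / 2)) = 2 * (s * sqrt (x * y) * h / (1 - r)) / 2"
    proof -
      have *: "q / (2 * (d / (2 * h))) = 2 * (q * h / d) / 2" if "d \<noteq> 0" for q d :: real
        using that h by (simp add: field_simps)
      show ?thesis unfolding S by (rule *) (use r1 in simp)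
    qed
    ultimately show ?thesis
      by (simp only: mehler_def theta_def exp_add r_def[symmetric]) (simp only: mult_ac)
  qed
  show "mehler \<alpha> t (sqrt u) x y = (1 - r) powr (- (\<alpha> + 1)) * exp (- ((x + y) / 2 * ((1 + r) / (1 - r)))) * theta \<alpha> (2 * sqrt (x * r / (1 - r)\<^sup>2 * y * u))"
    unfolding sq by (rule gen)
  show "mehler \<alpha> t (- sqrt u) x y = (1 - r) powr (- (\<alpha> + 1)) * exp (- ((x + y) / 2 * ((1 + r) / (1 - r)))) * theta \<alpha> (- (2 * sqrt (x * r / (1 - r)\<^sup>2 * y * u)))"
    unfolding sq using gen[of "- sqrt u"] by simp
qed

text \<open>The semigroup multiplies the k-th Laguerre function by exp(-k t). The constant on the
  right is the normalisation of Poisson's integral; it is carried along and divided out only when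
  the operator is formed.\<close>

lemma mehler_laguerre_integral:
  assumes \<alpha>: "\<alpha> > -1" and t: "t > 0" and x: "x > 0"
  shows "has_bochner_integral (halfline_measure \<alpha> \<Otimes>\<^sub>M bessel_measure \<alpha>)
     (\<lambda>(y, u). (mehler \<alpha> t (sqrt u) x y + mehler \<alpha> t (- sqrt u) x y) / 2 * laguerre_fun \<alpha> k y)
     (sqrt pi * Gamma (\<alpha> + 3 / 2) * (exp (- (real k * t)) * laguerre_fun \<alpha> k x))"
proof -
  define r where "r = exp (- t)"
  have r: "0 < r" "r < 1" using t by (simp_all add: r_def)
  define n where "n = sqrt (fact k / Gamma (real k + \<alpha> + 1))"
  define c where "c = sqrt pi * Gamma (\<alpha> + 3 / 2)"
  define K where "K = (1 - r) powr (- (\<alpha> + 1)) * exp (- (x / 2 * ((1 + r) / (1 - r)))) * n"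
  have "has_bochner_integral (halfline_measure \<alpha> \<Otimes>\<^sub>M bessel_measure \<alpha>)
     (\<lambda>z. K * (\<lambda>(y, u). exp (- (y / (1 - r))) * ((theta \<alpha> (2 * sqrt (x * r / (1 - r)\<^sup>2 * y * u)) + theta \<alpha> (- (2 * sqrt (x * r / (1 - r)\<^sup>2 * y * u)))) / 2) * laguerre \<alpha> k y) z)
     (K * (c * (1 - r) powr (\<alpha> + 1) * exp (x * r / (1 - r)) * (r ^ k * laguerre \<alpha> k x)))"
    unfolding c_def by (intro has_bochner_integral_mult_right laguerre_theta_integral[OF \<alpha> r x])
  moreover have "K * (\<lambda>(y, u). exp (- (y / (1 - r))) * ((theta \<alpha> (2 * sqrt (x * r / (1 - r)\<^sup>2 * y * u)) + theta \<alpha> (- (2 * sqrt (x * r / (1 - r)\<^sup>2 * y * u)))) / 2) * laguerre \<alpha> k y) z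
     = (\<lambda>(y, u). (mehler \<alpha> t (sqrt u) x y + mehler \<alpha> t (- sqrt u) x y) / 2 * laguerre_fun \<alpha> k y) z" for z
  proof (cases z)
    case (Pair y u)
    have "- (x / 2 * ((1 + r) / (1 - r))) + - (y / (1 - r)) = - ((x + y) / 2 * ((1 + r) / (1 - r))) + - y / 2"
    proof -
      have "- (x / 2 * ((1 + (1 - d)) / d)) + - (y / d) = - ((x + y) / 2 * ((1 + (1 - d)) / d)) + - y / 2" if "d \<noteq> 0" for d
        using that by (simp add: field_simps)
      from this[of "1 - r"] show ?thesis using r by simp
    qed
    hence e: "exp (- (x / 2 * ((1 + r) / (1 - r)))) * exp (- (y / (1 - r))) = exp (- ((x + y) / 2 * ((1 + r) / (1 - r)))) * exp (- y / 2)"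
      unfolding exp_add[symmetric] by (simp only:)
    have alg: "A * E1 * n * (E2 * (T / 2) * L) = A * (E1 * E2) * (T / 2) * n * L" for A E1 E2 T L :: real by simp
    have "mehler \<alpha> t (sqrt u) x y + mehler \<alpha> t (- sqrt u) x y = (1 - r) powr (- (\<alpha> + 1)) * exp (- ((x + y) / 2 * ((1 + r) / (1 - r)))) *
       (theta \<alpha> (2 * sqrt (x * r / (1 - r)\<^sup>2 * y * u)) + theta \<alpha> (- (2 * sqrt (x * r / (1 - r)\<^sup>2 * y * u))))"
      unfolding mehler_eq_theta[OF t] r_def[symmetric] by (simp only: ring_distribs)
    moreover have "A * (E1 * E2) * (T / 2) * n * L = A * E1 * T / 2 * (n * E2 * L)" for A E1 E2 T L :: real by simp
    ultimately show ?thesis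
      unfolding Pair prod.case K_def laguerre_fun_def n_def[symmetric] alg e by (simp only:)
  qed
  moreover have "K * (c * (1 - r) powr (\<alpha> + 1) * exp (x * r / (1 - r)) * (r ^ k * laguerre \<alpha> k x)) = c * (exp (- (real k * t)) * laguerre_fun \<alpha> k x)"
  proof -
    have p: "(1 - r) powr (- (\<alpha> + 1)) * (1 - r) powr (\<alpha> + 1) = 1" using r by (simp flip: powr_add)
    have "- (x / 2 * ((1 + r) / (1 - r))) + x * r / (1 - r) = - x / 2"
    proof -
      have "- (x / 2 * ((1 + (1 - d)) / d)) + x * (1 - d) / d = - x / 2" if "d \<noteq> 0" for d
        using that by (simp add: field_simps)
      from this[of "1 - r"] show ?thesis using r by simp
    qed
    hence e: "exp (- (x / 2 * ((1 + r) / (1 - r)))) * exp (x * r / (1 - r)) = exp (- x / 2)"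
      unfolding exp_add[symmetric] by (simp only:)
    have rk: "r ^ k = exp (- (real k * t))" by (simp add: r_def exp_of_nat_mult[symmetric])
    have "A * E1 * n * (c * B * E2 * (R * L)) = c * (R * (n * (E1 * E2) * L)) * (A * B)" for A E1 E2 B R L :: real by simp
    thus ?thesis unfolding K_def laguerre_fun_def n_def[symmetric] by (simp only: p e rk mult_1_right)
  qed
  ultimately show ?thesis unfolding c_def by simp
qed

section \<open>Pointwise bounds for the time derivative\<close>

text \<open>Differentiating the exponential brings down (w - v Ch)/(2 S^2), where w = (x + y)/2 and
  v = s g. The expressions \<phi> S - (w - v Ch) and \<phi> S + (w - v Ch) factor as (w + v)(Ch - 1)
  and (w - v)(Ch + 1), both nonnegative. Hence this term is at most \<phi>/(2 S), and a factor
  \<phi> can be absorbed by exp(-\<phi>).\<close>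

lemma abs_mehler_deriv_le:
  assumes \<alpha>: "\<alpha> > -1" and t: "t > 0" and x: "x \<ge> 0" and y: "y \<ge> 0" and s: "\<bar>s\<bar> \<le> 1"
  defines "g \<equiv> sqrt (x * y)" and "S \<equiv> sinh (t / 2)" and "Ch \<equiv> cosh (t / 2)"
  defines "\<phi> \<equiv> ((x + y) / 2 * Ch - s * g) / S"
  shows "\<phi> \<ge> 0" and "\<bar>mehler_deriv \<alpha> t s x y\<bar> \<le> (1 - exp (- t)) powr (- (\<alpha> + 1)) *
    ((\<alpha> + 1 + g / (2 * S)) * ((\<alpha> + 1 + \<phi>) / (2 * S)) + g * Ch / (4 * S\<^sup>2)) * exp (- \<phi>)"
proof -
  define w where "w = (x + y) / 2"
  define v where "v = s * g"
  have S0: "S > 0" using t by (simp add: S_def)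
  have C1: "Ch \<ge> 1" unfolding Ch_def by (rule cosh_real_ge_1)
  have g0: "g \<ge> 0" using x y by (simp add: g_def)
  have gw: "g \<le> w" using arith_geo_mean_sqrt[OF x y] by (simp add: g_def w_def)
  have vg: "\<bar>v\<bar> \<le> g" using s g0 mult_right_mono[of "\<bar>s\<bar>" 1 g] by (simp add: v_def abs_mult)
  have wC: "w \<le> w * Ch" using C1 gw g0 mult_left_mono[of 1 Ch w] by simp
  have phi: "\<phi> * S = w * Ch - v" using S0 by (simp add: \<phi>_def w_def v_def)
  have phi_eq: "\<phi> = (w * Ch - v) / S" using S0 by (simp add: \<phi>_def w_def v_def)
  show phi0: "\<phi> \<ge> 0" unfolding phi_eq using S0 wC gw vg by (intro divide_nonneg_nonneg) auto
  have "0 \<le> (w + v) * (Ch - 1)" "0 \<le> (w - v) * (1 + Ch)"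
    using C1 gw vg by (auto intro!: mult_nonneg_nonneg)
  hence wv: "\<bar>w - v * Ch\<bar> \<le> \<phi> * S" unfolding phi by (simp add: algebra_simps abs_le_iff)
  have r1: "exp (- t) < 1" using t by simp
  have b1: "\<bar>\<alpha> + 1 + v / (2 * S)\<bar> \<le> \<alpha> + 1 + g / (2 * S)"
  proof -
    have "\<bar>v / (2 * S)\<bar> \<le> g / (2 * S)" using vg S0 by (simp add: abs_mult divide_right_mono)
    thus ?thesis using \<alpha> by linarith
  qed
  \<comment> \<open>With h = exp(-t/2) the left side is (\<alpha> + 1) h^2/(1 - h^2); the right side
    has h in place of h^2.\<close>
  have b2: "\<bar>(\<alpha> + 1) * exp (- t) / (1 - exp (- t))\<bar> \<le> (\<alpha> + 1) / (2 * S)"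
  proof -
    define h where "h = exp (- (t / 2))"
    have h: "0 < h" "h < 1" using t by (simp_all add: h_def)
    have rh: "exp (- t) = h * h" unfolding h_def by (simp flip: exp_add)
    have "2 * S = (1 - h * h) / h"
      using h unfolding S_def sinh_field_def by (simp add: h_def exp_minus field_simps flip: exp_add)
    hence "(\<alpha> + 1) / (2 * S) = (\<alpha> + 1) * h / (1 - h * h)" by simp
    moreover have "(\<alpha> + 1) * (h * h) / (1 - h * h) \<le> (\<alpha> + 1) * h / (1 - h * h)"
      using h \<alpha> r1 unfolding rh by (intro divide_right_mono mult_left_mono) auto
    moreover have "0 \<le> (\<alpha> + 1) * (h * h) / (1 - h * h)"
      using h \<alpha> r1 unfolding rh by (intro divide_nonneg_nonneg mult_nonneg_nonneg) auto
    ultimately show ?thesis unfolding rh by (simp only: abs_of_nonneg)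
  qed
  have b3: "\<bar>(w - v * Ch) / (2 * S\<^sup>2)\<bar> \<le> \<phi> / (2 * S)"
  proof -
    have "\<bar>(w - v * Ch) / (2 * S\<^sup>2)\<bar> = \<bar>w - v * Ch\<bar> / (2 * S\<^sup>2)" by simp
    also have "\<dots> \<le> \<phi> * S / (2 * S\<^sup>2)" using wv by (intro divide_right_mono) auto
    also have "\<dots> = \<phi> / (2 * S)" using S0 by (simp add: power2_eq_square)
    finally show ?thesis .
  qed
  have b4: "\<bar>v * Ch / (4 * S\<^sup>2)\<bar> \<le> g * Ch / (4 * S\<^sup>2)"
    using vg C1 by (simp add: abs_mult divide_right_mono mult_right_mono)
  have "\<bar>(\<alpha> + 1 + v / (2 * S)) * (- ((\<alpha> + 1) * exp (- t) / (1 - exp (- t))) + (w - v * Ch) / (2 * S\<^sup>2)) - v * Ch / (4 * S\<^sup>2)\<bar>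
     \<le> \<bar>\<alpha> + 1 + v / (2 * S)\<bar> * \<bar>- ((\<alpha> + 1) * exp (- t) / (1 - exp (- t))) + (w - v * Ch) / (2 * S\<^sup>2)\<bar> + \<bar>v * Ch / (4 * S\<^sup>2)\<bar>"
    unfolding abs_mult[symmetric] by (rule abs_triangle_ineq4)
  also have "\<dots> \<le> (\<alpha> + 1 + g / (2 * S)) * ((\<alpha> + 1) / (2 * S) + \<phi> / (2 * S)) + g * Ch / (4 * S\<^sup>2)"
  proof (intro add_mono mult_mono b1 b4)
    show "\<bar>- ((\<alpha> + 1) * exp (- t) / (1 - exp (- t))) + (w - v * Ch) / (2 * S\<^sup>2)\<bar> \<le> (\<alpha> + 1) / (2 * S) + \<phi> / (2 * S)"
      using b2 b3 by linarith
    show "0 \<le> \<alpha> + 1 + g / (2 * S)" using \<alpha> g0 S0 by simp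
  qed auto
  also have "(\<alpha> + 1) / (2 * S) + \<phi> / (2 * S) = (\<alpha> + 1 + \<phi>) / (2 * S)" by (simp add: add_divide_distrib)
  finally have main: "\<bar>(\<alpha> + 1 + v / (2 * S)) * (- ((\<alpha> + 1) * exp (- t) / (1 - exp (- t))) + (w - v * Ch) / (2 * S\<^sup>2)) - v * Ch / (4 * S\<^sup>2)\<bar>
    \<le> (\<alpha> + 1 + g / (2 * S)) * ((\<alpha> + 1 + \<phi>) / (2 * S)) + g * Ch / (4 * S\<^sup>2)" .
  have "\<bar>mehler_deriv \<alpha> t s x y\<bar> = (1 - exp (- t)) powr (- (\<alpha> + 1)) * exp (- \<phi>) *
    \<bar>(\<alpha> + 1 + v / (2 * S)) * (- ((\<alpha> + 1) * exp (- t) / (1 - exp (- t))) + (w - v * Ch) / (2 * S\<^sup>2)) - v * Ch / (4 * S\<^sup>2)\<bar>"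
    unfolding mehler_deriv_def phi_eq v_def w_def g_def S_def Ch_def by (simp add: abs_mult)
  also have "\<dots> \<le> (1 - exp (- t)) powr (- (\<alpha> + 1)) * exp (- \<phi>) * ((\<alpha> + 1 + g / (2 * S)) * ((\<alpha> + 1 + \<phi>) / (2 * S)) + g * Ch / (4 * S\<^sup>2))"
    by (intro mult_left_mono main) auto
  finally show "\<bar>mehler_deriv \<alpha> t s x y\<bar> \<le> (1 - exp (- t)) powr (- (\<alpha> + 1)) *
    ((\<alpha> + 1 + g / (2 * S)) * ((\<alpha> + 1 + \<phi>) / (2 * S)) + g * Ch / (4 * S\<^sup>2)) * exp (- \<phi>)"
    by (simp only: mult_ac)
qed

text \<open>The inequality z \<le> exp z at z = x/k, raised to the power k.\<close>

lemma exp_minus_le_powr: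
  fixes x k :: real
  assumes "x > 0" "k > 0"
  shows "exp (- x) \<le> k powr k * x powr (- k)"
proof -
  have "x / k \<le> exp (x / k)" using exp_ge_add_one_self[of "x / k"] by linarith
  hence "(x / k) powr k \<le> exp (x / k) powr k" using assms by (intro powr_mono2) auto
  also have "exp (x / k) powr k = exp x" using assms by (simp add: powr_def)
  finally have "x powr k \<le> k powr k * exp x" using assms by (simp add: powr_divide field_simps)
  thus ?thesis using assms by (simp add: exp_minus powr_minus field_simps)
qed

lemma one_plus_mult_exp_minus_le:
  fixes x :: real
  assumes "x \<ge> 0"
  shows "(1 + x) * exp (- x) \<le> 2 * exp (- x / 2)"
proof -
  have "1 + x \<le> 2 * exp (x / 2)" using exp_ge_add_one_self[of "x / 2"] by linarith
  hence "(1 + x) * exp (- x) \<le> 2 * exp (x / 2) * exp (- x)" by (intro mult_right_mono) auto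
  also have "\<dots> = 2 * exp (- x / 2)" by (simp flip: exp_add)
  finally show ?thesis .
qed

lemma sinh_cosh_half_bounds:
  fixes t :: real
  assumes "0 < t" "t \<le> 1"
  shows "t / 4 \<le> sinh (t / 2)" "sinh (t / 2) \<le> t" "cosh (t / 2) \<le> 2" "t / 2 \<le> 1 - exp (- t)"
proof -
  define x where "x = t / 2"
  have x: "0 < x" "x \<le> 1 / 2" using assms by (auto simp: x_def)
  have e1: "exp x \<ge> 1 + x" by (rule exp_ge_add_one_self)
  have e2: "exp (- x) \<ge> 1 - x" using exp_ge_add_one_self[of "- x"] by simp
  have e3: "exp x \<le> 1 + x + x\<^sup>2" using x by (intro exp_bound) auto
  have e4: "exp (- x) \<le> 1" using x by simp
  have x2: "x\<^sup>2 \<le> x / 2" using x by (simp add: power2_eq_square field_simps)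
  have sh: "sinh (t / 2) = (exp x - exp (- x)) / 2" "cosh (t / 2) = (exp x + exp (- x)) / 2" and tx: "t = 2 * x"
    by (simp_all add: sinh_field_def cosh_field_def x_def)
  show "t / 4 \<le> sinh (t / 2)" unfolding sh diff_divide_distrib using e1 e4 tx by linarith
  show "sinh (t / 2) \<le> t" unfolding sh diff_divide_distrib using e3 e2 x2 x tx by linarith
  show "cosh (t / 2) \<le> 2" unfolding sh add_divide_distrib using e3 e4 x2 x by linarith
  have "exp (- t) \<le> 1 / (1 + t)"
    using exp_ge_add_one_self[of t] assms by (simp add: exp_minus field_simps)
  also have "\<dots> \<le> 1 - t / 2" using assms by (simp add: field_simps)
  finally show "t / 2 \<le> 1 - exp (- t)" by simp
qed

lemma sqrt_diff_square:
  fixes x y :: real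
  assumes "x \<ge> 0" "y \<ge> 0"
  shows "(sqrt x - sqrt y)\<^sup>2 = x + y - 2 * sqrt (x * y)"
  using assms by (simp add: power2_diff real_sqrt_mult)

text \<open>For t \<le> 1 both sinh(t/2) and 1 - exp(-t) are comparable with t, which gives the
  power of t. Half of \<phi> absorbs the factor 1 + \<phi>; the other half splits into a Gaussian in
  sqrt x - sqrt y and a factor decaying in 1 - u. The latter is kept because integrating it over u
  gains a power of sqrt(x y)/t.\<close>

lemma mehler_deriv_bound_small:
  assumes \<alpha>: "\<alpha> > -1"
  shows "\<exists>C>0. \<forall>t x y s u. 0 < t \<longrightarrow> t \<le> 1 \<longrightarrow> x \<ge> 0 \<longrightarrow> y \<ge> 0 \<longrightarrow> 0 \<le> u \<longrightarrow> u \<le> 1 \<longrightarrow> \<bar>s\<bar> = sqrt u \<longrightarrow>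
    \<bar>mehler_deriv \<alpha> t s x y\<bar> \<le> C * t powr (- \<alpha> - 2) * (1 + sqrt (x * y) / t)
      * exp (- ((sqrt x - sqrt y)\<^sup>2 / (4 * t))) * exp (- ((1 - u) / 4 * (sqrt (x * y) / t)))"
proof (intro exI conjI allI impI)
  \<comment> \<open>Collects the constants of \<open>f1\<close>, \<open>f2\<close> and
    \<open>f3\<close> below. The other factors 2 and \<open>2 powr (\<alpha> + 1)\<close> come from
    absorbing 1 + \<phi> and from \<open>pw\<close>.\<close>
  let ?K = "2 * (\<alpha> + 3) * (\<alpha> + 2) + 8"
  show "2 * ?K * 2 powr (\<alpha> + 1) > 0" using \<alpha> by (intro mult_pos_pos add_nonneg_pos mult_nonneg_nonneg) auto
  fix t x y s u :: real
  assume t: "0 < t" "t \<le> 1" and x: "x \<ge> 0" and y: "y \<ge> 0" and u: "0 \<le> u" "u \<le> 1" and s: "\<bar>s\<bar> = sqrt u"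
  define g where "g = sqrt (x * y)"
  define G where "G = g / t"
  define S where "S = sinh (t / 2)"
  define Ch where "Ch = cosh (t / 2)"
  define \<phi> where "\<phi> = ((x + y) / 2 * Ch - s * g) / S"
  note S = sinh_cosh_half_bounds[OF t, folded S_def Ch_def]
  have S0: "S > 0" using t by (simp add: S_def)
  have g0: "g \<ge> 0" using x y by (simp add: g_def)
  have G0: "G \<ge> 0" using g0 t by (simp add: G_def)
  have Ch0: "Ch \<ge> 0" by (simp add: Ch_def)
  have su: "sqrt u \<le> 1" using u by simp
  have s1: "\<bar>s\<bar> \<le> 1" using s su by simp
  note b = abs_mehler_deriv_le[OF \<alpha> t(1) x y s1, folded g_def S_def Ch_def, folded \<phi>_def]
  have phi0: "\<phi> \<ge> 0" by (rule b(1))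
  have inv: "1 / (2 * S) \<le> 2 / t" using S(1) S0 t by (simp add: field_simps)
  have f1: "\<alpha> + 1 + g / (2 * S) \<le> (\<alpha> + 3) * (1 + G)"
  proof -
    have "g / (2 * S) \<le> 2 * G" using mult_left_mono[OF inv g0] by (simp add: G_def mult.commute)
    moreover have "0 \<le> (\<alpha> + 1) * G" using \<alpha> G0 by simp
    ultimately show ?thesis by (simp add: algebra_simps)
  qed
  have f2: "(\<alpha> + 1 + \<phi>) / (2 * S) \<le> 2 * (\<alpha> + 2) * (1 + \<phi>) / t"
  proof -
    have "(\<alpha> + 1 + \<phi>) * (1 / (2 * S)) \<le> ((\<alpha> + 2) * (1 + \<phi>)) * (2 / t)"
    proof (rule mult_mono[OF _ inv])
      have "0 \<le> (\<alpha> + 1) * \<phi>" using \<alpha> phi0 by simp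
      thus "\<alpha> + 1 + \<phi> \<le> (\<alpha> + 2) * (1 + \<phi>)" by (simp add: algebra_simps)
      show "0 \<le> (\<alpha> + 2) * (1 + \<phi>)" using \<alpha> phi0 by (intro mult_nonneg_nonneg) auto
    qed (use S0 in auto)
    thus ?thesis by (simp add: mult_ac)
  qed
  have f3: "g * Ch / (4 * S\<^sup>2) \<le> 8 * (1 + G) * (1 + \<phi>) / t"
  proof -
    have "(1 / (2 * S))\<^sup>2 \<le> (2 / t)\<^sup>2" using inv S0 by (intro power_mono) auto
    hence q: "1 / (4 * S\<^sup>2) \<le> 4 / t\<^sup>2" by (simp add: power_divide power_mult_distrib)
    have e: "g * Ch / (4 * S\<^sup>2) = (g * Ch) * (1 / (4 * S\<^sup>2))" by simp
    have "(g * Ch) * (1 / (4 * S\<^sup>2)) \<le> (g * 2) * (4 / t\<^sup>2)"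
      using S(3) g0 Ch0 by (intro mult_mono q) auto
    also have "\<dots> = 8 * G / t" by (simp add: G_def power2_eq_square)
    also have "\<dots> \<le> 8 * ((1 + G) * (1 + \<phi>)) / t"
    proof (intro divide_right_mono mult_left_mono)
      have "0 \<le> \<phi> * (1 + G)" using phi0 G0 by simp
      thus "G \<le> (1 + G) * (1 + \<phi>)" by (simp add: algebra_simps)
    qed (use t in auto)
    finally show ?thesis unfolding e by (simp only: mult.assoc)
  qed
  have "(\<alpha> + 1 + g / (2 * S)) * ((\<alpha> + 1 + \<phi>) / (2 * S)) + g * Ch / (4 * S\<^sup>2) \<le>
    ((\<alpha> + 3) * (1 + G)) * (2 * (\<alpha> + 2) * (1 + \<phi>) / t) + 8 * (1 + G) * (1 + \<phi>) / t"
    using \<alpha> G0 t S0 phi0 by (intro add_mono mult_mono f1 f2 f3) (auto intro!: divide_nonneg_pos)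
  also have "\<dots> = ?K * (1 + G) * (1 + \<phi>) / t"
  proof -
    have "(a3 * P) * (2 * a2 * Q / t) + 8 * P * Q / t = (2 * a3 * a2 + 8) * P * Q / t" for a3 a2 P Q :: real
      using t by (simp add: field_simps)
    thus ?thesis .
  qed
  finally have main: "(\<alpha> + 1 + g / (2 * S)) * ((\<alpha> + 1 + \<phi>) / (2 * S)) + g * Ch / (4 * S\<^sup>2) \<le> ?K * (1 + G) * (1 + \<phi>) / t" .
  have K0: "?K \<ge> 0" using \<alpha> by simp
  have pw: "(1 - exp (- t)) powr (- (\<alpha> + 1)) \<le> 2 powr (\<alpha> + 1) * t powr (- (\<alpha> + 1))"
  proof -
    have "(1 - exp (- t)) powr (- (\<alpha> + 1)) \<le> (t / 2) powr (- (\<alpha> + 1))"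
      using S(4) t \<alpha> by (intro powr_mono2') auto
    also have "\<dots> = 2 powr (\<alpha> + 1) * t powr (- (\<alpha> + 1))"
      using t by (simp add: powr_divide powr_minus_divide[of 2] del: minus_add_distrib)
    finally show ?thesis .
  qed
  \<comment> \<open>From s \<le> sqrt u \<le> (1 + u)/2 one gets (x + y)/2 - s g \<ge> (sqrt x -
    sqrt y)^2/2 + (1 - u) g/2; the bounds cosh(t/2) \<ge> 1 and sinh(t/2) \<le> t do the
    rest.\<close>
  have phil: "(sqrt x - sqrt y)\<^sup>2 / (4 * t) + (1 - u) / 4 * G \<le> \<phi> / 2"
  proof -
    have w0: "0 \<le> (x + y) / 2" using x y by simp
    have "sqrt u \<le> (1 + u) / 2" using arith_geo_mean_sqrt[of 1 u] u by simp
    hence "sqrt u * g \<le> (1 + u) / 2 * g" by (rule mult_right_mono[OF _ g0])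
    moreover have "s * g \<le> sqrt u * g" using s g0 by (intro mult_right_mono) auto
    moreover have "(x + y) / 2 \<le> (x + y) / 2 * Ch"
      using w0 mult_left_mono[OF cosh_real_ge_1[of "t / 2"] w0] by (simp add: Ch_def)
    ultimately have "(x + y) / 2 - (1 + u) / 2 * g \<le> (x + y) / 2 * Ch - s * g" by linarith
    moreover have nn: "0 \<le> (x + y) / 2 - (1 + u) / 2 * g"
    proof -
      have "(1 + u) / 2 * g \<le> 1 * g" using u g0 by (intro mult_right_mono) auto
      thus ?thesis using arith_geo_mean_sqrt[OF x y] by (simp add: g_def)
    qed
    ultimately have Q: "((x + y) / 2 - (1 + u) / 2 * g) / t \<le> \<phi>"
      unfolding \<phi>_def
    proof (intro frac_le)
      show "0 \<le> (x + y) / 2 * Ch - s * g"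
        using nn \<open>(x + y) / 2 - (1 + u) / 2 * g \<le> (x + y) / 2 * Ch - s * g\<close> by linarith
    qed (use S(2) S0 in auto)
    moreover have "(sqrt x - sqrt y)\<^sup>2 / (4 * t) + (1 - u) / 4 * G = ((x + y) / 2 - (1 + u) / 2 * g) / t / 2"
      unfolding sqrt_diff_square[OF x y] g_def[symmetric] G_def using t by (simp add: field_simps)
    ultimately show ?thesis using divide_right_mono[OF Q, of 2] by simp
  qed
  have "\<bar>mehler_deriv \<alpha> t s x y\<bar> \<le> (1 - exp (- t)) powr (- (\<alpha> + 1)) *
    ((\<alpha> + 1 + g / (2 * S)) * ((\<alpha> + 1 + \<phi>) / (2 * S)) + g * Ch / (4 * S\<^sup>2)) * exp (- \<phi>)" by (rule b(2))
  also have "\<dots> \<le> (2 powr (\<alpha> + 1) * t powr (- (\<alpha> + 1))) * (?K * (1 + G) * (1 + \<phi>) / t) * exp (- \<phi>)"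
    using \<alpha> g0 S0 phi0 by (intro mult_right_mono mult_mono pw main) (auto simp: Ch_def intro!: add_nonneg_nonneg mult_nonneg_nonneg divide_nonneg_pos)
  also have "\<dots> = 2 powr (\<alpha> + 1) * (t powr (- (\<alpha> + 1)) / t) * ?K * (1 + G) * ((1 + \<phi>) * exp (- \<phi>))" by simp
  also have "t powr (- (\<alpha> + 1)) / t = t powr (- \<alpha> - 2)"
  proof -
    have "t powr (- (\<alpha> + 1)) / t = t powr (- (\<alpha> + 1) - 1)" using t by (subst powr_diff) simp
    thus ?thesis by (simp add: algebra_simps)
  qed
  also have "2 powr (\<alpha> + 1) * t powr (- \<alpha> - 2) * ?K * (1 + G) * ((1 + \<phi>) * exp (- \<phi>))
    \<le> 2 powr (\<alpha> + 1) * t powr (- \<alpha> - 2) * ?K * (1 + G) * (2 * exp (- ((sqrt x - sqrt y)\<^sup>2 / (4 * t) + (1 - u) / 4 * G)))"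
  proof (rule mult_left_mono)
    show "(1 + \<phi>) * exp (- \<phi>) \<le> 2 * exp (- ((sqrt x - sqrt y)\<^sup>2 / (4 * t) + (1 - u) / 4 * G))"
    proof (rule order_trans[OF one_plus_mult_exp_minus_le[OF phi0]])
      have "- \<phi> / 2 \<le> - ((sqrt x - sqrt y)\<^sup>2 / (4 * t) + (1 - u) / 4 * G)" using phil by linarith
      thus "2 * exp (- \<phi> / 2) \<le> 2 * exp (- ((sqrt x - sqrt y)\<^sup>2 / (4 * t) + (1 - u) / 4 * G))"
        by (simp only: exp_le_cancel_iff mult_le_cancel_left_pos zero_less_numeral)
    qed
    show "0 \<le> 2 powr (\<alpha> + 1) * t powr (- \<alpha> - 2) * ?K * (1 + G)"
      using K0 G0 by (intro mult_nonneg_nonneg) auto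
  qed
  also have "- ((sqrt x - sqrt y)\<^sup>2 / (4 * t) + (1 - u) / 4 * G) = - ((sqrt x - sqrt y)\<^sup>2 / (4 * t)) + - ((1 - u) / 4 * G)" by simp
  finally show "\<bar>mehler_deriv \<alpha> t s x y\<bar> \<le> 2 * ?K * 2 powr (\<alpha> + 1) * t powr (- \<alpha> - 2) * (1 + sqrt (x * y) / t)
      * exp (- ((sqrt x - sqrt y)\<^sup>2 / (4 * t))) * exp (- ((1 - u) / 4 * (sqrt (x * y) / t)))"
    unfolding exp_add G_def g_def by (simp only: mult_ac)
qed

text \<open>For t \<ge> 1, sinh(t/2) and cosh(t/2) are comparable and 1/S supplies the decay
  exp(-t/2). Moreover cosh(t/2) - 1 stays above a multiple of sinh(t/2), so \<phi> controls x + y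
  even on the diagonal with s = 1.\<close>

lemma mehler_deriv_bound_large:
  assumes \<alpha>: "\<alpha> > -1"
  shows "\<exists>C>0. \<forall>t x y s. 1 \<le> t \<longrightarrow> x \<ge> 0 \<longrightarrow> y \<ge> 0 \<longrightarrow> \<bar>s\<bar> \<le> 1 \<longrightarrow>
    \<bar>mehler_deriv \<alpha> t s x y\<bar> \<le> C * exp (- t / 2) * exp (- (x + y) / 40)"
proof (intro exI conjI allI impI)
  let ?K = "2 * (\<alpha> + 2)\<^sup>2 + 3"
  let ?C = "2 powr (\<alpha> + 1) * ?K * 160"
  have K0: "?K > 0" by (simp add: add_nonneg_pos)
  show "?C > 0" using K0 by simp
  fix t x y s :: real
  assume t: "1 \<le> t" and x: "x \<ge> 0" and y: "y \<ge> 0" and s1: "\<bar>s\<bar> \<le> 1"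
  define g where "g = sqrt (x * y)"
  define S where "S = sinh (t / 2)"
  define Ch where "Ch = cosh (t / 2)"
  define \<phi> where "\<phi> = ((x + y) / 2 * Ch - s * g) / S"
  define a where "a = exp (t / 2)"
  define w where "w = (x + y) / 2"
  have t0: "t > 0" using t by simp
  note b = abs_mehler_deriv_le[OF \<alpha> t0 x y s1, folded g_def S_def Ch_def, folded \<phi>_def]
  have phi0: "\<phi> \<ge> 0" by (rule b(1))
  have g0: "g \<ge> 0" using x y by (simp add: g_def)
  have gw: "g \<le> w" using arith_geo_mean_sqrt[OF x y] by (simp add: g_def w_def)
  have a15: "a \<ge> 3 / 2" using exp_ge_add_one_self[of "t / 2"] t unfolding a_def by linarith
  define ib where "ib = 1 / a"
  have Sa: "S = (a - ib) / 2" "Ch = (a + ib) / 2"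
    by (simp_all add: ib_def S_def Ch_def a_def sinh_field_def cosh_field_def exp_minus inverse_eq_divide)
  have ia: "ib \<le> 2 / 3" using a15 by (simp add: ib_def field_simps)
  have S4: "S \<ge> a / 4" using a15 ia unfolding Sa diff_divide_distrib by linarith
  have S0: "S > 0" using S4 a15 by linarith
  have C3: "Ch \<le> 3 * S" using a15 ia unfolding Sa by (simp add: field_simps)
  have Ch5: "Ch - 1 \<ge> S / 5"
  proof -
    \<comment> \<open>Multiplying Ch - 1 - S/5 by 5 a leaves 2 a^2 - 5 a + 3, whose larger root is
      3/2; and t \<ge> 1 gives a \<ge> 3/2.\<close>
    have "0 \<le> (a - 1) * (2 * a - 3)" using a15 by (intro mult_nonneg_nonneg) auto
    hence "0 \<le> (2 * a * a - 5 * a + 3) / (5 * a)" using a15 by (intro divide_nonneg_pos) (auto simp: algebra_simps)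
    also have "(2 * a * a - 5 * a + 3) / (5 * a) = Ch - 1 - S / 5"
      using a15 unfolding Sa ib_def by (simp add: field_simps)
    finally show ?thesis by simp
  qed
  have inv: "1 / (2 * S) \<le> 2 / a" using S4 S0 a15 by (simp add: field_simps)
  have r: "1 / 2 \<le> 1 - exp (- t)"
  proof -
    have "exp (- t) \<le> 1 / (1 + t)" using exp_ge_add_one_self[of t] t by (simp add: exp_minus field_simps)
    also have "\<dots> \<le> 1 / 2" using t by (simp add: field_simps)
    finally show ?thesis by simp
  qed
  have pw: "(1 - exp (- t)) powr (- (\<alpha> + 1)) \<le> 2 powr (\<alpha> + 1)"
  proof -
    have "(1 - exp (- t)) powr (- (\<alpha> + 1)) \<le> (1 / 2) powr (- (\<alpha> + 1))"
      using r \<alpha> by (intro powr_mono2') auto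
    also have "\<dots> = 2 powr (\<alpha> + 1)" by (simp add: powr_divide powr_minus_divide del: minus_add_distrib)
    finally show ?thesis .
  qed
  have S12: "1 / (2 * S) \<le> 4 / 3"
  proof -
    have "2 / a = 2 * ib" by (simp add: ib_def)
    thus ?thesis using inv ia by linarith
  qed
  have f1: "\<alpha> + 1 + g / (2 * S) \<le> 2 * (\<alpha> + 2) * (1 + g)"
  proof -
    have "g / (2 * S) \<le> g * (4 / 3)" using mult_left_mono[OF S12 g0] by simp
    moreover have "0 \<le> (\<alpha> + 1) * g" using \<alpha> g0 by simp
    ultimately show ?thesis using \<alpha> g0 by (simp add: algebra_simps)
  qed
  have f2: "(\<alpha> + 1 + \<phi>) / (2 * S) \<le> (\<alpha> + 2) * (1 + \<phi>) * (2 / a)"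
  proof -
    have "(\<alpha> + 1 + \<phi>) * (1 / (2 * S)) \<le> ((\<alpha> + 2) * (1 + \<phi>)) * (2 / a)"
    proof (rule mult_mono[OF _ inv])
      have "0 \<le> (\<alpha> + 1) * \<phi>" using \<alpha> phi0 by simp
      thus "\<alpha> + 1 + \<phi> \<le> (\<alpha> + 2) * (1 + \<phi>)" by (simp add: algebra_simps)
      show "0 \<le> (\<alpha> + 2) * (1 + \<phi>)" using \<alpha> phi0 by (intro mult_nonneg_nonneg) auto
    qed (use S0 in auto)
    thus ?thesis by simp
  qed
  have f3: "g * Ch / (4 * S\<^sup>2) \<le> 3 * (1 + g) * (1 + \<phi>) * (2 / a)"
  proof -
    have "g * Ch / (4 * S\<^sup>2) \<le> g * (3 * S) / (4 * S\<^sup>2)" using C3 g0 by (intro divide_right_mono mult_left_mono) auto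
    also have "\<dots> = (3 / 2 * g) * (1 / (2 * S))" using S0 by (simp add: power2_eq_square)
    also have "\<dots> \<le> (3 * ((1 + g) * (1 + \<phi>))) * (2 / a)"
    proof (rule mult_mono[OF _ inv])
      have "0 \<le> \<phi> * (1 + g)" using phi0 g0 by simp
      thus "3 / 2 * g \<le> 3 * ((1 + g) * (1 + \<phi>))" using g0 by (simp add: algebra_simps)
    qed (use g0 phi0 S0 in auto)
    finally show ?thesis by (simp only: mult.assoc)
  qed
  have "(\<alpha> + 1 + g / (2 * S)) * ((\<alpha> + 1 + \<phi>) / (2 * S)) + g * Ch / (4 * S\<^sup>2) \<le>
    (2 * (\<alpha> + 2) * (1 + g)) * ((\<alpha> + 2) * (1 + \<phi>) * (2 / a)) + 3 * (1 + g) * (1 + \<phi>) * (2 / a)"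
    using \<alpha> g0 S0 phi0 by (intro add_mono mult_mono f1 f2 f3) (auto intro!: divide_nonneg_pos)
  also have "\<dots> = ?K * ((1 + g) * (1 + \<phi>)) * (2 / a)"
    by (simp add: power2_eq_square algebra_simps)
  finally have main: "(\<alpha> + 1 + g / (2 * S)) * ((\<alpha> + 1 + \<phi>) / (2 * S)) + g * Ch / (4 * S\<^sup>2) \<le> ?K * ((1 + g) * (1 + \<phi>)) * (2 / a)" .
  have w0: "w \<ge> 0" using x y by (simp add: w_def)
  have phiw: "w / 5 \<le> \<phi>"
  proof -
    have "s * g \<le> 1 * g" using s1 g0 by (intro mult_right_mono) auto
    hence "w * Ch - w \<le> w * Ch - s * g" using gw by simp
    moreover have "w * (S / 5) \<le> w * (Ch - 1)" using Ch5 w0 by (rule mult_left_mono)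
    ultimately have "w * S / 5 \<le> w * Ch - s * g" by (simp add: algebra_simps)
    thus ?thesis unfolding \<phi>_def w_def[symmetric] using S0 by (simp add: field_simps)
  qed
  have fin: "(1 + g) * ((1 + \<phi>) * exp (- \<phi>)) \<le> 40 * exp (- w / 20)"
  proof -
    have "1 + g \<le> 20 * exp (w / 20)" using exp_ge_add_one_self[of "w / 20"] gw by linarith
    moreover have "(1 + \<phi>) * exp (- \<phi>) \<le> 2 * exp (- w / 10)"
    proof (rule order_trans[OF one_plus_mult_exp_minus_le[OF phi0]])
      have "- \<phi> / 2 \<le> - w / 10" using phiw by simp
      thus "2 * exp (- \<phi> / 2) \<le> 2 * exp (- w / 10)"
        by (simp only: exp_le_cancel_iff mult_le_cancel_left_pos zero_less_numeral)
    qed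
    ultimately have "(1 + g) * ((1 + \<phi>) * exp (- \<phi>)) \<le> (20 * exp (w / 20)) * (2 * exp (- w / 10))"
      using phi0 by (rule_tac mult_mono) auto
    also have "\<dots> = 40 * exp (- w / 20)" by (simp flip: exp_add)
    finally show ?thesis .
  qed
  have "\<bar>mehler_deriv \<alpha> t s x y\<bar> \<le> (1 - exp (- t)) powr (- (\<alpha> + 1)) *
    ((\<alpha> + 1 + g / (2 * S)) * ((\<alpha> + 1 + \<phi>) / (2 * S)) + g * Ch / (4 * S\<^sup>2)) * exp (- \<phi>)" by (rule b(2))
  also have "\<dots> \<le> 2 powr (\<alpha> + 1) * (?K * ((1 + g) * (1 + \<phi>)) * (2 / a)) * exp (- \<phi>)"
    using \<alpha> g0 S0 phi0 by (intro mult_right_mono mult_mono pw main) (auto simp: Ch_def intro!: add_nonneg_nonneg mult_nonneg_nonneg divide_nonneg_pos)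
  also have "\<dots> = 2 powr (\<alpha> + 1) * ?K * (2 / a) * ((1 + g) * ((1 + \<phi>) * exp (- \<phi>)))" by simp
  also have "\<dots> \<le> 2 powr (\<alpha> + 1) * ?K * (2 / a) * (40 * exp (- w / 20))"
    using K0 a15 by (intro mult_left_mono fin) auto
  also have "\<dots> \<le> 2 powr (\<alpha> + 1) * ?K * (4 / a) * (40 * exp (- w / 20))"
    using K0 a15 by (intro mult_right_mono mult_left_mono divide_right_mono) auto
  also have "\<dots> = ?C * (1 / a) * exp (- w / 20)" by simp
  also have "1 / a = exp (- t / 2)" by (simp add: a_def exp_minus inverse_eq_divide)
  also have "- w / 20 = - (x + y) / 40" unfolding w_def by linarith
  finally show "\<bar>mehler_deriv \<alpha> t s x y\<bar> \<le> ?C * exp (- t / 2) * exp (- (x + y) / 40)" .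
qed

text \<open>Crude in y but uniform over a compact interval of times. It serves to differentiate
  under the integral sign, where the exponential decay of the Laguerre functions makes up for sqrt(x
  y).\<close>

lemma mehler_deriv_bound_local:
  assumes \<alpha>: "\<alpha> > -1" and a: "0 < a"
  shows "\<exists>C. \<forall>t x y s. a \<le> t \<longrightarrow> t \<le> b \<longrightarrow> x \<ge> 0 \<longrightarrow> y \<ge> 0 \<longrightarrow> \<bar>s\<bar> \<le> 1 \<longrightarrow>
    \<bar>mehler_deriv \<alpha> t s x y\<bar> \<le> C * (1 + sqrt (x * y))"
proof (intro exI allI impI)
  define S1 where "S1 = sinh (a / 2)"
  define C1 where "C1 = cosh (b / 2)"
  have S1: "S1 > 0" using a by (simp add: S1_def)
  let ?P = "(1 - exp (- a)) powr (- (\<alpha> + 1))"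
  let ?K = "(\<alpha> + 1 + 1 / (2 * S1)) * ((\<alpha> + 2) / (2 * S1)) + C1 / (4 * S1\<^sup>2)"
  fix t x y s :: real
  assume t: "a \<le> t" "t \<le> b" and x: "x \<ge> 0" and y: "y \<ge> 0" and s1: "\<bar>s\<bar> \<le> 1"
  define g where "g = sqrt (x * y)"
  define S where "S = sinh (t / 2)"
  define Ch where "Ch = cosh (t / 2)"
  define \<phi> where "\<phi> = ((x + y) / 2 * Ch - s * g) / S"
  have t0: "t > 0" using t a by simp
  note b = abs_mehler_deriv_le[OF \<alpha> t0 x y s1, folded g_def S_def Ch_def, folded \<phi>_def]
  have phi0: "\<phi> \<ge> 0" by (rule b(1))
  have g0: "g \<ge> 0" using x y by (simp add: g_def)
  have SS: "S1 \<le> S" using t by (simp add: S1_def S_def)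
  have S0: "S > 0" using S1 SS by simp
  have CC: "Ch \<le> C1" using t t0 unfolding Ch_def C1_def by (subst cosh_real_nonneg_le_iff) auto
  have Ch0: "Ch \<ge> 0" by (simp add: Ch_def)
  have e1: "exp (- \<phi>) \<le> 1" using phi0 by simp
  have e2: "\<phi> * exp (- \<phi>) \<le> 1"
  proof -
    have "\<phi> \<le> exp \<phi>" using exp_ge_add_one_self[of \<phi>] by linarith
    thus ?thesis by (simp add: exp_minus field_simps)
  qed
  have "(\<alpha> + 1 + \<phi>) * exp (- \<phi>) = (\<alpha> + 1) * exp (- \<phi>) + \<phi> * exp (- \<phi>)" by (simp add: algebra_simps)
  also have "\<dots> \<le> (\<alpha> + 1) * 1 + 1" using \<alpha> by (intro add_mono mult_left_mono e1 e2) auto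
  finally have e3: "(\<alpha> + 1 + \<phi>) * exp (- \<phi>) \<le> \<alpha> + 2" by simp
  have pw: "(1 - exp (- t)) powr (- (\<alpha> + 1)) \<le> ?P"
    using a t \<alpha> by (intro powr_mono2') auto
  have "((\<alpha> + 1 + g / (2 * S)) * ((\<alpha> + 1 + \<phi>) / (2 * S)) + g * Ch / (4 * S\<^sup>2)) * exp (- \<phi>)
     = (\<alpha> + 1 + g / (2 * S)) * (((\<alpha> + 1 + \<phi>) * exp (- \<phi>)) / (2 * S)) + g * Ch / (4 * S\<^sup>2) * exp (- \<phi>)"
  proof -
    have "(P * (Q / D) + R) * E = P * (Q * E / D) + R * E" for P Q D R E :: real
      by (simp add: distrib_right)
    thus ?thesis .
  qed
  also have "\<dots> \<le> (\<alpha> + 1 + g / (2 * S1)) * ((\<alpha> + 2) / (2 * S1)) + g * C1 / (4 * S1\<^sup>2) * 1"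
  proof (intro add_mono mult_mono frac_le e1 e3 order.refl)
    show "S\<^sup>2 \<ge> S1\<^sup>2" using SS S1 by (intro power_mono) auto
  qed (use \<alpha> g0 S0 S1 SS CC Ch0 phi0 in \<open>auto intro!: add_nonneg_nonneg\<close>)
  also have "\<dots> \<le> ?K * (1 + g)"
  proof -
    define i where "i = 1 / (2 * S1)"
    define j where "j = (\<alpha> + 2) / (2 * S1)"
    define l where "l = C1 / (4 * S1\<^sup>2)"
    have nn: "0 \<le> i" "0 \<le> j" "0 \<le> l" using \<alpha> S1 by (auto simp: i_def j_def l_def C1_def)
    hence "0 \<le> i * j" "0 \<le> ((\<alpha> + 1) * j) * g" using \<alpha> g0 by (auto intro!: mult_nonneg_nonneg)
    moreover have "((\<alpha> + 1 + i) * j + l) * (1 + g) - ((\<alpha> + 1 + g * i) * j + g * l) = i * j + ((\<alpha> + 1) * j) * g + l"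
      by (simp add: algebra_simps)
    ultimately have "(\<alpha> + 1 + g * i) * j + g * l \<le> ((\<alpha> + 1 + i) * j + l) * (1 + g)"
      using nn(3) by linarith
    thus ?thesis by (simp add: i_def j_def l_def)
  qed
  finally have main: "((\<alpha> + 1 + g / (2 * S)) * ((\<alpha> + 1 + \<phi>) / (2 * S)) + g * Ch / (4 * S\<^sup>2)) * exp (- \<phi>) \<le> ?K * (1 + g)" .
  have "\<bar>mehler_deriv \<alpha> t s x y\<bar> \<le> (1 - exp (- t)) powr (- (\<alpha> + 1)) *
    (((\<alpha> + 1 + g / (2 * S)) * ((\<alpha> + 1 + \<phi>) / (2 * S)) + g * Ch / (4 * S\<^sup>2)) * exp (- \<phi>))"
    using b(2) by (simp only: mult.assoc)
  also have "\<dots> \<le> ?P * (?K * (1 + g))"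
  proof (rule mult_mono[OF pw main])
    show "0 \<le> ((\<alpha> + 1 + g / (2 * S)) * ((\<alpha> + 1 + \<phi>) / (2 * S)) + g * Ch / (4 * S\<^sup>2)) * exp (- \<phi>)"
    proof -
      have "0 \<le> \<alpha> + 1 + g / (2 * S)" using \<alpha> g0 S0 by (simp add: add_nonneg_nonneg)
      moreover have "0 \<le> (\<alpha> + 1 + \<phi>) / (2 * S)" "0 \<le> g * Ch / (4 * S\<^sup>2)" using \<alpha> g0 S0 phi0 Ch0 by auto
      ultimately show ?thesis by (rule_tac mult_nonneg_nonneg[OF add_nonneg_nonneg[OF mult_nonneg_nonneg]]) auto
    qed
  qed simp
  finally show "\<bar>mehler_deriv \<alpha> t s x y\<bar> \<le> ?P * ?K * (1 + sqrt (x * y))"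
    by (simp only: g_def mult.assoc)
qed

subsection \<open>The far and the near kernel\<close>

text \<open>Invariant under dilations. It lives on the whole line, with density 0 off the half-line,
  so that its measurable sets are the Borel sets.\<close>

definition haar :: "real measure" where
  "haar = density lborel (\<lambda>x. ennreal (indicator {0<..} x / x))"

lemma space_haar [simp]: "space haar = UNIV"
  by (simp add: haar_def)

lemma sets_haar [simp, measurable_cong]: "sets haar = sets borel"
  by (simp add: haar_def)

lemma sigma_finite_haar: "sigma_finite_measure haar"
  unfolding haar_def by (subst sigma_finite_measure.sigma_finite_iff_density_finite[OF sigma_finite_lborel]) auto

lemma nn_integral_haar:
  "f \<in> borel_measurable borel \<Longrightarrow> (\<integral>\<^sup>+x. f x \<partial>haar) = (\<integral>\<^sup>+x. ennreal (indicator {0<..} x / x) * f x \<partial>lborel)"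
  unfolding haar_def by (rule nn_integral_density) auto

lemma AE_haar: "AE x in haar. x > 0"
  unfolding haar_def by (subst AE_density) (auto simp: indicator_def)

lemma nn_integral_powr_to_inf:
  fixes e a :: real
  assumes "e < -1" "a > 0"
  shows "(\<integral>\<^sup>+x. ennreal (x powr e) * indicator {a..} x \<partial>lborel) = ennreal (- (a powr (e + 1)) / (e + 1))"
  by (intro nn_integral_has_integral_lebesgue' has_integral_powr_to_inf assms) auto

text \<open>A substitute for Hoelder's inequality. Up to the height \<open>M powr (1 / p)\<close> of
  f the first summand dominates; above it the second does, because \<open>f powr (p - 1)\<close> is
  then at least \<open>M powr (1 - 1 / p)\<close>.\<close>

lemma mult_le_root_mult_add:
  fixes u f M p :: real
  assumes u: "0 \<le> u" "u \<le> M" and M: "M > 0" and f: "f \<ge> 0" and p: "p > 1"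
  shows "u * f \<le> M powr (1 / p) * (u + f powr p)"
proof (cases "f \<le> M powr (1 / p)")
  case True
  have "u * f \<le> u * M powr (1 / p)" using True u by (intro mult_left_mono)
  also have "\<dots> \<le> M powr (1 / p) * (u + f powr p)" by (simp add: algebra_simps)
  finally show ?thesis .
next
  case False
  moreover have "M powr (1 / p) \<ge> 0" by simp
  ultimately have f0: "f > 0" by linarith
  have "(M powr (1 / p)) powr (p - 1) \<le> f powr (p - 1)" using False p by (intro powr_mono2) auto
  hence "M powr (1 / p) * (M powr (1 / p)) powr (p - 1) * f \<le> M powr (1 / p) * f powr (p - 1) * f"
    using f by (intro mult_right_mono mult_left_mono) auto
  moreover have "M powr (1 / p) * (M powr (1 / p)) powr (p - 1) = M"
    using M p by (simp add: powr_powr powr_add[symmetric] right_diff_distrib)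
  moreover have "f powr (p - 1) * f = f powr p" using f0 by (simp add: powr_diff)
  ultimately have "M * f \<le> M powr (1 / p) * f powr p" by (simp add: mult.assoc)
  moreover have "u * f \<le> M * f" using u f by (intro mult_right_mono)
  moreover have "0 \<le> M powr (1 / p) * u" using u by simp
  ultimately show ?thesis by (simp add: distrib_left)
qed

text \<open>Hoelder's inequality would give c^(1 - 1/p) instead of c + 1; all that matters later is
  the power of M.\<close>

lemma nn_integral_mult_le_root:
  fixes u f :: "real \<Rightarrow> real" and M p c :: real
  assumes [measurable]: "u \<in> borel_measurable borel" "f \<in> borel_measurable borel"
    and u: "\<And>y. 0 \<le> u y" "\<And>y. u y \<le> M" and M: "M > 0" and f: "\<And>y. f y \<ge> 0" and p: "p > 1"
    and fp: "(\<integral>\<^sup>+y. ennreal (f y powr p) \<partial>haar) \<le> 1" and ui: "(\<integral>\<^sup>+y. ennreal (u y) \<partial>haar) \<le> ennreal c" and c: "c \<ge> 0"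
  shows "(\<integral>\<^sup>+y. ennreal (u y * f y) \<partial>haar) \<le> ennreal (M powr (1 / p) * (c + 1))"
proof -
  have "(\<integral>\<^sup>+y. ennreal (u y * f y) \<partial>haar) \<le> (\<integral>\<^sup>+y. ennreal (M powr (1 / p)) * (ennreal (u y) + ennreal (f y powr p)) \<partial>haar)"
  proof (rule nn_integral_mono)
    fix y
    have "ennreal (u y * f y) \<le> ennreal (M powr (1 / p) * (u y + f y powr p))"
      by (intro ennreal_leI mult_le_root_mult_add u M f p)
    thus "ennreal (u y * f y) \<le> ennreal (M powr (1 / p)) * (ennreal (u y) + ennreal (f y powr p))"
      using u by (simp add: ennreal_mult')
  qed
  also have "\<dots> = ennreal (M powr (1 / p)) * ((\<integral>\<^sup>+y. ennreal (u y) \<partial>haar) + (\<integral>\<^sup>+y. ennreal (f y powr p) \<partial>haar))"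
  proof -
    have "(\<integral>\<^sup>+y. ennreal (M powr (1 / p)) * (ennreal (u y) + ennreal (f y powr p)) \<partial>haar) =
      ennreal (M powr (1 / p)) * (\<integral>\<^sup>+y. ennreal (u y) + ennreal (f y powr p) \<partial>haar)"
      by (rule nn_integral_cmult) measurable
    also have "(\<integral>\<^sup>+y. ennreal (u y) + ennreal (f y powr p) \<partial>haar) = (\<integral>\<^sup>+y. ennreal (u y) \<partial>haar) + (\<integral>\<^sup>+y. ennreal (f y powr p) \<partial>haar)"
      by (rule nn_integral_add) measurable
    finally show ?thesis .
  qed
  also have "\<dots> \<le> ennreal (M powr (1 / p)) * (ennreal c + 1)"
    by (intro mult_left_mono add_mono ui fp) auto
  also have "\<dots> = ennreal (M powr (1 / p) * (c + 1))"
    using c by (simp add: ennreal_mult')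
  finally show ?thesis .
qed

text \<open>The kernel max(x,y)^(-(A + B)) with the power weights of both spaces moved into it. It
  equals (y/x)^A for y < x and (x/y)^B for y > x, a Hardy kernel homogeneous of degree 0.\<close>

definition far_kernel :: "real \<Rightarrow> real \<Rightarrow> real \<Rightarrow> real \<Rightarrow> real" where
  "far_kernel A B x y = (if x > 0 \<and> y > 0 then x powr B * y powr A * max x y powr (- (A + B)) else 0)"

lemma far_kernel_measurable [measurable]: "(\<lambda>(x, y). far_kernel A B x y) \<in> borel_measurable (borel \<Otimes>\<^sub>M borel)"
  unfolding far_kernel_def by measurable

lemma far_kernel_sym: "far_kernel A B x y = far_kernel B A y x"
  by (simp add: far_kernel_def max.commute add.commute mult_ac)

lemma far_kernel_bounds:
  assumes "A > 0" "B > 0"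
  shows "0 \<le> far_kernel A B x y" "far_kernel A B x y \<le> 1"
proof -
  show "0 \<le> far_kernel A B x y" by (simp add: far_kernel_def)
  show "far_kernel A B x y \<le> 1"
  proof (cases "x > 0 \<and> y > 0")
    case True
    define X where "X = max x y"
    have X: "X > 0" using True by (simp add: X_def less_max_iff_disj)
    have "x powr B * y powr A \<le> X powr B * X powr A"
      using True assms by (intro mult_mono powr_mono2) (auto simp: X_def)
    hence "x powr B * y powr A * X powr (- (A + B)) \<le> X powr B * X powr A * X powr (- (A + B))"
      by (intro mult_right_mono) auto
    also have "\<dots> = 1" using X by (simp flip: powr_add)
    finally show ?thesis using True by (simp add: far_kernel_def X_def)
  next
    case False
    thus ?thesis by (auto simp: far_kernel_def)
  qed
qed

text \<open>For dy/y the part (y/x)^A below x has integral 1/A, the part (x/y)^B above x has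
  integral 1/B.\<close>

lemma nn_integral_far_kernel_le:
  assumes A: "A > 0" and B: "B > 0"
  shows "(\<integral>\<^sup>+y. ennreal (far_kernel A B x y) \<partial>haar) \<le> ennreal (1 / A + 1 / B)"
proof (cases "x > 0")
  case x: True
  have "(\<integral>\<^sup>+y. ennreal (far_kernel A B x y) \<partial>haar) = (\<integral>\<^sup>+y. ennreal (indicator {0<..} y / y) * ennreal (far_kernel A B x y) \<partial>lborel)"
    by (rule nn_integral_haar) measurable
  also have "\<dots> \<le> (\<integral>\<^sup>+y. ennreal (x powr (- A)) * (ennreal (y powr (A - 1)) * indicator {0<..<x} y)
      + ennreal (x powr B) * (ennreal (y powr (- B - 1)) * indicator {x..} y) \<partial>lborel)"
  proof (rule nn_integral_mono)
    fix y :: real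
    consider "y \<le> 0" | "0 < y" "y < x" | "x \<le> y" by linarith
    thus "ennreal (indicator {0<..} y / y) * ennreal (far_kernel A B x y) \<le>
      ennreal (x powr (- A)) * (ennreal (y powr (A - 1)) * indicator {0<..<x} y)
      + ennreal (x powr B) * (ennreal (y powr (- B - 1)) * indicator {x..} y)"
    proof cases
      case 2
      have "x powr B * x powr (- (A + B)) = x powr (- A)" by (simp flip: powr_add)
      hence "x powr B * y powr A * x powr (- (A + B)) / y = x powr (- A) * y powr (A - 1)"
        using 2 by (simp add: powr_diff mult_ac)
      thus ?thesis using 2 by (simp add: far_kernel_def max_def indicator_def ennreal_mult'[symmetric] mult_ac)
    next
      case 3
      hence y: "y > 0" using x by simp
      have e1: "y powr A * y powr (- (A + B)) = y powr (- B)" by (simp flip: powr_add)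
      have e2: "y powr (- B) / y = y powr (- B - 1)" using y by (subst powr_diff) simp
      have "x powr B * y powr A * y powr (- (A + B)) / y = x powr B * (y powr A * y powr (- (A + B)) / y)"
        by (simp only: times_divide_eq_right mult.assoc)
      hence "x powr B * y powr A * y powr (- (A + B)) / y = x powr B * y powr (- B - 1)"
        unfolding e1 e2 .
      thus ?thesis using 3 y x by (simp add: far_kernel_def max_def indicator_def ennreal_mult'[symmetric] mult_ac)
    qed (simp add: indicator_def)
  qed
  also have "\<dots> = ennreal (x powr (- A)) * (\<integral>\<^sup>+y. ennreal (y powr (A - 1)) * indicator {0<..<x} y \<partial>lborel)
      + ennreal (x powr B) * (\<integral>\<^sup>+y. ennreal (y powr (- B - 1)) * indicator {x..} y \<partial>lborel)"
  proof -
    have "(\<integral>\<^sup>+y. ennreal (x powr (- A)) * (ennreal (y powr (A - 1)) * indicator {0<..<x} y)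
      + ennreal (x powr B) * (ennreal (y powr (- B - 1)) * indicator {x..} y) \<partial>lborel) =
      (\<integral>\<^sup>+y. ennreal (x powr (- A)) * (ennreal (y powr (A - 1)) * indicator {0<..<x} y) \<partial>lborel)
      + (\<integral>\<^sup>+y. ennreal (x powr B) * (ennreal (y powr (- B - 1)) * indicator {x..} y) \<partial>lborel)"
      by (rule nn_integral_add) measurable
    also have "(\<integral>\<^sup>+y. ennreal (x powr (- A)) * (ennreal (y powr (A - 1)) * indicator {0<..<x} y) \<partial>lborel) =
      ennreal (x powr (- A)) * (\<integral>\<^sup>+y. ennreal (y powr (A - 1)) * indicator {0<..<x} y \<partial>lborel)"
      by (rule nn_integral_cmult) measurable
    also have "(\<integral>\<^sup>+y. ennreal (x powr B) * (ennreal (y powr (- B - 1)) * indicator {x..} y) \<partial>lborel) =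
      ennreal (x powr B) * (\<integral>\<^sup>+y. ennreal (y powr (- B - 1)) * indicator {x..} y \<partial>lborel)"
      by (rule nn_integral_cmult) measurable
    finally show ?thesis .
  qed
  also have "\<dots> = ennreal (x powr (- A)) * ennreal (x powr A / A) + ennreal (x powr B) * ennreal (x powr (- B) / B)"
    using nn_integral_powr_from_0[of "A - 1" x] nn_integral_powr_to_inf[of "- B - 1" x] A B x by simp
  also have "\<dots> = ennreal (1 / A + 1 / B)"
    using A B x by (simp add: ennreal_mult'[symmetric] ennreal_plus[symmetric] powr_minus del: ennreal_plus)
  finally show ?thesis .
qed (simp add: far_kernel_def)

lemma nn_integral_cauchy_le:
  assumes a: "a > 0"
  shows "(\<integral>\<^sup>+y. ennreal (a\<^sup>2 / (a\<^sup>2 + (c - y)\<^sup>2)) \<partial>lborel) \<le> ennreal (pi * a)"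
proof -
  have half: "(\<integral>\<^sup>+z. ennreal (1 / (1 + z\<^sup>2)) * indicator {0..} z \<partial>lborel) = ennreal (pi / 2 - arctan 0)"
    by (rule nn_integral_FTC_atLeast)
       (auto intro!: derivative_eq_intros tendsto_arctan_at_top simp: power2_eq_square field_simps add_nonneg_eq_0_iff)
  have "(\<integral>\<^sup>+y. ennreal (a\<^sup>2 / (a\<^sup>2 + (c - y)\<^sup>2)) \<partial>lborel) = ennreal \<bar>a\<bar> * (\<integral>\<^sup>+z. ennreal (a\<^sup>2 / (a\<^sup>2 + (c - (c + a * z))\<^sup>2)) \<partial>lborel)"
    using a by (intro nn_integral_real_affine) auto
  also have "(\<integral>\<^sup>+z. ennreal (a\<^sup>2 / (a\<^sup>2 + (c - (c + a * z))\<^sup>2)) \<partial>lborel) = (\<integral>\<^sup>+z. ennreal (1 / (1 + z\<^sup>2)) \<partial>lborel)"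
  proof (rule nn_integral_cong)
    fix z :: real
    have "a\<^sup>2 + (c - (c + a * z))\<^sup>2 = a\<^sup>2 * (1 + z\<^sup>2)" by (simp add: power_mult_distrib algebra_simps)
    thus "ennreal (a\<^sup>2 / (a\<^sup>2 + (c - (c + a * z))\<^sup>2)) = ennreal (1 / (1 + z\<^sup>2))" using a by simp
  qed
  also have "\<dots> \<le> (\<integral>\<^sup>+z. ennreal (1 / (1 + z\<^sup>2)) * indicator {0..} z + ennreal (1 / (1 + (0 + (-1) * z)\<^sup>2)) * indicator {0..} (0 + (-1) * z) \<partial>lborel)"
    by (rule nn_integral_mono) (auto simp: indicator_def)
  also have "\<dots> = (\<integral>\<^sup>+z. ennreal (1 / (1 + z\<^sup>2)) * indicator {0..} z \<partial>lborel)
      + (\<integral>\<^sup>+z. ennreal (1 / (1 + (0 + (-1) * z)\<^sup>2)) * indicator {0..} (0 + (-1) * z) \<partial>lborel)"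
    by (rule nn_integral_add) measurable
  also have "(\<integral>\<^sup>+z. ennreal (1 / (1 + (0 + (-1) * z)\<^sup>2)) * indicator {0..} (0 + (-1) * z) \<partial>lborel) = (\<integral>\<^sup>+z. ennreal (1 / (1 + z\<^sup>2)) * indicator {0..} z \<partial>lborel)"
    using nn_integral_real_affine[of "\<lambda>z. ennreal (1 / (1 + z\<^sup>2)) * indicator {0..} z" "-1" 0] by simp
  also have "(\<integral>\<^sup>+z. ennreal (1 / (1 + z\<^sup>2)) * indicator {0..} z \<partial>lborel) + (\<integral>\<^sup>+z. ennreal (1 / (1 + z\<^sup>2)) * indicator {0..} z \<partial>lborel) = ennreal pi"
    unfolding half by (simp flip: ennreal_plus)
  also have "ennreal \<bar>a\<bar> * ennreal pi = ennreal (pi * a)" using a by (simp add: ennreal_mult'[symmetric] mult.commute)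
  finally show ?thesis using a by (simp add: mult_left_mono)
qed

section \<open>The near kernel: averages over t of a bump of width sqrt(x t)\<close>

text \<open>A rational majorant of a Gaussian of width sqrt(x t) around the diagonal. The factor
  (x/t)^(1/2) is the reciprocal of the relative width, so the mass for dy/y stays bounded in x and
  t.\<close>

definition near_profile :: "real \<Rightarrow> real \<Rightarrow> real \<Rightarrow> real" where
  "near_profile x y t = (if 0 < x \<and> x / 4 \<le> y \<and> y \<le> 4 * x \<and> 0 < t
     then (x / t) powr (1 / 2) * (x * t / (x * t + (x - y)\<^sup>2)) else 0)"

lemma near_profile_measurable [measurable]:
  assumes [measurable]: "f \<in> borel_measurable M" "g \<in> borel_measurable M" "h \<in> borel_measurable M"
  shows "(\<lambda>z. near_profile (f z) (g z) (h z)) \<in> borel_measurable M"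
  unfolding near_profile_def by measurable

lemma near_profile_nonneg: "near_profile x y t \<ge> 0"
  by (auto simp: near_profile_def intro!: mult_nonneg_nonneg divide_nonneg_nonneg)

lemma near_profile_le: "0 < x \<Longrightarrow> 0 < t \<Longrightarrow> near_profile x y t \<le> (x / t) powr (1 / 2)"
proof -
  assume x: "0 < x" and t: "0 < t"
  have "x * t / (x * t + (x - y)\<^sup>2) \<le> 1"
    using x t by (subst divide_le_eq_1_pos) (simp_all add: add_pos_nonneg)
  hence "(x / t) powr (1 / 2) * (x * t / (x * t + (x - y)\<^sup>2)) \<le> (x / t) powr (1 / 2)"
    by (rule mult_left_le) simp
  thus ?thesis by (simp add: near_profile_def)
qed

text \<open>The scale in the definition is taken from x. Within x/4 \<le> y \<le> 4 x, taking it
  from y costs a factor 2 in the square root and 4 in the quotient. Needed to integrate over x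
  instead of y.\<close>

lemma near_profile_swap: "near_profile x y t \<le> 8 * near_profile y x t"
proof (cases "0 < x \<and> x / 4 \<le> y \<and> y \<le> 4 * x \<and> 0 < t")
  case True
  hence y: "0 < y" "y / 4 \<le> x" "x \<le> 4 * y" and x: "x > 0" and t: "t > 0" by auto
  define d where "d = (x - y)\<^sup>2"
  have d: "d \<ge> 0" "(y - x)\<^sup>2 = d" by (auto simp: d_def power2_commute)
  have "(x / t) powr (1 / 2) \<le> (4 * (y / t)) powr (1 / 2)"
    using y x t by (intro powr_mono2) (auto simp: field_simps)
  also have "\<dots> = 2 * (y / t) powr (1 / 2)"
    using y t by (simp only: powr_mult) (simp add: powr_half_sqrt)
  finally have 1: "(x / t) powr (1 / 2) \<le> 2 * (y / t) powr (1 / 2)" .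
  have 2: "x * t / (x * t + d) \<le> 4 * (y * t / (y * t + d))"
  proof -
    have "x * t * (y * t + d) \<le> 4 * (y * t) * (x * t + d)"
    proof -
      have "(x * t) * d \<le> (4 * (y * t)) * d" using y t d by (intro mult_right_mono) auto
      moreover have "0 \<le> (y * t) * (x * t)" using x y t by simp
      ultimately show ?thesis by (simp add: algebra_simps)
    qed
    moreover have "0 < x * t + d" "0 < y * t + d" using x y t d by (auto intro!: add_pos_nonneg)
    ultimately show ?thesis by (simp add: divide_simps mult_ac)
  qed
  have "(x / t) powr (1 / 2) * (x * t / (x * t + d)) \<le> (2 * (y / t) powr (1 / 2)) * (4 * (y * t / (y * t + d)))"
    using x y t d by (intro mult_mono[OF 1 2]) auto
  thus ?thesis using True y d by (simp add: near_profile_def d_def)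
next
  case False
  hence "near_profile x y t = 0" by (auto simp: near_profile_def)
  thus ?thesis using near_profile_nonneg[of y x t] by simp
qed

text \<open>On the support 1/y is at most 4/x, and the Cauchy density of width sqrt(x t) has
  integral pi sqrt(x t), which the factor (x/t)^(1/2) turns into pi x.\<close>

lemma nn_integral_near_profile_le:
  "(\<integral>\<^sup>+y. ennreal (near_profile x y t) \<partial>haar) \<le> ennreal (4 * pi)"
proof (cases "x > 0 \<and> t > 0")
  case True
  hence x: "x > 0" and t: "t > 0" by auto
  define a where "a = sqrt (x * t)"
  have a: "a > 0" "a\<^sup>2 = x * t" using x t by (auto simp: a_def)
  have "(\<integral>\<^sup>+y. ennreal (near_profile x y t) \<partial>haar) = (\<integral>\<^sup>+y. ennreal (indicator {0<..} y / y) * ennreal (near_profile x y t) \<partial>lborel)"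
    by (rule nn_integral_haar) measurable
  also have "\<dots> \<le> (\<integral>\<^sup>+y. ennreal (4 / x * (x / t) powr (1 / 2)) * ennreal (a\<^sup>2 / (a\<^sup>2 + (x - y)\<^sup>2)) \<partial>lborel)"
  proof (rule nn_integral_mono)
    fix y :: real
    show "ennreal (indicator {0<..} y / y) * ennreal (near_profile x y t) \<le> ennreal (4 / x * (x / t) powr (1 / 2)) * ennreal (a\<^sup>2 / (a\<^sup>2 + (x - y)\<^sup>2))"
    proof (cases "x / 4 \<le> y \<and> y \<le> 4 * x")
      case y: True
      hence y0: "y > 0" using x by simp
      have "1 / y \<le> 4 / x" using y y0 x by (simp add: field_simps)
      hence "1 / y * near_profile x y t \<le> 4 / x * near_profile x y t"
        by (intro mult_right_mono near_profile_nonneg)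
      also have "\<dots> = 4 / x * (x / t) powr (1 / 2) * (a\<^sup>2 / (a\<^sup>2 + (x - y)\<^sup>2))"
        using y x t by (simp add: near_profile_def a(2))
      finally show ?thesis using y0 x t near_profile_nonneg[of x y t]
        by (simp add: ennreal_mult'[symmetric] ennreal_leI)
    qed (auto simp: near_profile_def)
  qed
  also have "\<dots> = ennreal (4 / x * (x / t) powr (1 / 2)) * (\<integral>\<^sup>+y. ennreal (a\<^sup>2 / (a\<^sup>2 + (x - y)\<^sup>2)) \<partial>lborel)"
    by (rule nn_integral_cmult) measurable
  also have "\<dots> \<le> ennreal (4 / x * (x / t) powr (1 / 2)) * ennreal (pi * a)"
    by (intro mult_left_mono nn_integral_cauchy_le a) auto
  also have "\<dots> = ennreal (4 / x * (x / t) powr (1 / 2) * (pi * a))"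
    using x by (intro ennreal_mult'[symmetric]) auto
  also have "4 / x * (x / t) powr (1 / 2) * (pi * a) = 4 * pi"
  proof -
    have "(x / t) powr (1 / 2) = sqrt (x / t)" using x t by (intro powr_half_sqrt) auto
    hence "(x / t) powr (1 / 2) * a = sqrt (x / t) * sqrt (x * t)" by (simp only: a_def)
    also have "\<dots> = sqrt (x / t * (x * t))" by (rule real_sqrt_mult[symmetric])
    also have "x / t * (x * t) = x\<^sup>2" using t by (simp add: power2_eq_square)
    finally have "(x / t) powr (1 / 2) * a = x" using x by simp
    hence "4 / x * ((x / t) powr (1 / 2) * a) * pi = 4 * pi" using x by simp
    thus ?thesis by (simp only: mult_ac)
  qed
  finally show ?thesis .
qed (auto simp: near_profile_def)

text \<open>
  The set \<open>I\<close> restricts \<open>t / x\<close>; the kernel is split at \<open>t / x = R\<^sup>2\<close>.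
\<close>

definition near_weight :: "real \<Rightarrow> real \<Rightarrow> real set \<Rightarrow> real \<Rightarrow> real \<Rightarrow> real" where
  "near_weight \<sigma> \<tau> I x t = x powr (- \<tau>) * t powr (\<sigma> - 1) * (if 0 < t \<and> t \<le> 1 \<and> t \<le> x \<and> t / x \<in> I then 1 else 0)"

text \<open>Left as an integral over t rather than evaluated as a power of |x - y|: the splitting by
  height that the level set argument asks for is then simply a restriction of t/x.\<close>

definition near_kernel :: "real \<Rightarrow> real \<Rightarrow> real set \<Rightarrow> real \<Rightarrow> real \<Rightarrow> ennreal" where
  "near_kernel \<sigma> \<tau> I x y = (\<integral>\<^sup>+t. ennreal (near_weight \<sigma> \<tau> I x t * near_profile x y t) \<partial>lborel)"

lemma near_weight_measurable [measurable]:
  assumes [measurable]: "I \<in> sets borel" "f \<in> borel_measurable M" "g \<in> borel_measurable M"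
  shows "(\<lambda>z. near_weight \<sigma> \<tau> I (f z) (g z)) \<in> borel_measurable M"
  unfolding near_weight_def by measurable

lemma near_weight_nonneg: "near_weight \<sigma> \<tau> I x t \<ge> 0"
  by (simp add: near_weight_def)

lemma near_kernel_measurable [measurable]:
  assumes [measurable]: "I \<in> sets borel"
  shows "(\<lambda>(x, y). near_kernel \<sigma> \<tau> I x y) \<in> borel_measurable (borel \<Otimes>\<^sub>M borel)"
  unfolding near_kernel_def by measurable

lemma near_kernel_split:
  assumes [measurable]: "I \<in> sets borel" "J \<in> sets borel" and IJ: "I \<union> J = UNIV"
  shows "near_kernel \<sigma> \<tau> UNIV x y \<le> near_kernel \<sigma> \<tau> I x y + near_kernel \<sigma> \<tau> J x y"
proof -
  have "near_kernel \<sigma> \<tau> UNIV x y \<le> (\<integral>\<^sup>+t. ennreal (near_weight \<sigma> \<tau> I x t * near_profile x y t) + ennreal (near_weight \<sigma> \<tau> J x t * near_profile x y t) \<partial>lborel)"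
    unfolding near_kernel_def
  proof (rule nn_integral_mono)
    fix t
    have "near_weight \<sigma> \<tau> UNIV x t \<le> near_weight \<sigma> \<tau> I x t + near_weight \<sigma> \<tau> J x t"
      using IJ by (auto simp: near_weight_def)
    hence "near_weight \<sigma> \<tau> UNIV x t * near_profile x y t \<le> near_weight \<sigma> \<tau> I x t * near_profile x y t + near_weight \<sigma> \<tau> J x t * near_profile x y t"
      using mult_right_mono[OF _ near_profile_nonneg] by (simp flip: distrib_right)
    thus "ennreal (near_weight \<sigma> \<tau> UNIV x t * near_profile x y t) \<le> ennreal (near_weight \<sigma> \<tau> I x t * near_profile x y t) + ennreal (near_weight \<sigma> \<tau> J x t * near_profile x y t)"
      by (simp add: near_weight_nonneg near_profile_nonneg ennreal_leI flip: ennreal_plus)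
  qed
  also have "\<dots> = near_kernel \<sigma> \<tau> I x y + near_kernel \<sigma> \<tau> J x y"
    unfolding near_kernel_def by (rule nn_integral_add) measurable
  finally show ?thesis .
qed

lemma nn_integral_powr_atMost:
  fixes a c :: real
  assumes "a > -1" "c \<ge> 0"
  shows "(\<integral>\<^sup>+x. ennreal (x powr a) * indicator {0..c} x \<partial>lborel) = ennreal (c powr (a + 1) / (a + 1))"
  by (intro nn_integral_has_integral_lebesgue' has_integral_powr_from_0 assms) auto

text \<open>The upper limit m of integration is at most 1, so \<tau> \<le> \<sigma> gives m^\<sigma>
  \<le> m^\<tau>, and the bound m \<le> c \<rho> z lets z^\<tau> cancel the weight. What is left is
  \<rho>^\<tau> with \<rho> = min(1, R^2); it is at most R^\<beta>, by \<beta> \<le> 2 \<tau> for R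
  \<le> 1 and by \<beta> \<ge> 0 for R > 1. The factor c is 1 for rows and 4 for columns.\<close>

lemma nn_integral_near_weight_le:
  assumes \<sigma>: "\<sigma> > 0" and \<tau>: "0 \<le> \<tau>" "\<tau> \<le> \<sigma>" and \<beta>: "0 \<le> \<beta>" "\<beta> \<le> 2 * \<tau>"
    and R: "R > 0" and z: "z > 0" and c: "c \<ge> 1"
  shows "(\<integral>\<^sup>+t. ennreal (z powr (- \<tau>)) * (ennreal (t powr (\<sigma> - 1)) * indicator {0..min 1 (c * min 1 (R\<^sup>2) * z)} t) \<partial>lborel)
    \<le> ennreal (c powr \<tau> / \<sigma> * R powr \<beta>)"
proof -
  define \<rho> where "\<rho> = min 1 (R\<^sup>2)"
  define m where "m = min 1 (c * \<rho> * z)"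
  have \<rho>: "\<rho> > 0" using R by (simp add: \<rho>_def)
  have m: "0 < m" "m \<le> 1" "m \<le> c * \<rho> * z" using \<rho> c z by (auto simp: m_def)
  have "\<rho> powr \<tau> \<le> R powr \<beta>"
  proof (cases "R \<le> 1")
    case True
    have "R\<^sup>2 \<le> 1" using True R by (simp add: power_le_one)
    hence "\<rho> = R powr 2" using R by (simp add: \<rho>_def min_absorb2)
    hence "\<rho> powr \<tau> = R powr (2 * \<tau>)" by (simp add: powr_powr)
    also have "\<dots> \<le> R powr \<beta>" using True R \<beta> by (intro powr_mono') auto
    finally show ?thesis .
  next
    case False
    have "\<rho> powr \<tau> \<le> 1 powr \<tau>" using \<rho> \<tau> by (intro powr_mono2) (auto simp: \<rho>_def)
    also have "\<dots> \<le> R powr \<beta>" using False \<beta> by (simp add: ge_one_powr_ge_zero)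
    finally show ?thesis .
  qed
  hence "z powr (- \<tau>) * (c powr \<tau> * \<rho> powr \<tau> * z powr \<tau>) \<le> z powr (- \<tau>) * (c powr \<tau> * R powr \<beta> * z powr \<tau>)"
    by (intro mult_left_mono mult_right_mono) auto
  also have "\<dots> = c powr \<tau> * R powr \<beta>" using z by (simp add: powr_minus)
  finally have 1: "z powr (- \<tau>) * (c powr \<tau> * \<rho> powr \<tau> * z powr \<tau>) \<le> c powr \<tau> * R powr \<beta>" .
  have "m powr \<sigma> \<le> m powr \<tau>" using m \<tau> by (intro powr_mono') auto
  also have "\<dots> \<le> (c * \<rho> * z) powr \<tau>" using m \<tau> by (intro powr_mono2) auto
  also have "\<dots> = c powr \<tau> * \<rho> powr \<tau> * z powr \<tau>" using c \<rho> z by (simp add: powr_mult)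
  finally have "z powr (- \<tau>) * m powr \<sigma> \<le> c powr \<tau> * R powr \<beta>"
    using 1 mult_left_mono[of "m powr \<sigma>" "c powr \<tau> * \<rho> powr \<tau> * z powr \<tau>" "z powr (- \<tau>)"] by simp
  hence 2: "z powr (- \<tau>) * (m powr \<sigma> / \<sigma>) \<le> c powr \<tau> / \<sigma> * R powr \<beta>"
    using \<sigma> by (simp add: field_simps)
  have "(\<integral>\<^sup>+t. ennreal (z powr (- \<tau>)) * (ennreal (t powr (\<sigma> - 1)) * indicator {0..m} t) \<partial>lborel) =
    ennreal (z powr (- \<tau>)) * (\<integral>\<^sup>+t. ennreal (t powr (\<sigma> - 1)) * indicator {0..m} t \<partial>lborel)"
    by (rule nn_integral_cmult) measurable
  also have "\<dots> = ennreal (z powr (- \<tau>)) * ennreal (m powr \<sigma> / \<sigma>)"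
    using nn_integral_powr_atMost[of "\<sigma> - 1" m] \<sigma> m by simp
  also have "\<dots> = ennreal (z powr (- \<tau>) * (m powr \<sigma> / \<sigma>))"
    by (rule ennreal_mult'[symmetric]) simp
  also have "\<dots> \<le> ennreal (c powr \<tau> / \<sigma> * R powr \<beta>)" by (rule ennreal_leI[OF 2])
  finally show ?thesis by (simp add: m_def \<rho>_def)
qed

text \<open>For each t the profile has mass at most 4 pi in y, so only the weight remains to be
  integrated over t.\<close>

lemma nn_integral_near_kernel_row:
  assumes \<sigma>: "\<sigma> > 0" and \<tau>: "0 \<le> \<tau>" "\<tau> \<le> \<sigma>" and \<beta>: "0 \<le> \<beta>" "\<beta> \<le> 2 * \<tau>" and R: "R > 0"
  shows "(\<integral>\<^sup>+y. near_kernel \<sigma> \<tau> {..R\<^sup>2} x y \<partial>haar) \<le> ennreal (4 * pi / \<sigma> * R powr \<beta>)"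
proof (cases "x > 0")
  case x: True
  interpret H: sigma_finite_measure haar by (rule sigma_finite_haar)
  interpret pair_sigma_finite haar lborel ..
  let ?w = "near_weight \<sigma> \<tau> {..R\<^sup>2} x"
  have [measurable]: "?w \<in> borel_measurable borel" "near_profile x y \<in> borel_measurable borel" for y
    by measurable
  have "(\<integral>\<^sup>+y. near_kernel \<sigma> \<tau> {..R\<^sup>2} x y \<partial>haar) = (\<integral>\<^sup>+t. (\<integral>\<^sup>+y. ennreal (?w t * near_profile x y t) \<partial>haar) \<partial>lborel)"
    unfolding near_kernel_def by (rule Fubini'[symmetric]) measurable
  also have "\<dots> \<le> (\<integral>\<^sup>+t. ennreal (4 * pi) * (ennreal (x powr (- \<tau>)) * (ennreal (t powr (\<sigma> - 1)) * indicator {0..min 1 (1 * min 1 (R\<^sup>2) * x)} t)) \<partial>lborel)"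
  proof (rule nn_integral_mono)
    fix t
    have "(\<integral>\<^sup>+y. ennreal (?w t * near_profile x y t) \<partial>haar) = ennreal (?w t) * (\<integral>\<^sup>+y. ennreal (near_profile x y t) \<partial>haar)"
      unfolding ennreal_mult'[OF near_weight_nonneg] by (rule nn_integral_cmult) measurable
    also have "\<dots> \<le> ennreal (?w t) * ennreal (4 * pi)"
      by (intro mult_left_mono nn_integral_near_profile_le) auto
    also have "ennreal (?w t) \<le> ennreal (x powr (- \<tau>)) * (ennreal (t powr (\<sigma> - 1)) * indicator {0..min 1 (1 * min 1 (R\<^sup>2) * x)} t)"
    proof (cases "0 < t \<and> t \<le> 1 \<and> t \<le> x \<and> t / x \<le> R\<^sup>2")
      case True
      hence "t \<le> min 1 (R\<^sup>2) * x" using x by (auto simp: min_def field_simps)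
      thus ?thesis using True by (simp add: near_weight_def ennreal_mult')
    qed (auto simp: near_weight_def)
    finally show "(\<integral>\<^sup>+y. ennreal (?w t * near_profile x y t) \<partial>haar) \<le> ennreal (4 * pi) * (ennreal (x powr (- \<tau>)) * (ennreal (t powr (\<sigma> - 1)) * indicator {0..min 1 (1 * min 1 (R\<^sup>2) * x)} t))"
      by (simp add: mult.commute mult_right_mono)
  qed
  also have "\<dots> = ennreal (4 * pi) * (\<integral>\<^sup>+t. ennreal (x powr (- \<tau>)) * (ennreal (t powr (\<sigma> - 1)) * indicator {0..min 1 (1 * min 1 (R\<^sup>2) * x)} t) \<partial>lborel)"
    by (rule nn_integral_cmult) measurable
  also have "\<dots> \<le> ennreal (4 * pi) * ennreal (1 powr \<tau> / \<sigma> * R powr \<beta>)"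
    by (intro mult_left_mono nn_integral_near_weight_le \<sigma> \<tau> \<beta> R x) auto
  also have "\<dots> = ennreal (4 * pi / \<sigma> * R powr \<beta>)"
    using \<sigma> by (simp flip: ennreal_mult)
  finally show ?thesis .
next
  case False
  hence "near_kernel \<sigma> \<tau> {..R\<^sup>2} x y = 0" for y
    by (auto simp: near_kernel_def near_profile_def)
  thus ?thesis by simp
qed

text \<open>As for rows, after exchanging x and y in the profile at the cost of a factor 8. One
  factor \<open>4 powr \<tau>\<close> comes from x \<ge> y/4 in the weight, the other from x \<le> 4
  y, which enlarges the range of t.\<close>

lemma nn_integral_near_kernel_col:
  assumes \<sigma>: "\<sigma> > 0" and \<tau>: "0 \<le> \<tau>" "\<tau> \<le> \<sigma>" and \<beta>: "0 \<le> \<beta>" "\<beta> \<le> 2 * \<tau>" and R: "R > 0"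
  shows "(\<integral>\<^sup>+x. near_kernel \<sigma> \<tau> {..R\<^sup>2} x y \<partial>haar) \<le> ennreal (32 * pi * 4 powr \<tau> * 4 powr \<tau> / \<sigma> * R powr \<beta>)"
proof (cases "y > 0")
  case y: True
  interpret H: sigma_finite_measure haar by (rule sigma_finite_haar)
  interpret pair_sigma_finite haar lborel ..
  let ?I = "{0..min 1 (4 * min 1 (R\<^sup>2) * y)}"
  have "(\<integral>\<^sup>+x. near_kernel \<sigma> \<tau> {..R\<^sup>2} x y \<partial>haar) = (\<integral>\<^sup>+t. (\<integral>\<^sup>+x. ennreal (near_weight \<sigma> \<tau> {..R\<^sup>2} x t * near_profile x y t) \<partial>haar) \<partial>lborel)"
    unfolding near_kernel_def by (rule Fubini'[symmetric]) measurable
  also have "\<dots> \<le> (\<integral>\<^sup>+t. ennreal (32 * pi * 4 powr \<tau>) * (ennreal (y powr (- \<tau>)) * (ennreal (t powr (\<sigma> - 1)) * indicator ?I t)) \<partial>lborel)"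
  proof (rule nn_integral_mono)
    fix t
    have "(\<integral>\<^sup>+x. ennreal (near_weight \<sigma> \<tau> {..R\<^sup>2} x t * near_profile x y t) \<partial>haar) \<le>
      (\<integral>\<^sup>+x. ennreal (8 * 4 powr \<tau> * y powr (- \<tau>) * t powr (\<sigma> - 1) * indicator ?I t) * ennreal (near_profile y x t) \<partial>haar)"
    proof (rule nn_integral_mono)
      fix x
      have "near_weight \<sigma> \<tau> {..R\<^sup>2} x t * near_profile x y t \<le> 8 * 4 powr \<tau> * y powr (- \<tau>) * t powr (\<sigma> - 1) * indicator ?I t * near_profile y x t"
      proof (cases "0 < t \<and> t \<le> 1 \<and> t \<le> x \<and> t / x \<le> R\<^sup>2 \<and> 0 < x \<and> x / 4 \<le> y \<and> y \<le> 4 * x")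
        case True
        hence x: "x > 0" "x \<le> 4 * y" "y \<le> 4 * x" by auto
        have "t \<le> min 1 (R\<^sup>2) * x" using True by (auto simp: min_def field_simps)
        also have "\<dots> \<le> min 1 (R\<^sup>2) * (4 * y)" using x by (intro mult_left_mono) auto
        finally have tI: "t \<in> ?I" using True by (auto simp: mult_ac)
        have "x powr (- \<tau>) \<le> (y / 4) powr (- \<tau>)" using x y \<tau> by (intro powr_mono2') auto
        also have "\<dots> = 4 powr \<tau> * y powr (- \<tau>)" using y by (simp add: powr_divide powr_minus_divide[of 4])
        finally have "x powr (- \<tau>) * t powr (\<sigma> - 1) \<le> 4 powr \<tau> * y powr (- \<tau>) * t powr (\<sigma> - 1)"
          by (intro mult_right_mono) auto
        hence "x powr (- \<tau>) * t powr (\<sigma> - 1) * near_profile x y t \<le> 4 powr \<tau> * y powr (- \<tau>) * t powr (\<sigma> - 1) * (8 * near_profile y x t)"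
          by (rule mult_mono[OF _ near_profile_swap]) (auto simp: near_profile_nonneg)
        moreover have "near_weight \<sigma> \<tau> {..R\<^sup>2} x t = x powr (- \<tau>) * t powr (\<sigma> - 1)"
          using True by (simp add: near_weight_def)
        ultimately show ?thesis using tI by (simp add: mult_ac)
      next
        case False
        hence "near_weight \<sigma> \<tau> {..R\<^sup>2} x t * near_profile x y t = 0"
          by (auto simp: near_weight_def near_profile_def)
        moreover have "0 \<le> 8 * 4 powr \<tau> * y powr (- \<tau>) * t powr (\<sigma> - 1) * indicator ?I t * near_profile y x t"
          using near_profile_nonneg by (intro mult_nonneg_nonneg) auto
        ultimately show ?thesis by (simp only:)
      qed
      thus "ennreal (near_weight \<sigma> \<tau> {..R\<^sup>2} x t * near_profile x y t) \<le> ennreal (8 * 4 powr \<tau> * y powr (- \<tau>) * t powr (\<sigma> - 1) * indicator ?I t) * ennreal (near_profile y x t)"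
        by (subst ennreal_mult'[symmetric]) (auto intro: ennreal_leI)
    qed
    also have "\<dots> = ennreal (8 * 4 powr \<tau> * y powr (- \<tau>) * t powr (\<sigma> - 1) * indicator ?I t) * (\<integral>\<^sup>+x. ennreal (near_profile y x t) \<partial>haar)"
      by (rule nn_integral_cmult) measurable
    also have "\<dots> \<le> ennreal (8 * 4 powr \<tau> * y powr (- \<tau>) * t powr (\<sigma> - 1) * indicator ?I t) * ennreal (4 * pi)"
      by (intro mult_left_mono nn_integral_near_profile_le) auto
    also have "\<dots> = ennreal (32 * pi * 4 powr \<tau>) * (ennreal (y powr (- \<tau>)) * (ennreal (t powr (\<sigma> - 1)) * indicator ?I t))"
      by (auto simp: indicator_def ennreal_mult'[symmetric] mult_ac)
    finally show "(\<integral>\<^sup>+x. ennreal (near_weight \<sigma> \<tau> {..R\<^sup>2} x t * near_profile x y t) \<partial>haar) \<le> ennreal (32 * pi * 4 powr \<tau>) * (ennreal (y powr (- \<tau>)) * (ennreal (t powr (\<sigma> - 1)) * indicator ?I t))" .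
  qed
  also have "\<dots> = ennreal (32 * pi * 4 powr \<tau>) * (\<integral>\<^sup>+t. ennreal (y powr (- \<tau>)) * (ennreal (t powr (\<sigma> - 1)) * indicator ?I t) \<partial>lborel)"
    by (rule nn_integral_cmult) measurable
  also have "\<dots> \<le> ennreal (32 * pi * 4 powr \<tau>) * ennreal (4 powr \<tau> / \<sigma> * R powr \<beta>)"
    by (intro mult_left_mono nn_integral_near_weight_le \<sigma> \<tau> \<beta> R y) auto
  also have "\<dots> = ennreal (32 * pi * 4 powr \<tau> * 4 powr \<tau> / \<sigma> * R powr \<beta>)"
    by (simp add: ennreal_mult'[symmetric] mult.assoc)
  finally show ?thesis .
next
  case False
  hence "near_profile x y t = 0" for x t by (auto simp: near_profile_def)
  hence "near_kernel \<sigma> \<tau> {..R\<^sup>2} x y = 0" for x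
    by (simp add: near_kernel_def)
  thus ?thesis by simp
qed

text \<open>For fixed t the profile is at most M = (x/t)^(1/2) and has bounded mass, so its pairing
  with \<open>f\<close> is of order M^(1/p). On the support t \<le> 1 and t \<le> x, so the two
  bounds on \<tau> allow the weight to be replaced by (t/x)^((1/p - 1/q)/2)/t. The product is
  (t/x)^(-1/(2q))/t, and its integral over t > R^2 x is of order R^(-1/q).\<close>

lemma nn_integral_near_kernel_tail:
  assumes pq: "1 < p" "p \<le> q" and \<sigma>: "\<sigma> > 0" and \<tau>: "1 / p - 1 / q \<le> 2 * \<tau>" "\<tau> \<le> \<sigma>" and R: "R > 0"
    and [measurable]: "f \<in> borel_measurable borel" and f: "\<And>y. f y \<ge> 0"
    and fp: "(\<integral>\<^sup>+y. ennreal (f y powr p) \<partial>haar) \<le> 1"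
  shows "(\<integral>\<^sup>+y. near_kernel \<sigma> \<tau> {R\<^sup>2<..} x y * ennreal (f y) \<partial>haar) \<le> ennreal ((4 * pi + 1) * (2 * q) * R powr (- 1 / q))"
proof (cases "x > 0")
  case x: True
  interpret H: sigma_finite_measure haar by (rule sigma_finite_haar)
  interpret pair_sigma_finite haar lborel ..
  let ?w = "near_weight \<sigma> \<tau> {R\<^sup>2<..} x"
  have q: "q > 1" using pq by simp
  have [measurable]: "?w \<in> borel_measurable borel" "near_profile x y \<in> borel_measurable borel" for y
    by measurable
  have "(\<integral>\<^sup>+y. near_kernel \<sigma> \<tau> {R\<^sup>2<..} x y * ennreal (f y) \<partial>haar) = (\<integral>\<^sup>+y. (\<integral>\<^sup>+t. ennreal (?w t * near_profile x y t) * ennreal (f y) \<partial>lborel) \<partial>haar)"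
    unfolding near_kernel_def by (intro nn_integral_cong nn_integral_multc[symmetric]) measurable
  also have "\<dots> = (\<integral>\<^sup>+t. (\<integral>\<^sup>+y. ennreal (?w t * near_profile x y t) * ennreal (f y) \<partial>haar) \<partial>lborel)"
    by (rule Fubini'[symmetric]) measurable
  also have "\<dots> \<le> (\<integral>\<^sup>+t. ennreal ((4 * pi + 1) * x powr (1 / (2 * q))) * (ennreal (t powr (- 1 / (2 * q) - 1)) * indicator {R\<^sup>2 * x..} t) \<partial>lborel)"
  proof (rule nn_integral_mono)
    fix t
    show "(\<integral>\<^sup>+y. ennreal (?w t * near_profile x y t) * ennreal (f y) \<partial>haar) \<le> ennreal ((4 * pi + 1) * x powr (1 / (2 * q))) * (ennreal (t powr (- 1 / (2 * q) - 1)) * indicator {R\<^sup>2 * x..} t)"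
    proof (cases "0 < t \<and> t \<le> 1 \<and> t \<le> x \<and> R\<^sup>2 < t / x")
      case True
      hence t: "0 < t" "t \<le> 1" "t \<le> x" "R\<^sup>2 * x \<le> t" using x by (auto simp: field_simps)
      define M where "M = (x / t) powr (1 / 2)"
      have M: "M > 0" using x t by (simp add: M_def)
      have "(\<integral>\<^sup>+y. ennreal (?w t * near_profile x y t) * ennreal (f y) \<partial>haar) = (\<integral>\<^sup>+y. ennreal (?w t) * ennreal (near_profile x y t * f y) \<partial>haar)"
        using near_profile_nonneg near_weight_nonneg f by (simp add: ennreal_mult' mult.assoc)
      also have "\<dots> = ennreal (?w t) * (\<integral>\<^sup>+y. ennreal (near_profile x y t * f y) \<partial>haar)"
        by (rule nn_integral_cmult) measurable
      also have "\<dots> \<le> ennreal (?w t) * ennreal (M powr (1 / p) * (4 * pi + 1))"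
      proof (intro mult_left_mono nn_integral_mult_le_root)
        show "near_profile x y t \<le> M" for y using near_profile_le[OF x t(1)] by (simp add: M_def)
      qed (use M f pq fp near_profile_nonneg nn_integral_near_profile_le in auto)
      also have "\<dots> = ennreal (?w t * (M powr (1 / p) * (4 * pi + 1)))"
        by (rule ennreal_mult'[symmetric]) (rule near_weight_nonneg)
      also have "\<dots> \<le> ennreal ((4 * pi + 1) * x powr (1 / (2 * q)) * t powr (- 1 / (2 * q) - 1))"
      proof (rule ennreal_leI)
        have w: "?w t = x powr (- \<tau>) * t powr (\<sigma> - 1)" using True by (simp add: near_weight_def)
        have "t powr (\<sigma> - 1) \<le> t powr (\<tau> - 1)" using t \<tau> by (intro powr_mono') auto
        hence "?w t \<le> x powr (- \<tau>) * t powr (\<tau> - 1)" unfolding w by (intro mult_left_mono) auto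
        also have "\<dots> = (t / x) powr \<tau> / t" using x t by (simp add: powr_divide powr_minus_divide powr_diff)
        also have "\<dots> \<le> (t / x) powr ((1 / p - 1 / q) / 2) / t"
          using t x \<tau> by (intro divide_right_mono powr_mono') auto
        finally have wt: "?w t \<le> (t / x) powr ((1 / p - 1 / q) / 2) / t" .
        have Mp: "M powr (1 / p) = (t / x) powr (- (1 / (2 * p)))"
        proof -
          have "M = (t / x) powr (- 1 / 2)" using x t by (simp add: M_def powr_divide powr_minus_divide)
          thus ?thesis by (simp add: powr_powr)
        qed
        have "?w t * M powr (1 / p) \<le> (t / x) powr ((1 / p - 1 / q) / 2) / t * (t / x) powr (- (1 / (2 * p)))"
          unfolding Mp by (intro mult_right_mono wt) auto
        also have "(t / x) powr ((1 / p - 1 / q) / 2) / t * (t / x) powr (- (1 / (2 * p))) = (t / x) powr (- 1 / (2 * q)) / t"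
        proof -
          have "(1 / p - 1 / q) / 2 + - (1 / (2 * p)) = - 1 / (2 * q)" by (simp add: diff_divide_distrib)
          hence "(t / x) powr ((1 / p - 1 / q) / 2) * (t / x) powr (- (1 / (2 * p))) = (t / x) powr (- 1 / (2 * q))"
            unfolding powr_add[symmetric] by (simp only:)
          thus ?thesis by simp
        qed
        also have "\<dots> = x powr (1 / (2 * q)) * t powr (- 1 / (2 * q) - 1)"
          using x t by (simp add: powr_divide powr_diff powr_minus_divide)
        finally have "?w t * M powr (1 / p) * (4 * pi + 1) \<le> x powr (1 / (2 * q)) * t powr (- 1 / (2 * q) - 1) * (4 * pi + 1)"
          by (intro mult_right_mono) auto
        thus "?w t * (M powr (1 / p) * (4 * pi + 1)) \<le> (4 * pi + 1) * x powr (1 / (2 * q)) * t powr (- 1 / (2 * q) - 1)"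
          by (simp only: mult_ac)
      qed
      also have "\<dots> = ennreal ((4 * pi + 1) * x powr (1 / (2 * q))) * (ennreal (t powr (- 1 / (2 * q) - 1)) * indicator {R\<^sup>2 * x..} t)"
        using t by (simp add: ennreal_mult')
      finally show ?thesis .
    qed (auto simp: near_weight_def)
  qed
  also have "\<dots> = ennreal ((4 * pi + 1) * x powr (1 / (2 * q))) * (\<integral>\<^sup>+t. ennreal (t powr (- 1 / (2 * q) - 1)) * indicator {R\<^sup>2 * x..} t \<partial>lborel)"
    by (rule nn_integral_cmult) measurable
  also have "(\<integral>\<^sup>+t. ennreal (t powr (- 1 / (2 * q) - 1)) * indicator {R\<^sup>2 * x..} t \<partial>lborel) = ennreal (2 * q * (R\<^sup>2 * x) powr (- 1 / (2 * q)))"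
    using nn_integral_powr_to_inf[of "- 1 / (2 * q) - 1" "R\<^sup>2 * x"] R x q by (simp add: mult_ac)
  also have "ennreal ((4 * pi + 1) * x powr (1 / (2 * q))) * ennreal (2 * q * (R\<^sup>2 * x) powr (- 1 / (2 * q))) =
    ennreal ((4 * pi + 1) * x powr (1 / (2 * q)) * (2 * q * (R\<^sup>2 * x) powr (- 1 / (2 * q))))"
    by (rule ennreal_mult'[symmetric]) simp
  also have "(4 * pi + 1) * x powr (1 / (2 * q)) * (2 * q * (R\<^sup>2 * x) powr (- 1 / (2 * q))) = (4 * pi + 1) * (2 * q) * R powr (- 1 / q)"
  proof -
    have "R\<^sup>2 = R powr 2" using R by simp
    hence "(R\<^sup>2 * x) powr (- 1 / (2 * q)) = R powr (- 1 / q) * x powr (- 1 / (2 * q))"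
      using R x by (simp only: powr_mult powr_powr) simp
    moreover have "x powr (1 / (2 * q)) * x powr (- 1 / (2 * q)) = 1" using x by (simp flip: powr_add)
    ultimately show ?thesis by (simp add: mult_ac)
  qed
  finally show ?thesis .
next
  case False
  hence "near_kernel \<sigma> \<tau> {R\<^sup>2<..} x y = 0" for y
    by (auto simp: near_kernel_def near_profile_def)
  thus ?thesis by simp
qed

text \<open>Supplies the splittings required by the level set estimate. The near kernel is cut at
  t/x = R^2. The far kernel is bounded by 1 and has bounded row and column integrals, so it goes
  entirely into \<open>k1\<close> if R \<ge> 1, where R^(1/p - 1/q) \<ge> 1, and entirely into
  \<open>k2\<close> if R < 1, where R^(-1/q) \<ge> 1.\<close>

lemma far_near_kernel_bounded:
  assumes pq: "1 < p" "p \<le> q" and A: "A > 0" and B: "B > 0" and \<sigma>: "\<sigma> > 0"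
    and \<tau>: "1 / p - 1 / q \<le> 2 * \<tau>" "\<tau> \<le> \<sigma>"
  shows "\<exists>K>0. \<forall>f. f \<in> borel_measurable borel \<longrightarrow> (\<forall>y. f y \<ge> 0) \<longrightarrow> (\<integral>\<^sup>+y. ennreal (f y powr p) \<partial>haar) \<le> 1 \<longrightarrow>
    (AE x in haar. (\<integral>\<^sup>+y. (ennreal (far_kernel A B x y) + near_kernel \<sigma> \<tau> UNIV x y) * ennreal (f y) \<partial>haar) < \<infinity>) \<and>
    (\<integral>\<^sup>+x. ennreal (enn2real (\<integral>\<^sup>+y. (ennreal (far_kernel A B x y) + near_kernel \<sigma> \<tau> UNIV x y) * ennreal (f y) \<partial>haar) powr q) \<partial>haar) \<le> ennreal K"
proof -
  define \<beta> where "\<beta> = 1 / p - 1 / q"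
  have \<beta>: "0 \<le> \<beta>" "\<beta> \<le> 2 * \<tau>" using pq \<tau> by (auto simp: \<beta>_def intro!: divide_left_mono)
  hence \<tau>0: "0 \<le> \<tau>" by simp
  have q: "q > 1" using pq by simp
  define c0 where "c0 = 1 / A + 1 / B"
  define c1 where "c1 = 4 * pi / \<sigma>"
  define c2 where "c2 = 32 * pi * 4 powr \<tau> * 4 powr \<tau> / \<sigma>"
  define c3 where "c3 = (4 * pi + 1) * (2 * q)"
  have c: "c0 > 0" "c1 > 0" "c2 > 0" "c3 > 0"
    using A B \<sigma> q by (auto simp: c0_def c1_def c2_def c3_def intro!: add_pos_pos mult_pos_pos divide_pos_pos)
  define C where "C = c0 + 1 + c1 + c2 + c3"
  have C: "C > 0" using c by (simp add: C_def)
  define K where "K = (3 * C) powr q * (p / (p - 1))"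
  have "K > 0" using C pq by (simp add: K_def)
  moreover have "(AE x in haar. (\<integral>\<^sup>+y. (ennreal (far_kernel A B x y) + near_kernel \<sigma> \<tau> UNIV x y) * ennreal (f y) \<partial>haar) < \<infinity>) \<and>
    (\<integral>\<^sup>+x. ennreal (enn2real (\<integral>\<^sup>+y. (ennreal (far_kernel A B x y) + near_kernel \<sigma> \<tau> UNIV x y) * ennreal (f y) \<partial>haar) powr q) \<partial>haar) \<le> ennreal K"
    if [measurable]: "f \<in> borel_measurable borel" and f: "\<And>y. f y \<ge> 0" and fp: "(\<integral>\<^sup>+y. ennreal (f y powr p) \<partial>haar) \<le> 1" for f
    unfolding K_def
  proof (rule nn_integral_kernel_bounded_Lp_Lq[OF sigma_finite_haar sigma_finite_haar _ _ f fp pq C])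
    show "(\<lambda>(x, y). ennreal (far_kernel A B x y) + near_kernel \<sigma> \<tau> UNIV x y) \<in> borel_measurable (haar \<Otimes>\<^sub>M haar)" by measurable
    show "f \<in> borel_measurable haar" by measurable
    fix R :: real assume R: "R > 0"
    define k1 where "k1 = (\<lambda>x y. ennreal (if R < 1 then 0 else far_kernel A B x y) + near_kernel \<sigma> \<tau> {..R\<^sup>2} x y)"
    define k2 where "k2 = (\<lambda>x y. ennreal (if R < 1 then far_kernel A B x y else 0) + near_kernel \<sigma> \<tau> {R\<^sup>2<..} x y)"
    have nm[measurable]: "(\<lambda>y. near_kernel \<sigma> \<tau> I x y) \<in> borel_measurable borel" "(\<lambda>x. near_kernel \<sigma> \<tau> I x y) \<in> borel_measurable borel"
      if "I \<in> sets borel" for I x y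
      using measurable_Pair2[OF near_kernel_measurable[OF that], of x] measurable_Pair1[OF near_kernel_measurable[OF that], of y] by simp_all
    have fm[measurable]: "(\<lambda>y. far_kernel A B x y) \<in> borel_measurable borel" "(\<lambda>x. far_kernel A B x y) \<in> borel_measurable borel" for x y
      using measurable_Pair2[OF far_kernel_measurable, of x A B] measurable_Pair1[OF far_kernel_measurable, of y A B] by simp_all
    have Rb: "c0 * (if R < 1 then 0 else 1) \<le> c0 * R powr \<beta>"
      using c \<beta> by (intro mult_left_mono) (auto simp: ge_one_powr_ge_zero)
    have k1m: "(\<lambda>(x, y). k1 x y) \<in> borel_measurable (haar \<Otimes>\<^sub>M haar)" unfolding k1_def by measurable
    have k2m: "(\<lambda>(x, y). k2 x y) \<in> borel_measurable (haar \<Otimes>\<^sub>M haar)" unfolding k2_def by measurable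
    have le: "ennreal (far_kernel A B x y) + near_kernel \<sigma> \<tau> UNIV x y \<le> k1 x y + k2 x y" for x y
    proof -
      have "near_kernel \<sigma> \<tau> UNIV x y \<le> near_kernel \<sigma> \<tau> {..R\<^sup>2} x y + near_kernel \<sigma> \<tau> {R\<^sup>2<..} x y"
        by (rule near_kernel_split) auto
      hence "ennreal (far_kernel A B x y) + near_kernel \<sigma> \<tau> UNIV x y \<le> ennreal (far_kernel A B x y) + (near_kernel \<sigma> \<tau> {..R\<^sup>2} x y + near_kernel \<sigma> \<tau> {R\<^sup>2<..} x y)"
        by (rule add_left_mono)
      also have "\<dots> = k1 x y + k2 x y" by (simp add: k1_def k2_def add_ac)
      finally show ?thesis .
    qed
    have far: "(\<integral>\<^sup>+y. ennreal (if R < 1 then 0 else far_kernel A B x y) \<partial>haar) \<le> ennreal (c0 * R powr \<beta>)"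
      "(\<integral>\<^sup>+x. ennreal (if R < 1 then 0 else far_kernel A B x y) \<partial>haar) \<le> ennreal (c0 * R powr \<beta>)" for x y
    proof -
      have "(\<integral>\<^sup>+y. ennreal (if R < 1 then 0 else far_kernel A B x y) \<partial>haar) \<le> ennreal (c0 * (if R < 1 then 0 else 1))"
        using nn_integral_far_kernel_le[OF A B, of x] by (simp add: c0_def)
      thus "(\<integral>\<^sup>+y. ennreal (if R < 1 then 0 else far_kernel A B x y) \<partial>haar) \<le> ennreal (c0 * R powr \<beta>)"
        using ennreal_leI[OF Rb] by (rule order_trans)
      have "(\<integral>\<^sup>+x. ennreal (if R < 1 then 0 else far_kernel A B x y) \<partial>haar) \<le> ennreal (c0 * (if R < 1 then 0 else 1))"
        using nn_integral_far_kernel_le[OF B A, of y] by (simp add: c0_def add.commute far_kernel_sym[of A B])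
      thus "(\<integral>\<^sup>+x. ennreal (if R < 1 then 0 else far_kernel A B x y) \<partial>haar) \<le> ennreal (c0 * R powr \<beta>)"
        using ennreal_leI[OF Rb] by (rule order_trans)
    qed
    have row: "(\<integral>\<^sup>+y. k1 x y \<partial>haar) \<le> ennreal (C * R powr (1 / p - 1 / q))" for x
    proof -
      have "(\<integral>\<^sup>+y. k1 x y \<partial>haar) = (\<integral>\<^sup>+y. ennreal (if R < 1 then 0 else far_kernel A B x y) \<partial>haar) + (\<integral>\<^sup>+y. near_kernel \<sigma> \<tau> {..R\<^sup>2} x y \<partial>haar)"
        unfolding k1_def by (rule nn_integral_add) measurable
      also have "\<dots> \<le> ennreal (c0 * R powr \<beta>) + ennreal (c1 * R powr \<beta>)"
        unfolding c1_def by (intro add_mono far nn_integral_near_kernel_row \<sigma> \<tau>0 \<tau> \<beta> R)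
      also have "\<dots> = ennreal (c0 * R powr \<beta> + c1 * R powr \<beta>)" using c by (intro ennreal_plus[symmetric]) auto
      also have "\<dots> \<le> ennreal (C * R powr \<beta>)"
        unfolding distrib_right[symmetric] using c by (intro ennreal_leI mult_right_mono) (auto simp: C_def)
      finally show ?thesis by (simp add: \<beta>_def)
    qed
    have col: "(\<integral>\<^sup>+x. k1 x y \<partial>haar) \<le> ennreal (C * R powr (1 / p - 1 / q))" for y
    proof -
      have "(\<integral>\<^sup>+x. k1 x y \<partial>haar) = (\<integral>\<^sup>+x. ennreal (if R < 1 then 0 else far_kernel A B x y) \<partial>haar) + (\<integral>\<^sup>+x. near_kernel \<sigma> \<tau> {..R\<^sup>2} x y \<partial>haar)"
        unfolding k1_def by (rule nn_integral_add) measurable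
      also have "\<dots> \<le> ennreal (c0 * R powr \<beta>) + ennreal (c2 * R powr \<beta>)"
        unfolding c2_def by (intro add_mono far nn_integral_near_kernel_col \<sigma> \<tau>0 \<tau> \<beta> R)
      also have "\<dots> = ennreal (c0 * R powr \<beta> + c2 * R powr \<beta>)" using c by (intro ennreal_plus[symmetric]) auto
      also have "\<dots> \<le> ennreal (C * R powr \<beta>)"
        unfolding distrib_right[symmetric] using c by (intro ennreal_leI mult_right_mono) (auto simp: C_def)
      finally show ?thesis by (simp add: \<beta>_def)
    qed
    have tail: "(\<integral>\<^sup>+y. k2 x y * ennreal (f y) \<partial>haar) \<le> ennreal (C * R powr (- 1 / q))" for x
    proof -
      have "(\<integral>\<^sup>+y. k2 x y * ennreal (f y) \<partial>haar) = (\<integral>\<^sup>+y. ennreal (if R < 1 then far_kernel A B x y else 0) * ennreal (f y) \<partial>haar) + (\<integral>\<^sup>+y. near_kernel \<sigma> \<tau> {R\<^sup>2<..} x y * ennreal (f y) \<partial>haar)"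
        unfolding k2_def distrib_right by (rule nn_integral_add) measurable
      also have "\<dots> \<le> ennreal ((c0 + 1) * R powr (- 1 / q)) + ennreal (c3 * R powr (- 1 / q))"
      proof (intro add_mono)
        show "(\<integral>\<^sup>+y. near_kernel \<sigma> \<tau> {R\<^sup>2<..} x y * ennreal (f y) \<partial>haar) \<le> ennreal (c3 * R powr (- 1 / q))"
          unfolding c3_def by (rule nn_integral_near_kernel_tail[OF pq \<sigma> \<tau> R _ f fp]) measurable
        show "(\<integral>\<^sup>+y. ennreal (if R < 1 then far_kernel A B x y else 0) * ennreal (f y) \<partial>haar) \<le> ennreal ((c0 + 1) * R powr (- 1 / q))"
        proof (cases "R < 1")
          case True
          have "(\<integral>\<^sup>+y. ennreal (if R < 1 then far_kernel A B x y else 0) * ennreal (f y) \<partial>haar) = (\<integral>\<^sup>+y. ennreal (far_kernel A B x y * f y) \<partial>haar)"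
            using True far_kernel_bounds[OF A B] by (simp add: ennreal_mult')
          also have "\<dots> \<le> ennreal (1 powr (1 / p) * (c0 + 1))"
            unfolding c0_def using far_kernel_bounds[OF A B] nn_integral_far_kernel_le[OF A B] f fp pq A B
            by (intro nn_integral_mult_le_root) auto
          also have "\<dots> \<le> ennreal ((c0 + 1) * R powr (- 1 / q))"
          proof (rule ennreal_leI)
            have "1 \<le> R powr (- 1 / q)" using powr_mono'[of "- 1 / q" 0 R] True R q by simp
            thus "1 powr (1 / p) * (c0 + 1) \<le> (c0 + 1) * R powr (- 1 / q)" using c by simp
          qed
          finally show ?thesis .
        qed simp
      qed
      also have "\<dots> = ennreal ((c0 + 1) * R powr (- 1 / q) + c3 * R powr (- 1 / q))" using c by (intro ennreal_plus[symmetric]) auto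
      also have "\<dots> \<le> ennreal (C * R powr (- 1 / q))"
        unfolding distrib_right[symmetric] using c by (intro ennreal_leI mult_right_mono) (auto simp: C_def)
      finally show ?thesis .
    qed
    show "\<exists>k1 k2. (\<lambda>(x, y). k1 x y) \<in> borel_measurable (haar \<Otimes>\<^sub>M haar) \<and> (\<lambda>(x, y). k2 x y) \<in> borel_measurable (haar \<Otimes>\<^sub>M haar) \<and>
      (\<forall>x\<in>space haar. \<forall>y\<in>space haar. ennreal (far_kernel A B x y) + near_kernel \<sigma> \<tau> UNIV x y \<le> k1 x y + k2 x y) \<and>
      (\<forall>x\<in>space haar. (\<integral>\<^sup>+y. k1 x y \<partial>haar) \<le> ennreal (C * R powr (1 / p - 1 / q))) \<and>
      (\<forall>y\<in>space haar. (\<integral>\<^sup>+x. k1 x y \<partial>haar) \<le> ennreal (C * R powr (1 / p - 1 / q))) \<and>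
      (\<forall>x\<in>space haar. (\<integral>\<^sup>+y. k2 x y * ennreal (f y) \<partial>haar) \<le> ennreal (C * R powr (- 1 / q)))"
      using k1m k2m le row col tail by blast
  qed
  ultimately show ?thesis by blast
qed

section \<open>Back to the power-weighted spaces\<close>

lemma nn_integral_halfline_haar:
  assumes [measurable]: "f \<in> borel_measurable borel"
  shows "(\<integral>\<^sup>+x. f x \<partial>halfline_measure \<gamma>) = (\<integral>\<^sup>+x. ennreal (x powr (\<gamma> + 1)) * f x \<partial>haar)"
proof -
  have "(\<integral>\<^sup>+x. f x \<partial>halfline_measure \<gamma>) = (\<integral>\<^sup>+x. ennreal (x powr \<gamma>) * f x * indicator {0<..} x \<partial>lborel)"
    by (intro nn_integral_halfline_measure measurable_halfline_measure) measurable
  also have "\<dots> = (\<integral>\<^sup>+x. ennreal (indicator {0<..} x / x) * (ennreal (x powr (\<gamma> + 1)) * f x) \<partial>lborel)"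
  proof (rule nn_integral_cong)
    fix x :: real
    show "ennreal (x powr \<gamma>) * f x * indicator {0<..} x = ennreal (indicator {0<..} x / x) * (ennreal (x powr (\<gamma> + 1)) * f x)"
    proof (cases "x > 0")
      case True
      hence "x powr \<gamma> = 1 / x * x powr (\<gamma> + 1)" by (simp add: powr_add)
      hence "ennreal (x powr \<gamma>) = ennreal (1 / x) * ennreal (x powr (\<gamma> + 1))"
        using True by (simp only: ennreal_mult' divide_nonneg_pos zero_le_one)
      thus ?thesis using True by (simp add: mult.assoc)
    qed simp
  qed
  also have "\<dots> = (\<integral>\<^sup>+x. ennreal (x powr (\<gamma> + 1)) * f x \<partial>haar)"
    by (rule nn_integral_haar[symmetric]) measurable
  finally show ?thesis .
qed

lemma AE_halfline_haar:
  assumes "Measurable.pred borel P" "AE x in haar. P x"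
  shows "AE x in halfline_measure \<gamma>. P x"
proof -
  have "(\<integral>\<^sup>+x. indicator {x. \<not> P x} x \<partial>haar) = 0"
    using assms by (subst nn_integral_0_iff_AE) (auto simp: indicator_def haar_def elim!: eventually_mono)
  moreover have "(\<integral>\<^sup>+x. ennreal (x powr (\<gamma> + 1)) * indicator {x. \<not> P x} x \<partial>haar) = 0"
    using assms by (subst nn_integral_0_iff_AE) (auto simp: indicator_def elim!: eventually_mono)
  hence "(\<integral>\<^sup>+x. indicator {x. \<not> P x} x \<partial>halfline_measure \<gamma>) = 0"
    using assms by (subst nn_integral_halfline_haar) auto
  moreover have "(\<lambda>x. indicator {x. \<not> P x} x :: ennreal) \<in> borel_measurable (halfline_measure \<gamma>)"
    using assms by (intro measurable_halfline_measure) measurable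
  ultimately have "AE x in halfline_measure \<gamma>. (indicator {x. \<not> P x} x :: ennreal) = 0"
    using nn_integral_0_iff_AE by blast
  thus ?thesis by eventually_elim (auto simp: indicator_def split: if_splits)
qed

text \<open>The substitution f(y) = |g(y)| y^((\<alpha> + 1)/p + a)/s turns the weighted L^p norm
  into the one for dy/y. The power of y left over is y^A, and x^B is what the weight of the target
  space contributes. The bound is stated for any s > 0 above the norm, so that functions of norm 0
  need no separate treatment.\<close>

lemma weighted_kernel_bound:
  fixes \<alpha> p q a b \<sigma> C :: real and H :: "real \<Rightarrow> real \<Rightarrow> ennreal"
  defines "A \<equiv> (\<alpha> + 1) * (1 - 1 / p) - a" and "B \<equiv> (\<alpha> + 1) / q - b"
  defines "\<tau> \<equiv> \<alpha> + 1 - (A + B)"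
  assumes pq: "1 < p" "p \<le> q" and A: "A > 0" and B: "B > 0" and \<sigma>: "\<sigma> > 0"
    and \<tau>: "1 / p - 1 / q \<le> 2 * \<tau>" "\<tau> \<le> \<sigma>" and C: "C > 0"
    and Hm [measurable]: "case_prod H \<in> borel_measurable (borel \<Otimes>\<^sub>M borel)"
    and H: "\<And>x y. x > 0 \<Longrightarrow> y > 0 \<Longrightarrow> H x y \<le> ennreal C * (ennreal (max x y powr (- (A + B))) + ennreal (x powr (- (A + B))) * near_kernel \<sigma> \<tau> UNIV x y)"
  shows "\<exists>K>0. \<forall>g s. g \<in> borel_measurable borel \<longrightarrow> s > 0 \<longrightarrow>
    (\<integral>\<^sup>+y. ennreal (\<bar>g y\<bar> powr p) \<partial>halfline_measure (\<alpha> + a * p)) \<le> ennreal (s powr p) \<longrightarrow>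
    (AE x in halfline_measure (\<alpha> - b * q). (\<integral>\<^sup>+y. H x y * ennreal \<bar>g y\<bar> \<partial>halfline_measure \<alpha>) < \<infinity>) \<and>
    (\<integral>\<^sup>+x. ennreal (enn2real (\<integral>\<^sup>+y. H x y * ennreal \<bar>g y\<bar> \<partial>halfline_measure \<alpha>) powr q) \<partial>halfline_measure (\<alpha> - b * q)) \<le> ennreal (K * s powr q)"
proof -
  define k where "k = (\<lambda>x y. ennreal (far_kernel A B x y) + near_kernel \<sigma> \<tau> UNIV x y)"
  have km[measurable]: "case_prod k \<in> borel_measurable (borel \<Otimes>\<^sub>M borel)" unfolding k_def by measurable
  obtain K0 where K0: "K0 > 0" and main: "\<And>f. f \<in> borel_measurable borel \<Longrightarrow> (\<And>y. f y \<ge> 0) \<Longrightarrow> (\<integral>\<^sup>+y. ennreal (f y powr p) \<partial>haar) \<le> 1 \<Longrightarrow>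
    (AE x in haar. (\<integral>\<^sup>+y. k x y * ennreal (f y) \<partial>haar) < \<infinity>) \<and>
    (\<integral>\<^sup>+x. ennreal (enn2real (\<integral>\<^sup>+y. k x y * ennreal (f y) \<partial>haar) powr q) \<partial>haar) \<le> ennreal K0"
    using far_near_kernel_bounded[OF pq A B \<sigma> \<tau>] unfolding k_def by blast
  interpret Hh: sigma_finite_measure haar by (rule sigma_finite_haar)
  have q: "q > 1" using pq by simp
  \<comment> \<open>The near kernel is supported in y \<le> 4 x, where y^A is at most 4^A x^A; the
    powers of x then cancel.\<close>
  define D where "D = C * 4 powr A"
  have D: "D > 0" "D \<ge> C" using C A by (auto simp: D_def ge_one_powr_ge_zero)
  have Hk: "ennreal (x powr B * y powr A) * H x y \<le> ennreal D * k x y" if x: "x > 0" and y: "y > 0" for x y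
  proof -
    have 1: "ennreal (x powr B * y powr A) * ennreal (max x y powr (- (A + B))) = ennreal (far_kernel A B x y)"
      using x y by (simp add: far_kernel_def ennreal_mult'[symmetric])
    have 2: "ennreal (x powr B * y powr A) * (ennreal (x powr (- (A + B))) * near_kernel \<sigma> \<tau> UNIV x y) \<le> ennreal (4 powr A) * near_kernel \<sigma> \<tau> UNIV x y"
    proof (cases "y \<le> 4 * x")
      case True
      have "y powr A \<le> (4 * x) powr A" using True y A by (intro powr_mono2) auto
      hence "x powr B * y powr A * x powr (- (A + B)) \<le> x powr B * (4 * x) powr A * x powr (- (A + B))"
        by (intro mult_right_mono mult_left_mono) auto
      also have "\<dots> = 4 powr A * (x powr B * x powr A * x powr (- (A + B)))" using x by (simp only: powr_mult mult_ac)
      also have "x powr B * x powr A * x powr (- (A + B)) = 1" using x by (simp flip: powr_add)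
      finally have "ennreal (x powr B * y powr A * x powr (- (A + B))) \<le> ennreal (4 powr A)" by (intro ennreal_leI) simp
      hence "ennreal (x powr B * y powr A * x powr (- (A + B))) * near_kernel \<sigma> \<tau> UNIV x y \<le> ennreal (4 powr A) * near_kernel \<sigma> \<tau> UNIV x y"
        by (rule mult_right_mono) simp
      moreover have "ennreal (x powr B * y powr A * x powr (- (A + B))) = ennreal (x powr B * y powr A) * ennreal (x powr (- (A + B)))"
        by (rule ennreal_mult') simp
      ultimately show ?thesis by (simp only: mult.assoc)
    next
      case False
      hence "near_kernel \<sigma> \<tau> UNIV x y = 0" by (simp add: near_kernel_def near_profile_def)
      thus ?thesis by simp
    qed
    have "ennreal (x powr B * y powr A) * H x y \<le> ennreal (x powr B * y powr A) * (ennreal C * (ennreal (max x y powr (- (A + B))) + ennreal (x powr (- (A + B))) * near_kernel \<sigma> \<tau> UNIV x y))"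
      by (intro mult_left_mono H x y) simp
    also have "\<dots> = ennreal C * (ennreal (x powr B * y powr A) * ennreal (max x y powr (- (A + B))) + ennreal (x powr B * y powr A) * (ennreal (x powr (- (A + B))) * near_kernel \<sigma> \<tau> UNIV x y))"
      by (simp only: distrib_left mult_ac)
    also have "\<dots> \<le> ennreal C * (ennreal (far_kernel A B x y) + ennreal (4 powr A) * near_kernel \<sigma> \<tau> UNIV x y)"
      unfolding 1 by (intro mult_left_mono add_left_mono 2) simp
    also have "\<dots> = ennreal C * ennreal (far_kernel A B x y) + ennreal D * near_kernel \<sigma> \<tau> UNIV x y"
      using C by (simp add: D_def distrib_left ennreal_mult' mult.assoc)
    also have "\<dots> \<le> ennreal D * ennreal (far_kernel A B x y) + ennreal D * near_kernel \<sigma> \<tau> UNIV x y"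
      by (intro add_right_mono mult_right_mono ennreal_leI D) simp
    finally show ?thesis by (simp add: k_def distrib_left)
  qed
  have "D powr q * K0 > 0" using D K0 by simp
  moreover have "(AE x in halfline_measure (\<alpha> - b * q). (\<integral>\<^sup>+y. H x y * ennreal \<bar>g y\<bar> \<partial>halfline_measure \<alpha>) < \<infinity>) \<and>
    (\<integral>\<^sup>+x. ennreal (enn2real (\<integral>\<^sup>+y. H x y * ennreal \<bar>g y\<bar> \<partial>halfline_measure \<alpha>) powr q) \<partial>halfline_measure (\<alpha> - b * q)) \<le> ennreal (D powr q * K0 * s powr q)"
    if gm[measurable]: "g \<in> borel_measurable borel" and s: "s > 0"
      and gp: "(\<integral>\<^sup>+y. ennreal (\<bar>g y\<bar> powr p) \<partial>halfline_measure (\<alpha> + a * p)) \<le> ennreal (s powr p)" for g s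
  proof -
    define f where "f = (\<lambda>y. \<bar>g y\<bar> * y powr ((\<alpha> + 1) / p + a) / s)"
    have fm[measurable]: "f \<in> borel_measurable borel" unfolding f_def by measurable
    have f0: "f y \<ge> 0" for y using s by (simp add: f_def)
    have "(\<integral>\<^sup>+y. ennreal (f y powr p) \<partial>haar) = (\<integral>\<^sup>+y. ennreal (s powr (- p)) * (ennreal (y powr (\<alpha> + a * p + 1)) * ennreal (\<bar>g y\<bar> powr p)) \<partial>haar)"
    proof (rule nn_integral_cong_AE, rule AE_mp[OF AE_haar], rule AE_I2, rule impI)
      fix y :: real assume y: "y > 0"
      have "f y powr p = \<bar>g y\<bar> powr p * (y powr ((\<alpha> + 1) / p + a)) powr p / s powr p"
        using s y by (simp add: f_def powr_divide powr_mult)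
      also have "(y powr ((\<alpha> + 1) / p + a)) powr p = y powr (\<alpha> + a * p + 1)"
      proof -
        have "((\<alpha> + 1) / p + a) * p = \<alpha> + a * p + 1" using pq by (simp add: field_simps)
        thus ?thesis by (simp only: powr_powr)
      qed
      finally have "f y powr p = s powr (- p) * (y powr (\<alpha> + a * p + 1) * \<bar>g y\<bar> powr p)"
        by (simp add: powr_minus_divide)
      thus "ennreal (f y powr p) = ennreal (s powr (- p)) * (ennreal (y powr (\<alpha> + a * p + 1)) * ennreal (\<bar>g y\<bar> powr p))"
        by (simp only: ennreal_mult' powr_ge_zero)
    qed
    also have "\<dots> = ennreal (s powr (- p)) * (\<integral>\<^sup>+y. ennreal (y powr (\<alpha> + a * p + 1)) * ennreal (\<bar>g y\<bar> powr p) \<partial>haar)"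
      by (rule nn_integral_cmult) measurable
    also have "(\<integral>\<^sup>+y. ennreal (y powr (\<alpha> + a * p + 1)) * ennreal (\<bar>g y\<bar> powr p) \<partial>haar) = (\<integral>\<^sup>+y. ennreal (\<bar>g y\<bar> powr p) \<partial>halfline_measure (\<alpha> + a * p))"
      by (rule nn_integral_halfline_haar[symmetric]) measurable
    also have "ennreal (s powr (- p)) * \<dots> \<le> ennreal (s powr (- p)) * ennreal (s powr p)"
      by (intro mult_left_mono gp) simp
    also have "\<dots> = 1" using s by (simp add: ennreal_mult'[symmetric] powr_minus)
    finally have fp: "(\<integral>\<^sup>+y. ennreal (f y powr p) \<partial>haar) \<le> 1" .
    define T where "T = (\<lambda>x. \<integral>\<^sup>+y. k x y * ennreal (f y) \<partial>haar)"
    have Tm[measurable]: "T \<in> borel_measurable borel" unfolding T_def by measurable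
    have Tfin: "AE x in haar. T x < \<infinity>" and TK: "(\<integral>\<^sup>+x. ennreal (enn2real (T x) powr q) \<partial>haar) \<le> ennreal K0"
      using main[OF fm f0 fp] by (auto simp: T_def)
    define U where "U = (\<lambda>x. \<integral>\<^sup>+y. H x y * ennreal \<bar>g y\<bar> \<partial>halfline_measure \<alpha>)"
    have U_haar: "U x = (\<integral>\<^sup>+y. ennreal (y powr (\<alpha> + 1)) * (H x y * ennreal \<bar>g y\<bar>) \<partial>haar)" for x
    proof -
      have [measurable]: "H x \<in> borel_measurable borel" using measurable_Pair2[OF Hm, of x] by simp
      show ?thesis unfolding U_def by (rule nn_integral_halfline_haar) measurable
    qed
    have Um[measurable]: "U \<in> borel_measurable borel"
      unfolding U_haar by measurable
    have UT: "ennreal (x powr B) * U x \<le> ennreal (D * s) * T x" if x: "x > 0" for x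
    proof -
      have [measurable]: "H x \<in> borel_measurable borel" using measurable_Pair2[OF Hm, of x] by simp
      have [measurable]: "k x \<in> borel_measurable borel" using measurable_Pair2[OF km, of x] by simp
      have "ennreal (x powr B) * U x = (\<integral>\<^sup>+y. ennreal (x powr B) * (ennreal (y powr (\<alpha> + 1)) * (H x y * ennreal \<bar>g y\<bar>)) \<partial>haar)"
        unfolding U_haar by (rule nn_integral_cmult[symmetric]) measurable
      also have "\<dots> \<le> (\<integral>\<^sup>+y. ennreal (D * s) * (k x y * ennreal (f y)) \<partial>haar)"
      proof (rule nn_integral_mono_AE, rule AE_mp[OF AE_haar], rule AE_I2, rule impI)
        fix y :: real assume y: "y > 0"
        have e: "y powr (\<alpha> + 1) = y powr A * y powr ((\<alpha> + 1) / p + a)"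
        proof -
          have "\<alpha> + 1 = A + ((\<alpha> + 1) / p + a)" by (simp add: A_def right_diff_distrib)
          thus ?thesis by (simp only: powr_add[symmetric])
        qed
        have fs: "y powr ((\<alpha> + 1) / p + a) * \<bar>g y\<bar> = s * f y" using s by (simp add: f_def)
        have "ennreal (x powr B) * (ennreal (y powr (\<alpha> + 1)) * (H x y * ennreal \<bar>g y\<bar>)) =
           (ennreal (x powr B * y powr A) * H x y) * ennreal (y powr ((\<alpha> + 1) / p + a) * \<bar>g y\<bar>)"
          unfolding e by (simp add: ennreal_mult' mult_ac)
        also have "\<dots> \<le> (ennreal D * k x y) * ennreal (s * f y)"
          unfolding fs by (intro mult_right_mono Hk x y) simp
        also have "\<dots> = ennreal (D * s) * (k x y * ennreal (f y))"
          using D s by (simp add: ennreal_mult' mult_ac)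
        finally show "ennreal (x powr B) * (ennreal (y powr (\<alpha> + 1)) * (H x y * ennreal \<bar>g y\<bar>)) \<le> ennreal (D * s) * (k x y * ennreal (f y))" .
      qed
      also have "\<dots> = ennreal (D * s) * T x" unfolding T_def by (rule nn_integral_cmult) measurable
      finally show ?thesis .
    qed
    have Ufin: "AE x in haar. U x < \<infinity>"
      using Tfin AE_haar
    proof eventually_elim
      case (elim x)
      have "ennreal (D * s) * T x < \<infinity>" using elim(1) by (simp add: ennreal_mult_less_top)
      hence "ennreal (x powr B) * U x < \<infinity>" by (rule le_less_trans[OF UT[OF elim(2)]])
      thus ?case using elim(2) by (auto simp: ennreal_mult_less_top)
    qed
    have "(\<integral>\<^sup>+x. ennreal (enn2real (U x) powr q) \<partial>halfline_measure (\<alpha> - b * q)) = (\<integral>\<^sup>+x. ennreal (x powr (\<alpha> - b * q + 1)) * ennreal (enn2real (U x) powr q) \<partial>haar)"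
      by (rule nn_integral_halfline_haar) measurable
    also have "\<dots> \<le> (\<integral>\<^sup>+x. ennreal ((D * s) powr q) * ennreal (enn2real (T x) powr q) \<partial>haar)"
    proof (rule nn_integral_mono_AE)
      show "AE x in haar. ennreal (x powr (\<alpha> - b * q + 1)) * ennreal (enn2real (U x) powr q) \<le> ennreal ((D * s) powr q) * ennreal (enn2real (T x) powr q)"
        using Tfin AE_haar
      proof eventually_elim
        case (elim x)
        have "enn2real (ennreal (x powr B) * U x) \<le> enn2real (ennreal (D * s) * T x)"
          using UT[OF elim(2)] elim(1) by (intro enn2real_mono) (auto simp: ennreal_mult_less_top)
        hence le: "x powr B * enn2real (U x) \<le> D * s * enn2real (T x)"
          using D s by (simp add: enn2real_mult)
        have "x powr (\<alpha> - b * q + 1) * enn2real (U x) powr q = (x powr B * enn2real (U x)) powr q"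
        proof -
          have "B * q = \<alpha> - b * q + 1" using q by (simp add: B_def left_diff_distrib)
          thus ?thesis using elim(2) by (simp add: powr_mult powr_powr)
        qed
        also have "\<dots> \<le> (D * s * enn2real (T x)) powr q" using le q by (intro powr_mono2) auto
        also have "\<dots> = (D * s) powr q * enn2real (T x) powr q" using D s by (simp add: powr_mult)
        finally show ?case by (simp add: ennreal_mult'[symmetric] ennreal_leI)
      qed
    qed
    also have "\<dots> = ennreal ((D * s) powr q) * (\<integral>\<^sup>+x. ennreal (enn2real (T x) powr q) \<partial>haar)"
      by (rule nn_integral_cmult) measurable
    also have "\<dots> \<le> ennreal ((D * s) powr q) * ennreal K0" by (intro mult_left_mono TK) simp
    also have "\<dots> = ennreal (D powr q * K0 * s powr q)"
      using D s K0 by (simp add: ennreal_mult'[symmetric] powr_mult mult_ac)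
    finally have "(\<integral>\<^sup>+x. ennreal (enn2real (U x) powr q) \<partial>halfline_measure (\<alpha> - b * q)) \<le> ennreal (D powr q * K0 * s powr q)" .
    moreover have "AE x in halfline_measure (\<alpha> - b * q). U x < \<infinity>"
      by (rule AE_halfline_haar[OF _ Ufin]) measurable
    ultimately show ?thesis by (simp add: U_def)
  qed
  ultimately show ?thesis by blast
qed

subsection \<open>Bounds for the multiplier kernel\<close>

lemma nn_integral_exp_bessel_measure_le:
  assumes \<alpha>: "\<alpha> > -1"
  shows "\<exists>C>0. (\<forall>\<zeta>\<ge>0. (\<integral>\<^sup>+u. ennreal (exp (- ((1 - u) / 4 * \<zeta>))) \<partial>bessel_measure \<alpha>) \<le> ennreal C) \<and>
    (\<forall>\<zeta>>0. (\<integral>\<^sup>+u. ennreal (exp (- ((1 - u) / 4 * \<zeta>))) \<partial>bessel_measure \<alpha>) \<le> ennreal (C * \<zeta> powr (- (\<alpha> + 3 / 2))))"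
proof -
  define \<kappa> where "\<kappa> = \<alpha> + 3 / 2"
  have \<kappa>: "\<kappa> > 0" using \<alpha> by (simp add: \<kappa>_def)
  define V where "V = Beta (1 / 2) \<kappa>"
  have V: "(\<integral>\<^sup>+u. 1 \<partial>bessel_measure \<alpha>) = ennreal V"
    using nn_integral_power_bessel_measure[OF \<alpha>, of 0] by (simp add: V_def \<kappa>_def)
  have V0: "V > 0" using \<kappa> by (simp add: V_def Beta_def Gamma_real_pos)
  have dens: "(\<integral>\<^sup>+u. f u \<partial>bessel_measure \<alpha>) = (\<integral>\<^sup>+u. ennreal (indicator {0<..<1} u * (u powr (- 1 / 2) * (1 - u) powr (\<alpha> + 1 / 2))) * f u \<partial>lborel)"
    if "f \<in> borel_measurable borel" for f :: "real \<Rightarrow> ennreal"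
    unfolding bessel_measure_def by (rule nn_integral_density) (use that in measurable)
  define C1 where "C1 = V * (\<kappa> powr \<kappa> * 8 powr \<kappa>)"
  define C2 where "C2 = 2 * Gamma \<kappa> * 4 powr \<kappa>"
  have C1: "C1 > 0" using V0 \<kappa> by (simp add: C1_def)
  have C2: "C2 > 0" using \<kappa> by (simp add: C2_def Gamma_real_pos)
  have b1: "(\<integral>\<^sup>+u. ennreal (exp (- ((1 - u) / 4 * \<zeta>))) \<partial>bessel_measure \<alpha>) \<le> ennreal V" if "\<zeta> \<ge> 0" for \<zeta>
  proof -
    have "(\<integral>\<^sup>+u. ennreal (exp (- ((1 - u) / 4 * \<zeta>))) \<partial>bessel_measure \<alpha>) \<le> (\<integral>\<^sup>+u. 1 \<partial>bessel_measure \<alpha>)"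
    proof (rule nn_integral_mono_AE, rule AE_mp[OF AE_bessel_measure], rule AE_I2, rule impI)
      fix u :: real assume "0 < u \<and> u < 1"
      hence "exp (- ((1 - u) / 4 * \<zeta>)) \<le> 1" using that by simp
      thus "ennreal (exp (- ((1 - u) / 4 * \<zeta>))) \<le> 1" by simp
    qed
    also have "\<dots> = ennreal V" by (rule V)
    finally show ?thesis .
  qed
  have b2: "(\<integral>\<^sup>+u. ennreal (exp (- ((1 - u) / 4 * \<zeta>))) \<partial>bessel_measure \<alpha>) \<le> ennreal ((C1 + C2) * \<zeta> powr (- \<kappa>))" if z: "\<zeta> > 0" for \<zeta>
  proof -
    let ?d = "\<lambda>u. indicator {0<..<1} u * (u powr (- 1 / 2) * (1 - u) powr (\<alpha> + 1 / 2))"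
    let ?h = "\<lambda>v. ennreal (v powr (\<kappa> - 1)) * ennreal (exp (- (\<zeta> / 4) * v)) * indicator {0<..} v"
    have "(\<integral>\<^sup>+u. ennreal (exp (- ((1 - u) / 4 * \<zeta>))) \<partial>bessel_measure \<alpha>) = (\<integral>\<^sup>+u. ennreal (?d u) * ennreal (exp (- ((1 - u) / 4 * \<zeta>))) \<partial>lborel)"
      by (rule dens) measurable
    \<comment> \<open>For u \<le> 1/2 the exponential is at most exp(-\<zeta>/8), which beats every
      power. For u > 1/2 the factor u^(-1/2) is at most 2 and a Gamma integral in 1 - u remains;
      \<open>1 + (-1) * u\<close> is the form that the affine substitution rule expects.\<close>
    also have "\<dots> \<le> (\<integral>\<^sup>+u. ennreal (exp (- (\<zeta> / 8))) * (ennreal (?d u) * 1) + ennreal 2 * ?h (1 + (-1) * u) \<partial>lborel)"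
    proof (rule nn_integral_mono)
      fix u :: real
      consider "u \<notin> {0<..<1}" | "0 < u" "u \<le> 1 / 2" | "1 / 2 < u" "u < 1" by fastforce
      thus "ennreal (?d u) * ennreal (exp (- ((1 - u) / 4 * \<zeta>))) \<le> ennreal (exp (- (\<zeta> / 8))) * (ennreal (?d u) * 1) + ennreal 2 * ?h (1 + (-1) * u)"
      proof cases
        case 2
        have "\<zeta> / 8 \<le> (1 - u) / 4 * \<zeta>" using 2 z by (simp add: field_simps)
        hence "exp (- ((1 - u) / 4 * \<zeta>)) \<le> exp (- (\<zeta> / 8))" by simp
        hence "ennreal (?d u) * ennreal (exp (- ((1 - u) / 4 * \<zeta>))) \<le> ennreal (?d u) * ennreal (exp (- (\<zeta> / 8)))"
          by (intro mult_left_mono ennreal_leI) auto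
        also have "\<dots> = ennreal (exp (- (\<zeta> / 8))) * (ennreal (?d u) * 1)" by (simp add: mult.commute)
        finally show ?thesis by (rule order_trans) simp
      next
        case 3
        have "u powr (- 1 / 2) \<le> (1 / 2) powr (- 1 / 2)" using 3 by (intro powr_mono2') auto
        also have "\<dots> \<le> 2"
        proof -
          have "(1 / 2 :: real) powr (- 1 / 2) = sqrt 2" by (simp add: powr_divide powr_minus_divide powr_half_sqrt)
          also have "\<dots> \<le> 2" by (simp add: real_le_lsqrt)
          finally show ?thesis .
        qed
        finally have main: "u powr (- 1 / 2) * (1 - u) powr (\<alpha> + 1 / 2) * exp (- ((1 - u) / 4 * \<zeta>)) \<le> 2 * (1 - u) powr (\<alpha> + 1 / 2) * exp (- ((1 - u) / 4 * \<zeta>))"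
          by (intro mult_right_mono) auto
        have ak: "\<alpha> + 1 / 2 = \<kappa> - 1" by (simp add: \<kappa>_def)
        have e: "exp (- ((1 - u) / 4 * \<zeta>)) = exp (- (\<zeta> / 4) * (1 - u))"
          by (rule arg_cong[where f = exp]) (simp add: algebra_simps)
        have "u powr (- 1 / 2) * (1 - u) powr (\<alpha> + 1 / 2) * exp (- ((1 - u) / 4 * \<zeta>)) \<le> 2 * ((1 - u) powr (\<kappa> - 1) * exp (- (\<zeta> / 4) * (1 - u)))"
          using main unfolding e ak by (simp only: mult.assoc)
        hence "ennreal (u powr (- 1 / 2) * (1 - u) powr (\<alpha> + 1 / 2) * exp (- ((1 - u) / 4 * \<zeta>))) \<le> ennreal (2 * ((1 - u) powr (\<kappa> - 1) * exp (- (\<zeta> / 4) * (1 - u))))"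
          by (rule ennreal_leI)
        also have "\<dots> = ennreal 2 * ?h (1 + (-1) * u)" using 3 by (simp add: ennreal_mult')
        also have "ennreal (u powr (- 1 / 2) * (1 - u) powr (\<alpha> + 1 / 2) * exp (- ((1 - u) / 4 * \<zeta>))) = ennreal (?d u) * ennreal (exp (- ((1 - u) / 4 * \<zeta>)))"
          using 3 by (simp add: ennreal_mult')
        finally have "ennreal (?d u) * ennreal (exp (- ((1 - u) / 4 * \<zeta>))) \<le> ennreal 2 * ?h (1 + (-1) * u)" .
        thus ?thesis by (rule order_trans) simp
      qed auto
    qed
    also have "\<dots> = (\<integral>\<^sup>+u. ennreal (exp (- (\<zeta> / 8))) * (ennreal (?d u) * 1) \<partial>lborel) + (\<integral>\<^sup>+u. ennreal 2 * ?h (1 + (-1) * u) \<partial>lborel)"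
      by (rule nn_integral_add) measurable
    also have "(\<integral>\<^sup>+u. ennreal (exp (- (\<zeta> / 8))) * (ennreal (?d u) * 1) \<partial>lborel) = ennreal (exp (- (\<zeta> / 8))) * (\<integral>\<^sup>+u. ennreal (?d u) * 1 \<partial>lborel)"
      by (rule nn_integral_cmult) measurable
    also have "(\<integral>\<^sup>+u. ennreal (?d u) * 1 \<partial>lborel) = ennreal V" using V dens[of "\<lambda>_. 1"] by simp
    also have "(\<integral>\<^sup>+u. ennreal 2 * ?h (1 + (-1) * u) \<partial>lborel) = ennreal 2 * (\<integral>\<^sup>+u. ?h (1 + (-1) * u) \<partial>lborel)"
      by (rule nn_integral_cmult) measurable
    also have "(\<integral>\<^sup>+u. ?h (1 + (-1) * u) \<partial>lborel) = (\<integral>\<^sup>+v. ?h v \<partial>lborel)"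
      using nn_integral_real_affine[of ?h "-1" 1] by simp
    also have "(\<integral>\<^sup>+v. ?h v \<partial>lborel) = (\<integral>\<^sup>+v. ennreal (exp (- (\<zeta> / 4) * v)) \<partial>halfline_measure (\<kappa> - 1))"
      by (rule nn_integral_halfline_measure[symmetric], rule measurable_halfline_measure) measurable
    also have "\<dots> = ennreal (Gamma \<kappa> * (\<zeta> / 4) powr (- \<kappa>))"
      using nn_integral_exp_halfline_measure[of "\<zeta> / 4" "\<kappa> - 1"] z \<kappa> by simp
    also have "ennreal (exp (- (\<zeta> / 8))) * ennreal V + ennreal 2 * ennreal (Gamma \<kappa> * (\<zeta> / 4) powr (- \<kappa>)) =
       ennreal (exp (- (\<zeta> / 8)) * V + 2 * (Gamma \<kappa> * (\<zeta> / 4) powr (- \<kappa>)))"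
    proof -
      have e1: "ennreal (exp (- (\<zeta> / 8))) * ennreal V = ennreal (exp (- (\<zeta> / 8)) * V)" by (rule ennreal_mult'[symmetric]) simp
      have e2: "ennreal 2 * ennreal (Gamma \<kappa> * (\<zeta> / 4) powr (- \<kappa>)) = ennreal (2 * (Gamma \<kappa> * (\<zeta> / 4) powr (- \<kappa>)))" by (rule ennreal_mult'[symmetric]) simp
      have "Gamma \<kappa> \<ge> 0" using \<kappa> by (intro less_imp_le Gamma_real_pos)
      thus ?thesis unfolding e1 e2 using V0 by (intro ennreal_plus[symmetric]) auto
    qed
    also have "\<dots> \<le> ennreal ((C1 + C2) * \<zeta> powr (- \<kappa>))"
    proof (rule ennreal_leI)
      have "exp (- (\<zeta> / 8)) \<le> \<kappa> powr \<kappa> * (\<zeta> / 8) powr (- \<kappa>)"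
        using exp_minus_le_powr[of "\<zeta> / 8" \<kappa>] z \<kappa> by simp
      also have "(\<zeta> / 8) powr (- \<kappa>) = 8 powr \<kappa> * \<zeta> powr (- \<kappa>)"
        using z by (simp add: powr_divide powr_minus_divide)
      finally have "exp (- (\<zeta> / 8)) * V \<le> C1 * \<zeta> powr (- \<kappa>)"
        using V0 mult_right_mono[of "exp (- (\<zeta> / 8))" "\<kappa> powr \<kappa> * (8 powr \<kappa> * \<zeta> powr (- \<kappa>))" V] by (simp add: C1_def mult_ac)
      moreover have "2 * (Gamma \<kappa> * (\<zeta> / 4) powr (- \<kappa>)) = C2 * \<zeta> powr (- \<kappa>)"
        using z by (simp add: C2_def powr_divide powr_minus_divide)
      ultimately show "exp (- (\<zeta> / 8)) * V + 2 * (Gamma \<kappa> * (\<zeta> / 4) powr (- \<kappa>)) \<le> (C1 + C2) * \<zeta> powr (- \<kappa>)"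
        by (simp add: distrib_right)
    qed
    finally show ?thesis .
  qed
  show ?thesis
  proof (intro exI[of _ "V + C1 + C2"] conjI allI impI)
    show "0 < V + C1 + C2" using V0 C1 C2 by simp
    show "(\<integral>\<^sup>+u. ennreal (exp (- ((1 - u) / 4 * \<zeta>))) \<partial>bessel_measure \<alpha>) \<le> ennreal (V + C1 + C2)" if "0 \<le> \<zeta>" for \<zeta>
      using b1[OF that] C1 C2 by (rule_tac order_trans) (auto intro: ennreal_leI)
    show "(\<integral>\<^sup>+u. ennreal (exp (- ((1 - u) / 4 * \<zeta>))) \<partial>bessel_measure \<alpha>) \<le> ennreal ((V + C1 + C2) * \<zeta> powr (- (\<alpha> + 3 / 2)))" if "0 < \<zeta>" for \<zeta>
    proof (rule order_trans[OF b2[OF that]], rule ennreal_leI)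
      show "(C1 + C2) * \<zeta> powr (- \<kappa>) \<le> (V + C1 + C2) * \<zeta> powr (- (\<alpha> + 3 / 2))"
        unfolding \<kappa>_def using V0 by (intro mult_right_mono) auto
    qed
  qed
qed

text \<open>Below X the integrand is at most the constant X^(-D - 1), above X at most t^(-D - 1).
  The exponent D + 1 inside the minimum is what cancels t in the lower part.\<close>

lemma nn_integral_powr_min_le:
  assumes D: "D > 0" and X: "X > 0"
  shows "(\<integral>\<^sup>+t. ennreal (t powr (- D - 1) * min 1 ((t / X) powr (D + 1))) * indicator {0<..} t \<partial>lborel) \<le> ennreal ((1 + 1 / D) * X powr (- D))"
proof -
  have "(\<integral>\<^sup>+t. ennreal (t powr (- D - 1) * min 1 ((t / X) powr (D + 1))) * indicator {0<..} t \<partial>lborel)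
    \<le> (\<integral>\<^sup>+t. ennreal (X powr (- D - 1)) * indicator {0..X} t + ennreal (t powr (- D - 1)) * indicator {X..} t \<partial>lborel)"
  proof (rule nn_integral_mono)
    fix t :: real
    consider "t \<le> 0" | "0 < t" "t \<le> X" | "X < t" by linarith
    thus "ennreal (t powr (- D - 1) * min 1 ((t / X) powr (D + 1))) * indicator {0<..} t \<le> ennreal (X powr (- D - 1)) * indicator {0..X} t + ennreal (t powr (- D - 1)) * indicator {X..} t"
    proof cases
      case 2
      have "t powr (- D - 1) * min 1 ((t / X) powr (D + 1)) \<le> t powr (- D - 1) * (t / X) powr (D + 1)"
        by (intro mult_left_mono) auto
      also have "\<dots> = (t powr (- D - 1) * t powr (D + 1)) / X powr (D + 1)" using 2 X by (simp add: powr_divide)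
      also have "t powr (- D - 1) * t powr (D + 1) = 1" using 2 by (simp flip: powr_add)
      also have "1 / X powr (D + 1) = X powr (- D - 1)"
        using powr_minus_divide[of X "D + 1"] by simp
      finally have "ennreal (t powr (- D - 1) * min 1 ((t / X) powr (D + 1))) \<le> ennreal (X powr (- D - 1))" by (rule ennreal_leI)
      thus ?thesis using 2 by (simp add: add_increasing2)
    next
      case 3
      have "t powr (- D - 1) * min 1 ((t / X) powr (D + 1)) \<le> t powr (- D - 1) * 1"
        by (intro mult_left_mono) auto
      thus ?thesis using 3 X by (simp add: ennreal_leI)
    qed simp
  qed
  also have "\<dots> = (\<integral>\<^sup>+t. ennreal (X powr (- D - 1)) * indicator {0..X} t \<partial>lborel) + (\<integral>\<^sup>+t. ennreal (t powr (- D - 1)) * indicator {X..} t \<partial>lborel)"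
    by (rule nn_integral_add) measurable
  also have "(\<integral>\<^sup>+t. ennreal (X powr (- D - 1)) * indicator {0..X} t \<partial>lborel) = ennreal (X powr (- D - 1)) * ennreal X"
    using X by (subst nn_integral_cmult_indicator) auto
  also have "\<dots> = ennreal (X powr (- D))"
    using X by (simp add: ennreal_mult'[symmetric] powr_diff)
  also have "(\<integral>\<^sup>+t. ennreal (t powr (- D - 1)) * indicator {X..} t \<partial>lborel) = ennreal (X powr (- D) / D)"
    using nn_integral_powr_to_inf[of "- D - 1" X] D X by simp
  also have "ennreal (X powr (- D)) + ennreal (X powr (- D) / D) = ennreal ((1 + 1 / D) * X powr (- D))"
    using D by (simp add: ennreal_plus[symmetric] distrib_right del: ennreal_plus)
  finally show ?thesis .
qed

text \<open>Off this region the smaller square root is at most half of the larger one.\<close>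

lemma sqrt_diff_square_far:
  fixes x y :: real
  assumes "x > 0" "y > 0" "\<not> (x / 4 \<le> y \<and> y \<le> 4 * x)"
  shows "max x y / 4 \<le> (sqrt x - sqrt y)\<^sup>2"
proof -
  have aux: "x / 4 \<le> (sqrt x - sqrt y)\<^sup>2" if "0 < y" "y < x / 4" for x y :: real
  proof -
    have "sqrt y \<le> sqrt (x / 4)" using that by simp
    also have "\<dots> = sqrt x / 2" by (simp add: real_sqrt_divide)
    finally have "sqrt x / 2 \<le> sqrt x - sqrt y" by simp
    hence "(sqrt x / 2)\<^sup>2 \<le> (sqrt x - sqrt y)\<^sup>2" using that by (intro power_mono) auto
    thus ?thesis using that by (simp add: power_divide)
  qed
  consider "y < x / 4" | "x < y / 4" using assms(3) by fastforce
  thus ?thesis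
  proof cases
    case 1
    thus ?thesis using aux[of y x] assms by (simp add: max_def)
  next
    case 2
    thus ?thesis using aux[of x y] assms by (simp add: max_def power2_commute)
  qed
qed

text \<open>Combine exp(-z) \<le> 1/(1 + z) at z = (sqrt x - sqrt y)^2/(4 t) with (x - y)^2 \<le> 9
  x (sqrt x - sqrt y)^2, which holds since sqrt x + sqrt y \<le> 3 sqrt x. The constant 36 is 4
  times 9.\<close>

lemma exp_sqrt_diff_square_near:
  fixes x y t :: real
  assumes x: "x > 0" and y: "y > 0" "y \<le> 4 * x" and t: "t > 0"
  shows "exp (- ((sqrt x - sqrt y)\<^sup>2 / (4 * t))) \<le> 36 * (x * t / (x * t + (x - y)\<^sup>2))"
proof -
  define d where "d = (sqrt x - sqrt y)\<^sup>2"
  have "sqrt y \<le> 2 * sqrt x" using y x real_sqrt_le_mono[of y "4 * x"] by (simp add: real_sqrt_mult)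
  hence "(sqrt x + sqrt y)\<^sup>2 \<le> (3 * sqrt x)\<^sup>2" using x y by (intro power_mono) auto
  also have "\<dots> = 9 * x" using x by (simp add: power_mult_distrib)
  finally have s: "(sqrt x + sqrt y)\<^sup>2 \<le> 9 * x" .
  have "x - y = (sqrt x - sqrt y) * (sqrt x + sqrt y)" using x y by (simp add: algebra_simps)
  hence "(x - y)\<^sup>2 = d * (sqrt x + sqrt y)\<^sup>2" by (simp add: d_def power_mult_distrib)
  also have "\<dots> \<le> d * (9 * x)" using s by (intro mult_left_mono) (auto simp: d_def)
  finally have dx: "(x - y)\<^sup>2 \<le> d * (9 * x)" .
  have d0: "d \<ge> 0" by (simp add: d_def)
  have "1 + d / (4 * t) \<le> exp (d / (4 * t))" by (rule exp_ge_add_one_self)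
  hence "exp (- (d / (4 * t))) \<le> 1 / (1 + d / (4 * t))"
    using d0 t by (simp add: exp_minus field_simps add_pos_nonneg)
  also have "\<dots> \<le> 36 * (x * t / (x * t + (x - y)\<^sup>2))"
  proof -
    have "1 / (1 + d / (4 * t)) = 36 * (x * t) / (36 * (x * t) + d * (9 * x))"
      using x t d0 by (simp add: divide_simps add_nonneg_eq_0_iff) (simp add: algebra_simps)
    also have "\<dots> \<le> 36 * (x * t) / (x * t + (x - y)\<^sup>2)"
      using x t dx d0 by (intro divide_left_mono mult_pos_pos add_pos_nonneg add_mono) auto
    finally show ?thesis by simp
  qed
  finally show ?thesis by (simp add: d_def)
qed

section \<open>A majorant of the multiplier kernel\<close>

text \<open>All absolute values stand inside the integrals, so one bound yields absolute
  convergence, the use of Fubini and the size of the kernel. With values in \<open>ennreal\<close>,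
  points where it is infinite need no exception.\<close>

definition mehler_abs :: "real \<Rightarrow> (real \<Rightarrow> real) \<Rightarrow> real \<Rightarrow> real \<Rightarrow> ennreal" where
  "mehler_abs \<alpha> \<psi> x y = (\<integral>\<^sup>+t. (\<integral>\<^sup>+u. ennreal (indicator {0<..} t * \<bar>\<psi> t\<bar> *
     (\<bar>mehler_deriv \<alpha> t (sqrt u) x y\<bar> + \<bar>mehler_deriv \<alpha> t (- sqrt u) x y\<bar>)) \<partial>bessel_measure \<alpha>) \<partial>lborel)"

lemma mehler_abs_measurable [measurable]:
  assumes [measurable]: "\<psi> \<in> borel_measurable borel"
  shows "(\<lambda>(x, y). mehler_abs \<alpha> \<psi> x y) \<in> borel_measurable (borel \<Otimes>\<^sub>M borel)"
proof -
  interpret B: sigma_finite_measure "bessel_measure \<alpha>" by (rule sigma_finite_bessel_measure)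
  show ?thesis unfolding mehler_abs_def by measurable
qed

lemma exp_linear_le_min_powr:
  fixes z D :: real
  assumes "z > 0" "D > 0"
  shows "(1 + z) * exp (- (z / 16)) \<le> 32 * (1 + D powr D * 32 powr D) * min 1 (z powr (- D))"
proof -
  have "1 + z \<le> 32 * exp (z / 32)" using exp_ge_add_one_self[of "z / 32"] assms by linarith
  hence "(1 + z) * exp (- (z / 16)) \<le> 32 * exp (z / 32) * exp (- (z / 16))" by (intro mult_right_mono) auto
  also have "\<dots> = 32 * exp (- (z / 32))" by (simp flip: exp_add)
  also have "\<dots> \<le> 32 * ((1 + D powr D * 32 powr D) * min 1 (z powr (- D)))"
  proof (rule mult_left_mono)
    have "exp (- (z / 32)) \<le> D powr D * (z / 32) powr (- D)"
      using exp_minus_le_powr[of "z / 32" D] assms by simp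
    also have "(z / 32) powr (- D) = 32 powr D * z powr (- D)"
      using assms by (simp add: powr_divide powr_minus_divide)
    finally have 1: "exp (- (z / 32)) \<le> D powr D * 32 powr D * z powr (- D)" by simp
    have 2: "exp (- (z / 32)) \<le> 1" using assms by simp
    show "exp (- (z / 32)) \<le> (1 + D powr D * 32 powr D) * min 1 (z powr (- D))"
    proof (cases "z powr (- D) \<le> 1")
      case True
      have "0 \<le> z powr (- D)" by simp
      thus ?thesis using 1 True by (simp add: distrib_right min_absorb2 add_increasing)
    next
      case False
      have "0 \<le> D powr D * 32 powr D" by simp
      thus ?thesis using False by (intro order_trans[OF 2]) (simp add: min_absorb1)
    qed
  qed simp
  finally show ?thesis by (simp only: mult.assoc)
qed

text \<open>There are three regimes. For t > 1 everything decays exponentially in t and in x + y.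
  For t \<le> 1 outside x/4 \<le> y \<le> 4 x, or with t > x, the bound is t^(-D - 1) times a
  function of t/max(x,y) and integrates to max(x,y)^(-D). For t \<le> x near the diagonal, the
  u-integral gains a power of x/t and the integrand of the near kernel appears.\<close>

lemma mehler_abs_bound:
  fixes \<alpha> \<sigma> D P :: real and \<psi> :: "real \<Rightarrow> real"
  assumes \<alpha>: "\<alpha> > -1" and [measurable]: "\<psi> \<in> borel_measurable borel" and P: "P > 0"
    and \<psi>1: "\<And>t. 0 < t \<Longrightarrow> t \<le> 1 \<Longrightarrow> \<bar>\<psi> t\<bar> \<le> P * t powr \<sigma>" and \<psi>2: "\<And>t. t \<ge> 1 \<Longrightarrow> \<bar>\<psi> t\<bar> \<le> P"
    and D: "D > 0" and \<tau>: "\<alpha> + 1 - D \<le> \<sigma>"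
  shows "\<exists>C>0. \<forall>x>0. \<forall>y>0. mehler_abs \<alpha> \<psi> x y \<le>
     ennreal C * (ennreal (max x y powr (- D)) + ennreal (x powr (- D)) * near_kernel \<sigma> (\<alpha> + 1 - D) UNIV x y)"
proof -
  define \<kappa> where "\<kappa> = \<alpha> + 3 / 2"
  obtain C1 where C1: "C1 > 0" and small: "\<And>t x y s u. 0 < t \<Longrightarrow> t \<le> 1 \<Longrightarrow> x \<ge> 0 \<Longrightarrow> y \<ge> 0 \<Longrightarrow> 0 \<le> u \<Longrightarrow> u \<le> 1 \<Longrightarrow> \<bar>s\<bar> = sqrt u \<Longrightarrow>
    \<bar>mehler_deriv \<alpha> t s x y\<bar> \<le> C1 * t powr (- \<alpha> - 2) * (1 + sqrt (x * y) / t)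
      * exp (- ((sqrt x - sqrt y)\<^sup>2 / (4 * t))) * exp (- ((1 - u) / 4 * (sqrt (x * y) / t)))"
    using mehler_deriv_bound_small[OF \<alpha>] by blast
  obtain C2 where C2: "C2 > 0" and large: "\<And>t x y s. 1 \<le> t \<Longrightarrow> x \<ge> 0 \<Longrightarrow> y \<ge> 0 \<Longrightarrow> \<bar>s\<bar> \<le> 1 \<Longrightarrow>
    \<bar>mehler_deriv \<alpha> t s x y\<bar> \<le> C2 * exp (- t / 2) * exp (- (x + y) / 40)"
    using mehler_deriv_bound_large[OF \<alpha>] by blast
  define U where "U = (\<lambda>\<zeta>. \<integral>\<^sup>+u. ennreal (exp (- ((1 - u) / 4 * \<zeta>))) \<partial>bessel_measure \<alpha>)"
  obtain C3 where C3: "C3 > 0" and U1: "\<And>\<zeta>. \<zeta> \<ge> 0 \<Longrightarrow> U \<zeta> \<le> ennreal C3"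
    and U2: "\<And>\<zeta>. \<zeta> > 0 \<Longrightarrow> U \<zeta> \<le> ennreal (C3 * \<zeta> powr (- \<kappa>))"
    using nn_integral_exp_bessel_measure_le[OF \<alpha>] unfolding U_def \<kappa>_def by blast
  \<comment> \<open>Exponent of the cutoff \<open>m\<close> below, matched to
    \<open>nn_integral_powr_min_le\<close>.\<close>
  define D1 where "D1 = D + 1"
  have D1: "D1 > 0" using D by (simp add: D1_def)
  define Kf where "Kf = 32 * (1 + D1 powr D1 * 32 powr D1) + 3 * 4 powr D1"
  have Kf: "Kf > 0" unfolding Kf_def by (intro add_pos_nonneg mult_pos_pos) auto
  define K1 where "K1 = 2 * P * C1 * C3 * Kf"
  define K2 where "K2 = 2 * P * C1 * C3 * (3 * 2 powr \<bar>1 - \<kappa>\<bar> * 36)"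
  define K3 where "K3 = 2 * P * C2 * C3 * (D powr D * 40 powr D)"
  have K: "K1 > 0" "K2 > 0" "K3 > 0" using P C1 C2 C3 Kf D by (simp_all add: K1_def K2_def K3_def)
  define m where "m = (\<lambda>X t. min 1 ((t / X) powr D1))"
  let ?near = "\<lambda>x y t. near_weight \<sigma> (\<alpha> + 1 - D) UNIV x t * near_profile x y t"
  have inner: "(\<integral>\<^sup>+u. ennreal (indicator {0<..} t * \<bar>\<psi> t\<bar> * (\<bar>mehler_deriv \<alpha> t (sqrt u) x y\<bar> + \<bar>mehler_deriv \<alpha> t (- sqrt u) x y\<bar>)) \<partial>bessel_measure \<alpha>)
     \<le> ennreal K1 * (ennreal (t powr (- D - 1) * m (max x y) t) * indicator {0<..} t)
       + ennreal (K2 * x powr (- D)) * ennreal (?near x y t)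
       + ennreal (K3 * max x y powr (- D)) * (ennreal (t powr 0) * ennreal (exp (- (1 / 2) * t)) * indicator {0<..} t)"
    (is "?I \<le> ?A + ?B + ?E") if x: "x > 0" and y: "y > 0" for x y t
  proof -
    define X where "X = max x y"
    have X: "X > 0" "x \<le> X" "y \<le> X" using x y by (auto simp: X_def)
    consider "t \<le> 0" | "t > 1" | "0 < t" "t \<le> 1" by linarith
    thus ?thesis
    proof cases
      case 1
      thus ?thesis by simp
    next
      case 2
      \<comment> \<open>The last factor is 1; it is written out so that the u-integral becomes
        \<open>U 0\<close>.\<close>
      have "?I \<le> (\<integral>\<^sup>+u. ennreal (P * (2 * (C2 * exp (- t / 2) * exp (- (x + y) / 40)))) * ennreal (exp (- ((1 - u) / 4 * 0))) \<partial>bessel_measure \<alpha>)"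
      proof (rule nn_integral_mono_AE, rule AE_mp[OF AE_bessel_measure], rule AE_I2, rule impI)
        fix u :: real assume u: "0 < u \<and> u < 1"
        have "\<bar>mehler_deriv \<alpha> t (sqrt u) x y\<bar> + \<bar>mehler_deriv \<alpha> t (- sqrt u) x y\<bar> \<le> 2 * (C2 * exp (- t / 2) * exp (- (x + y) / 40))"
          using large[of t x y "sqrt u"] large[of t x y "- sqrt u"] 2 x y u by simp
        hence "\<bar>\<psi> t\<bar> * (\<bar>mehler_deriv \<alpha> t (sqrt u) x y\<bar> + \<bar>mehler_deriv \<alpha> t (- sqrt u) x y\<bar>) \<le> P * (2 * (C2 * exp (- t / 2) * exp (- (x + y) / 40)))"
          using \<psi>2[of t] 2 P by (intro mult_mono) auto
        thus "ennreal (indicator {0<..} t * \<bar>\<psi> t\<bar> * (\<bar>mehler_deriv \<alpha> t (sqrt u) x y\<bar> + \<bar>mehler_deriv \<alpha> t (- sqrt u) x y\<bar>))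
          \<le> ennreal (P * (2 * (C2 * exp (- t / 2) * exp (- (x + y) / 40)))) * ennreal (exp (- ((1 - u) / 4 * 0)))"
          using 2 by (simp add: ennreal_leI)
      qed
      also have "\<dots> = ennreal (P * (2 * (C2 * exp (- t / 2) * exp (- (x + y) / 40)))) * U 0"
        unfolding U_def by (rule nn_integral_cmult) measurable
      also have "\<dots> \<le> ennreal (P * (2 * (C2 * exp (- t / 2) * exp (- (x + y) / 40)))) * ennreal C3"
        by (intro mult_left_mono U1) auto
      also have "\<dots> = ennreal (P * (2 * (C2 * exp (- t / 2) * exp (- (x + y) / 40))) * C3)"
        using P C2 by (intro ennreal_mult'[symmetric]) auto
      also have "\<dots> \<le> ennreal (K3 * X powr (- D) * exp (- (1 / 2) * t))"
      proof (rule ennreal_leI)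
        have "exp (- (x + y) / 40) \<le> exp (- (X / 40))" using x y by (simp add: X_def max_def)
        also have "\<dots> \<le> D powr D * (X / 40) powr (- D)" using exp_minus_le_powr[of "X / 40" D] X D by simp
        also have "(X / 40) powr (- D) = 40 powr D * X powr (- D)" using X by (simp add: powr_divide powr_minus_divide)
        finally have e: "exp (- (x + y) / 40) \<le> D powr D * 40 powr D * X powr (- D)" by simp
        have "P * (2 * (C2 * exp (- t / 2) * exp (- (x + y) / 40))) * C3 = (2 * P * C2 * C3 * exp (- t / 2)) * exp (- (x + y) / 40)"
          by (simp only: mult_ac)
        also have "\<dots> \<le> (2 * P * C2 * C3 * exp (- t / 2)) * (D powr D * 40 powr D * X powr (- D))"
          using P C2 C3 by (intro mult_left_mono e) auto
        also have "\<dots> = K3 * X powr (- D) * exp (- t / 2)" by (simp only: K3_def mult_ac)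
        finally show "P * (2 * (C2 * exp (- t / 2) * exp (- (x + y) / 40))) * C3 \<le> K3 * X powr (- D) * exp (- (1 / 2) * t)" by simp
      qed
      also have "\<dots> = ?E" using 2 K by (simp add: X_def ennreal_mult')
      finally show ?thesis by (rule order_trans) (simp add: add_increasing)
    next
      case 3
      define g where "g = sqrt (x * y)"
      define \<zeta> where "\<zeta> = g / t"
      define E where "E = exp (- ((sqrt x - sqrt y)\<^sup>2 / (4 * t)))"
      have g: "g > 0" using x y by (simp add: g_def)
      have gX: "g \<le> X" 
      proof -
        have "x * y \<le> X * X" using X x y by (intro mult_mono) auto
        thus ?thesis unfolding g_def using X by (intro real_le_lsqrt) (auto simp: power2_eq_square)
      qed
      have z: "\<zeta> > 0" using g 3 by (simp add: \<zeta>_def)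
      have zX: "\<zeta> \<le> X / t" using gX 3 by (simp add: \<zeta>_def divide_right_mono)
      have E: "E > 0" "E \<le> 1" using 3 by (simp_all add: E_def)
      define W where "W = 2 * P * C1 * t powr (\<sigma> - \<alpha> - 2) * ((1 + \<zeta>) * E)"
      have W0: "W \<ge> 0" using P C1 z E by (simp add: W_def)
      have "?I \<le> (\<integral>\<^sup>+u. ennreal W * ennreal (exp (- ((1 - u) / 4 * \<zeta>))) \<partial>bessel_measure \<alpha>)"
      proof (rule nn_integral_mono_AE, rule AE_mp[OF AE_bessel_measure], rule AE_I2, rule impI)
        fix u :: real assume u: "0 < u \<and> u < 1"
        let ?b = "C1 * t powr (- \<alpha> - 2) * (1 + \<zeta>) * E * exp (- ((1 - u) / 4 * \<zeta>))"
        have "\<bar>mehler_deriv \<alpha> t (sqrt u) x y\<bar> \<le> ?b" "\<bar>mehler_deriv \<alpha> t (- sqrt u) x y\<bar> \<le> ?b"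
          unfolding \<zeta>_def g_def E_def using 3 x y u by (intro small; simp)+
        hence "\<bar>mehler_deriv \<alpha> t (sqrt u) x y\<bar> + \<bar>mehler_deriv \<alpha> t (- sqrt u) x y\<bar> \<le> 2 * ?b" by simp
        hence "\<bar>\<psi> t\<bar> * (\<bar>mehler_deriv \<alpha> t (sqrt u) x y\<bar> + \<bar>mehler_deriv \<alpha> t (- sqrt u) x y\<bar>) \<le> P * t powr \<sigma> * (2 * ?b)"
          using \<psi>1[of t] 3 P by (intro mult_mono) auto
        also have "\<dots> = 2 * P * C1 * (t powr \<sigma> * t powr (- \<alpha> - 2)) * ((1 + \<zeta>) * E) * exp (- ((1 - u) / 4 * \<zeta>))"
          by (simp only: mult_ac)
        also have "t powr \<sigma> * t powr (- \<alpha> - 2) = t powr (\<sigma> - \<alpha> - 2)" by (simp add: powr_add[symmetric] algebra_simps)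
        finally have "\<bar>\<psi> t\<bar> * (\<bar>mehler_deriv \<alpha> t (sqrt u) x y\<bar> + \<bar>mehler_deriv \<alpha> t (- sqrt u) x y\<bar>) \<le> W * exp (- ((1 - u) / 4 * \<zeta>))"
          by (simp only: W_def)
        hence "ennreal (\<bar>\<psi> t\<bar> * (\<bar>mehler_deriv \<alpha> t (sqrt u) x y\<bar> + \<bar>mehler_deriv \<alpha> t (- sqrt u) x y\<bar>)) \<le> ennreal (W * exp (- ((1 - u) / 4 * \<zeta>)))"
          by (rule ennreal_leI)
        thus "ennreal (indicator {0<..} t * \<bar>\<psi> t\<bar> * (\<bar>mehler_deriv \<alpha> t (sqrt u) x y\<bar> + \<bar>mehler_deriv \<alpha> t (- sqrt u) x y\<bar>))
          \<le> ennreal W * ennreal (exp (- ((1 - u) / 4 * \<zeta>)))"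
          using 3 W0 by (simp add: ennreal_mult')
      qed
      also have "\<dots> = ennreal W * U \<zeta>" unfolding U_def by (rule nn_integral_cmult) measurable
      finally have IW: "?I \<le> ennreal W * U \<zeta>" .
      show ?thesis
      proof (cases "(x / 4 \<le> y \<and> y \<le> 4 * x) \<and> t \<le> x")
        case False
        \<comment> \<open>Far from the diagonal the Gaussian absorbs the growth in \<zeta>.
          Otherwise t > x with x comparable to the maximum; then \<zeta> \<le> 2 and the cutoff
          \<open>m\<close> is bounded below.\<close>
        have key: "(1 + \<zeta>) * E \<le> Kf * m X t"
        proof (cases "x / 4 \<le> y \<and> y \<le> 4 * x")
          case True
          hence tx: "x < t" using False by auto
          have "X \<le> 4 * x" using True x by (auto simp: X_def)
          hence tX: "X / 4 \<le> t" using tx by simp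
          have "g \<le> sqrt (x * (4 * x))" unfolding g_def using True x by (intro real_sqrt_le_mono mult_left_mono) auto
          also have "\<dots> = 2 * x" using x by (simp add: real_sqrt_mult)
          finally have "\<zeta> \<le> 2" using tx 3 by (simp add: \<zeta>_def field_simps)
          hence "(1 + \<zeta>) * E \<le> 3 * 1" using E z by (intro mult_mono) auto
          also have "3 * 1 \<le> 3 * (4 powr D1 * m X t)"
          proof (rule mult_left_mono)
            have "(1 / 4) powr D1 \<le> (t / X) powr D1" using tX X D1 3 by (intro powr_mono2) (auto simp: field_simps)
            hence "1 \<le> 4 powr D1 * (t / X) powr D1" by (simp add: powr_divide field_simps)
            moreover have "1 \<le> 4 powr D1" using D1 by (simp add: ge_one_powr_ge_zero)
            ultimately show "1 \<le> 4 powr D1 * m X t" by (simp add: m_def min_def)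
          qed simp
          also have "\<dots> \<le> Kf * m X t"
          proof -
            have "0 \<le> m X t" by (simp add: m_def)
            moreover have "3 * 4 powr D1 \<le> Kf" by (simp add: Kf_def)
            ultimately show ?thesis using mult_right_mono[of "3 * 4 powr D1" Kf "m X t"] by simp
          qed
          finally show ?thesis .
        next
          case F: False
          have "X / 4 \<le> (sqrt x - sqrt y)\<^sup>2" unfolding X_def by (rule sqrt_diff_square_far[OF x y F])
          hence "X / 4 / (4 * t) \<le> (sqrt x - sqrt y)\<^sup>2 / (4 * t)" using 3 by (intro divide_right_mono) auto
          hence "E \<le> exp (- ((X / t) / 16))" by (simp add: E_def)
          hence "(1 + \<zeta>) * E \<le> (1 + X / t) * exp (- ((X / t) / 16))" using zX z E by (intro mult_mono) auto
          also have "\<dots> \<le> 32 * (1 + D1 powr D1 * 32 powr D1) * min 1 ((X / t) powr (- D1))"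
            using X 3 D1 by (intro exp_linear_le_min_powr) auto
          also have "(X / t) powr (- D1) = (t / X) powr D1" using X 3 by (simp add: powr_divide powr_minus_divide)
          also have "32 * (1 + D1 powr D1 * 32 powr D1) * min 1 ((t / X) powr D1) \<le> Kf * m X t"
            unfolding m_def by (intro mult_right_mono) (auto simp: Kf_def)
          finally show ?thesis .
        qed
        \<comment> \<open>Uses t \<le> 1 and \<alpha> + 1 - D \<le> \<sigma>; in the application the
          latter is the upper bound on a + b.\<close>
        have "t powr (\<sigma> - \<alpha> - 2) \<le> t powr (- D - 1)" using 3 \<tau> by (intro powr_mono') auto
        hence "2 * P * C1 * t powr (\<sigma> - \<alpha> - 2) \<le> 2 * P * C1 * t powr (- D - 1)"
          using P C1 by (intro mult_left_mono) auto
        from mult_mono[OF this key] have "W \<le> 2 * P * C1 * t powr (- D - 1) * (Kf * m X t)"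
          unfolding W_def using P C1 z E by simp
        hence "W * C3 \<le> 2 * P * C1 * t powr (- D - 1) * (Kf * m X t) * C3" using C3 by (intro mult_right_mono) auto
        also have "\<dots> = K1 * (t powr (- D - 1) * m X t)" by (simp only: K1_def mult_ac)
        finally have WC: "W * C3 \<le> K1 * (t powr (- D - 1) * m X t)" .
        have "?I \<le> ennreal W * ennreal C3" using IW mult_left_mono[OF U1[OF less_imp_le[OF z]], of "ennreal W"] by (rule order_trans) simp
        also have "\<dots> = ennreal (W * C3)" using W0 by (rule ennreal_mult'[symmetric])
        also have "\<dots> \<le> ennreal (K1 * (t powr (- D - 1) * m X t))" by (rule ennreal_leI[OF WC])
        also have "\<dots> = ?A" using 3 K by (simp add: X_def ennreal_mult')
        finally show ?thesis by (rule order_trans) (simp add: add.assoc)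
      next
        case True
        hence near: "x / 4 \<le> y" "y \<le> 4 * x" "t \<le> x" by auto
        have z2: "x / t \<le> 2 * \<zeta>" "\<zeta> \<le> 2 * (x / t)"
        proof -
          have "sqrt (x * (x / 4)) \<le> g" unfolding g_def using near x by (intro real_sqrt_le_mono mult_left_mono) auto
          moreover have "sqrt (x * (x / 4)) = x / 2" using x by (simp add: real_sqrt_mult real_sqrt_divide)
          moreover have "g \<le> sqrt (x * (4 * x))" unfolding g_def using near x by (intro real_sqrt_le_mono mult_left_mono) auto
          moreover have "sqrt (x * (4 * x)) = 2 * x" using x by (simp add: real_sqrt_mult)
          ultimately show "x / t \<le> 2 * \<zeta>" "\<zeta> \<le> 2 * (x / t)" using 3 by (simp_all add: \<zeta>_def field_simps)
        qed
        have xt: "x / t \<ge> 1" using near 3 by simp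
        \<comment> \<open>\<zeta> lies between x/(2t) and 2x/t. The sign of 1 - \<kappa> = -
          \<alpha> - 1/2 depends on \<alpha>, so either the upper or the lower comparison is used,
          with the common constant \<open>2 powr \<bar>1 - \<kappa>\<bar>\<close>.\<close>
        have zk: "(1 + \<zeta>) * \<zeta> powr (- \<kappa>) \<le> 3 * 2 powr \<bar>1 - \<kappa>\<bar> * (x / t) powr (1 - \<kappa>)"
        proof -
          have "1 + \<zeta> \<le> 3 * \<zeta>" using z2(1) xt by linarith
          hence "(1 + \<zeta>) * \<zeta> powr (- \<kappa>) \<le> 3 * \<zeta> * \<zeta> powr (- \<kappa>)" by (intro mult_right_mono) auto
          also have "\<dots> = 3 * \<zeta> powr (1 - \<kappa>)" using z by (simp add: powr_diff powr_minus_divide)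
          also have "\<zeta> powr (1 - \<kappa>) \<le> 2 powr \<bar>1 - \<kappa>\<bar> * (x / t) powr (1 - \<kappa>)"
          proof (cases "1 - \<kappa> \<ge> 0")
            case True
            have "\<zeta> powr (1 - \<kappa>) \<le> (2 * (x / t)) powr (1 - \<kappa>)" using z z2 True by (intro powr_mono2) auto
            also have "\<dots> = 2 powr (1 - \<kappa>) * (x / t) powr (1 - \<kappa>)" by (rule powr_mult)
            finally show ?thesis using True by simp
          next
            case False
            have "\<zeta> powr (1 - \<kappa>) \<le> (1 / 2 * (x / t)) powr (1 - \<kappa>)" using xt z2 False by (intro powr_mono2') auto
            also have "\<dots> = (1 / 2) powr (1 - \<kappa>) * (x / t) powr (1 - \<kappa>)" by (rule powr_mult)
            also have "(1 / 2) powr (1 - \<kappa>) = 2 powr (\<kappa> - 1)"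
              using powr_minus_divide[of 2 "1 - \<kappa>"] by (simp add: powr_divide)
            finally show ?thesis using False by simp
          qed
          finally show ?thesis by simp
        qed
        have Eb: "E \<le> 36 * (x * t / (x * t + (x - y)\<^sup>2))"
          unfolding E_def by (rule exp_sqrt_diff_square_near[OF x y near(2) 3(1)])
        define Q where "Q = x * t / (x * t + (x - y)\<^sup>2)"
        have Q: "Q \<ge> 0" using x 3 by (simp add: Q_def)
        have "W * (C3 * \<zeta> powr (- \<kappa>)) = 2 * P * C1 * C3 * t powr (\<sigma> - \<alpha> - 2) * (((1 + \<zeta>) * \<zeta> powr (- \<kappa>)) * E)"
          by (simp only: W_def mult_ac)
        also have "\<dots> \<le> 2 * P * C1 * C3 * t powr (\<sigma> - \<alpha> - 2) * ((3 * 2 powr \<bar>1 - \<kappa>\<bar> * (x / t) powr (1 - \<kappa>)) * (36 * Q))"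
        proof (rule mult_left_mono)
          show "((1 + \<zeta>) * \<zeta> powr (- \<kappa>)) * E \<le> (3 * 2 powr \<bar>1 - \<kappa>\<bar> * (x / t) powr (1 - \<kappa>)) * (36 * Q)"
            using E z by (intro mult_mono[OF zk Eb[folded Q_def]]) auto
        qed (use P C1 C3 in simp)
        also have "\<dots> = K2 * (t powr (\<sigma> - \<alpha> - 2) * (x / t) powr (1 - \<kappa>)) * Q" by (simp only: K2_def mult_ac)
        \<comment> \<open>(x/t)^(1 - \<kappa>) is split into (x/t)^(-\<alpha> - 1), which with the
          power of t forms x^(-D) times the weight, and (x/t)^(1/2), which belongs to the
          profile.\<close>
        also have "t powr (\<sigma> - \<alpha> - 2) * (x / t) powr (1 - \<kappa>) = x powr (- D) * (x powr (- (\<alpha> + 1 - D)) * t powr (\<sigma> - 1)) * (x / t) powr (1 / 2)"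
        proof -
          have "x powr (- D) * x powr (- (\<alpha> + 1 - D)) = x powr (- (\<alpha> + 1))" by (simp flip: powr_add)
          moreover have "(x / t) powr (1 - \<kappa>) = (x / t) powr (- (\<alpha> + 1)) * (x / t) powr (1 / 2)"
            by (simp add: \<kappa>_def powr_add[symmetric])
          moreover have "t powr (\<sigma> - \<alpha> - 2) * (x / t) powr (- (\<alpha> + 1)) = x powr (- (\<alpha> + 1)) * t powr (\<sigma> - 1)"
          proof -
            have "(x / t) powr (- (\<alpha> + 1)) = x powr (- (\<alpha> + 1)) * t powr (\<alpha> + 1)"
              using x 3 by (simp add: powr_divide powr_minus_divide del: minus_add_distrib)
            moreover have "t powr (\<sigma> - \<alpha> - 2) * t powr (\<alpha> + 1) = t powr (\<sigma> - 1)" by (simp flip: powr_add)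
            ultimately show ?thesis by (metis mult.commute mult.left_commute)
          qed
          ultimately show ?thesis by (metis mult.assoc)
        qed
        also have "K2 * (x powr (- D) * (x powr (- (\<alpha> + 1 - D)) * t powr (\<sigma> - 1)) * (x / t) powr (1 / 2)) * Q = K2 * x powr (- D) * ?near x y t"
          using near x y 3 by (simp add: near_weight_def near_profile_def Q_def)
        finally have WC: "W * (C3 * \<zeta> powr (- \<kappa>)) \<le> K2 * x powr (- D) * ?near x y t" .
        have "?I \<le> ennreal W * ennreal (C3 * \<zeta> powr (- \<kappa>))" using IW mult_left_mono[OF U2[OF z], of "ennreal W"] by (rule order_trans) simp
        also have "\<dots> = ennreal (W * (C3 * \<zeta> powr (- \<kappa>)))" using W0 by (rule ennreal_mult'[symmetric])
        also have "\<dots> \<le> ennreal (K2 * x powr (- D) * ?near x y t)" by (rule ennreal_leI[OF WC])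
        also have "\<dots> = ?B" using K by (intro ennreal_mult') simp
        finally show ?thesis by (rule order_trans) (simp add: add_increasing add_increasing2)
      qed
    qed
  qed
  define C where "C = K1 * (1 + 1 / D) + K2 + K3 * 2"
  have C: "C > 0" using K D by (auto simp: C_def intro!: add_pos_pos mult_pos_pos)
  have "mehler_abs \<alpha> \<psi> x y \<le> ennreal C * (ennreal (max x y powr (- D)) + ennreal (x powr (- D)) * near_kernel \<sigma> (\<alpha> + 1 - D) UNIV x y)"
    if x: "x > 0" and y: "y > 0" for x y
  proof -
    have X: "max x y > 0" using x by (simp add: less_max_iff_disj)
    let ?X = "max x y"
    have "mehler_abs \<alpha> \<psi> x y \<le> (\<integral>\<^sup>+t. ennreal K1 * (ennreal (t powr (- D - 1) * m ?X t) * indicator {0<..} t)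
       + ennreal (K2 * x powr (- D)) * ennreal (?near x y t)
       + ennreal (K3 * ?X powr (- D)) * (ennreal (t powr 0) * ennreal (exp (- (1 / 2) * t)) * indicator {0<..} t) \<partial>lborel)"
      unfolding mehler_abs_def by (rule nn_integral_mono) (rule inner[OF x y])
    also have "\<dots> = (\<integral>\<^sup>+t. ennreal K1 * (ennreal (t powr (- D - 1) * m ?X t) * indicator {0<..} t)
       + ennreal (K2 * x powr (- D)) * ennreal (?near x y t) \<partial>lborel)
       + (\<integral>\<^sup>+t. ennreal (K3 * ?X powr (- D)) * (ennreal (t powr 0) * ennreal (exp (- (1 / 2) * t)) * indicator {0<..} t) \<partial>lborel)"
      unfolding m_def by (rule nn_integral_add) measurable
    also have "(\<integral>\<^sup>+t. ennreal K1 * (ennreal (t powr (- D - 1) * m ?X t) * indicator {0<..} t)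
       + ennreal (K2 * x powr (- D)) * ennreal (?near x y t) \<partial>lborel) =
       (\<integral>\<^sup>+t. ennreal K1 * (ennreal (t powr (- D - 1) * m ?X t) * indicator {0<..} t) \<partial>lborel)
       + (\<integral>\<^sup>+t. ennreal (K2 * x powr (- D)) * ennreal (?near x y t) \<partial>lborel)"
      unfolding m_def by (rule nn_integral_add) measurable
    also have "(\<integral>\<^sup>+t. ennreal K1 * (ennreal (t powr (- D - 1) * m ?X t) * indicator {0<..} t) \<partial>lborel) =
       ennreal K1 * (\<integral>\<^sup>+t. ennreal (t powr (- D - 1) * m ?X t) * indicator {0<..} t \<partial>lborel)"
      unfolding m_def by (rule nn_integral_cmult) measurable
    also have "(\<integral>\<^sup>+t. ennreal (K2 * x powr (- D)) * ennreal (?near x y t) \<partial>lborel) = ennreal (K2 * x powr (- D)) * near_kernel \<sigma> (\<alpha> + 1 - D) UNIV x y"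
      unfolding near_kernel_def by (rule nn_integral_cmult) measurable
    also have "(\<integral>\<^sup>+t. ennreal (K3 * ?X powr (- D)) * (ennreal (t powr 0) * ennreal (exp (- (1 / 2) * t)) * indicator {0<..} t) \<partial>lborel) =
      ennreal (K3 * ?X powr (- D)) * (\<integral>\<^sup>+t. ennreal (t powr 0) * ennreal (exp (- (1 / 2) * t)) * indicator {0<..} t \<partial>lborel)"
      by (rule nn_integral_cmult) measurable
    also have "(\<integral>\<^sup>+t. ennreal (t powr 0) * ennreal (exp (- (1 / 2) * t)) * indicator {0<..} t \<partial>lborel) = (\<integral>\<^sup>+t. ennreal (exp (- (1 / 2) * t)) \<partial>halfline_measure 0)"
      by (rule nn_integral_halfline_measure[symmetric], rule measurable_halfline_measure) measurable
    also have "\<dots> = ennreal 2"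
      using nn_integral_exp_halfline_measure[of "1 / 2" 0] by (simp add: powr_minus_divide)
    also have "ennreal K1 * (\<integral>\<^sup>+t. ennreal (t powr (- D - 1) * m ?X t) * indicator {0<..} t \<partial>lborel) + ennreal (K2 * x powr (- D)) * near_kernel \<sigma> (\<alpha> + 1 - D) UNIV x y + ennreal (K3 * ?X powr (- D)) * ennreal 2
      \<le> ennreal K1 * ennreal ((1 + 1 / D) * ?X powr (- D)) + ennreal (K2 * x powr (- D)) * near_kernel \<sigma> (\<alpha> + 1 - D) UNIV x y + ennreal (K3 * ?X powr (- D)) * ennreal 2"
      unfolding m_def D1_def by (intro add_right_mono mult_left_mono nn_integral_powr_min_le D X) simp
    also have "\<dots> = ennreal (K1 * (1 + 1 / D) + K3 * 2) * ennreal (?X powr (- D)) + ennreal K2 * (ennreal (x powr (- D)) * near_kernel \<sigma> (\<alpha> + 1 - D) UNIV x y)"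
    proof -
      have e1: "ennreal K1 * ennreal ((1 + 1 / D) * ?X powr (- D)) = ennreal (K1 * (1 + 1 / D) * ?X powr (- D))"
        using K by (simp only: ennreal_mult'[symmetric] less_imp_le mult.assoc)
      have e2: "ennreal (K3 * ?X powr (- D)) * ennreal 2 = ennreal (K3 * 2 * ?X powr (- D))"
      proof -
        have "K3 * ?X powr (- D) * 2 = K3 * 2 * ?X powr (- D)" by simp
        moreover have "0 \<le> K3 * ?X powr (- D)" using K by simp
        ultimately show ?thesis by (metis ennreal_mult')
      qed
      have e3: "ennreal (K2 * x powr (- D)) = ennreal K2 * ennreal (x powr (- D))" using K by (intro ennreal_mult') simp
      have e4: "ennreal (K1 * (1 + 1 / D) * ?X powr (- D)) + ennreal (K3 * 2 * ?X powr (- D)) = ennreal (K1 * (1 + 1 / D) + K3 * 2) * ennreal (?X powr (- D))"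
        using K D by (subst ennreal_plus[symmetric]) (auto simp: ennreal_mult'[symmetric] distrib_right)
      have e5: "u + v + w = (u + w) + v" for u v w :: ennreal by (simp only: add_ac)
      show ?thesis unfolding e1 e2 e3 by (subst e5, subst e4) (simp only: mult.assoc)
    qed
    also have "\<dots> \<le> ennreal C * ennreal (?X powr (- D)) + ennreal C * (ennreal (x powr (- D)) * near_kernel \<sigma> (\<alpha> + 1 - D) UNIV x y)"
      using K D by (intro add_mono mult_right_mono ennreal_leI) (auto simp: C_def)
    finally show ?thesis by (simp only: distrib_left)
  qed
  thus ?thesis using C by blast
qed

section \<open>Decay of the Laguerre functions and differentiation of the eigenvalue
  relation\<close>

text \<open>In the generating function at -x all terms are nonnegative, so each is bounded by the
  sum. At w = 1/5 the exponent x w/(1 - w) is x/4, half of what exp(-x/2) can absorb.\<close>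

lemma abs_laguerre_fun_le:
  assumes \<alpha>: "\<alpha> > -1"
  shows "\<exists>C\<ge>0. \<forall>x\<ge>0. \<bar>laguerre_fun \<alpha> k x\<bar> \<le> C * exp (- x / 4)"
proof -
  define G where "G = sqrt (fact k / Gamma (real k + \<alpha> + 1))"
  define c where "c = (1 - 1 / 5) powr (- \<alpha> - 1) * 5 ^ k"
  have G: "G \<ge> 0" unfolding G_def using \<alpha> by (intro real_sqrt_ge_zero divide_nonneg_nonneg Gamma_real_nonneg) auto
  have c: "c \<ge> 0" by (simp add: c_def)
  have "\<bar>laguerre_fun \<alpha> k x\<bar> \<le> (G * c) * exp (- x / 4)" if x: "x \<ge> 0" for x
  proof -
    have pos: "laguerre \<alpha> j (- x) \<ge> 0" for j using abs_laguerre_le[OF \<alpha> x, of j] by linarith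
    have s: "(\<lambda>j. laguerre \<alpha> j (- x) * (1 / 5) ^ j) sums ((1 - 1 / 5) powr (- \<alpha> - 1) * exp (- (- x) * (1 / 5) / (1 - 1 / 5)))"
      by (rule laguerre_generating_function[OF \<alpha>]) simp
    have "(\<Sum>j<Suc k. laguerre \<alpha> j (- x) * (1 / 5) ^ j) \<le> (1 - 1 / 5) powr (- \<alpha> - 1) * exp (- (- x) * (1 / 5) / (1 - 1 / 5))"
      using sum_le_suminf[OF sums_summable[OF s], of "{..<Suc k}"] pos sums_unique[OF s] by simp
    moreover have "0 \<le> (\<Sum>j<k. laguerre \<alpha> j (- x) * (1 / 5) ^ j)" using pos by (intro sum_nonneg) simp
    ultimately have "laguerre \<alpha> k (- x) * (1 / 5) ^ k \<le> (1 - 1 / 5) powr (- \<alpha> - 1) * exp (x / 4)" by simp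
    hence "laguerre \<alpha> k (- x) \<le> c * exp (x / 4)"
      by (simp add: c_def power_one_over field_simps)
    hence L: "\<bar>laguerre \<alpha> k x\<bar> \<le> c * exp (x / 4)" using abs_laguerre_le[OF \<alpha> x, of k] by linarith
    have "\<bar>laguerre_fun \<alpha> k x\<bar> = G * exp (- x / 2) * \<bar>laguerre \<alpha> k x\<bar>"
      using G by (simp add: laguerre_fun_def G_def[symmetric] abs_mult)
    also have "\<dots> \<le> G * exp (- x / 2) * (c * exp (x / 4))" using G by (intro mult_left_mono L) auto
    also have "\<dots> = (G * c) * (exp (- x / 2) * exp (x / 4))" by (simp only: mult_ac)
    also have "exp (- x / 2) * exp (x / 4) = exp (- x / 4)" by (simp flip: exp_add)
    finally show ?thesis .
  qed
  thus ?thesis using G c by (intro exI[of _ "G * c"]) auto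
qed

lemma laguerre_sum_bound:
  assumes \<alpha>: "\<alpha> > -1"
  shows "\<exists>C\<ge>0. \<forall>x\<ge>0. \<bar>\<Sum>k<N. c k * laguerre_fun \<alpha> k x\<bar> \<le> C * exp (- x / 4)"
proof -
  obtain B where B: "\<And>k. B k \<ge> 0" "\<And>k x. x \<ge> 0 \<Longrightarrow> \<bar>laguerre_fun \<alpha> k x\<bar> \<le> B k * exp (- x / 4)"
    using abs_laguerre_fun_le[OF \<alpha>] by metis
  have "\<bar>\<Sum>k<N. c k * laguerre_fun \<alpha> k x\<bar> \<le> (\<Sum>k<N. \<bar>c k\<bar> * B k) * exp (- x / 4)" if "x \<ge> 0" for x
  proof -
    have "\<bar>\<Sum>k<N. c k * laguerre_fun \<alpha> k x\<bar> \<le> (\<Sum>k<N. \<bar>c k * laguerre_fun \<alpha> k x\<bar>)" by (rule sum_abs)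
    also have "\<dots> \<le> (\<Sum>k<N. \<bar>c k\<bar> * (B k * exp (- x / 4)))"
      unfolding abs_mult by (intro sum_mono mult_left_mono B that) auto
    finally show ?thesis by (simp add: sum_distrib_right mult.assoc)
  qed
  moreover have "0 \<le> (\<Sum>k<N. \<bar>c k\<bar> * B k)" using B by (intro sum_nonneg mult_nonneg_nonneg) auto
  ultimately show ?thesis by blast
qed

lemma exp_bounded_in_Lp_space:
  assumes fm: "f \<in> borel_measurable borel" and f: "\<And>x. x \<ge> 0 \<Longrightarrow> \<bar>f x\<bar> \<le> C * exp (- x / 4)"
    and C: "C \<ge> 0" and r: "r > 0" and \<gamma>: "\<gamma> > -1"
  shows "f \<in> Lp_space r (halfline_measure \<gamma>)"
proof -
  have m: "(\<lambda>x. \<bar>f x\<bar> powr r) \<in> borel_measurable (halfline_measure \<gamma>)"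
    by (rule measurable_halfline_measure) (use fm in measurable)
  have "(\<integral>\<^sup>+x. ennreal (\<bar>f x\<bar> powr r) \<partial>halfline_measure \<gamma>) \<le> (\<integral>\<^sup>+x. ennreal (C powr r) * ennreal (exp (- (r / 4) * x)) \<partial>halfline_measure \<gamma>)"
  proof (rule nn_integral_mono)
    fix x assume "x \<in> space (halfline_measure \<gamma>)"
    hence x: "x > 0" by simp
    have "\<bar>f x\<bar> powr r \<le> (C * exp (- x / 4)) powr r" using f[of x] x r by (intro powr_mono2) auto
    also have "\<dots> = C powr r * exp (- (r / 4) * x)" by (simp add: powr_mult powr_def[of "exp _"])
    finally show "ennreal (\<bar>f x\<bar> powr r) \<le> ennreal (C powr r) * ennreal (exp (- (r / 4) * x))"
      by (simp add: ennreal_mult'[symmetric] ennreal_leI)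
  qed
  also have "\<dots> = ennreal (C powr r) * (\<integral>\<^sup>+x. ennreal (exp (- (r / 4) * x)) \<partial>halfline_measure \<gamma>)"
    by (intro nn_integral_cmult measurable_halfline_measure) measurable
  also have "\<dots> < \<infinity>"
    using nn_integral_exp_halfline_measure[of "r / 4" \<gamma>] r \<gamma> by (simp add: ennreal_mult_less_top)
  finally have "integrable (halfline_measure \<gamma>) (\<lambda>x. \<bar>f x\<bar> powr r)"
    by (intro integrableI_nonneg m) auto
  thus ?thesis using fm by (simp add: Lp_space_def measurable_halfline_measure)
qed

text \<open>The eigenvalue relation of the semigroup is differentiated under the integral. By the
  mean value theorem the difference quotients are values of the derivative at intermediate times in
  [t, t + 1], hence dominated.\<close>

lemma mehler_deriv_laguerre_integral:
  assumes \<alpha>: "\<alpha> > -1" and t: "t > 0" and x: "x > 0"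
  shows "has_bochner_integral (halfline_measure \<alpha> \<Otimes>\<^sub>M bessel_measure \<alpha>)
     (\<lambda>(y, u). (mehler_deriv \<alpha> t (sqrt u) x y + mehler_deriv \<alpha> t (- sqrt u) x y) / 2 * laguerre_fun \<alpha> k y)
     (sqrt pi * Gamma (\<alpha> + 3 / 2) * (- real k * exp (- (real k * t)) * laguerre_fun \<alpha> k x))"
proof -
  let ?M = "halfline_measure \<alpha> \<Otimes>\<^sub>M bessel_measure \<alpha>"
  interpret B: sigma_finite_measure "bessel_measure \<alpha>" by (rule sigma_finite_bessel_measure)
  interpret H: sigma_finite_measure "halfline_measure \<alpha>" by (rule sigma_finite_halfline_measure)
  interpret P: pair_sigma_finite "halfline_measure \<alpha>" "bessel_measure \<alpha>" ..
  define c where "c = sqrt pi * Gamma (\<alpha> + 3 / 2)"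
  define m where "m = (\<lambda>t (y, u). (mehler \<alpha> t (sqrt u) x y + mehler \<alpha> t (- sqrt u) x y) / 2 * laguerre_fun \<alpha> k y)"
  define m' where "m' = (\<lambda>t (y, u). (mehler_deriv \<alpha> t (sqrt u) x y + mehler_deriv \<alpha> t (- sqrt u) x y) / 2 * laguerre_fun \<alpha> k y)"
  have der: "((\<lambda>t. m t z) has_real_derivative m' t z) (at t)" if "t > 0" for t z
    unfolding m_def m'_def case_prod_unfold
    by (intro DERIV_cmult_right DERIV_cdivide DERIV_add mehler_has_real_derivative that)
  have mint: "has_bochner_integral ?M (m t) (c * (exp (- (real k * t)) * laguerre_fun \<alpha> k x))" if "t > 0" for t
    unfolding m_def c_def by (rule mehler_laguerre_integral[OF \<alpha> that x])
  have m'm: "m' t \<in> borel_measurable ?M"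
    unfolding m'_def by (rule measurable_halfline_bessel) measurable
  obtain C where C: "\<And>t' y s. t \<le> t' \<Longrightarrow> t' \<le> t + 1 \<Longrightarrow> y \<ge> 0 \<Longrightarrow> \<bar>s\<bar> \<le> 1 \<Longrightarrow> \<bar>mehler_deriv \<alpha> t' s x y\<bar> \<le> C * (1 + sqrt (x * y))"
    using mehler_deriv_bound_local[OF \<alpha> t, of "t + 1"] x by (metis less_imp_le)
  obtain Cl where Cl: "Cl \<ge> 0" "\<And>y. y \<ge> 0 \<Longrightarrow> \<bar>laguerre_fun \<alpha> k y\<bar> \<le> Cl * exp (- y / 4)"
    using abs_laguerre_fun_le[OF \<alpha>] by blast
  define C' where "C' = \<bar>C\<bar> * (1 + x + 8) * Cl"
  have C'0: "C' \<ge> 0" using Cl x by (simp add: C'_def)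
  define w where "w = (\<lambda>(y, u :: real). C' * exp (- (1 / 8) * y))"
  have AEz: "AE z in ?M. 0 < fst z \<and> 0 < snd z \<and> snd z < 1"
  proof (rule P.AE_pair_measure)
    have "fst \<in> borel_measurable ?M" "snd \<in> borel_measurable ?M"
      by (rule measurable_halfline_bessel, measurable)+
    thus "{z \<in> space ?M. 0 < fst z \<and> 0 < snd z \<and> snd z < 1} \<in> sets ?M" by measurable
    show "AE y in halfline_measure \<alpha>. AE u in bessel_measure \<alpha>. 0 < fst (y, u) \<and> 0 < snd (y, u) \<and> snd (y, u) < 1"
    proof (rule AE_I2)
      fix y assume "y \<in> space (halfline_measure \<alpha>)"
      thus "AE u in bessel_measure \<alpha>. 0 < fst (y, u) \<and> 0 < snd (y, u) \<and> snd (y, u) < 1"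
        using AE_bessel_measure[of \<alpha>] by simp
    qed
  qed
  have m'w: "\<bar>m' t' z\<bar> \<le> w z" if t': "t \<le> t'" "t' \<le> t + 1" and z: "0 < fst z \<and> 0 < snd z \<and> snd z < 1" for t' z
  proof (cases z)
    case (Pair y u)
    have y: "y > 0" and u: "0 < u" "u < 1" using z by (auto simp: Pair)
    have su: "\<bar>sqrt u\<bar> \<le> 1" "\<bar>- sqrt u\<bar> \<le> 1" using u by auto
    have "sqrt (x * y) \<le> (x + y) / 2" using x y by (intro arith_geo_mean_sqrt) auto
    hence s1: "1 + sqrt (x * y) \<le> 1 + x + y" using x y by simp
    \<comment> \<open>Only half of the decay exp(-y/4) of the Laguerre function is spent on the
      growth in y; exp(-y/8) remains for integrability.\<close>
    have "1 + x + y \<le> (1 + x + 8) * exp (y / 8)"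
    proof -
      have e: "1 + y / 8 \<le> exp (y / 8)" by (rule exp_ge_add_one_self)
      hence "(1 + x) * 1 \<le> (1 + x) * exp (y / 8)" using x y by (intro mult_left_mono) auto
      moreover have "y \<le> 8 * exp (y / 8)" using e by linarith
      ultimately show ?thesis by (simp add: distrib_right)
    qed
    hence s2: "1 + sqrt (x * y) \<le> (1 + x + 8) * exp (y / 8)" using s1 by linarith
    have d: "\<bar>mehler_deriv \<alpha> t' s x y\<bar> \<le> \<bar>C\<bar> * ((1 + x + 8) * exp (y / 8))" if "\<bar>s\<bar> \<le> 1" for s
    proof -
      have "\<bar>mehler_deriv \<alpha> t' s x y\<bar> \<le> C * (1 + sqrt (x * y))" using C[OF t' _ that, of y] y by simp
      also have "\<dots> \<le> \<bar>C\<bar> * (1 + sqrt (x * y))" using x y by (intro mult_right_mono) auto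
      also have "\<dots> \<le> \<bar>C\<bar> * ((1 + x + 8) * exp (y / 8))" by (intro mult_left_mono s2) auto
      finally show ?thesis .
    qed
    have "\<bar>m' t' z\<bar> = \<bar>mehler_deriv \<alpha> t' (sqrt u) x y + mehler_deriv \<alpha> t' (- sqrt u) x y\<bar> / 2 * \<bar>laguerre_fun \<alpha> k y\<bar>"
      by (simp add: m'_def Pair abs_mult)
    also have "\<dots> \<le> (\<bar>C\<bar> * ((1 + x + 8) * exp (y / 8))) * (Cl * exp (- y / 4))"
    proof (rule mult_mono)
      show "\<bar>mehler_deriv \<alpha> t' (sqrt u) x y + mehler_deriv \<alpha> t' (- sqrt u) x y\<bar> / 2 \<le> \<bar>C\<bar> * ((1 + x + 8) * exp (y / 8))"
      proof -
        have "\<bar>mehler_deriv \<alpha> t' (sqrt u) x y + mehler_deriv \<alpha> t' (- sqrt u) x y\<bar> \<le> 2 * (\<bar>C\<bar> * ((1 + x + 8) * exp (y / 8)))"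
          using d[OF su(1)] d[OF su(2)] by linarith
        thus ?thesis by simp
      qed
    qed (use Cl y x in auto)
    also have "\<dots> = C' * (exp (y / 8) * exp (- y / 4))" by (simp only: C'_def mult_ac)
    also have "exp (y / 8) * exp (- y / 4) = exp (- (1 / 8) * y)" by (simp flip: exp_add)
    finally show ?thesis by (simp add: w_def Pair)
  qed
  have wint: "integrable ?M w"
  proof (rule integrableI_nonneg)
    show wm: "w \<in> borel_measurable ?M" unfolding w_def by (rule measurable_halfline_bessel) measurable
    show "AE z in ?M. 0 \<le> w z" using C'0 by (intro AE_I2) (auto simp: w_def split: prod.splits)
    have "(\<integral>\<^sup>+z. ennreal (w z) \<partial>?M) = (\<integral>\<^sup>+y. (\<integral>\<^sup>+u. ennreal (w (y, u)) \<partial>bessel_measure \<alpha>) \<partial>halfline_measure \<alpha>)"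
      using B.nn_integral_fst[of "\<lambda>z. ennreal (w z)" "halfline_measure \<alpha>"] wm by simp
    also have "\<dots> = (\<integral>\<^sup>+y. ennreal (C' * Beta (1 / 2) (\<alpha> + 3 / 2)) * ennreal (exp (- (1 / 8) * y)) \<partial>halfline_measure \<alpha>)"
    proof (rule nn_integral_cong)
      fix y
      have "(\<integral>\<^sup>+u. ennreal (w (y, u)) \<partial>bessel_measure \<alpha>) = (\<integral>\<^sup>+u. ennreal (C' * exp (- (1 / 8) * y)) * ennreal (u ^ 0) \<partial>bessel_measure \<alpha>)"
        by (simp add: w_def)
      also have "\<dots> = ennreal (C' * exp (- (1 / 8) * y)) * (\<integral>\<^sup>+u. ennreal (u ^ 0) \<partial>bessel_measure \<alpha>)"
        by (rule nn_integral_cmult) simp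
      also have "\<dots> = ennreal (C' * exp (- (1 / 8) * y)) * ennreal (Beta (1 / 2) (\<alpha> + 3 / 2))"
        unfolding nn_integral_power_bessel_measure[OF \<alpha>] by simp
      also have "\<dots> = ennreal (C' * exp (- (1 / 8) * y) * Beta (1 / 2) (\<alpha> + 3 / 2))"
        using C'0 by (intro ennreal_mult'[symmetric]) simp
      also have "C' * exp (- (1 / 8) * y) * Beta (1 / 2) (\<alpha> + 3 / 2) = exp (- (1 / 8) * y) * (C' * Beta (1 / 2) (\<alpha> + 3 / 2))"
        by (simp only: mult_ac)
      also have "ennreal (exp (- (1 / 8) * y) * (C' * Beta (1 / 2) (\<alpha> + 3 / 2))) = ennreal (C' * Beta (1 / 2) (\<alpha> + 3 / 2)) * ennreal (exp (- (1 / 8) * y))"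
        by (subst ennreal_mult') (simp_all add: mult.commute)
      finally show "(\<integral>\<^sup>+u. ennreal (w (y, u)) \<partial>bessel_measure \<alpha>) = ennreal (C' * Beta (1 / 2) (\<alpha> + 3 / 2)) * ennreal (exp (- (1 / 8) * y))" .
    qed
    also have "\<dots> = ennreal (C' * Beta (1 / 2) (\<alpha> + 3 / 2)) * (\<integral>\<^sup>+y. ennreal (exp (- (1 / 8) * y)) \<partial>halfline_measure \<alpha>)"
      by (intro nn_integral_cmult measurable_halfline_measure) measurable
    also have "\<dots> < \<infinity>"
      using nn_integral_exp_halfline_measure[of "1 / 8" \<alpha>] \<alpha> by (simp add: ennreal_mult_less_top)
    finally show "(\<integral>\<^sup>+z. ennreal (w z) \<partial>?M) < \<infinity>" .
  qed
  \<comment> \<open>A null sequence of increments in (0, 1], so that all intermediate times stay in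
    [t, t + 1], where the dominating bound holds.\<close>
  define h where "h = (\<lambda>n. inverse (real (Suc n)))"
  have h0: "h n > 0" "h n \<le> 1" for n by (auto simp: h_def inverse_le_1_iff)
  have hlim: "h \<longlonglongrightarrow> 0" unfolding h_def by (rule LIMSEQ_inverse_real_of_nat)
  have hat: "filterlim h (at 0) sequentially"
    using hlim h0(1) by (intro filterlim_atI) (auto intro!: always_eventually simp: less_imp_neq[symmetric])
  define s where "s = (\<lambda>n z. (m (t + h n) z - m t z) / h n)"
  have s_int: "has_bochner_integral ?M (s n) ((c * (exp (- (real k * (t + h n))) * laguerre_fun \<alpha> k x) - c * (exp (- (real k * t)) * laguerre_fun \<alpha> k x)) / h n)" for n
    unfolding s_def using t h0(1)[of n] by (intro has_bochner_integral_divide_zero has_bochner_integral_diff mint) auto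
  have lim: "(\<lambda>n. s n z) \<longlonglongrightarrow> m' t z" for z
  proof -
    have "((\<lambda>h. (m (t + h) z - m t z) / h) \<longlongrightarrow> m' t z) (at 0)"
      using der[OF t, of z] by (simp add: DERIV_def)
    from filterlim_compose[OF this hat] show ?thesis by (simp add: s_def)
  qed
  have bound: "AE z in ?M. norm (s n z) \<le> w z" for n
    using AEz
  proof eventually_elim
    case (elim z)
    have "\<exists>\<xi>. t < \<xi> \<and> \<xi> < t + h n \<and> m (t + h n) z - m t z = (t + h n - t) * m' \<xi> z"
      by (rule MVT2) (use h0(1)[of n] t der in auto)
    then obtain \<xi> where \<xi>: "t < \<xi>" "\<xi> < t + h n" "m (t + h n) z - m t z = h n * m' \<xi> z" by auto
    have "s n z = m' \<xi> z" using \<xi>(3) h0(1)[of n] by (simp add: s_def)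
    thus ?case using m'w[of \<xi> z] \<xi> h0(2)[of n] elim by simp
  qed
  have sm: "s n \<in> borel_measurable ?M" for n using s_int[of n] by (auto simp: has_bochner_integral_iff)
  have i1: "integrable ?M (m' t)"
    by (rule integrable_dominated_convergence[OF m'm sm wint AE_I2[OF lim] bound])
  have i2: "(\<lambda>n. integral\<^sup>L ?M (s n)) \<longlonglongrightarrow> integral\<^sup>L ?M (m' t)"
    by (rule integral_dominated_convergence[OF m'm sm wint AE_I2[OF lim] bound])
  have "((\<lambda>\<tau>. c * (exp (- (real k * \<tau>)) * laguerre_fun \<alpha> k x)) has_real_derivative (c * (- real k * exp (- (real k * t)) * laguerre_fun \<alpha> k x))) (at t)"
    by (auto intro!: derivative_eq_intros)
  hence "((\<lambda>h. (c * (exp (- (real k * (t + h))) * laguerre_fun \<alpha> k x) - c * (exp (- (real k * t)) * laguerre_fun \<alpha> k x)) / h) \<longlongrightarrow> c * (- real k * exp (- (real k * t)) * laguerre_fun \<alpha> k x)) (at 0)"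
    by (simp add: DERIV_def)
  from filterlim_compose[OF this hat]
  have "(\<lambda>n. integral\<^sup>L ?M (s n)) \<longlonglongrightarrow> c * (- real k * exp (- (real k * t)) * laguerre_fun \<alpha> k x)"
    using s_int by (simp add: has_bochner_integral_iff)
  hence "integral\<^sup>L ?M (m' t) = c * (- real k * exp (- (real k * t)) * laguerre_fun \<alpha> k x)"
    using i2 LIMSEQ_unique by blast
  thus ?thesis using i1 unfolding m'_def c_def by (simp add: has_bochner_integral_iff)
qed

section \<open>The multiplier kernel and its action on Laguerre functions\<close>

lemma measurable_pair_halfline:
  assumes f: "f \<in> borel_measurable (borel \<Otimes>\<^sub>M borel)" and N: "sets N = sets borel"
  shows "f \<in> borel_measurable (N \<Otimes>\<^sub>M halfline_measure \<gamma>)" "f \<in> borel_measurable (halfline_measure \<gamma> \<Otimes>\<^sub>M N)"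
proof -
  have id: "(\<lambda>x. x) \<in> halfline_measure \<gamma> \<rightarrow>\<^sub>M borel" by (rule measurable_halfline_measure) measurable
  have idN: "(\<lambda>x. x) \<in> N \<rightarrow>\<^sub>M borel" using N by (simp add: measurable_ident_sets)
  have "(\<lambda>z. (fst z, snd z)) \<in> N \<Otimes>\<^sub>M halfline_measure \<gamma> \<rightarrow>\<^sub>M borel \<Otimes>\<^sub>M borel"
    by (rule measurable_Pair[OF measurable_compose[OF measurable_fst idN] measurable_compose[OF measurable_snd id]])
  from measurable_compose[OF this f] show "f \<in> borel_measurable (N \<Otimes>\<^sub>M halfline_measure \<gamma>)" by simp
  have "(\<lambda>z. (fst z, snd z)) \<in> halfline_measure \<gamma> \<Otimes>\<^sub>M N \<rightarrow>\<^sub>M borel \<Otimes>\<^sub>M borel"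
    by (rule measurable_Pair[OF measurable_compose[OF measurable_fst id] measurable_compose[OF measurable_snd idN]])
  from measurable_compose[OF this f] show "f \<in> borel_measurable (halfline_measure \<gamma> \<Otimes>\<^sub>M N)" by simp
qed

text \<open>Holds without integrability, because the Bochner integral of a non-integrable function
  is 0.\<close>

lemma abs_integral_le_nn_integral: "ennreal \<bar>\<integral>x. f x \<partial>M\<bar> \<le> (\<integral>\<^sup>+x. ennreal \<bar>f x\<bar> \<partial>M)" for f :: "'a \<Rightarrow> real"
proof (cases "integrable M f")
  case True
  thus ?thesis using integral_norm_bound_ennreal[OF True] by simp
qed (simp add: not_integrable_integral_eq)

text \<open>Up to the normalisation of Poisson's integral, this is the integral of \<psi>(t) (d/dt)
  P_t(x,y) dt. Where the integrals diverge the value is 0 by default, and the bound by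
  \<open>mehler_abs\<close> persists.\<close>

definition laplace_kernel :: "real \<Rightarrow> (real \<Rightarrow> real) \<Rightarrow> real \<Rightarrow> real \<Rightarrow> real" where
  "laplace_kernel \<alpha> \<psi> x y = (\<integral>t. indicator {0<..} t * \<psi> t *
     (\<integral>u. (mehler_deriv \<alpha> t (sqrt u) x y + mehler_deriv \<alpha> t (- sqrt u) x y) / 2 \<partial>bessel_measure \<alpha>) \<partial>lborel)"

lemma laplace_kernel_measurable [measurable]:
  assumes [measurable]: "\<psi> \<in> borel_measurable borel"
  shows "(\<lambda>(x, y). laplace_kernel \<alpha> \<psi> x y) \<in> borel_measurable (borel \<Otimes>\<^sub>M borel)"
proof -
  interpret B: sigma_finite_measure "bessel_measure \<alpha>" by (rule sigma_finite_bessel_measure)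
  show ?thesis unfolding laplace_kernel_def by measurable
qed

lemma nn_integral_mehler_average_le:
  "(\<integral>\<^sup>+t. ennreal \<bar>indicator {0<..} t * \<psi> t * (\<integral>u. (mehler_deriv \<alpha> t (sqrt u) x y + mehler_deriv \<alpha> t (- sqrt u) x y) / 2 \<partial>bessel_measure \<alpha>)\<bar> \<partial>lborel) \<le> mehler_abs \<alpha> \<psi> x y"
  unfolding mehler_abs_def
proof (rule nn_integral_mono)
  fix t :: real
  let ?a = "\<lambda>u. (mehler_deriv \<alpha> t (sqrt u) x y + mehler_deriv \<alpha> t (- sqrt u) x y) / 2"
  have "ennreal \<bar>indicator {0<..} t * \<psi> t * (\<integral>u. ?a u \<partial>bessel_measure \<alpha>)\<bar> = ennreal \<bar>\<integral>u. indicator {0<..} t * \<psi> t * ?a u \<partial>bessel_measure \<alpha>\<bar>"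
    by simp
  also have "\<dots> \<le> (\<integral>\<^sup>+u. ennreal \<bar>indicator {0<..} t * \<psi> t * ?a u\<bar> \<partial>bessel_measure \<alpha>)"
    by (rule abs_integral_le_nn_integral)
  also have "\<dots> \<le> (\<integral>\<^sup>+u. ennreal (indicator {0<..} t * \<bar>\<psi> t\<bar> * (\<bar>mehler_deriv \<alpha> t (sqrt u) x y\<bar> + \<bar>mehler_deriv \<alpha> t (- sqrt u) x y\<bar>)) \<partial>bessel_measure \<alpha>)"
  proof (intro nn_integral_mono ennreal_leI)
    fix u
    have "\<bar>?a u\<bar> \<le> \<bar>mehler_deriv \<alpha> t (sqrt u) x y\<bar> + \<bar>mehler_deriv \<alpha> t (- sqrt u) x y\<bar>" by simp
    hence "\<bar>indicator {0<..} t * \<psi> t\<bar> * \<bar>?a u\<bar> \<le> \<bar>indicator {0<..} t * \<psi> t\<bar> * (\<bar>mehler_deriv \<alpha> t (sqrt u) x y\<bar> + \<bar>mehler_deriv \<alpha> t (- sqrt u) x y\<bar>)"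
      by (rule mult_left_mono) simp
    thus "\<bar>indicator {0<..} t * \<psi> t * ?a u\<bar> \<le> indicator {0<..} t * \<bar>\<psi> t\<bar> * (\<bar>mehler_deriv \<alpha> t (sqrt u) x y\<bar> + \<bar>mehler_deriv \<alpha> t (- sqrt u) x y\<bar>)"
      by (simp only: abs_mult abs_indicator)
  qed
  finally show "ennreal \<bar>indicator {0<..} t * \<psi> t * (\<integral>u. ?a u \<partial>bessel_measure \<alpha>)\<bar> \<le>
    (\<integral>\<^sup>+u. ennreal (indicator {0<..} t * \<bar>\<psi> t\<bar> * (\<bar>mehler_deriv \<alpha> t (sqrt u) x y\<bar> + \<bar>mehler_deriv \<alpha> t (- sqrt u) x y\<bar>)) \<partial>bessel_measure \<alpha>)" .
qed

lemma abs_laplace_kernel_le: "ennreal \<bar>laplace_kernel \<alpha> \<psi> x y\<bar> \<le> mehler_abs \<alpha> \<psi> x y"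
  unfolding laplace_kernel_def by (rule order_trans[OF abs_integral_le_nn_integral nn_integral_mehler_average_le])

text \<open>Where the majorant is finite, Fubini allows integrating over y first, which replaces the
  time derivative of the kernel by -k exp(-k t). The remaining t-integral is \<open>\<mu>\<close>,
  in the application the multiplier value. For k = 0 it vanishes whatever that value is, so this
  mode has to be restored in the operator.\<close>

lemma laplace_kernel_laguerre:
  assumes \<alpha>: "\<alpha> > -1" and x: "x > 0" and \<psi>m [measurable]: "\<psi> \<in> borel_measurable borel"
    and fin: "(\<integral>\<^sup>+y. mehler_abs \<alpha> \<psi> x y * ennreal \<bar>laguerre_fun \<alpha> k y\<bar> \<partial>halfline_measure \<alpha>) < \<infinity>"
    and m: "k > 0 \<Longrightarrow> has_bochner_integral lborel (\<lambda>t. indicator {0<..} t * (real k * exp (- (real k * t)) * \<psi> t)) \<mu>"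
  shows "(\<integral>y. laplace_kernel \<alpha> \<psi> x y * laguerre_fun \<alpha> k y \<partial>halfline_measure \<alpha>) =
    - (sqrt pi * Gamma (\<alpha> + 3 / 2)) * (if k = 0 then 0 else \<mu>) * laguerre_fun \<alpha> k x"
proof -
  interpret B: sigma_finite_measure "bessel_measure \<alpha>" by (rule sigma_finite_bessel_measure)
  interpret H: sigma_finite_measure "halfline_measure \<alpha>" by (rule sigma_finite_halfline_measure)
  interpret HL: pair_sigma_finite "halfline_measure \<alpha>" lborel ..
  interpret HB: pair_sigma_finite "halfline_measure \<alpha>" "bessel_measure \<alpha>" ..
  let ?a = "\<lambda>t u y. (mehler_deriv \<alpha> t (sqrt u) x y + mehler_deriv \<alpha> t (- sqrt u) x y) / 2"
  define c where "c = sqrt pi * Gamma (\<alpha> + 3 / 2)"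
  define A where "A = (\<lambda>t y. \<integral>u. ?a t u y \<partial>bessel_measure \<alpha>)"
  define l where "l = laguerre_fun \<alpha> k"
  define G where "G = (\<lambda>y t. indicator {0<..} t * \<psi> t * A t y * l y)"
  have [measurable]: "l \<in> borel_measurable borel" by (simp add: l_def)
  have Am: "(\<lambda>(t, y). A t y) \<in> borel_measurable (borel \<Otimes>\<^sub>M borel)" unfolding A_def by measurable
  have [measurable]: "(\<lambda>z. A (f z) (g z)) \<in> borel_measurable M" if "f \<in> borel_measurable M" "g \<in> borel_measurable M" for f g and M :: "'z measure"
    using measurable_compose[OF measurable_Pair[OF that] Am] by simp
  have Gm: "case_prod G \<in> borel_measurable (halfline_measure \<alpha> \<Otimes>\<^sub>M lborel)"
  proof -
    have [measurable]: "(\<lambda>z. l (fst z)) \<in> borel_measurable (borel \<Otimes>\<^sub>M (borel :: real measure))"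
      by (rule measurable_compose[OF measurable_fst]) measurable
    have "case_prod G \<in> borel_measurable (borel \<Otimes>\<^sub>M borel)" unfolding G_def split_beta' by measurable
    thus ?thesis by (rule measurable_pair_halfline(2)) simp
  qed
  have Gint: "integrable (halfline_measure \<alpha> \<Otimes>\<^sub>M lborel) (case_prod G)"
  proof (rule integrableI_bounded[OF Gm])
    have "(\<integral>\<^sup>+z. ennreal (norm (case_prod G z)) \<partial>(halfline_measure \<alpha> \<Otimes>\<^sub>M lborel)) = (\<integral>\<^sup>+y. (\<integral>\<^sup>+t. ennreal \<bar>G y t\<bar> \<partial>lborel) \<partial>halfline_measure \<alpha>)"
      using lborel.nn_integral_fst[of "\<lambda>z. ennreal (norm (case_prod G z))" "halfline_measure \<alpha>"] Gm by simp
    also have "\<dots> \<le> (\<integral>\<^sup>+y. mehler_abs \<alpha> \<psi> x y * ennreal \<bar>l y\<bar> \<partial>halfline_measure \<alpha>)"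
    proof (rule nn_integral_mono)
      fix y
      have "(\<integral>\<^sup>+t. ennreal \<bar>G y t\<bar> \<partial>lborel) = (\<integral>\<^sup>+t. ennreal \<bar>indicator {0<..} t * \<psi> t * A t y\<bar> * ennreal \<bar>l y\<bar> \<partial>lborel)"
        unfolding G_def by (intro nn_integral_cong) (simp add: abs_mult ennreal_mult')
      also have "\<dots> = (\<integral>\<^sup>+t. ennreal \<bar>indicator {0<..} t * \<psi> t * A t y\<bar> \<partial>lborel) * ennreal \<bar>l y\<bar>"
        by (rule nn_integral_multc) measurable
      also have "\<dots> \<le> mehler_abs \<alpha> \<psi> x y * ennreal \<bar>l y\<bar>"
        unfolding A_def by (intro mult_right_mono nn_integral_mehler_average_le) simp
      finally show "(\<integral>\<^sup>+t. ennreal \<bar>G y t\<bar> \<partial>lborel) \<le> mehler_abs \<alpha> \<psi> x y * ennreal \<bar>l y\<bar>" .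
    qed
    also have "\<dots> < \<infinity>" using fin by (simp add: l_def)
    finally show "(\<integral>\<^sup>+z. ennreal (norm (case_prod G z)) \<partial>(halfline_measure \<alpha> \<Otimes>\<^sub>M lborel)) < \<infinity>" .
  qed
  have "(\<integral>y. laplace_kernel \<alpha> \<psi> x y * l y \<partial>halfline_measure \<alpha>) = (\<integral>y. (\<integral>t. G y t \<partial>lborel) \<partial>halfline_measure \<alpha>)"
    by (simp add: laplace_kernel_def G_def A_def)
  also have "\<dots> = (\<integral>t. (\<integral>y. G y t \<partial>halfline_measure \<alpha>) \<partial>lborel)"
    by (rule HL.Fubini_integral[OF Gint, symmetric])
  also have "\<dots> = (\<integral>t. (- c * l x) * (indicator {0<..} t * (real k * exp (- (real k * t)) * \<psi> t)) \<partial>lborel)"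
  proof (intro Bochner_Integration.integral_cong refl)
    fix t :: real
    show "(\<integral>y. G y t \<partial>halfline_measure \<alpha>) = (- c * l x) * (indicator {0<..} t * (real k * exp (- (real k * t)) * \<psi> t))"
    proof (cases "t > 0")
      case t: True
      have hb: "has_bochner_integral (halfline_measure \<alpha> \<Otimes>\<^sub>M bessel_measure \<alpha>) (\<lambda>(y, u). ?a t u y * l y)
         (c * (- real k * exp (- (real k * t)) * l x))"
        unfolding c_def l_def by (rule mehler_deriv_laguerre_integral[OF \<alpha> t x])
      have "(\<integral>y. G y t \<partial>halfline_measure \<alpha>) = (\<integral>y. \<psi> t * (\<integral>u. ?a t u y * l y \<partial>bessel_measure \<alpha>) \<partial>halfline_measure \<alpha>)"
        using t by (simp add: G_def A_def mult.assoc)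
      also have "\<dots> = \<psi> t * (\<integral>y. (\<integral>u. ?a t u y * l y \<partial>bessel_measure \<alpha>) \<partial>halfline_measure \<alpha>)"
        by (rule integral_mult_right_zero)
      also have "(\<integral>y. (\<integral>u. ?a t u y * l y \<partial>bessel_measure \<alpha>) \<partial>halfline_measure \<alpha>) = c * (- real k * exp (- (real k * t)) * l x)"
        using HB.integral_fst[of "\<lambda>y u. ?a t u y * l y"] hb by (simp add: has_bochner_integral_iff)
      finally show ?thesis using t by simp
    qed (simp add: G_def)
  qed
  also have "\<dots> = (- c * l x) * (\<integral>t. indicator {0<..} t * (real k * exp (- (real k * t)) * \<psi> t) \<partial>lborel)"
    by (rule integral_mult_right_zero)
  also have "(\<integral>t. indicator {0<..} t * (real k * exp (- (real k * t)) * \<psi> t) \<partial>lborel) = (if k = 0 then 0 else \<mu>)"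
    using m by (auto simp: has_bochner_integral_iff)
  finally show ?thesis by (simp add: c_def l_def mult_ac)
qed

section \<open>Lp spaces on the half-line, and the operator\<close>

text \<open>Membership says nothing about \<open>f\<close> off the half-line. Cutting it off gives a
  Borel function on the whole line, as the kernel estimates require.\<close>

lemma Lp_space_halfline_measurable:
  assumes "f \<in> Lp_space p (halfline_measure \<gamma>)"
  shows "(\<lambda>y. indicator {0<..} y * f y) \<in> borel_measurable borel"
proof -
  have "f \<in> borel_measurable (halfline_measure \<gamma>)" using assms by (simp add: Lp_space_def)
  hence "f \<in> borel_measurable (restrict_space borel {0<..})"
    by (subst (asm) measurable_cong_sets[OF sets_halfline_measure refl])
  thus ?thesis by (subst (asm) borel_measurable_restrict_space_iff) auto
qed

lemma Lp_space_nn_integral: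
  assumes "f \<in> Lp_space p M" "p > 0"
  shows "(\<integral>\<^sup>+y. ennreal (\<bar>f y\<bar> powr p) \<partial>M) = ennreal (Lp_norm p M f powr p)"
proof -
  have "(\<integral>\<^sup>+y. ennreal (\<bar>f y\<bar> powr p) \<partial>M) = ennreal (\<integral>y. \<bar>f y\<bar> powr p \<partial>M)"
    using assms by (intro nn_integral_eq_integral) (auto simp: Lp_space_def)
  also have "(\<integral>y. \<bar>f y\<bar> powr p \<partial>M) = Lp_norm p M f powr p"
    using assms by (simp add: Lp_norm_def powr_powr)
  finally show ?thesis .
qed

lemma Lp_spaceI_nn_integral:
  assumes fm: "f \<in> borel_measurable M" and q: "q > 0" and b: "b \<ge> 0"
    and le: "(\<integral>\<^sup>+x. ennreal (\<bar>f x\<bar> powr q) \<partial>M) \<le> ennreal (b powr q)"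
  shows "f \<in> Lp_space q M \<and> Lp_norm q M f \<le> b"
proof -
  have "(\<integral>\<^sup>+x. ennreal (\<bar>f x\<bar> powr q) \<partial>M) < \<infinity>" using le by (rule le_less_trans) simp
  hence i: "integrable M (\<lambda>x. \<bar>f x\<bar> powr q)" using fm by (intro integrableI_nonneg) auto
  hence sp: "f \<in> Lp_space q M" using fm by (simp add: Lp_space_def)
  have "ennreal (\<integral>x. \<bar>f x\<bar> powr q \<partial>M) \<le> ennreal (b powr q)"
    using le nn_integral_eq_integral[OF i] by simp
  hence "(\<integral>x. \<bar>f x\<bar> powr q \<partial>M) \<le> b powr q" by simp
  hence "(\<integral>x. \<bar>f x\<bar> powr q \<partial>M) powr (1 / q) \<le> (b powr q) powr (1 / q)"
    using q by (intro powr_mono2) (auto intro: integral_nonneg_AE)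
  also have "\<dots> = b" using q b by (simp add: powr_powr)
  finally show ?thesis using sp by (simp add: Lp_norm_def)
qed

text \<open>The extension is not obtained by density: \<open>T\<close> is given by the kernel on the
  whole source space, and agreement with the multiplier is verified on the Laguerre functions and
  carried to their span by linearity.\<close>

theorem theorem1p1:
  fixes \<alpha> \<sigma> p q a b :: real
    and \<Psi> :: "real \<Rightarrow> real"
    and m :: "nat \<Rightarrow> real"
  assumes alpha: "\<alpha> > -1"
    and bv: "bounded_variation_on {0..} \<Psi>"
    and m: "\<And>k. has_stieltjes_integral (\<lambda>t. exp (- (real k * t))) \<Psi> (m k)"
    and H1: "\<exists>I. has_abs_stieltjes_integral (\<lambda>t. 1) \<Psi> I"
    and sigma: "0 < \<sigma>" "\<sigma> < \<alpha> + 1"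
    and H2: "\<exists>\<delta>>0. \<exists>C>0. \<forall>t. 0 \<le> t \<and> t \<le> \<delta> \<longrightarrow> \<bar>\<Psi> t\<bar> \<le> C * t powr \<sigma>"
    and pq: "1 < p" "p \<le> q"
    and a: "a < (\<alpha> + 1) / (p / (p - 1))"
    and b: "b < (\<alpha> + 1) / q"
    and ab_lower: "(1 / q - 1 / p) * (\<alpha> + 1 / 2) \<le> a + b"
    and ab_upper: "a + b \<le> (1 / q - 1 / p) * (\<alpha> + 1) + \<sigma>"
  shows "\<exists>C T.
    bounded_Lp_operator p (halfline_measure (\<alpha> + a * p)) q (halfline_measure (\<alpha> - b * q)) C T \<and>
    (\<forall>f\<in>laguerre_span \<alpha>.
       f \<in> Lp_space p (halfline_measure (\<alpha> + a * p)) \<and>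
       (AE x in halfline_measure (\<alpha> - b * q). T f x = laguerre_multiplier \<alpha> m f x) \<and>
       laguerre_multiplier \<alpha> m f \<in> Lp_space q (halfline_measure (\<alpha> - b * q)) \<and>
       Lp_norm q (halfline_measure (\<alpha> - b * q)) (laguerre_multiplier \<alpha> m f)
         \<le> C * Lp_norm p (halfline_measure (\<alpha> + a * p)) f)"
proof -
  have q: "q > 1" using pq by simp
  \<comment> \<open>Agrees with \<Psi> on [0, \<infinity>), where all information lies, and is Borel
    on the whole line.\<close>
  define \<psi> where "\<psi> = (\<lambda>t. \<Psi> (max 0 t))"
  have \<psi>m[measurable]: "\<psi> \<in> borel_measurable borel"
    unfolding \<psi>_def by (rule bounded_variation_measurable[OF bv])
  obtain \<delta> C0 where \<delta>: "\<delta> > 0" and C0: "C0 > 0" and near0: "\<And>t. 0 \<le> t \<Longrightarrow> t \<le> \<delta> \<Longrightarrow> \<bar>\<Psi> t\<bar> \<le> C0 * t powr \<sigma>"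
    using H2 by blast
  \<comment> \<open>(H2) at t = 0, because \<open>0 powr \<sigma> = 0\<close>. This removes the
    boundary term at 0 in the integration by parts.\<close>
  have \<Psi>0: "\<Psi> 0 = 0" using near0[of 0] \<delta> by simp
  obtain B0 where B0: "\<And>t. t \<ge> 0 \<Longrightarrow> \<bar>\<Psi> t\<bar> \<le> B0" using bounded_variation_bounded[OF bv] by blast
  have B0n: "B0 \<ge> 0" using B0[of 0] by simp
  \<comment> \<open>The summands serve t \<le> \<delta>, \<delta> < t \<le> 1 and t \<ge> 1 in turn:
    (H2) is local, and boundedness of \<Psi> extends it.\<close>
  define P where "P = C0 + B0 * \<delta> powr (- \<sigma>) + B0"
  have P: "P > 0" using C0 B0n by (simp add: P_def add_pos_nonneg)
  have \<psi>1: "\<bar>\<psi> t\<bar> \<le> P * t powr \<sigma>" if t: "0 < t" "t \<le> 1" for t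
  proof (cases "t \<le> \<delta>")
    case True
    have "\<bar>\<psi> t\<bar> \<le> C0 * t powr \<sigma>" using near0[of t] True t by (simp add: \<psi>_def)
    also have "\<dots> \<le> P * t powr \<sigma>" using B0n by (intro mult_right_mono) (auto simp: P_def)
    finally show ?thesis .
  next
    case False
    have "1 \<le> (t / \<delta>) powr \<sigma>" using False \<delta> sigma by (intro ge_one_powr_ge_zero) auto
    hence "B0 * 1 \<le> B0 * (t / \<delta>) powr \<sigma>" using B0n by (intro mult_left_mono)
    also have "\<dots> = B0 * \<delta> powr (- \<sigma>) * t powr \<sigma>" using t \<delta> by (simp add: powr_divide powr_minus_divide)
    also have "\<dots> \<le> P * t powr \<sigma>" using B0n C0 by (intro mult_right_mono) (auto simp: P_def)
    finally show ?thesis using B0[of t] t by (simp add: \<psi>_def)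
  qed
  have \<psi>2: "\<bar>\<psi> t\<bar> \<le> P" if "t \<ge> 1" for t
  proof -
    have "0 \<le> B0 * \<delta> powr (- \<sigma>)" using B0n by simp
    moreover have "\<bar>\<psi> t\<bar> \<le> B0" using B0[of t] that by (simp add: \<psi>_def)
    ultimately show ?thesis using C0 unfolding P_def by linarith
  qed
  have mk: "has_bochner_integral lborel (\<lambda>t. indicator {0<..} t * (real k * exp (- (real k * t)) * \<psi> t)) (m k)" if k: "k > 0" for k
  proof -
    have "has_bochner_integral lborel (\<lambda>t. indicator {0<..} t * (real k * exp (- (real k * t)) * \<Psi> t)) (m k)"
      by (rule stieltjes_integral_exp[OF bv _ \<Psi>0 m]) (use k in simp)
    moreover have "(\<lambda>t. indicator {0<..} t * (real k * exp (- (real k * t)) * \<Psi> t)) = (\<lambda>t. indicator {0<..} t * (real k * exp (- (real k * t)) * \<psi> t))"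
      by (auto simp: \<psi>_def indicator_def fun_eq_iff)
    ultimately show ?thesis by simp
  qed
  \<comment> \<open>Here 1 - 1/p stands for 1/p'. The hypotheses on a and b say that
    \<open>A\<close> and \<open>B\<close> are positive.\<close>
  define A where "A = (\<alpha> + 1) * (1 - 1 / p) - a"
  define B where "B = (\<alpha> + 1) / q - b"
  define D where "D = A + B"
  have "(\<alpha> + 1) / (p / (p - 1)) = (\<alpha> + 1) * (1 - 1 / p)" using pq by (simp add: field_simps)
  hence A: "A > 0" using a by (simp add: A_def)
  have B: "B > 0" using b by (simp add: B_def)
  have D: "D > 0" using A B by (simp add: D_def)
  have \<tau>eq: "\<alpha> + 1 - D = (a + b) - (1 / q - 1 / p) * (\<alpha> + 1)"
    unfolding D_def A_def B_def by (simp add: algebra_simps add_divide_distrib)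
  \<comment> \<open>The lower bound on a + b: passing from \<alpha> + 1/2 to \<alpha> + 1 produces
    the extra (1/p - 1/q)/2.\<close>
  have \<tau>1: "1 / p - 1 / q \<le> 2 * (\<alpha> + 1 - D)"
  proof -
    define d where "d = 1 / q - 1 / p"
    have "d * (\<alpha> + 1 / 2) = d * (\<alpha> + 1) - d / 2" by (simp add: algebra_simps)
    moreover have "d * (\<alpha> + 1 / 2) \<le> a + b" using ab_lower by (simp only: d_def)
    moreover have "\<alpha> + 1 - D = (a + b) - d * (\<alpha> + 1)" unfolding d_def by (rule \<tau>eq)
    moreover have "1 / p - 1 / q = - d" by (simp add: d_def)
    moreover have "e \<le> 2 * E" if "w = v - d / 2" "w \<le> s" "E = s - v" "e = - d" for e E s v w :: real
      using that by linarith
    ultimately show ?thesis by blast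
  qed
  have \<tau>2: "\<alpha> + 1 - D \<le> \<sigma>" using ab_upper unfolding \<tau>eq by linarith
  \<comment> \<open>The source weight is integrable at 0, as needed for Laguerre functions to lie in
    the source space: D \<le> \<alpha> + 1 and B > 0 give A < \<alpha> + 1, that is, a > -(\<alpha>
    + 1)/p.\<close>
  have \<gamma>p: "\<alpha> + a * p > -1"
  proof -
    have "1 / q \<le> 1 / p" using pq by (intro divide_left_mono) auto
    hence "0 \<le> 2 * (\<alpha> + 1 - D)" using \<tau>1 by (meson diff_ge_0_iff_ge order_trans)
    hence "D \<le> \<alpha> + 1" by simp
    hence "A < \<alpha> + 1" using B by (simp add: D_def)
    hence "0 < (a + (\<alpha> + 1) / p) * p" using pq by (intro mult_pos_pos) (auto simp: A_def right_diff_distrib)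
    also have "(a + (\<alpha> + 1) / p) * p = a * p + (\<alpha> + 1)" using pq by (simp only: distrib_right) simp
    finally show ?thesis by linarith
  qed
  let ?p = "halfline_measure (\<alpha> + a * p)" and ?q = "halfline_measure (\<alpha> - b * q)" and ?M = "halfline_measure \<alpha>"
  interpret M: sigma_finite_measure ?M by (rule sigma_finite_halfline_measure)
  define l where "l = laguerre_fun \<alpha>"
  have lm[measurable]: "l k \<in> borel_measurable borel" for k by (simp add: l_def)
  define c where "c = sqrt pi * Gamma (\<alpha> + 3 / 2)"
  have c: "c > 0" using alpha by (simp add: c_def Gamma_real_pos)
  \<comment> \<open>Division by \<open>c\<close> undoes the normalisation of Poisson's integral; the
    minus sign offsets the one in the time derivative of exp(-k t).\<close>
  define K where "K = (\<lambda>x y. m 0 * l 0 x * l 0 y - laplace_kernel \<alpha> \<psi> x y / c)"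
  define T where "T = (\<lambda>f x. \<integral>y. K x y * f y \<partial>?M)"
  define H where "H = (\<lambda>x y. ennreal \<bar>m 0 * l 0 x * l 0 y\<bar> + ennreal (1 / c) * mehler_abs \<alpha> \<psi> x y)"
  have Km[measurable]: "case_prod K \<in> borel_measurable (borel \<Otimes>\<^sub>M borel)" unfolding K_def by measurable
  have Hm[measurable]: "case_prod H \<in> borel_measurable (borel \<Otimes>\<^sub>M borel)" unfolding H_def by measurable
  have Kx: "K x \<in> borel_measurable borel" "H x \<in> borel_measurable borel" for x
    using measurable_Pair2[OF Km, of x] measurable_Pair2[OF Hm, of x] by simp_all
  have KH: "ennreal \<bar>K x y\<bar> \<le> H x y" for x y
  proof -
    have "ennreal \<bar>K x y\<bar> \<le> ennreal (\<bar>m 0 * l 0 x * l 0 y\<bar> + 1 / c * \<bar>laplace_kernel \<alpha> \<psi> x y\<bar>)"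
      using c abs_triangle_ineq4[of "m 0 * l 0 x * l 0 y" "laplace_kernel \<alpha> \<psi> x y / c"] by (intro ennreal_leI) (simp add: K_def)
    also have "\<dots> = ennreal \<bar>m 0 * l 0 x * l 0 y\<bar> + ennreal (1 / c) * ennreal \<bar>laplace_kernel \<alpha> \<psi> x y\<bar>"
      using c by (simp add: ennreal_mult'[symmetric])
    also have "\<dots> \<le> H x y" unfolding H_def by (intro add_left_mono mult_left_mono abs_laplace_kernel_le) simp
    finally show ?thesis .
  qed
  obtain C1 where C1: "C1 > 0" and mab: "\<And>x y. x > 0 \<Longrightarrow> y > 0 \<Longrightarrow> mehler_abs \<alpha> \<psi> x y \<le>
     ennreal C1 * (ennreal (max x y powr (- D)) + ennreal (x powr (- D)) * near_kernel \<sigma> (\<alpha> + 1 - D) UNIV x y)"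
    using mehler_abs_bound[OF alpha \<psi>m P \<psi>1 \<psi>2 D \<tau>2] by blast
  obtain Cl where Cl: "Cl \<ge> 0" "\<And>x. x \<ge> 0 \<Longrightarrow> \<bar>l 0 x\<bar> \<le> Cl * exp (- x / 4)"
    using abs_laguerre_fun_le[OF alpha, of 0] unfolding l_def by blast
  define C2 where "C2 = \<bar>m 0\<bar> * Cl * Cl * (D powr D * 4 powr D)"
  have C2: "C2 \<ge> 0" using Cl by (simp add: C2_def)
  \<comment> \<open>The rank-one term decays exponentially in the larger variable and is therefore
    dominated by max(x,y)^(-D).\<close>
  have l00: "\<bar>m 0 * l 0 x * l 0 y\<bar> \<le> C2 * max x y powr (- D)" if x: "x > 0" and y: "y > 0" for x y
  proof -
    define X where "X = max x y"
    have X: "X > 0" using x by (simp add: X_def less_max_iff_disj)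
    have "\<bar>m 0 * l 0 x * l 0 y\<bar> \<le> \<bar>m 0\<bar> * ((Cl * exp (- x / 4)) * (Cl * exp (- y / 4)))"
      unfolding abs_mult mult.assoc using Cl x y by (intro mult_left_mono mult_mono[OF Cl(2) Cl(2), unfolded mult.assoc]) auto
    also have "\<dots> = \<bar>m 0\<bar> * Cl * Cl * exp (- x / 4 + - y / 4)" by (simp only: exp_add mult_ac)
    also have "\<dots> \<le> \<bar>m 0\<bar> * Cl * Cl * exp (- (X / 4))" using x y Cl by (intro mult_left_mono) (auto simp: X_def max_def)
    also have "\<dots> \<le> \<bar>m 0\<bar> * Cl * Cl * (D powr D * (X / 4) powr (- D))"
      using exp_minus_le_powr[of "X / 4" D] X D Cl by (intro mult_left_mono) auto
    also have "(X / 4) powr (- D) = 4 powr D * X powr (- D)" using X by (simp add: powr_divide powr_minus_divide)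
    finally show ?thesis by (simp add: C2_def X_def mult_ac)
  qed
  define C where "C = C2 + C1 / c"
  have C: "C > 0" using C2 C1 c by (simp add: C_def add_nonneg_pos)
  have Hbound: "H x y \<le> ennreal C * (ennreal (max x y powr (- D)) + ennreal (x powr (- D)) * near_kernel \<sigma> (\<alpha> + 1 - D) UNIV x y)"
    if x: "x > 0" and y: "y > 0" for x y
  proof -
    let ?X = "ennreal (max x y powr (- D))" and ?N = "ennreal (x powr (- D)) * near_kernel \<sigma> (\<alpha> + 1 - D) UNIV x y"
    have "H x y \<le> ennreal (C2 * max x y powr (- D)) + ennreal (1 / c) * (ennreal C1 * (?X + ?N))"
      unfolding H_def by (intro add_mono mult_left_mono ennreal_leI l00 mab x y) simp
    also have "ennreal (C2 * max x y powr (- D)) = ennreal C2 * ?X" using C2 by (rule ennreal_mult')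
    also have "ennreal (1 / c) * (ennreal C1 * (?X + ?N)) = ennreal (C1 / c) * (?X + ?N)"
      using c C1 by (simp add: mult.assoc[symmetric] ennreal_mult'[symmetric])
    also have "ennreal C2 * ?X \<le> ennreal C2 * (?X + ?N)" by (intro mult_left_mono) auto
    also have "ennreal C2 * (?X + ?N) + ennreal (C1 / c) * (?X + ?N) = ennreal C * (?X + ?N)"
      using C2 C1 c by (simp add: C_def distrib_right)
    finally show ?thesis by (simp add: add_right_mono)
  qed
  obtain Q where Q: "Q > 0" and main: "\<And>g s. g \<in> borel_measurable borel \<Longrightarrow> s > 0 \<Longrightarrow>
    (\<integral>\<^sup>+y. ennreal (\<bar>g y\<bar> powr p) \<partial>?p) \<le> ennreal (s powr p) \<Longrightarrow>
    (AE x in ?q. (\<integral>\<^sup>+y. H x y * ennreal \<bar>g y\<bar> \<partial>?M) < \<infinity>) \<and>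
    (\<integral>\<^sup>+x. ennreal (enn2real (\<integral>\<^sup>+y. H x y * ennreal \<bar>g y\<bar> \<partial>?M) powr q) \<partial>?q) \<le> ennreal (Q * s powr q)"
    using weighted_kernel_bound[OF pq A[unfolded A_def] B[unfolded B_def] sigma(1) \<tau>1[unfolded D_def A_def B_def] \<tau>2[unfolded D_def A_def B_def] C Hm
        Hbound[unfolded D_def A_def B_def]]
    by blast
  define U where "U = (\<lambda>f x. \<integral>\<^sup>+y. H x y * ennreal \<bar>f y\<bar> \<partial>?M)"
  define R where "R = Q powr (1 / q)"
  have R: "R > 0" using Q by (simp add: R_def)
  \<comment> \<open>The integrals see \<open>f\<close> on the half-line only, so \<open>f\<close>
    may be replaced by its Borel cutoff.\<close>
  have Uind: "U (\<lambda>y. indicator {0<..} y * f y) = U f" for f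
    unfolding U_def by (intro ext nn_integral_cong) auto
  have Tind: "T (\<lambda>y. indicator {0<..} y * f y) = T f" for f
    unfolding T_def by (intro ext Bochner_Integration.integral_cong) auto
  have bounds: "(AE x in ?q. U f x < \<infinity>) \<and> (\<integral>\<^sup>+x. ennreal (enn2real (U f x) powr q) \<partial>?q) \<le> ennreal ((R * s) powr q)"
    if f: "f \<in> Lp_space p ?p" and s: "s > 0" "Lp_norm p ?p f \<le> s" for f s
  proof -
    let ?g = "\<lambda>y. indicator {0<..} y * f y"
    have "(\<integral>\<^sup>+y. ennreal (\<bar>?g y\<bar> powr p) \<partial>?p) = (\<integral>\<^sup>+y. ennreal (\<bar>f y\<bar> powr p) \<partial>?p)"
      by (intro nn_integral_cong) auto
    also have "\<dots> = ennreal (Lp_norm p ?p f powr p)" using f pq by (intro Lp_space_nn_integral) auto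
    also have "\<dots> \<le> ennreal (s powr p)" using s pq by (intro ennreal_leI powr_mono2) (auto simp: Lp_norm_def)
    finally have "(AE x in ?q. U ?g x < \<infinity>) \<and> (\<integral>\<^sup>+x. ennreal (enn2real (U ?g x) powr q) \<partial>?q) \<le> ennreal (Q * s powr q)"
      unfolding U_def by (rule main[OF Lp_space_halfline_measurable[OF f] s(1)])
    moreover have "Q * s powr q = (R * s) powr q" using q Q s by (simp add: R_def powr_mult powr_powr)
    ultimately show ?thesis unfolding Uind by simp
  qed
  \<comment> \<open>Adding 1 to the norm provides the positive \<open>s\<close> that
    \<open>bounds\<close> requires.\<close>
  have Ufin: "AE x in ?q. U f x < \<infinity>" if "f \<in> Lp_space p ?p" for f
    using bounds[OF that, of "Lp_norm p ?p f + 1"] by (simp add: Lp_norm_def add_nonneg_pos)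
  have Kint: "integrable ?M (\<lambda>y. K x y * f y)" if f: "f \<in> Lp_space p ?p" and x: "U f x < \<infinity>" for f x
  proof -
    let ?g = "\<lambda>y. indicator {0<..} y * f y"
    have gm: "?g \<in> borel_measurable borel" by (rule Lp_space_halfline_measurable[OF f])
    have "integrable ?M (\<lambda>y. K x y * ?g y)"
    proof (rule integrableI_bounded)
      show "(\<lambda>y. K x y * ?g y) \<in> borel_measurable ?M"
        by (intro measurable_halfline_measure borel_measurable_times Kx gm)
      have "(\<integral>\<^sup>+y. ennreal (norm (K x y * ?g y)) \<partial>?M) \<le> U ?g x"
        unfolding U_def by (intro nn_integral_mono) (simp add: abs_mult ennreal_mult' mult_right_mono KH)
      also have "\<dots> < \<infinity>" using x by (simp add: Uind)
      finally show "(\<integral>\<^sup>+y. ennreal (norm (K x y * ?g y)) \<partial>?M) < \<infinity>" .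
    qed
    thus ?thesis by (rule Bochner_Integration.integrable_cong[THEN iffD1, rotated 2]) auto
  qed
  have TU: "\<bar>T f x\<bar> \<le> enn2real (U f x)" if "U f x < \<infinity>" for f x
  proof -
    have "ennreal \<bar>T f x\<bar> \<le> (\<integral>\<^sup>+y. ennreal \<bar>K x y * f y\<bar> \<partial>?M)" unfolding T_def by (rule abs_integral_le_nn_integral)
    also have "\<dots> \<le> U f x" unfolding U_def by (intro nn_integral_mono) (simp add: abs_mult ennreal_mult' mult_right_mono KH)
    finally have "enn2real (ennreal \<bar>T f x\<bar>) \<le> enn2real (U f x)" using that by (intro enn2real_mono) auto
    thus ?thesis by simp
  qed
  have Tm: "T f \<in> borel_measurable ?q" if f: "f \<in> Lp_space p ?p" for f
  proof -
    have [measurable]: "(\<lambda>y. indicator {0<..} y * f y) \<in> borel_measurable borel" by (rule Lp_space_halfline_measurable[OF f])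
    have "(\<lambda>(x, y). K x y * (indicator {0<..} y * f y)) \<in> borel_measurable (borel \<Otimes>\<^sub>M borel)" by measurable
    hence "(\<lambda>(x, y). K x y * (indicator {0<..} y * f y)) \<in> borel_measurable (borel \<Otimes>\<^sub>M ?M)"
      by (rule measurable_pair_halfline(1)) simp
    hence "T (\<lambda>y. indicator {0<..} y * f y) \<in> borel_measurable borel"
      unfolding T_def by (rule M.borel_measurable_lebesgue_integral)
    thus ?thesis unfolding Tind by (rule measurable_halfline_measure)
  qed
  have Tbound: "T f \<in> Lp_space q ?q \<and> Lp_norm q ?q (T f) \<le> R * s"
    if f: "f \<in> Lp_space p ?p" and s: "s > 0" "Lp_norm p ?p f \<le> s" for f s
  proof (rule Lp_spaceI_nn_integral[OF Tm[OF f]])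
    have "(\<integral>\<^sup>+x. ennreal (\<bar>T f x\<bar> powr q) \<partial>?q) \<le> (\<integral>\<^sup>+x. ennreal (enn2real (U f x) powr q) \<partial>?q)"
    proof (rule nn_integral_mono_AE)
      show "AE x in ?q. ennreal (\<bar>T f x\<bar> powr q) \<le> ennreal (enn2real (U f x) powr q)"
        using Ufin[OF f] by eventually_elim (use TU q in \<open>auto intro!: ennreal_leI powr_mono2\<close>)
    qed
    also have "\<dots> \<le> ennreal ((R * s) powr q)" using bounds[OF f s] by simp
    finally show "(\<integral>\<^sup>+x. ennreal (\<bar>T f x\<bar> powr q) \<partial>?q) \<le> ennreal ((R * s) powr q)" .
  qed (use q R s in auto)
  \<comment> \<open>\<open>Tbound\<close> needs a positive \<open>s\<close> while the norm may be 0,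
    so \<open>s\<close> exceeds the norm by e/R and e > 0 is arbitrary.\<close>
  have Tnorm: "T f \<in> Lp_space q ?q \<and> Lp_norm q ?q (T f) \<le> R * Lp_norm p ?p f" if f: "f \<in> Lp_space p ?p" for f
  proof
    have N0: "Lp_norm p ?p f \<ge> 0" by (simp add: Lp_norm_def)
    show "T f \<in> Lp_space q ?q" using Tbound[OF f, of "Lp_norm p ?p f + 1"] N0 by simp
    show "Lp_norm q ?q (T f) \<le> R * Lp_norm p ?p f"
    proof (rule field_le_epsilon)
      fix e :: real assume e: "e > 0"
      have "Lp_norm q ?q (T f) \<le> R * (Lp_norm p ?p f + e / R)"
        using Tbound[OF f, of "Lp_norm p ?p f + e / R"] N0 e R by (simp add: add_nonneg_pos)
      thus "Lp_norm q ?q (T f) \<le> R * Lp_norm p ?p f + e" using R by (simp add: distrib_left)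
    qed
  qed
  \<comment> \<open>Additivity of the Bochner integral needs both integrals to converge absolutely,
    which holds for almost every x only.\<close>
  have Tlin: "AE x in ?q. T (\<lambda>y. d * f y + e * g y) x = d * T f x + e * T g x"
    if f: "f \<in> Lp_space p ?p" and g: "g \<in> Lp_space p ?p" for f g d e
    using Ufin[OF f] Ufin[OF g]
  proof eventually_elim
    case (elim x)
    have "T (\<lambda>y. d * f y + e * g y) x = (\<integral>y. d * (K x y * f y) + e * (K x y * g y) \<partial>?M)"
      unfolding T_def by (intro Bochner_Integration.integral_cong refl) (simp add: algebra_simps)
    also have "\<dots> = d * T f x + e * T g x"
      unfolding T_def using Kint[OF f elim(1)] Kint[OF g elim(2)] by simp
    finally show ?case .
  qed
  have op: "bounded_Lp_operator p ?p q ?q R T"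
    unfolding bounded_Lp_operator_def using Tnorm Tlin by blast
  have lp: "l k \<in> Lp_space p ?p" for k
  proof -
    obtain C where "C \<ge> 0" "\<And>x. x \<ge> 0 \<Longrightarrow> \<bar>l k x\<bar> \<le> C * exp (- x / 4)"
      using abs_laguerre_fun_le[OF alpha, of k] unfolding l_def by blast
    thus ?thesis using pq \<gamma>p by (intro exp_bounded_in_Lp_space[OF lm]) auto
  qed
  \<comment> \<open>Fubini is available at those x where the majorant paired with \<open>l k\<close>
    is finite, hence almost everywhere.\<close>
  have Tl: "AE x in ?q. T (l k) x = m k * l k x" for k
    using Ufin[OF lp[of k]] AE_space
  proof eventually_elim
    case (elim x)
    hence x: "x > 0" by simp
    have [measurable]: "mehler_abs \<alpha> \<psi> x \<in> borel_measurable borel"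
      using measurable_Pair2[OF mehler_abs_measurable[OF \<psi>m], of x] by simp
    have fin: "(\<integral>\<^sup>+y. mehler_abs \<alpha> \<psi> x y * ennreal \<bar>laguerre_fun \<alpha> k y\<bar> \<partial>?M) < \<infinity>"
    proof -
      have "ennreal (1 / c) * (\<integral>\<^sup>+y. mehler_abs \<alpha> \<psi> x y * ennreal \<bar>l k y\<bar> \<partial>?M) = (\<integral>\<^sup>+y. ennreal (1 / c) * (mehler_abs \<alpha> \<psi> x y * ennreal \<bar>l k y\<bar>) \<partial>?M)"
        by (rule nn_integral_cmult[symmetric], rule measurable_halfline_measure) measurable
      also have "\<dots> \<le> U (l k) x"
        unfolding U_def H_def by (intro nn_integral_mono) (simp add: distrib_right mult.assoc)
      also have "\<dots> < \<infinity>" by (rule elim(1))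
      finally show ?thesis using c by (auto simp: ennreal_mult_less_top l_def)
    qed
    have i1: "has_bochner_integral ?M (\<lambda>y. m 0 * l 0 x * (l 0 y * l k y)) (m 0 * l 0 x * (if 0 = k then 1 else 0))"
      unfolding l_def by (intro has_bochner_integral_mult_right laguerre_fun_orthonormal alpha)
    have i2: "integrable ?M (\<lambda>y. laplace_kernel \<alpha> \<psi> x y * l k y)"
    proof -
      have "integrable ?M (\<lambda>y. c * (m 0 * l 0 x * (l 0 y * l k y) - K x y * l k y))"
        using i1 Kint[OF lp elim(1)] by (auto simp: has_bochner_integral_iff)
      also have "(\<lambda>y. c * (m 0 * l 0 x * (l 0 y * l k y) - K x y * l k y)) = (\<lambda>y. laplace_kernel \<alpha> \<psi> x y * l k y)"
        using c by (simp add: K_def fun_eq_iff algebra_simps)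
      finally show ?thesis .
    qed
    have "T (l k) x = (\<integral>y. m 0 * l 0 x * (l 0 y * l k y) - (laplace_kernel \<alpha> \<psi> x y * l k y) / c \<partial>?M)"
      unfolding T_def K_def by (intro Bochner_Integration.integral_cong refl) (simp add: algebra_simps)
    also have "\<dots> = m 0 * l 0 x * (if 0 = k then 1 else 0) - (\<integral>y. laplace_kernel \<alpha> \<psi> x y * l k y \<partial>?M) / c"
      using i1 i2 by (simp add: has_bochner_integral_iff)
    also have "(\<integral>y. laplace_kernel \<alpha> \<psi> x y * l k y \<partial>?M) = - c * (if k = 0 then 0 else m k) * l k x"
      unfolding l_def c_def by (rule laplace_kernel_laguerre[OF alpha x \<psi>m fin mk])
    finally show ?case using c by auto
  qed
  have span: "f \<in> Lp_space p ?p \<and> (AE x in ?q. T f x = laguerre_multiplier \<alpha> m f x) \<and>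
       laguerre_multiplier \<alpha> m f \<in> Lp_space q ?q \<and> Lp_norm q ?q (laguerre_multiplier \<alpha> m f) \<le> R * Lp_norm p ?p f"
    if span: "f \<in> laguerre_span \<alpha>" for f
  proof -
    obtain N d where f: "f = (\<lambda>x. \<Sum>k<N. d k * l k x)" using span unfolding laguerre_span_def l_def by auto
    have fm[measurable]: "f \<in> borel_measurable borel" unfolding f by measurable
    obtain Cf where "Cf \<ge> 0" "\<And>x. x \<ge> 0 \<Longrightarrow> \<bar>f x\<bar> \<le> Cf * exp (- x / 4)"
      using laguerre_sum_bound[OF alpha, of d N] unfolding f l_def by blast
    hence fp: "f \<in> Lp_space p ?p" using pq \<gamma>p by (intro exp_bounded_in_Lp_space[OF fm]) auto
    have coeff: "laguerre_coeff \<alpha> j f = (if j < N then d j else 0)" for j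
    proof -
      have "has_bochner_integral ?M (\<lambda>y. \<Sum>k<N. d k * (laguerre_fun \<alpha> k y * laguerre_fun \<alpha> j y)) (\<Sum>k<N. d k * (if k = j then 1 else 0))"
        by (intro has_bochner_integral_sum has_bochner_integral_mult_right laguerre_fun_orthonormal alpha)
      hence "laguerre_coeff \<alpha> j f = (\<Sum>k<N. d k * (if k = j then 1 else 0))"
        unfolding laguerre_coeff_def f l_def by (simp add: has_bochner_integral_iff sum_distrib_right mult.assoc)
      thus ?thesis by (simp add: if_distrib cong: if_cong)
    qed
    have mult: "laguerre_multiplier \<alpha> m f = (\<lambda>x. \<Sum>k<N. (d k * m k) * l k x)"
    proof
      fix x
      have "laguerre_multiplier \<alpha> m f x = (\<Sum>k<N. laguerre_coeff \<alpha> k f * m k * laguerre_fun \<alpha> k x)"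
        unfolding laguerre_multiplier_def by (rule suminf_finite) (auto simp: coeff)
      thus "laguerre_multiplier \<alpha> m f x = (\<Sum>k<N. (d k * m k) * l k x)" by (simp add: coeff l_def)
    qed
    have AEall: "AE x in ?q. \<forall>k\<in>{..<N}. U (l k) x < \<infinity> \<and> T (l k) x = m k * l k x"
      by (rule AE_finite_allI) (use Ufin[OF lp] Tl in \<open>auto simp: AE_conj_iff\<close>)
    have eq: "AE x in ?q. T f x = laguerre_multiplier \<alpha> m f x"
      using AEall
    proof eventually_elim
      case (elim x)
      have "T f x = (\<integral>y. (\<Sum>k<N. d k * (K x y * l k y)) \<partial>?M)"
        unfolding T_def f by (intro Bochner_Integration.integral_cong refl) (simp add: sum_distrib_left mult_ac)
      also have "\<dots> = (\<Sum>k<N. (\<integral>y. d k * (K x y * l k y) \<partial>?M))"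
        using elim by (intro Bochner_Integration.integral_sum integrable_mult_right Kint[OF lp]) auto
      also have "\<dots> = (\<Sum>k<N. d k * T (l k) x)" by (simp add: T_def)
      also have "\<dots> = (\<Sum>k<N. (d k * m k) * l k x)" using elim by (intro sum.cong) auto
      finally show ?case by (simp add: mult)
    qed
    have mm[measurable]: "laguerre_multiplier \<alpha> m f \<in> borel_measurable borel" unfolding mult by measurable
    have "(\<integral>\<^sup>+x. ennreal (\<bar>laguerre_multiplier \<alpha> m f x\<bar> powr q) \<partial>?q) = (\<integral>\<^sup>+x. ennreal (\<bar>T f x\<bar> powr q) \<partial>?q)"
      using eq by (intro nn_integral_cong_AE) (auto elim!: eventually_mono)
    also have "\<dots> = ennreal (Lp_norm q ?q (T f) powr q)"
      using Tnorm[OF fp] q by (intro Lp_space_nn_integral) auto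
    also have "\<dots> \<le> ennreal ((R * Lp_norm p ?p f) powr q)"
      using Tnorm[OF fp] q by (intro ennreal_leI powr_mono2) (auto simp: Lp_norm_def)
    finally have "laguerre_multiplier \<alpha> m f \<in> Lp_space q ?q \<and> Lp_norm q ?q (laguerre_multiplier \<alpha> m f) \<le> R * Lp_norm p ?p f"
      using q R by (intro Lp_spaceI_nn_integral measurable_halfline_measure[OF mm]) (auto simp: Lp_norm_def)
    thus ?thesis using fp eq by blast
  qed
  show ?thesis by (intro exI[of _ R] exI[of _ T] conjI ballI op span)
qed

end
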